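(* Assume (M0), (E0) and (E1), let $\mathbf{u}_0\in\mathcal{K}$, and suppose that $\delta_0<\overline{\mathbf{u}}_0$ (componentwise) for some $0<\delta_0<\frac1N$. Let $(\mathbf u,\mathbf w)$ be a global finite energy solution with initial datum $\mathbf u_0$. Then the energy $\mathcal E(t):=\mathcal E(\mathbf u(t))$ satisfies $$\mathcal E(t)\le C_1e^{-\omega t}\mathcal E(0)+C_2,\qquad\forall\,t\ge0,$$ where $C_1,C_2>0$ depend on $\Omega$, $\boldsymbol\alpha$, $\Psi$ and $\overline{\mathbf u}_0$, while $\omega>0$ is a universal constant.
   Context: Let $d\in\{2,3\}$, $\Omega\subset\mathbb{R}^d$ a bounded domain with smooth boundary and outward unit normal $\mathbf n$, $N\ge2$ an integer, $\gamma>0$. Bold function spaces ($\mathbf{L}^p(\Omega)$, $\mathbf{H}^k(\Omega)$) denote $\mathbb{R}^N$-valued functions with components in the corresponding scalar space; $(\cdot,\cdot)$ and $\|\cdot\|$ are the $L^2(\Omega)$ inner product and norm (also for vector- and matrix-valued functions). $\overline f=|\Omega|^{-1}\int_\Omega f\,dx$ is the mean (componentwise for vectors). Inequalities between a vector and a scalar are understood componentwise. $T\Sigma=\{\mathbf d\in\mathbb{R}^N:\sum_i d_i=0\}$, and $\mathbf P$ is the Euclidean projection of $\mathbb{R}^N$ onto $T\Sigma$: $(\mathbf P\mathbf v)_l=v_l-\frac1N\sum_{m=1}^N v_m$. Also $$\mathcal{K}=\Big\{\boldsymbol\eta\in\mathbf{H}^1(\Omega):\ \sum_{i=1}^N\eta_i=1,\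 \eta_i\ge0\ \ \forall i=1,\dots,N\Big\}.$$ Mobility: $\boldsymbol\alpha$ is a constant symmetric positive semidefinite $N\times N$ matrix with kernel $\mathrm{span}\{(1,\dots,1)\}$. Assumption (M0): there exists $l_0>0$ such that $\boldsymbol\alpha\boldsymbol\eta\cdot\boldsymbol\eta\ge l_0\,\boldsymbol\eta\cdot\boldsymbol\eta$ for all $\boldsymbol\eta\in T\Sigma$. Potential: $\mathbf A$ is a constant symmetric $N\times N$ matrix with largest eigenvalue $\lambda_{\mathbf A}>0$; $\psi\in C[0,1]\cap C^2(0,1]$; $\phi=\psi'$; $\boldsymbol\phi(\mathbf u)=(\phi(u_1),\dots,\phi(u_N))$; $\Psi(\mathbf s)=\sum_{i=1}^N\psi(s_i)-\frac12\mathbf s^T\mathbf A\mathbf s$. Assumptions: (E0) there is a constant $\zeta>0$ with $\psi''(s)\ge\zeta$ for all $s\in(0,1]$; (E1) $\lim_{s\to0^+}\psi'(s)=-\infty$. Energy: $\mathcal E(\mathbf u)=\int_\Omega\Psi(\mathbf u)\,dx+\frac\gamma2\|\nabla\mathbf u\|^2$. Global finite energy solution with initial datum $\mathbf u_0$: a pair $(\mathbf u,\mathbf w)$ defined on $[0,\infty)$ such that for any $T>0$: $\mathbf u\in C([0,T];\mathbf L^2(\Omega))\cap L^\infty(0,T;\mathbf H^1(\Omega))\cap L^2(0,T;\mathbf H^2(\Omega))$, $\partial_t\mathbf u\in L^2(0,T;\mathbf L^2(\Omega))$, $\mathbf w\in L^2(0,T;\mathbf L^2(\Omega))$, $\phi(u_i)\in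 L^2(0,T;L^2(\Omega))$ for $i=1,\dots,N$; $\mathbf u(\cdot,t)\in\mathcal K$ and $\overline{\mathbf u}(t)=\overline{\mathbf u}_0$ for a.a. $t\in(0,T)$; $0<\mathbf u<1$ a.e. in $\Omega\times(0,T)$; $\partial_t\mathbf u+\boldsymbol\alpha(\mathbf w-\overline{\mathbf w})=\mathbf 0$ and $\mathbf w=\mathbf P(-\mathbf A\mathbf u+\boldsymbol\phi(\mathbf u))-\gamma\Delta\mathbf u$ a.e. in $\Omega\times(0,T)$; $\partial_{\mathbf n}\mathbf u=\mathbf 0$ a.e. on $\partial\Omega\times(0,T)$; $\mathbf u(0)=\mathbf u_0$ a.e. in $\Omega$. Such a solution exists under the stated assumptions and satisfies $\mathcal E(\mathbf u(t))+\int_0^t(\boldsymbol\alpha(\mathbf w-\overline{\mathbf w}),\mathbf w-\overline{\mathbf w})\,ds\le\mathcal E(\mathbf u_0)$ for all $t\ge0$. *)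

theory Defs
  imports "HOL-Analysis.Analysis"
begin

text \<open>
  The codomain dimension \<open>N\<close> is a natural number quantified inside the statement. Elements of
  \<open>R^N\<close> are functions \<open>nat \<Rightarrow> real\<close> and \<open>N \<times> N\<close> matrices are functions \<open>nat \<Rightarrow> nat \<Rightarrow> real\<close>;
  only the entries with indices \<open>< N\<close> are ever used. Function spaces of vector-valued functions are
  taken componentwise.
\<close>

section \<open>Smooth functions and smooth domains\<close>

definition partial_derivative :: "'a::euclidean_space \<Rightarrow> ('a \<Rightarrow> real) \<Rightarrow> 'a \<Rightarrow> real" where
  "partial_derivative b f x = frechet_derivative f (at x) b"

definition gradient :: "('a::euclidean_space \<Rightarrow> real) \<Rightarrow> 'a \<Rightarrow> 'a" where
  "gradient f x = (\<Sum>b\<in>Basis. partial_derivative b f x *\<^sub>R b)"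

text \<open>The set \<open>S\<close> is meant to be open.\<close>

primrec Ck_on :: "nat \<Rightarrow> 'a::euclidean_space set \<Rightarrow> ('a \<Rightarrow> real) \<Rightarrow> bool" where
  "Ck_on 0 S f \<longleftrightarrow> continuous_on S f"
| "Ck_on (Suc k) S f \<longleftrightarrow>
     f differentiable_on S \<and> (\<forall>b\<in>Basis. Ck_on k S (partial_derivative b f))"

definition smooth_on :: "'a::euclidean_space set \<Rightarrow> ('a \<Rightarrow> real) \<Rightarrow> bool" where
  "smooth_on S f \<longleftrightarrow> (\<forall>k. Ck_on k S f)"

definition test_function :: "'a::euclidean_space set \<Rightarrow> ('a \<Rightarrow> real) \<Rightarrow> bool" where
  "test_function \<Omega> f \<longleftrightarrow>
     smooth_on UNIV f \<and> compact (closure {x. f x \<noteq> 0}) \<and> closure {x. f x \<noteq> 0} \<subseteq> \<Omega>"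

definition local_defining_function ::
  "'a::euclidean_space set \<Rightarrow> 'a \<Rightarrow> 'a set \<Rightarrow> ('a \<Rightarrow> real) \<Rightarrow> bool" where
  "local_defining_function \<Omega> x U \<rho> \<longleftrightarrow>
     open U \<and> x \<in> U \<and> smooth_on U \<rho> \<and> (\<forall>y\<in>U. gradient \<rho> y \<noteq> 0) \<and>
     \<Omega> \<inter> U = {y \<in> U. \<rho> y < 0}"

definition smooth_bounded_domain :: "'a::euclidean_space set \<Rightarrow> bool" where
  "smooth_bounded_domain \<Omega> \<longleftrightarrow>
     open \<Omega> \<and> connected \<Omega> \<and> \<Omega> \<noteq> {} \<and> bounded \<Omega> \<and>
     (\<forall>x\<in>frontier \<Omega>. \<exists>U \<rho>. local_defining_function \<Omega> x U \<rho>)"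

text \<open>The value does not depend on the defining function, since all of them are negative exactly
  on the \<open>\<Omega>\<close> side.\<close>

definition outward_normal :: "'a::euclidean_space set \<Rightarrow> 'a \<Rightarrow> 'a" where
  "outward_normal \<Omega> x =
     (THE n. \<exists>U \<rho>. local_defining_function \<Omega> x U \<rho> \<and> n = gradient \<rho> x /\<^sub>R norm (gradient \<rho> x))"

section \<open>Surface measure\<close>

text \<open>
  The surface measure on a smooth hypersurface of an \<open>n\<close>-dimensional space is the restriction of
  the \<open>(n - 1)\<close>-dimensional Hausdorff measure, normalised so that it agrees with Lebesgue measure
  on flat pieces. The dimension \<open>k\<close> is assumed to be positive (the empty set has
  \<open>diameter {} = 0\<close> and must not contribute).
\<close>

definition hausdorff_gauge :: "nat \<Rightarrow> 'a::euclidean_space set \<Rightarrow> ennreal" where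
  "hausdorff_gauge k U = ennreal (unit_ball_vol (real k) * (diameter U / 2) ^ k)"

definition hausdorff_pre :: "nat \<Rightarrow> real \<Rightarrow> 'a::euclidean_space set \<Rightarrow> ennreal" where
  "hausdorff_pre k \<delta> S =
     (INF U \<in> {U :: nat \<Rightarrow> 'a set. S \<subseteq> (\<Union>n. U n) \<and> (\<forall>n. bounded (U n) \<and> diameter (U n) \<le> \<delta>)}.
        \<Sum>n. hausdorff_gauge k (U n))"

definition hausdorff_outer :: "nat \<Rightarrow> 'a::euclidean_space set \<Rightarrow> ennreal" where
  "hausdorff_outer k S = (SUP \<delta> \<in> {0<..}. hausdorff_pre k \<delta> S)"

definition hausdorff_measure :: "nat \<Rightarrow> 'a::euclidean_space measure" where
  "hausdorff_measure k = measure_of UNIV (sets borel) (hausdorff_outer k)"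

text \<open>
  \<open>measure_of\<close> silently returns the null measure if its argument is not countably additive;
  the following lemmas show that this is not the case here.
\<close>

lemma hausdorff_pre_mono: "S \<subseteq> T \<Longrightarrow> hausdorff_pre k \<delta> S \<le> hausdorff_pre k \<delta> T"
  unfolding hausdorff_pre_def by (rule INF_superset_mono) auto

lemma hausdorff_pre_antimono: "\<delta> \<le> \<delta>' \<Longrightarrow> hausdorff_pre k \<delta>' S \<le> hausdorff_pre k \<delta> S"
  unfolding hausdorff_pre_def by (rule INF_superset_mono) (auto intro: order_trans)

lemma hausdorff_outer_mono: "S \<subseteq> T \<Longrightarrow> hausdorff_outer k S \<le> hausdorff_outer k T"
  unfolding hausdorff_outer_def by (rule SUP_mono) (auto intro: hausdorff_pre_mono)

lemma hausdorff_gauge_empty: "0 < k \<Longrightarrow> hausdorff_gauge k {} = 0"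
  by (simp add: hausdorff_gauge_def)

lemma hausdorff_outer_empty:
  assumes "0 < k"
  shows "hausdorff_outer k ({} :: 'a::euclidean_space set) = 0"
proof -
  have "hausdorff_pre k \<delta> ({} :: 'a set) \<le> 0" if "0 < \<delta>" for \<delta>
    unfolding hausdorff_pre_def using that assms
    by (intro INF_lower2[of "\<lambda>_. {}"]) (auto simp: hausdorff_gauge_empty)
  then show ?thesis
    unfolding hausdorff_outer_def by (intro antisym SUP_least) auto
qed

lemma hausdorff_pre_countably_subadditive:
  fixes A :: "nat \<Rightarrow> 'a::euclidean_space set"
  assumes fin: "(\<Sum>i. hausdorff_pre k \<delta> (A i)) < \<infinity>"
  shows "hausdorff_pre k \<delta> (\<Union>i. A i) \<le> (\<Sum>i. hausdorff_pre k \<delta> (A i))"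
proof (rule ennreal_le_epsilon)
  fix e :: real assume e: "0 < e"
  have fin': "hausdorff_pre k \<delta> (A i) < \<infinity>" for i
    using fin by (metis ennreal_suminf_lessD infinity_ennreal_def)
  have ex: "\<exists>U. A i \<subseteq> (\<Union>n. U n) \<and> (\<forall>n. bounded (U n) \<and> diameter (U n) \<le> \<delta>) \<and>
        (\<Sum>n. hausdorff_gauge k (U n)) \<le> hausdorff_pre k \<delta> (A i) + ennreal (e * (1/2) ^ Suc i)" for i
  proof -
    have "hausdorff_pre k \<delta> (A i) < hausdorff_pre k \<delta> (A i) + ennreal (e * (1/2) ^ Suc i)"
      using fin'[of i] e ennreal_add_left_cancel_less[of "hausdorff_pre k \<delta> (A i)" 0 "ennreal (e * (1/2) ^ Suc i)"]
      by (simp add: less_top)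
    then show ?thesis
      unfolding hausdorff_pre_def
      by (subst (asm) INF_less_iff) (auto simp: hausdorff_pre_def[symmetric] intro: less_imp_le)
  qed
  then obtain U where U: "\<And>i. A i \<subseteq> (\<Union>n. U i n)" "\<And>i n. bounded (U i n)"
      "\<And>i n. diameter (U i n) \<le> \<delta>"
      "\<And>i. (\<Sum>n. hausdorff_gauge k (U i n)) \<le> hausdorff_pre k \<delta> (A i) + ennreal (e * (1/2) ^ Suc i)"
    by metis
  let ?V = "\<lambda>m. case prod_decode m of (i, n) \<Rightarrow> U i n"
  have "(\<Union>i. A i) \<subseteq> (\<Union>m. ?V m)"
  proof
    fix x assume "x \<in> (\<Union>i. A i)"
    then obtain i where "x \<in> A i" by (rule UN_E)
    then have "x \<in> (\<Union>n. U i n)" using U(1)[of i] by (rule subsetD[rotated])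
    then obtain n where "x \<in> U i n" by (rule UN_E)
    then have "x \<in> ?V (prod_encode (i, n))" by simp
    then show "x \<in> (\<Union>m. ?V m)" by (rule UN_I[OF UNIV_I])
  qed
  then have "hausdorff_pre k \<delta> (\<Union>i. A i) \<le> (\<Sum>m. hausdorff_gauge k (?V m))"
    unfolding hausdorff_pre_def using U(2,3) by (intro INF_lower) (auto split: prod.split)
  also have "\<dots> = (\<Sum>m. (\<lambda>(i, n). hausdorff_gauge k (U i n)) (prod_decode m))"
    by (intro suminf_cong) (simp split: prod.split)
  also have "\<dots> = (\<Sum>i. \<Sum>n. hausdorff_gauge k (U i n))"
    by (rule suminf_ennreal_2dimen) simp
  also have "\<dots> \<le> (\<Sum>i. hausdorff_pre k \<delta> (A i) + ennreal (e * (1/2) ^ Suc i))"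
    by (intro suminf_le U(4)) auto
  also have "\<dots> = (\<Sum>i. hausdorff_pre k \<delta> (A i)) + (\<Sum>i. ennreal (e * (1/2) ^ Suc i))"
    by (intro suminf_add[symmetric]) auto
  also have "(\<Sum>i. ennreal (e * (1/2) ^ Suc i)) = ennreal e"
    using sums_mult[OF power_half_series, of e] e by (intro suminf_ennreal_eq) auto
  finally show "hausdorff_pre k \<delta> (\<Union>i. A i) \<le> (\<Sum>i. hausdorff_pre k \<delta> (A i)) + ennreal e" .
qed

lemma hausdorff_outer_countably_subadditive:
  fixes A :: "nat \<Rightarrow> 'a::euclidean_space set"
  shows "hausdorff_outer k (\<Union>i. A i) \<le> (\<Sum>i. hausdorff_outer k (A i))"
  unfolding hausdorff_outer_def[of k "\<Union>i. A i"]
proof (rule SUP_least)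
  fix \<delta> :: real assume d: "\<delta> \<in> {0<..}"
  have le: "(\<Sum>i. hausdorff_pre k \<delta> (A i)) \<le> (\<Sum>i. hausdorff_outer k (A i))"
    unfolding hausdorff_outer_def by (intro suminf_le SUP_upper d) auto
  show "hausdorff_pre k \<delta> (\<Union>i. A i) \<le> (\<Sum>i. hausdorff_outer k (A i))"
  proof (cases "(\<Sum>i. hausdorff_pre k \<delta> (A i)) < \<infinity>")
    case True
    from order_trans[OF hausdorff_pre_countably_subadditive[OF this] le] show ?thesis .
  next
    case False
    then have "(\<Sum>i. hausdorff_outer k (A i)) = top"
      using le by (metis infinity_ennreal_def less_top neq_top_trans)
    then show ?thesis by simp
  qed
qed

lemma hausdorff_outer_measure_space:
  "0 < k \<Longrightarrow> outer_measure_space (Pow UNIV) (hausdorff_outer k :: 'a::euclidean_space set \<Rightarrow> ennreal)"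
  unfolding outer_measure_space_def positive_def increasing_def countably_subadditive_def
  by (intro conjI ballI allI impI hausdorff_outer_mono hausdorff_outer_countably_subadditive
      hausdorff_outer_empty)

lemma hausdorff_outer_subadditive:
  assumes "0 < k"
  shows "hausdorff_outer k (A \<union> B) \<le> hausdorff_outer k A + hausdorff_outer k (B :: 'a::euclidean_space set)"
proof -
  have "hausdorff_outer k (A \<union> B) = hausdorff_outer k (\<Union>i. binaryset A B i)"
    by (simp add: UN_binaryset_eq)
  also have "\<dots> \<le> (\<Sum>i. hausdorff_outer k (binaryset A B i))"
    by (rule hausdorff_outer_countably_subadditive)
  also have "\<dots> = hausdorff_outer k A + hausdorff_outer k B"
    using assms by (intro suminf_binaryset_eq hausdorff_outer_empty)
  finally show ?thesis .
qed

lemma hausdorff_outer_metric: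
  fixes A B :: "'a::euclidean_space set"
  assumes k: "0 < k" and e: "0 < e" and sep: "\<And>x y. x \<in> A \<Longrightarrow> y \<in> B \<Longrightarrow> e \<le> dist x y"
  shows "hausdorff_outer k A + hausdorff_outer k B \<le> hausdorff_outer k (A \<union> B)"
proof -
  have key: "hausdorff_pre k \<delta> A + hausdorff_pre k \<delta> B \<le> hausdorff_pre k \<delta> (A \<union> B)"
    if d: "0 < \<delta>" "\<delta> < e" for \<delta>
    unfolding hausdorff_pre_def[of k \<delta> "A \<union> B"]
  proof (rule INF_greatest)
    fix U :: "nat \<Rightarrow> 'a set"
    assume "U \<in> {U. A \<union> B \<subseteq> (\<Union>n. U n) \<and> (\<forall>n. bounded (U n) \<and> diameter (U n) \<le> \<delta>)}"
    then have U: "A \<union> B \<subseteq> (\<Union>n. U n)" "\<And>n. bounded (U n)" "\<And>n. diameter (U n) \<le> \<delta>" by auto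
    let ?V = "\<lambda>S n. if U n \<inter> S \<noteq> {} then U n else {}"
    have pre: "hausdorff_pre k \<delta> S \<le> (\<Sum>n. hausdorff_gauge k (?V S n))" if S: "S \<subseteq> A \<union> B" for S
    proof -
      have "S \<subseteq> (\<Union>n. ?V S n)"
      proof
        fix x assume "x \<in> S"
        moreover from this obtain n where "x \<in> U n" using U(1) S by blast
        ultimately have "x \<in> ?V S n" by auto
        then show "x \<in> (\<Union>n. ?V S n)" by blast
      qed
      then show ?thesis
        unfolding hausdorff_pre_def using U(2,3) d by (intro INF_lower) auto
    qed
    have disj: "U n \<inter> A = {} \<or> U n \<inter> B = {}" for n
    proof (rule ccontr)
      assume "\<not> ?thesis"
      then obtain x y where xy: "x \<in> U n" "x \<in> A" "y \<in> U n" "y \<in> B" by auto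
      then have "e \<le> dist x y" using sep by blast
      also have "dist x y \<le> diameter (U n)" using xy U(2) by (intro diameter_bounded_bound) auto
      finally show False using U(3)[of n] d by simp
    qed
    have "hausdorff_pre k \<delta> A + hausdorff_pre k \<delta> B
        \<le> (\<Sum>n. hausdorff_gauge k (?V A n)) + (\<Sum>n. hausdorff_gauge k (?V B n))"
      by (intro add_mono pre) auto
    also have "\<dots> = (\<Sum>n. hausdorff_gauge k (?V A n) + hausdorff_gauge k (?V B n))"
      by (intro suminf_add) auto
    also have "\<dots> \<le> (\<Sum>n. hausdorff_gauge k (U n))"
      using disj by (intro suminf_le) (auto simp: hausdorff_gauge_empty[OF k])
    finally show "hausdorff_pre k \<delta> A + hausdorff_pre k \<delta> B \<le> (\<Sum>n. hausdorff_gauge k (U n))" .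
  qed
  have SUP2: "hausdorff_pre k \<delta> A + hausdorff_pre k \<delta>' B \<le> hausdorff_outer k (A \<union> B)"
    if "0 < \<delta>" "0 < \<delta>'" for \<delta> \<delta>'
  proof -
    define r where "r = min (min \<delta> \<delta>') (e/2)"
    have r: "0 < r" "r < e" "r \<le> \<delta>" "r \<le> \<delta>'" using that e by (auto simp: r_def)
    have "hausdorff_pre k \<delta> A + hausdorff_pre k \<delta>' B \<le> hausdorff_pre k r A + hausdorff_pre k r B"
      using r by (intro add_mono hausdorff_pre_antimono) auto
    also have "\<dots> \<le> hausdorff_pre k r (A \<union> B)" using key r by blast
    also have "\<dots> \<le> hausdorff_outer k (A \<union> B)"
      unfolding hausdorff_outer_def using r by (intro SUP_upper) auto
    finally show ?thesis .
  qed
  have ne: "{0::real<..} \<noteq> {}" by (metis greaterThan_iff empty_iff zero_less_one)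
  have one: "hausdorff_pre k \<delta> A + hausdorff_outer k B \<le> hausdorff_outer k (A \<union> B)"
    if "0 < \<delta>" for \<delta>
  proof -
    have "hausdorff_pre k \<delta> A + hausdorff_outer k B
        = (SUP \<delta>'\<in>{0<..}. hausdorff_pre k \<delta>' B + hausdorff_pre k \<delta> A)"
      unfolding hausdorff_outer_def by (subst ennreal_SUP_add_left[OF ne]) (rule add.commute)
    also have "\<dots> \<le> hausdorff_outer k (A \<union> B)"
      using SUP2[OF that] by (intro SUP_least) (subst add.commute, simp)
    finally show ?thesis .
  qed
  have "hausdorff_outer k A + hausdorff_outer k B
      = (SUP \<delta>\<in>{0<..}. hausdorff_pre k \<delta> A + hausdorff_outer k B)"
    unfolding hausdorff_outer_def[of k A] by (rule ennreal_SUP_add_left[OF ne, symmetric])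
  also have "\<dots> \<le> hausdorff_outer k (A \<union> B)"
    using one by (intro SUP_least) simp
  finally show ?thesis .
qed

lemma hausdorff_outer_closed_split:
  fixes C X :: "'a::euclidean_space set"
  assumes k: "0 < k" and C: "closed C" "C \<noteq> {}"
  shows "hausdorff_outer k (X \<inter> C) + hausdorff_outer k (X - C) \<le> hausdorff_outer k X"
proof (cases "hausdorff_outer k X = top")
  case False
  let ?H = "hausdorff_outer k :: 'a set \<Rightarrow> ennreal"
  define d where "d x = infdist x C" for x
  have d_le: "d x \<le> d y + dist x y" for x y
    unfolding d_def by (rule infdist_triangle)
  have d_pos: "0 < d x" if "x \<notin> C" for x
    using that C unfolding d_def
    by (metis in_closed_iff_infdist_zero infdist_nonneg less_eq_real_def)
  have d_C: "d x = 0" if "x \<in> C" for x using that unfolding d_def by simp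
  define B where "B n = {x \<in> X. 1 / real (n + 1) \<le> d x}" for n :: nat
  define R where "R j = {x \<in> X. 1 / real (j + 2) \<le> d x \<and> d x < 1 / real (j + 1)}" for j :: nat
  have half: "(\<Sum>j<m. ?H (R (2 * j + p))) \<le> ?H (\<Union>j<m. R (2 * j + p))" for m p
  proof (induction m)
    case (Suc m)
    define e where "e = (if m = 0 then 1 else 1 / real (2 * m + p) - 1 / real (2 * m + p + 1))"
    have e: "0 < e" by (auto simp: e_def intro!: divide_strict_left_mono)
    have sep: "e \<le> dist x y"
      if x: "x \<in> (\<Union>j<m. R (2 * j + p))" and y: "y \<in> R (2 * m + p)" for x y
    proof -
      from x obtain j where j: "j < m" "x \<in> R (2 * j + p)" by auto
      have "1 / real (2 * m + p) \<le> 1 / real (2 * j + p + 2)"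
        using j by (intro divide_left_mono) auto
      also have "\<dots> \<le> d x" using j by (simp add: R_def)
      finally have "1 / real (2 * m + p) \<le> d x" .
      moreover have "d y < 1 / real (2 * m + p + 1)" using y by (simp add: R_def)
      moreover have "d x \<le> d y + dist x y" by (rule d_le)
      moreover have "m \<noteq> 0" using j by simp
      ultimately show ?thesis unfolding e_def by simp
    qed
    have "(\<Sum>j<Suc m. ?H (R (2 * j + p))) \<le> ?H (\<Union>j<m. R (2 * j + p)) + ?H (R (2 * m + p))"
      using Suc.IH by (simp add: add_right_mono)
    also have "\<dots> \<le> ?H ((\<Union>j<m. R (2 * j + p)) \<union> R (2 * m + p))"
      by (rule hausdorff_outer_metric[OF k e sep])
    also have "(\<Union>j<m. R (2 * j + p)) \<union> R (2 * m + p) = (\<Union>j<Suc m. R (2 * j + p))"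
      by (auto simp: lessThan_Suc)
    finally show ?case .
  qed simp
  have half': "(\<Sum>j<m. ?H (R (2 * j + p))) \<le> ?H X" for m p
    by (rule order_trans[OF half hausdorff_outer_mono]) (auto simp: R_def)
  have part: "(\<Sum>j<n. ?H (R j)) \<le> ?H X + ?H X" for n
  proof -
    have "(\<Sum>j<n. ?H (R j)) \<le> (\<Sum>j<2*n. ?H (R j))" by (intro sum_mono2) auto
    also have "\<dots> = (\<Sum>j<n. ?H (R (2 * j + 0))) + (\<Sum>j<n. ?H (R (2 * j + 1)))"
      by (induction n) (auto simp: algebra_simps)
    also have "\<dots> \<le> ?H X + ?H X" by (intro add_mono half')
    finally show ?thesis .
  qed
  have total: "(\<Sum>j. ?H (R j)) \<le> ?H X + ?H X"
    by (intro suminf_le_const part) auto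
  have total_fin: "(\<Sum>j. ?H (R j)) < top"
    using total False by (metis ennreal_add_eq_top less_top neq_top_trans)
  show ?thesis
  proof (rule ennreal_le_epsilon)
    fix e :: real assume e: "0 < e"
    have "(\<lambda>n. (\<Sum>j<n. ?H (R j)) + ennreal e) \<longlonglongrightarrow> (\<Sum>j. ?H (R j)) + ennreal e"
      by (intro tendsto_add summable_LIMSEQ tendsto_const summableI)
    moreover have "(\<Sum>j. ?H (R j)) < (\<Sum>j. ?H (R j)) + ennreal e"
      using total_fin e ennreal_add_left_cancel_less[of "\<Sum>j. ?H (R j)" 0 "ennreal e"]
      by (simp add: less_top)
    ultimately have "eventually (\<lambda>n. (\<Sum>j. ?H (R j)) < (\<Sum>j<n. ?H (R j)) + ennreal e) sequentially"
      by (rule order_tendstoD(1))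
    then obtain n where n: "(\<Sum>j. ?H (R j)) \<le> (\<Sum>j<n. ?H (R j)) + ennreal e"
      by (auto simp: eventually_sequentially intro: less_imp_le)
    have fin: "(\<Sum>j<n. ?H (R j)) \<noteq> \<infinity>"
      using part[of n] False by (metis ennreal_add_eq_top infinity_ennreal_def neq_top_trans)
    have "(\<Sum>j<n. ?H (R j)) + (\<Sum>j. ?H (R (j + n))) = (\<Sum>j. ?H (R j))"
      by (subst suminf_offset[of "\<lambda>j. ?H (R j)" n]) (auto simp: add.commute)
    with n have "(\<Sum>j<n. ?H (R j)) + (\<Sum>j. ?H (R (j + n))) \<le> (\<Sum>j<n. ?H (R j)) + ennreal e"
      by simp
    then have tail: "(\<Sum>j. ?H (R (j + n))) \<le> ennreal e"
      using fin by (simp add: ennreal_add_left_cancel_le)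
    have "X - C \<subseteq> B n \<union> (\<Union>j. R (j + n))"
    proof
      fix x assume x: "x \<in> X - C"
      show "x \<in> B n \<union> (\<Union>j. R (j + n))"
      proof (cases "x \<in> B n")
        case notB: False
        define j where "j = (LEAST j. 1 / real (j + 2) \<le> d x)"
        obtain i :: nat where "1 / d x < real i" using reals_Archimedean2 by blast
        then have "1 / real (i + 2) \<le> d x" using d_pos[of x] x by (simp add: field_simps)
        then have j: "1 / real (j + 2) \<le> d x" unfolding j_def by (rule LeastI)
        have "n \<le> j"
        proof (rule ccontr)
          assume "\<not> n \<le> j"
          then have "1 / real (n + 1) \<le> 1 / real (j + 2)" by (intro divide_left_mono) auto
          with j notB x show False by (simp add: B_def)
        qed
        moreover have "d x < 1 / real (j + 1)"
        proof (cases j)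
          case 0
          with \<open>n \<le> j\<close> notB x show ?thesis by (simp add: B_def)
        next
          case (Suc i)
          then have "\<not> 1 / real (i + 2) \<le> d x" unfolding j_def by (metis lessI not_less_Least)
          then show ?thesis using Suc by simp
        qed
        ultimately have "x \<in> R ((j - n) + n)" using j x by (simp add: R_def)
        then show ?thesis by blast
      qed simp
    qed
    then have "?H (X - C) \<le> ?H (B n \<union> (\<Union>j. R (j + n)))" by (rule hausdorff_outer_mono)
    also have "\<dots> \<le> ?H (B n) + ?H (\<Union>j. R (j + n))" by (rule hausdorff_outer_subadditive[OF k])
    also have "\<dots> \<le> ?H (B n) + (\<Sum>j. ?H (R (j + n)))"
      by (intro add_left_mono hausdorff_outer_countably_subadditive)
    also have "\<dots> \<le> ?H (B n) + ennreal e" by (intro add_left_mono tail)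
    finally have "?H (X \<inter> C) + ?H (X - C) \<le> (?H (X \<inter> C) + ?H (B n)) + ennreal e"
      by (simp add: add.assoc add_left_mono)
    also have "?H (X \<inter> C) + ?H (B n) \<le> ?H ((X \<inter> C) \<union> B n)"
    proof (rule hausdorff_outer_metric[OF k, of "1 / real (n + 1)"])
      fix x y assume "x \<in> X \<inter> C" "y \<in> B n"
      then show "1 / real (n + 1) \<le> dist x y"
        using d_le[of y x] d_C[of x] by (auto simp: B_def dist_commute)
    qed simp
    also have "?H ((X \<inter> C) \<union> B n) \<le> ?H X" by (rule hausdorff_outer_mono) (auto simp: B_def)
    finally show "?H (X \<inter> C) + ?H (X - C) \<le> ?H X + ennreal e" by simp
  qed
qed simp

lemma hausdorff_outer_borel_measure_space:
  assumes k: "0 < k"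
  shows "measure_space UNIV (sets borel) (hausdorff_outer k :: 'a::euclidean_space set \<Rightarrow> ennreal)"
proof -
  let ?H = "hausdorff_outer k :: 'a set \<Rightarrow> ennreal"
  let ?L = "lambda_system UNIV (Pow UNIV) ?H"
  interpret P: sigma_algebra "UNIV :: 'a set" "Pow UNIV" by (rule sigma_algebra_Pow)
  have L: "measure_space UNIV ?L ?H"
    by (rule P.caratheodory_lemma[OF hausdorff_outer_measure_space[OF k]])
  then interpret L: sigma_algebra "UNIV :: 'a set" ?L by (simp add: measure_space_def)
  have "C \<in> ?L" if "closed C" for C :: "'a set"
  proof (cases "C = {}")
    case True
    then show ?thesis using L.empty_sets by simp
  next
    case ne: False
    have "?H (X \<inter> C) + ?H (X - C) = ?H X" for X
    proof (rule antisym)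
      show "?H (X \<inter> C) + ?H (X - C) \<le> ?H X"
        by (rule hausdorff_outer_closed_split[OF k that ne])
      have "?H X = ?H ((X \<inter> C) \<union> (X - C))" by (simp add: Int_Diff_Un)
      also have "\<dots> \<le> ?H (X \<inter> C) + ?H (X - C)" by (rule hausdorff_outer_subadditive[OF k])
      finally show "?H X \<le> ?H (X \<inter> C) + ?H (X - C)" .
    qed
    then show ?thesis unfolding P.lambda_system_eq by simp
  qed
  then have "sigma_sets UNIV (Collect closed) \<subseteq> ?L"
    by (intro L.sigma_sets_subset) auto
  then have "sets borel \<subseteq> ?L" by (simp add: borel_eq_closed)
  moreover have "sigma_algebra UNIV (sets borel :: 'a set set)"
    using sets.sigma_algebra_axioms[of "borel :: 'a measure"] by simp
  ultimately show ?thesis using measure_down[OF L] by blast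
qed

lemma emeasure_hausdorff_measure:
  fixes S :: "'a::euclidean_space set"
  assumes "0 < k" "S \<in> sets borel"
  shows "emeasure (hausdorff_measure k) S = hausdorff_outer k S"
  unfolding hausdorff_measure_def
  using hausdorff_outer_borel_measure_space[OF assms(1), where 'a='a] assms(2)
  by (intro emeasure_measure_of_sigma) (auto simp: measure_space_def)

definition surface_measure :: "'a::euclidean_space set \<Rightarrow> 'a measure" where
  "surface_measure \<Omega> = restrict_space (hausdorff_measure (DIM('a) - 1)) (frontier \<Omega>)"

section \<open>Sobolev spaces\<close>

definition L2 :: "'a measure \<Rightarrow> ('a \<Rightarrow> real) set" where
  "L2 M = {f \<in> borel_measurable M. integrable M (\<lambda>x. (f x)\<^sup>2)}"

definition L2_norm :: "'a measure \<Rightarrow> ('a \<Rightarrow> real) \<Rightarrow> real" where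
  "L2_norm M f = sqrt (LINT x|M. (f x)\<^sup>2)"

definition locally_integrable :: "'a::euclidean_space set \<Rightarrow> ('a \<Rightarrow> real) \<Rightarrow> bool" where
  "locally_integrable \<Omega> f \<longleftrightarrow> (\<forall>K. compact K \<and> K \<subseteq> \<Omega> \<longrightarrow> integrable (lebesgue_on K) f)"

definition has_weak_partial ::
  "'a::euclidean_space set \<Rightarrow> 'a \<Rightarrow> ('a \<Rightarrow> real) \<Rightarrow> ('a \<Rightarrow> real) \<Rightarrow> bool" where
  "has_weak_partial \<Omega> b f g \<longleftrightarrow>
     locally_integrable \<Omega> f \<and> locally_integrable \<Omega> g \<and>
     (\<forall>\<eta>. test_function \<Omega> \<eta> \<longrightarrow>
        (LINT x|lebesgue_on \<Omega>. f x * partial_derivative b \<eta> x) = - (LINT x|lebesgue_on \<Omega>. g x * \<eta> x))"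

text \<open>A weak derivative is determined up to a null set only; \<open>weak_partial\<close> picks a representative.\<close>

definition weak_partial :: "'a::euclidean_space set \<Rightarrow> 'a \<Rightarrow> ('a \<Rightarrow> real) \<Rightarrow> 'a \<Rightarrow> real" where
  "weak_partial \<Omega> b f = (SOME g. has_weak_partial \<Omega> b f g)"

definition H1 :: "'a::euclidean_space set \<Rightarrow> ('a \<Rightarrow> real) set" where
  "H1 \<Omega> = {f \<in> L2 (lebesgue_on \<Omega>). \<forall>b\<in>Basis. \<exists>g\<in>L2 (lebesgue_on \<Omega>). has_weak_partial \<Omega> b f g}"

definition H1_norm :: "'a::euclidean_space set \<Rightarrow> ('a \<Rightarrow> real) \<Rightarrow> real" where
  "H1_norm \<Omega> f = sqrt ((L2_norm (lebesgue_on \<Omega>) f)\<^sup>2 +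
     (\<Sum>b\<in>Basis. (L2_norm (lebesgue_on \<Omega>) (weak_partial \<Omega> b f))\<^sup>2))"

definition H2 :: "'a::euclidean_space set \<Rightarrow> ('a \<Rightarrow> real) set" where
  "H2 \<Omega> = {f \<in> H1 \<Omega>. \<forall>b\<in>Basis. weak_partial \<Omega> b f \<in> H1 \<Omega>}"

definition H2_norm :: "'a::euclidean_space set \<Rightarrow> ('a \<Rightarrow> real) \<Rightarrow> real" where
  "H2_norm \<Omega> f = sqrt ((L2_norm (lebesgue_on \<Omega>) f)\<^sup>2 +
     (\<Sum>b\<in>Basis. (H1_norm \<Omega> (weak_partial \<Omega> b f))\<^sup>2))"

definition weak_laplacian :: "'a::euclidean_space set \<Rightarrow> ('a \<Rightarrow> real) \<Rightarrow> 'a \<Rightarrow> real" where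
  "weak_laplacian \<Omega> f x = (\<Sum>b\<in>Basis. weak_partial \<Omega> b (weak_partial \<Omega> b f) x)"

text \<open>
  The trace operator is the continuous extension to \<open>H\<^sup>1(\<Omega>)\<close> of the restriction
  \<open>C\<^sup>\<infinity>(closure \<Omega>) \<rightarrow> L\<^sup>2(\<partial>\<Omega>)\<close>, written here as a relation.
\<close>

definition has_trace :: "'a::euclidean_space set \<Rightarrow> ('a \<Rightarrow> real) \<Rightarrow> ('a \<Rightarrow> real) \<Rightarrow> bool" where
  "has_trace \<Omega> f g \<longleftrightarrow>
     f \<in> H1 \<Omega> \<and> g \<in> L2 (surface_measure \<Omega>) \<and>
     (\<exists>F :: nat \<Rightarrow> 'a \<Rightarrow> real. (\<forall>k. smooth_on UNIV (F k)) \<and>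
        (\<lambda>k. H1_norm \<Omega> (\<lambda>x. F k x - f x)) \<longlonglongrightarrow> 0 \<and>
        (\<lambda>k. L2_norm (surface_measure \<Omega>) (\<lambda>x. F k x - g x)) \<longlonglongrightarrow> 0)"

definition has_normal_derivative ::
  "'a::euclidean_space set \<Rightarrow> ('a \<Rightarrow> real) \<Rightarrow> ('a \<Rightarrow> real) \<Rightarrow> bool" where
  "has_normal_derivative \<Omega> f h \<longleftrightarrow>
     (\<exists>g. (\<forall>b\<in>Basis. has_trace \<Omega> (weak_partial \<Omega> b f) (g b)) \<and>
          (\<forall>x. h x = (\<Sum>b\<in>Basis. g b x * (outward_normal \<Omega> x \<bullet> b))))"

section \<open>Function spaces on the time interval \<open>(0, T)\<close>\<close>

text \<open>
  A function from time into a space of functions on \<open>\<Omega>\<close> is represented by \<open>f t x\<close>; \<open>L\<^sup>p(0,T;X)\<close>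
  carries joint Lebesgue measurability of the representative, so that \<open>L\<^sup>2(0,T;L\<^sup>2(\<Omega>))\<close> is
  \<open>L\<^sup>2((0,T) \<times> \<Omega>)\<close>.
\<close>

definition jointly_measurable ::
  "'a::euclidean_space set \<Rightarrow> real \<Rightarrow> (real \<Rightarrow> 'a \<Rightarrow> real) \<Rightarrow> bool" where
  "jointly_measurable \<Omega> T f \<longleftrightarrow>
     (\<lambda>(t, x). f t x) \<in> borel_measurable (lebesgue_on ({0<..<T} \<times> \<Omega>))"

definition C_L2 :: "'a::euclidean_space set \<Rightarrow> real \<Rightarrow> (real \<Rightarrow> 'a \<Rightarrow> real) set" where
  "C_L2 \<Omega> T = {f. (\<forall>t\<in>{0..T}. f t \<in> L2 (lebesgue_on \<Omega>)) \<and>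
     (\<forall>s\<in>{0..T}. ((\<lambda>t. L2_norm (lebesgue_on \<Omega>) (\<lambda>x. f t x - f s x)) \<longlongrightarrow> 0) (at s within {0..T}))}"

definition L2_L2 :: "'a::euclidean_space set \<Rightarrow> real \<Rightarrow> (real \<Rightarrow> 'a \<Rightarrow> real) set" where
  "L2_L2 \<Omega> T = {f. (\<lambda>(t, x). f t x) \<in> L2 (lebesgue_on ({0<..<T} \<times> \<Omega>))}"

definition Linf_H1 :: "'a::euclidean_space set \<Rightarrow> real \<Rightarrow> (real \<Rightarrow> 'a \<Rightarrow> real) set" where
  "Linf_H1 \<Omega> T = {f. jointly_measurable \<Omega> T f \<and>
     (\<exists>M. AE t in lebesgue_on {0<..<T}. f t \<in> H1 \<Omega> \<and> H1_norm \<Omega> (f t) \<le> M)}"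

definition L2_H2 :: "'a::euclidean_space set \<Rightarrow> real \<Rightarrow> (real \<Rightarrow> 'a \<Rightarrow> real) set" where
  "L2_H2 \<Omega> T = {f. jointly_measurable \<Omega> T f \<and>
     (AE t in lebesgue_on {0<..<T}. f t \<in> H2 \<Omega>) \<and>
     (\<lambda>t. H2_norm \<Omega> (f t)) \<in> L2 (lebesgue_on {0<..<T})}"

text \<open>
  The distributional time derivative: \<open>\<integral> f \<theta>' dt = - \<integral> g \<theta> dt\<close> as elements of \<open>L\<^sup>2(\<Omega>)\<close>, i.e. for
  almost every \<open>x\<close>.
\<close>

definition has_weak_time_derivative ::
  "'a::euclidean_space set \<Rightarrow> real \<Rightarrow> (real \<Rightarrow> 'a \<Rightarrow> real) \<Rightarrow> (real \<Rightarrow> 'a \<Rightarrow> real) \<Rightarrow> bool" where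
  "has_weak_time_derivative \<Omega> T f g \<longleftrightarrow>
     (\<forall>\<theta>. test_function {0<..<T} \<theta> \<longrightarrow>
        (AE x in lebesgue_on \<Omega>.
           (LINT t|lebesgue_on {0<..<T}. f t x * deriv \<theta> t) =
           - (LINT t|lebesgue_on {0<..<T}. g t x * \<theta> t)))"

section \<open>The multi-component system\<close>

definition mat_vec :: "nat \<Rightarrow> (nat \<Rightarrow> nat \<Rightarrow> real) \<Rightarrow> (nat \<Rightarrow> real) \<Rightarrow> nat \<Rightarrow> real" where
  "mat_vec N M v i = (\<Sum>j<N. M i j * v j)"

definition dot :: "nat \<Rightarrow> (nat \<Rightarrow> real) \<Rightarrow> (nat \<Rightarrow> real) \<Rightarrow> real" where
  "dot N v w = (\<Sum>i<N. v i * w i)"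

definition symmetric_mat :: "nat \<Rightarrow> (nat \<Rightarrow> nat \<Rightarrow> real) \<Rightarrow> bool" where
  "symmetric_mat N M \<longleftrightarrow> (\<forall>i<N. \<forall>j<N. M i j = M j i)"

definition eigenvalues :: "nat \<Rightarrow> (nat \<Rightarrow> nat \<Rightarrow> real) \<Rightarrow> real set" where
  "eigenvalues N M = {l. \<exists>v. (\<exists>i<N. v i \<noteq> 0) \<and> (\<forall>i<N. mat_vec N M v i = l * v i)}"

definition T_Sigma :: "nat \<Rightarrow> (nat \<Rightarrow> real) set" where
  "T_Sigma N = {v. (\<Sum>i<N. v i) = 0}"

definition proj :: "nat \<Rightarrow> (nat \<Rightarrow> real) \<Rightarrow> nat \<Rightarrow> real" where
  "proj N v l = v l - (\<Sum>m<N. v m) / real N"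

definition mean :: "'a::euclidean_space set \<Rightarrow> ('a \<Rightarrow> nat \<Rightarrow> real) \<Rightarrow> nat \<Rightarrow> real" where
  "mean \<Omega> f i = (LINT x|lebesgue_on \<Omega>. f x i) / measure lebesgue \<Omega>"

definition K_set :: "'a::euclidean_space set \<Rightarrow> nat \<Rightarrow> ('a \<Rightarrow> nat \<Rightarrow> real) set" where
  "K_set \<Omega> N = {\<eta>. (\<forall>i<N. (\<lambda>x. \<eta> x i) \<in> H1 \<Omega>) \<and>
     (AE x in lebesgue_on \<Omega>. (\<Sum>i<N. \<eta> x i) = 1 \<and> (\<forall>i<N. 0 \<le> \<eta> x i))}"

definition mobility_matrix :: "nat \<Rightarrow> (nat \<Rightarrow> nat \<Rightarrow> real) \<Rightarrow> bool" where
  "mobility_matrix N \<alpha> \<longleftrightarrow>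
     symmetric_mat N \<alpha> \<and> (\<forall>v. 0 \<le> dot N (mat_vec N \<alpha> v) v) \<and>
     (\<forall>v. (\<forall>i<N. mat_vec N \<alpha> v i = 0) \<longleftrightarrow> (\<exists>c. \<forall>i<N. v i = c))"

definition M0 :: "nat \<Rightarrow> (nat \<Rightarrow> nat \<Rightarrow> real) \<Rightarrow> bool" where
  "M0 N \<alpha> \<longleftrightarrow> (\<exists>l0>0. \<forall>\<eta>\<in>T_Sigma N. l0 * dot N \<eta> \<eta> \<le> dot N (mat_vec N \<alpha> \<eta>) \<eta>)"

text \<open>The derivative on \<open>(0,1]\<close>, one-sided at \<open>1\<close>.\<close>

definition D01 :: "(real \<Rightarrow> real) \<Rightarrow> real \<Rightarrow> real" where
  "D01 f s = vector_derivative f (at s within {0<..1})"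

definition potential :: "nat \<Rightarrow> (nat \<Rightarrow> nat \<Rightarrow> real) \<Rightarrow> (real \<Rightarrow> real) \<Rightarrow> bool" where
  "potential N A \<psi> \<longleftrightarrow>
     symmetric_mat N A \<and> 0 < Max (eigenvalues N A) \<and>
     continuous_on {0..1} \<psi> \<and> \<psi> differentiable_on {0<..1} \<and>
     D01 \<psi> differentiable_on {0<..1} \<and> continuous_on {0<..1} (D01 (D01 \<psi>))"

definition E0 :: "(real \<Rightarrow> real) \<Rightarrow> bool" where
  "E0 \<psi> \<longleftrightarrow> (\<exists>\<zeta>>0. \<forall>s\<in>{0<..1}. \<zeta> \<le> D01 (D01 \<psi>) s)"

definition E1 :: "(real \<Rightarrow> real) \<Rightarrow> bool" where
  "E1 \<psi> \<longleftrightarrow> filterlim (D01 \<psi>) at_bot (at_right 0)"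

definition Psi :: "nat \<Rightarrow> (nat \<Rightarrow> nat \<Rightarrow> real) \<Rightarrow> (real \<Rightarrow> real) \<Rightarrow> (nat \<Rightarrow> real) \<Rightarrow> real" where
  "Psi N A \<psi> s = (\<Sum>i<N. \<psi> (s i)) - 1 / 2 * dot N s (mat_vec N A s)"

definition energy ::
  "'a::euclidean_space set \<Rightarrow> nat \<Rightarrow> real \<Rightarrow> (nat \<Rightarrow> nat \<Rightarrow> real) \<Rightarrow> (real \<Rightarrow> real) \<Rightarrow>
   ('a \<Rightarrow> nat \<Rightarrow> real) \<Rightarrow> real" where
  "energy \<Omega> N \<gamma> A \<psi> v =
     (LINT x|lebesgue_on \<Omega>. Psi N A \<psi> (v x)) +
     \<gamma> / 2 * (\<Sum>i<N. \<Sum>b\<in>Basis. (L2_norm (lebesgue_on \<Omega>) (weak_partial \<Omega> b (\<lambda>x. v x i)))\<^sup>2)"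

text \<open>
  ``Almost everywhere in \<open>\<Omega> \<times> (0,T)\<close>'' is written as ``for a.e. \<open>t\<close>, for a.e. \<open>x\<close>'', and similarly
  on \<open>\<partial>\<Omega> \<times> (0,T)\<close>: the spatial weak derivatives and traces are chosen separately for each \<open>t\<close>, and
  such a choice need not be jointly measurable.
\<close>

definition finite_energy_solution ::
  "'a::euclidean_space set \<Rightarrow> nat \<Rightarrow> real \<Rightarrow> (nat \<Rightarrow> nat \<Rightarrow> real) \<Rightarrow> (nat \<Rightarrow> nat \<Rightarrow> real) \<Rightarrow>
   (real \<Rightarrow> real) \<Rightarrow> ('a \<Rightarrow> nat \<Rightarrow> real) \<Rightarrow> (real \<Rightarrow> 'a \<Rightarrow> nat \<Rightarrow> real) \<Rightarrow>
   (real \<Rightarrow> 'a \<Rightarrow> nat \<Rightarrow> real) \<Rightarrow> bool" where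
  "finite_energy_solution \<Omega> N \<gamma> \<alpha> A \<psi> u0 u w \<longleftrightarrow>
     (\<forall>T>0.
        (\<forall>i<N. (\<lambda>t x. u t x i) \<in> C_L2 \<Omega> T \<inter> Linf_H1 \<Omega> T \<inter> L2_H2 \<Omega> T \<and>
               (\<lambda>t x. w t x i) \<in> L2_L2 \<Omega> T \<and>
               (\<lambda>t x. D01 \<psi> (u t x i)) \<in> L2_L2 \<Omega> T) \<and>
        (AE t in lebesgue_on {0<..<T}.
           u t \<in> K_set \<Omega> N \<and> (\<forall>i<N. mean \<Omega> (u t) i = mean \<Omega> u0 i)) \<and>
        (AE t in lebesgue_on {0<..<T}. AE x in lebesgue_on \<Omega>. \<forall>i<N. 0 < u t x i \<and> u t x i < 1) \<and>
        (\<exists>ut. (\<forall>i<N. (\<lambda>t x. ut t x i) \<in> L2_L2 \<Omega> T \<and>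
                     has_weak_time_derivative \<Omega> T (\<lambda>t x. u t x i) (\<lambda>t x. ut t x i)) \<and>
              (AE t in lebesgue_on {0<..<T}. AE x in lebesgue_on \<Omega>. \<forall>i<N.
                 ut t x i + mat_vec N \<alpha> (\<lambda>j. w t x j - mean \<Omega> (w t) j) i = 0)) \<and>
        (AE t in lebesgue_on {0<..<T}. AE x in lebesgue_on \<Omega>. \<forall>i<N.
           w t x i = proj N (\<lambda>j. - mat_vec N A (u t x) j + D01 \<psi> (u t x j)) i
                     - \<gamma> * weak_laplacian \<Omega> (\<lambda>y. u t y i) x) \<and>
        (AE t in lebesgue_on {0<..<T}. \<forall>i<N. \<exists>h.
           has_normal_derivative \<Omega> (\<lambda>x. u t x i) h \<and> (AE x in surface_measure \<Omega>. h x = 0))) \<and>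
     (AE x in lebesgue_on \<Omega>. \<forall>i<N. u 0 x i = u0 x i)"

end

theory Submission
  imports Defs
begin

text \<open>
  Let \<open>f(t)\<close> be the convex part \<open>\<integral> \<Sum> \<psi>(u\<^sub>i) + \<gamma>/2 |\<nabla>u|\<^sup>2\<close> of the energy, which differs from the energy by
  a bounded amount, and let \<open>\<xi> = \<psi>'(u) - \<gamma> \<Delta>u\<close> be its subgradient; that it is one follows from Green's
  formula and the Neumann condition. Hence \<open>f(t) - f(s) \<le> (\<xi>(t), u(t) - u(s))\<close>, and averaging this over
  small time steps gives \<open>f(t) - f(s) \<le> \<integral> (\<xi>, u\<^sub>t) dr\<close>. Testing the subgradient inequality with the constant
  \<open>mean u\<close> and inserting \<open>u\<^sub>t = - \<alpha> (w - mean w)\<close> shows \<open>(\<xi>, u\<^sub>t) \<le> C - f\<close> with \<open>C\<close> independent of \<open>\<gamma>\<close> and of the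
  solution, because (M0) makes the quadratic term in \<open>w - mean w\<close> negative definite. A discrete Gronwall
  argument yields the decay of \<open>f\<close> for almost all times; weak lower semicontinuity of the Dirichlet
  integral extends it to all times.
\<close>

section \<open>Smooth functions\<close>

text \<open>A solution is H2 in space only at almost every time and has only a distributional time
  derivative, so the energy is a priori neither continuous nor measurable in time. Subgradient
  inequalities avoid this: they compare two times directly, hold for all pairs of good times, and
  survive averaging, while a chain rule with equality would need more regularity.

  Green's formula meets a trace that is known only as an L2 limit of smooth approximations on the
  Hausdorff surface measure. No boundary integral is computed. Instead, a vanishing normal trace is
  shown to make the normal part of \<open>\<nabla>u\<close> of order o(d) in the L1 norm over a
  layer of width d along the boundary, which beats the factor 1/d in the gradient of a cut-off
  function.

  The constant does not see \<open>\<gamma>\<close> because the competitor \<open>mean u\<close> has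
  no Dirichlet energy. In the dissipation the subgradient is paired with the sum of
  \<open>u\<^sub>t\<close> and \<open>u - mean u\<close>; this field has components that sum to 0
  and integrate to 0, so the multiplier of the projection and the mean of \<open>w\<close> both drop
  out.\<close>

lemma partial_derivative_eq:
  "(f has_derivative f') (at x) ==> partial_derivative b f x = f' b"
  unfolding partial_derivative_def by (metis frechet_derivative_at)

lemma has_derivative_partial:
  assumes "f differentiable (at x)"
  shows "(f has_derivative (\<lambda>h. \<Sum>b\<in>Basis. (h \<bullet> b) * partial_derivative b f x)) (at x)"
proof -
  have d: "(f has_derivative frechet_derivative f (at x)) (at x)"
    using assms frechet_derivative_works by blast
  have "frechet_derivative f (at x) h = (\<Sum>b\<in>Basis. (h \<bullet> b) * partial_derivative b f x)" for h
  proof -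
    have "frechet_derivative f (at x) h = frechet_derivative f (at x) (\<Sum>b\<in>Basis. (h \<bullet> b) *\<^sub>R b)"
      by (simp add: euclidean_representation)
    also have "\<dots> = (\<Sum>b\<in>Basis. (h \<bullet> b) * frechet_derivative f (at x) b)"
      using has_derivative_linear[OF d] by (simp add: linear_sum linear_cmul)
    finally show ?thesis by (simp add: partial_derivative_def)
  qed
  then have "frechet_derivative f (at x) = (\<lambda>h. \<Sum>b\<in>Basis. (h \<bullet> b) * partial_derivative b f x)"
    by (rule ext)
  then show ?thesis using d by metis
qed

lemma inner_gradient: "b \<in> Basis ==> gradient f x \<bullet> b = partial_derivative b f x"
  unfolding gradient_def by (simp add: inner_sum_left inner_Basis if_distrib cong: if_cong)

lemma Ck_on_subset: "Ck_on k S f ==> T \<subseteq> S ==> Ck_on k T f"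
  by (induction k arbitrary: f) (auto intro: continuous_on_subset differentiable_on_subset)

lemma Ck_on_differentiable: "Ck_on (Suc k) S f ==> open S ==> x \<in> S ==> f differentiable (at x)"
  by (simp add: differentiable_on_eq_differentiable_at)

lemma Ck_on_SucD: "Ck_on (Suc k) S f ==> Ck_on k S f"
  by (induction k arbitrary: f) (auto intro: differentiable_imp_continuous_on)

lemma partial_derivative_cong:
  assumes "open S" "x \<in> S" "\<And>y. y \<in> S ==> f y = g y"
  shows "partial_derivative b f x = partial_derivative b g x"
proof -
  have "(f has_derivative D) (at x) \<longleftrightarrow> (g has_derivative D) (at x)" for D
    using has_derivative_transform_within_open[of f D x UNIV S g]
      has_derivative_transform_within_open[of g D x UNIV S f] assms by auto
  then show ?thesis unfolding partial_derivative_def frechet_derivative_def by simp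
qed

lemma Ck_on_cong:
  assumes "open S" "\<And>y. y \<in> S ==> f y = g y" "Ck_on k S f"
  shows "Ck_on k S g"
  using assms(2,3)
proof (induction k arbitrary: f g)
  case 0 then show ?case by (simp cong: continuous_on_cong)
next
  case (Suc k)
  have "g differentiable_on S"
    using Suc.prems by (metis Ck_on.simps(2) differentiable_on_def differentiable_transform_within zero_less_one)
  moreover have "Ck_on k S (partial_derivative b g)" if "b \<in> Basis" for b
    using Suc.IH[of "partial_derivative b f" "partial_derivative b g"] that Suc.prems
      partial_derivative_cong[OF assms(1)] by (metis Ck_on.simps(2))
  ultimately show ?case by simp
qed

lemma Ck_on_const: "Ck_on k S (\<lambda>x. c)"
proof (induction k arbitrary: c)
  case (Suc k)
  have "partial_derivative b (\<lambda>x. c) = (\<lambda>x. 0)" for b :: 'a and c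
    by (rule ext, rule partial_derivative_eq[OF has_derivative_const, THEN trans]) simp
  then show ?case using Suc by simp
qed simp

lemma Ck_on_inner: "Ck_on k S (\<lambda>x. x \<bullet> a)"
proof (cases k)
  case (Suc j)
  have "partial_derivative b (\<lambda>x. x \<bullet> a) = (\<lambda>x. b \<bullet> a)" for b
    by (rule ext, rule partial_derivative_eq) (auto intro!: derivative_eq_intros)
  moreover have "(\<lambda>x. x \<bullet> a) differentiable_on S"
    by (intro linear_imp_differentiable_on bounded_linear.linear bounded_linear_inner_left)
  ultimately show ?thesis using Suc by (simp add: Ck_on_const)
qed (auto intro: continuous_intros)

lemma Ck_on_add:
  assumes "open S" "Ck_on k S f" "Ck_on k S g"
  shows "Ck_on k S (\<lambda>x. f x + g x)"
  using assms(2,3)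
proof (induction k arbitrary: f g)
  case (Suc k)
  have "Ck_on k S (partial_derivative b (\<lambda>x. f x + g x))" if "b \<in> Basis" for b
  proof (rule Ck_on_cong[OF assms(1) _ Suc.IH[of "partial_derivative b f" "partial_derivative b g"]])
    fix y assume "y \<in> S"
    then show "partial_derivative b f y + partial_derivative b g y = partial_derivative b (\<lambda>x. f x + g x) y"
      using Suc.prems assms(1) by (intro partial_derivative_eq[symmetric, THEN trans, OF has_derivative_add])
        (auto simp: partial_derivative_def frechet_derivative_works[symmetric] differentiable_on_eq_differentiable_at)
  qed (use Suc.prems that in auto)
  then show ?case using Suc.prems by (auto intro: derivative_intros)
qed (auto intro: continuous_intros)

lemma partial_derivative_mult:
  assumes "f differentiable (at x)" "g differentiable (at x)"
  shows "partial_derivative b (\<lambda>x. f x * g x) x = partial_derivative b f x * g x + f x * partial_derivative b g x"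
proof -
  have "(f has_derivative frechet_derivative f (at x)) (at x)" "(g has_derivative frechet_derivative g (at x)) (at x)"
    using assms frechet_derivative_works by blast+
  from partial_derivative_eq[OF has_derivative_mult[OF this], of b] show ?thesis
    by (simp add: partial_derivative_def)
qed

lemma Ck_on_mult:
  assumes "open S" "Ck_on k S f" "Ck_on k S g"
  shows "Ck_on k S (\<lambda>x. f x * g x)"
  using assms(2,3)
proof (induction k arbitrary: f g)
  case (Suc k)
  have "Ck_on k S (partial_derivative b (\<lambda>x. f x * g x))" if b: "b \<in> Basis" for b
  proof (rule Ck_on_cong[OF assms(1)])
    show "Ck_on k S (\<lambda>x. partial_derivative b f x * g x + f x * partial_derivative b g x)"
      using Suc.prems b Ck_on_SucD[OF Suc.prems(1)] Ck_on_SucD[OF Suc.prems(2)]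
      by (intro Ck_on_add Suc.IH assms(1)) auto
    fix y assume "y \<in> S"
    then show "partial_derivative b f y * g y + f y * partial_derivative b g y = partial_derivative b (\<lambda>x. f x * g x) y"
      using Suc.prems assms(1) by (intro partial_derivative_mult[symmetric])
        (auto simp: differentiable_on_eq_differentiable_at)
  qed
  then show ?case using Suc.prems by (auto intro: derivative_intros)
qed (auto intro: continuous_intros)

text \<open>The chain rule writes a partial derivative of the composition as \<open>h'\<close>
  composed with \<open>f\<close>, times a partial derivative of \<open>f\<close>. Hence the
  induction keeps \<open>f\<close> fixed and lets \<open>h\<close> vary: the hypothesis is used for
  \<open>h'\<close>, and \<open>f\<close> is merely downgraded by one order.\<close>

lemma Ck_on_compose:
  fixes h :: "real => real"
  assumes "open S" "open T" "f ` S \<subseteq> T" "Ck_on k T h" "Ck_on k S f"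
  shows "Ck_on k S (\<lambda>x. h (f x))"
  using assms(4,5)
proof (induction k arbitrary: h)
  case 0
  then show ?case using assms(3) by (auto intro: continuous_on_compose2)
next
  case (Suc k)
  have dd: "((\<lambda>x. h (f x)) has_derivative (\<lambda>v. partial_derivative 1 h (f x) * frechet_derivative f (at x) v)) (at x)"
    if "x \<in> S" for x
  proof -
    have "f differentiable (at x)" "h differentiable (at (f x))"
      using Suc.prems that assms(1-3) by (auto simp: differentiable_on_eq_differentiable_at)
    then have "(f has_derivative frechet_derivative f (at x)) (at x)"
       "(h has_derivative (\<lambda>v. \<Sum>b\<in>Basis. (v \<bullet> b) * partial_derivative b h (f x))) (at (f x))"
      using frechet_derivative_works has_derivative_partial by blast+
    from has_derivative_compose[OF this] show ?thesis by (simp add: mult.commute)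
  qed
  have "Ck_on k S (partial_derivative b (\<lambda>x. h (f x)))" if b: "b \<in> Basis" for b
  proof (rule Ck_on_cong[OF assms(1)])
    show "Ck_on k S (\<lambda>x. partial_derivative 1 h (f x) * partial_derivative b f x)"
      by (rule Ck_on_mult[OF assms(1) Suc.IH[of "partial_derivative 1 h"]])
        (use Suc.prems b Ck_on_SucD[OF Suc.prems(2)] in auto)
    fix y assume "y \<in> S"
    then show "partial_derivative 1 h (f y) * partial_derivative b f y = partial_derivative b (\<lambda>x. h (f x)) y"
      using partial_derivative_eq[OF dd[of y], of b] by (simp add: partial_derivative_def)
  qed
  moreover have "(\<lambda>x. h (f x)) differentiable_on S"
    using dd assms(1) by (auto simp: differentiable_on_eq_differentiable_at differentiable_def)
  ultimately show ?case by simp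
qed

text \<open>Smoothness is local. This is the gluing principle behind the cut-offs below, which are
  given by a formula on one open set and vanish on another one that completes the cover.\<close>

lemma Ck_on_Un:
  assumes "open S" "open T" "Ck_on k S f" "Ck_on k T f"
  shows "Ck_on k (S \<union> T) f"
  using assms(3,4)
proof (induction k arbitrary: f)
  case 0
  then show ?case using assms(1,2) by (simp add: continuous_on_open_Un)
next
  case (Suc k)
  have "f differentiable_on S \<union> T"
    unfolding differentiable_on_eq_differentiable_at[OF open_Un[OF assms(1,2)]]
  proof
    fix x assume "x \<in> S \<union> T"
    then show "f differentiable (at x)"
      using Ck_on_differentiable[OF Suc.prems(1) assms(1), of x]
        Ck_on_differentiable[OF Suc.prems(2) assms(2), of x] by (elim UnE)
  qed
  moreover have "Ck_on k (S \<union> T) (partial_derivative b f)" if "b \<in> Basis" for b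
    using Suc.IH[of "partial_derivative b f"] Suc.prems that by simp
  ultimately show ?case by simp
qed

lemma smooth_onI: "(\<And>k. Ck_on k S f) ==> smooth_on S f"
  unfolding smooth_on_def by (rule allI)

lemma smooth_onD: "smooth_on S f ==> Ck_on k S f"
  unfolding smooth_on_def by (rule spec)

lemma smooth_on_partial:
  assumes "smooth_on S f" "b \<in> Basis"
  shows "smooth_on S (partial_derivative b f)"
  unfolding smooth_on_def
proof
  fix k
  have "Ck_on (Suc k) S f" using assms(1) unfolding smooth_on_def by (rule spec)
  then show "Ck_on k S (partial_derivative b f)" using assms(2) by simp
qed

lemma smooth_on_differentiable: "smooth_on S f ==> open S ==> x \<in> S ==> f differentiable (at x)"
  by (rule Ck_on_differentiable[OF smooth_onD[of _ _ "Suc 0"]])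

lemma smooth_on_continuous: "smooth_on S f ==> continuous_on S f"
  using smooth_onD[of S f 0] by simp

lemma smooth_on_const: "smooth_on S (\<lambda>x. c)"
  by (simp add: smooth_on_def Ck_on_const)

lemma smooth_on_inner: "smooth_on S (\<lambda>x. x \<bullet> a)"
  by (simp add: smooth_on_def Ck_on_inner)

lemma smooth_on_id: "smooth_on S (\<lambda>x::real. x)"
  using smooth_on_inner[of S "1::real"] by (simp only: inner_real_def mult_1_right)

lemma smooth_on_add: "open S ==> smooth_on S f ==> smooth_on S g ==> smooth_on S (\<lambda>x. f x + g x)"
  by (rule smooth_onI, rule Ck_on_add) (assumption | erule smooth_onD)+

lemma smooth_on_mult: "open S ==> smooth_on S f ==> smooth_on S g ==> smooth_on S (\<lambda>x. f x * g x)"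
  by (rule smooth_onI, rule Ck_on_mult) (assumption | erule smooth_onD)+

lemma smooth_on_uminus: "open S ==> smooth_on S f ==> smooth_on S (\<lambda>x. - f x)"
  using smooth_on_mult[of S "\<lambda>x. -1", OF _ smooth_on_const] by (simp only: mult_minus1)

lemma smooth_on_diff: "open S ==> smooth_on S f ==> smooth_on S g ==> smooth_on S (\<lambda>x. f x - g x)"
  using smooth_on_add[OF _ _ smooth_on_uminus, of S f g] by simp

lemma smooth_on_sum: "open S ==> (\<And>i. i \<in> I ==> smooth_on S (f i)) ==> smooth_on S (\<lambda>x. \<Sum>i\<in>I. f i x)"
  by (induction I rule: infinite_finite_induct) (simp_all add: smooth_on_const smooth_on_add)

lemma smooth_on_prod: "open S ==> (\<And>i. i \<in> I ==> smooth_on S (f i)) ==> smooth_on S (\<lambda>x. \<Prod>i\<in>I. f i x)"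
  by (induction I rule: infinite_finite_induct) (simp_all add: smooth_on_const smooth_on_mult)

lemma smooth_on_compose:
  fixes h :: "real => real"
  shows "open S ==> open T ==> f ` S \<subseteq> T ==> smooth_on T h ==> smooth_on S f ==> smooth_on S (\<lambda>x. h (f x))"
  by (rule smooth_onI, rule Ck_on_compose[of S T]) (assumption | erule smooth_onD)+

lemma smooth_on_Un: "open S ==> open T ==> smooth_on S f ==> smooth_on T f ==> smooth_on (S \<union> T) f"
  by (rule smooth_onI, rule Ck_on_Un) (assumption | erule smooth_onD)+

lemma smooth_on_cong: "open S ==> (\<And>y. y \<in> S ==> f y = g y) ==> smooth_on S f ==> smooth_on S g"
  by (rule smooth_onI, rule Ck_on_cong[of S f g]) (assumption | blast | erule smooth_onD)+

lemma smooth_on_subset: "smooth_on S f ==> T \<subseteq> S ==> smooth_on T f"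
  by (rule smooth_onI, rule Ck_on_subset[of _ S f T]) (assumption | erule smooth_onD)+

section \<open>Smooth functions of one real variable and a smooth step\<close>

lemma partial_derivative_real: "partial_derivative 1 (h::real=>real) x = deriv h x" if "h differentiable (at x)"
proof -
  from that obtain D where D: "(h has_real_derivative D) (at x)"
    using real_differentiable_def by blast
  then have "partial_derivative 1 h x = D"
    using partial_derivative_eq[of h "(*) D" x 1] by (simp add: has_field_derivative_def)
  then show ?thesis using D by (simp add: DERIV_imp_deriv)
qed

text \<open>Bootstrapping for a family that is closed under differentiation up to algebra: once
  every member is \<open>k\<close> times continuously differentiable, so is every derivative, which
  lifts all members to order \<open>k + 1\<close> together.\<close>

lemma smooth_on_realI:
  fixes F :: "'i => real => real"
  assumes "open S" "\<And>i x. x \<in> S ==> (F i has_real_derivative G i x) (at x)"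
    "\<And>k i. (\<And>j. Ck_on k S (F j)) ==> Ck_on k S (G i)"
  shows "smooth_on S (F i)"
proof -
  have "Ck_on k S (F i)" for k i
  proof (induction k arbitrary: i)
    case 0
    show ?case using assms(2) by (auto intro!: continuous_at_imp_continuous_on DERIV_isCont)
  next
    case (Suc k)
    have "partial_derivative 1 (F i) x = G i x" if "x \<in> S" for x
      using assms(2)[OF that, of i] partial_derivative_eq[of "F i" "(*) (G i x)" x 1]
      by (simp add: has_field_derivative_def)
    then have "Ck_on k S (partial_derivative 1 (F i))"
      using Ck_on_cong[OF assms(1), of "G i"] assms(3)[OF Suc.IH] by simp
    moreover have "F i differentiable_on S"
      using assms(1,2) by (meson differentiable_on_eq_differentiable_at real_differentiable_def)
    ultimately show ?case by simp
  qed
  then show ?thesis by (simp add: smooth_on_def)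
qed

lemma smooth_on_inverse: "smooth_on {0<..} (inverse :: real => real)"
proof (rule smooth_on_realI[where F = "\<lambda>_::unit. inverse" and G = "\<lambda>_ x. (-1) * (inverse x * inverse x)"])
  fix k :: nat
  assume "\<And>j::unit. Ck_on k {0<..} (inverse :: real => real)"
  then show "Ck_on k {0<..} (\<lambda>x::real. (-1) * (inverse x * inverse x))"
    by (intro Ck_on_mult[OF open_greaterThan Ck_on_const] Ck_on_mult[OF open_greaterThan])
qed (auto intro!: derivative_eq_intros)

text \<open>The classical flat function exp(-1/t). The powers of 1/t are carried along because
  differentiation produces them: the derivative of \<open>flat n\<close> is a combination of
  \<open>flat (n + 2)\<close> and \<open>flat (n + 1)\<close>, so the family is closed.\<close>

definition flat :: "nat => real => real" where
  "flat n t = (if t \<le> 0 then 0 else exp (- inverse t) * inverse t ^ n)"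

text \<open>With \<open>x\<close> = 1/h the quotient becomes \<open>x ^ Suc n / exp x\<close>, and
  the exponential wins.\<close>

lemma flat_at_0: "((\<lambda>h. flat n h / h) \<longlongrightarrow> 0) (at 0)"
proof -
  have "((\<lambda>x::real. x ^ Suc n / exp x) \<longlongrightarrow> 0) at_top"
    by (rule tendsto_power_div_exp_0)
  then have "((\<lambda>h::real. inverse h ^ Suc n / exp (inverse h)) \<longlongrightarrow> 0) (at_right 0)"
    by (rule filterlim_compose[OF _ filterlim_inverse_at_top_right])
  then have "((\<lambda>h. flat n h / h) \<longlongrightarrow> 0) (at_right 0)"
    by (rule Lim_transform_eventually)
      (auto simp: eventually_at_filter flat_def exp_minus field_simps)
  moreover have "((\<lambda>h. flat n h / h) \<longlongrightarrow> 0) (at_left 0)"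
    by (rule Lim_transform_eventually[OF tendsto_const])
      (auto simp: eventually_at_filter flat_def)
  ultimately show ?thesis by (simp add: filterlim_at_split)
qed

lemma DERIV_flat:
  "(flat n has_real_derivative (flat (n + 2) t - real n * flat (n + 1) t)) (at t)"
proof -
  consider "t < 0" | "t = 0" | "t > 0" by linarith
  then show ?thesis
  proof cases
    case 1
    then have "flat (n + 2) t - real n * flat (n + 1) t = 0" by (simp add: flat_def)
    moreover have "(flat n has_real_derivative 0) (at t)"
      by (rule has_field_derivative_transform_within_open[OF DERIV_const open_lessThan[of 0]])
        (use 1 in \<open>simp_all add: flat_def\<close>)
    ultimately show ?thesis by simp
  next
    case 2
    then show ?thesis
      using flat_at_0[of n] by (simp add: has_field_derivative_iff flat_def)
  next
    case 3
    have "((\<lambda>t. exp (- inverse t) * inverse t ^ n) has_real_derivative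
       (flat (n + 2) t - real n * flat (n + 1) t)) (at t)"
      using 3 by (auto intro!: derivative_eq_intros simp: flat_def algebra_simps power2_eq_square)
        (cases n, auto simp: algebra_simps)
    then show ?thesis
      by (rule has_field_derivative_transform_within_open[OF _ open_greaterThan[of 0]])
        (use 3 in \<open>simp_all add: flat_def\<close>)
  qed
qed

lemma smooth_flat: "smooth_on UNIV (flat n)"
proof (rule smooth_on_realI[where F = flat and G = "\<lambda>n t. flat (n + 2) t + (- real n) * flat (n + 1) t"])
  fix k i
  assume "\<And>j. Ck_on k UNIV (flat j)"
  then show "Ck_on k UNIV (\<lambda>t. flat (i + 2) t + (- real i) * flat (i + 1) t)"
    by (intro Ck_on_add[OF open_UNIV] Ck_on_mult[OF open_UNIV Ck_on_const])
qed (use DERIV_flat in auto)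

definition smooth_step :: "real => real" where
  "smooth_step t = flat 0 t * inverse (flat 0 t + flat 0 (1 - t))"

text \<open>The numbers \<open>t\<close> and \<open>1 - t\<close> cannot both be
  nonpositive.\<close>

lemma flat_denominator: "0 < flat 0 t + flat 0 (1 - t)"
  by (cases "t \<le> 0"; cases "t \<ge> 1") (auto simp: flat_def intro: add_pos_pos)

lemma smooth_smooth_step: "smooth_on UNIV smooth_step"
proof -
  have f: "smooth_on UNIV (\<lambda>t. flat 0 (1 - t))"
    by (rule smooth_on_compose[of UNIV UNIV])
      (auto intro: smooth_flat smooth_on_diff smooth_on_const smooth_on_id)
  have "smooth_on UNIV (\<lambda>t. inverse (flat 0 t + flat 0 (1 - t)))"
    by (rule smooth_on_compose[of UNIV "{0<..}" _ inverse])
      (use flat_denominator in \<open>auto intro: smooth_flat smooth_on_inverse smooth_on_add f\<close>)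
  then show ?thesis
    unfolding smooth_step_def[abs_def] by (intro smooth_on_mult smooth_flat open_UNIV)
qed

lemma smooth_step_le_0: "t \<le> 0 ==> smooth_step t = 0"
  by (simp add: smooth_step_def flat_def)

lemma smooth_step_ge_1: "t \<ge> 1 ==> smooth_step t = 1"
  using flat_denominator[of t] by (simp add: smooth_step_def flat_def)

lemma smooth_step_bounds: "0 \<le> smooth_step t" "smooth_step t \<le> 1"
proof -
  have "0 \<le> flat 0 t" "0 \<le> flat 0 (1 - t)" by (auto simp: flat_def)
  then show "0 \<le> smooth_step t" "smooth_step t \<le> 1"
    using flat_denominator[of t] by (auto simp: smooth_step_def field_simps)
qed

section \<open>Square-integrable functions\<close>

lemma L2_measurable: "f \<in> L2 M ==> f \<in> borel_measurable M"
  by (simp add: L2_def)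

lemma L2_integrable_square: "f \<in> L2 M ==> integrable M (\<lambda>x. (f x)\<^sup>2)"
  by (simp add: L2_def)

lemma L2_integrable_mult:
  assumes "f \<in> L2 M" "g \<in> L2 M"
  shows "integrable M (\<lambda>x. f x * g x)"
proof (rule Bochner_Integration.integrable_bound)
  show "integrable M (\<lambda>x. (f x)\<^sup>2 + (g x)\<^sup>2)"
    using assms by (intro Bochner_Integration.integrable_add L2_integrable_square)
  show "(\<lambda>x. f x * g x) \<in> borel_measurable M"
    using assms[THEN L2_measurable] by measurable
  have "\<bar>a * b\<bar> \<le> a\<^sup>2 + b\<^sup>2" for a b :: real
  proof -
    have "0 \<le> (\<bar>a\<bar> - \<bar>b\<bar>)\<^sup>2" "0 \<le> \<bar>a\<bar> * \<bar>b\<bar>" by auto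
    then have "2 * (\<bar>a\<bar> * \<bar>b\<bar>) \<le> a\<^sup>2 + b\<^sup>2" by (simp add: power2_eq_square algebra_simps)
    then show ?thesis using \<open>0 \<le> \<bar>a\<bar> * \<bar>b\<bar>\<close> by (simp only: abs_mult)
  qed
  then show "AE x in M. norm (f x * g x) \<le> norm ((f x)\<^sup>2 + (g x)\<^sup>2)"
    by auto
qed

lemma L2_cmult: "f \<in> L2 M ==> (\<lambda>x. c * f x) \<in> L2 M"
  by (simp add: L2_def power_mult_distrib borel_measurable_times)

lemma L2_add:
  assumes "f \<in> L2 M" "g \<in> L2 M"
  shows "(\<lambda>x. f x + g x) \<in> L2 M"
proof -
  have "integrable M (\<lambda>x. (f x)\<^sup>2 + (g x)\<^sup>2 + 2 * (f x * g x))"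
    using assms by (intro Bochner_Integration.integrable_add integrable_mult_right L2_integrable_square L2_integrable_mult)
  then show ?thesis
    using assms[THEN L2_measurable] by (auto simp: L2_def power2_sum algebra_simps)
qed

lemma L2_uminus: "f \<in> L2 M ==> (\<lambda>x. - f x) \<in> L2 M"
  using L2_cmult[of f M "-1"] by simp

lemma L2_diff: "f \<in> L2 M ==> g \<in> L2 M ==> (\<lambda>x. f x - g x) \<in> L2 M"
  using L2_add[OF _ L2_uminus, of f M g] by simp

lemma L2_zero: "(\<lambda>x. 0) \<in> L2 M"
  by (simp add: L2_def)

lemma L2_sum: "(\<And>i. i \<in> I ==> f i \<in> L2 M) ==> (\<lambda>x. \<Sum>i\<in>I. f i x) \<in> L2 M"
  by (induction I rule: infinite_finite_induct) (simp_all add: L2_zero L2_add)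

lemma L2_bound:
  assumes "g \<in> L2 M" "f \<in> borel_measurable M" "AE x in M. \<bar>f x\<bar> \<le> \<bar>g x\<bar>"
  shows "f \<in> L2 M"
proof -
  have "integrable M (\<lambda>x. (f x)\<^sup>2)"
    using assms by (intro Bochner_Integration.integrable_bound[OF L2_integrable_square[OF assms(1)]])
      (auto simp: abs_le_square_iff)
  then show ?thesis using assms by (simp add: L2_def)
qed

lemma L2_bounded_mult:
  assumes "g \<in> L2 M" "f \<in> borel_measurable M" "AE x in M. \<bar>f x\<bar> \<le> C"
  shows "(\<lambda>x. f x * g x) \<in> L2 M"
proof (rule L2_bound[OF L2_cmult[OF assms(1), of C]])
  show "(\<lambda>x. f x * g x) \<in> borel_measurable M"
    using assms L2_measurable[OF assms(1)] by measurable
  show "AE x in M. \<bar>f x * g x\<bar> \<le> \<bar>C * g x\<bar>"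
    using assms(3) by eventually_elim (auto simp: abs_mult intro!: mult_right_mono)
qed

lemma L2_norm_nonneg: "0 \<le> L2_norm M f"
  by (simp add: L2_norm_def)

lemma L2_norm_sq: "(L2_norm M f)\<^sup>2 = (LINT x|M. (f x)\<^sup>2)"
  by (simp add: L2_norm_def)

lemma L2_norm_cong_AE:
  assumes "f \<in> borel_measurable M" "g \<in> borel_measurable M" "AE x in M. f x = g x"
  shows "L2_norm M f = L2_norm M g"
  unfolding L2_norm_def
  by (intro arg_cong[where f = sqrt] integral_cong_AE borel_measurable_power assms) (use assms(3) in auto)

lemma L2_Cauchy_Schwarz_abs:
  assumes "f \<in> L2 M" "g \<in> L2 M"
  shows "(LINT x|M. \<bar>f x * g x\<bar>) \<le> L2_norm M f * L2_norm M g"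
proof -
  let ?a = "LINT x|M. (f x)\<^sup>2" and ?b = "LINT x|M. (g x)\<^sup>2" and ?c = "LINT x|M. \<bar>f x * g x\<bar>"
  have c0: "0 \<le> ?c" and a0: "0 \<le> ?a" and b0: "0 \<le> ?b" by auto
  have key: "2 * t * ?c \<le> ?a + t\<^sup>2 * ?b" if "0 \<le> t" for t
  proof -
    have "(LINT x|M. 2 * t * \<bar>f x * g x\<bar>) \<le> (LINT x|M. (f x)\<^sup>2 + t\<^sup>2 * (g x)\<^sup>2)"
    proof (rule integral_mono)
      show "integrable M (\<lambda>x. 2 * t * \<bar>f x * g x\<bar>)"
        using L2_integrable_mult[OF assms] by auto
      show "integrable M (\<lambda>x. (f x)\<^sup>2 + t\<^sup>2 * (g x)\<^sup>2)"
        using assms by (intro Bochner_Integration.integrable_add integrable_mult_right L2_integrable_square)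
      fix x
      have "0 \<le> (\<bar>f x\<bar> - t * \<bar>g x\<bar>)\<^sup>2" by simp
      then show "2 * t * \<bar>f x * g x\<bar> \<le> (f x)\<^sup>2 + t\<^sup>2 * (g x)\<^sup>2"
        by (simp add: power2_eq_square algebra_simps abs_mult)
    qed
    then show ?thesis
      using assms[THEN L2_integrable_square] by simp
  qed
  \<comment> \<open>The discriminant argument needs the optimal \<open>t = ?c / ?b\<close>. If
    \<open>?b = 0\<close>, letting \<open>t\<close> grow forces \<open>?c\<close> below every
    positive \<open>e\<close>.\<close>
  have "?c\<^sup>2 \<le> ?a * ?b"
  proof (cases "?b = 0")
    case True
    have "?c \<le> e" if "e > 0" for e
    proof -
      have "2 * ((?a + 1) / e) * ?c \<le> ?a" using key[of "(?a + 1) / e"] True a0 that by simp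
      then have "(?a + 1) * (2 * ?c) \<le> (?a + 1) * e"
        using that a0 by (simp add: field_simps)
      then have "2 * ?c \<le> e" by (rule mult_left_le_imp_le) (use a0 in linarith)
      then show ?thesis using c0 by linarith
    qed
    then have "?c \<le> 0" by (rule field_le_epsilon[of ?c 0, simplified])
    then show ?thesis using c0 True by simp
  next
    case False
    then have "0 < ?b" using b0 by linarith
    then show ?thesis using key[of "?c / ?b"] c0 by (simp add: field_simps power2_eq_square)
  qed
  then have "?c \<le> sqrt (?a * ?b)" by (rule real_le_rsqrt)
  then show ?thesis by (simp add: L2_norm_def real_sqrt_mult)
qed

lemma L2_Cauchy_Schwarz:
  assumes "f \<in> L2 M" "g \<in> L2 M"
  shows "\<bar>LINT x|M. f x * g x\<bar> \<le> L2_norm M f * L2_norm M g"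
  using integral_abs_bound[of M "\<lambda>x. f x * g x"] L2_Cauchy_Schwarz_abs[OF assms] by linarith

lemma L2_tendsto_inner:
  assumes F: "\<And>k. F k \<in> L2 M" and f: "f \<in> L2 M" and g: "g \<in> L2 M"
    and lim: "((\<lambda>k. L2_norm M (\<lambda>x. F k x - f x)) \<longlongrightarrow> 0) net"
  shows "((\<lambda>k. LINT x|M. F k x * g x) \<longlongrightarrow> (LINT x|M. f x * g x)) net"
proof (rule Lim_null[THEN iffD2], rule Lim_null_comparison)
  show "((\<lambda>k. L2_norm M (\<lambda>x. F k x - f x) * L2_norm M g) \<longlongrightarrow> 0) net"
    using tendsto_mult_left_zero[OF lim] .
  have "(LINT x|M. F k x * g x) - (LINT x|M. f x * g x) = (LINT x|M. (F k x - f x) * g x)" for k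
    using L2_integrable_mult[OF F g] L2_integrable_mult[OF f g]
    by (simp add: left_diff_distrib)
  then show "\<forall>\<^sub>F k in net. norm ((LINT x|M. F k x * g x) - (LINT x|M. f x * g x))
       \<le> L2_norm M (\<lambda>x. F k x - f x) * L2_norm M g"
    using L2_Cauchy_Schwarz[OF L2_diff[OF F f] g] by simp
qed

lemma (in finite_measure) L2_const: "(\<lambda>x. c) \<in> L2 M"
  by (simp add: L2_def)

lemma (in finite_measure) L2_integrable:
  assumes "f \<in> L2 M" shows "integrable M f"
  using L2_integrable_mult[OF assms L2_const[of 1]] by simp

lemma (in finite_measure) L2_bounded:
  assumes "f \<in> borel_measurable M" "AE x in M. \<bar>f x\<bar> \<le> C"
  shows "f \<in> L2 M"
  using L2_bounded_mult[OF L2_const[of 1] assms] by simp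

lemma (in finite_measure) L1_le_L2:
  assumes "f \<in> L2 M"
  shows "(LINT x|M. \<bar>f x\<bar>) \<le> L2_norm M f * sqrt (measure M (space M))"
  using L2_Cauchy_Schwarz_abs[OF assms L2_const[of 1]] by (simp add: L2_norm_def)

lemma L2_norm_triangle:
  assumes "f \<in> L2 M" "g \<in> L2 M"
  shows "L2_norm M (\<lambda>x. f x + g x) \<le> L2_norm M f + L2_norm M g"
proof -
  have i: "integrable M (\<lambda>x. (f x)\<^sup>2)" "integrable M (\<lambda>x. (g x)\<^sup>2)" "integrable M (\<lambda>x. f x * g x)"
    using assms by (auto intro: L2_integrable_square L2_integrable_mult)
  have "(LINT x|M. (f x + g x)\<^sup>2) = (LINT x|M. (f x)\<^sup>2 + (g x)\<^sup>2 + 2 * (f x * g x))"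
    by (simp add: power2_sum algebra_simps)
  also have "\<dots> = (L2_norm M f)\<^sup>2 + (L2_norm M g)\<^sup>2 + 2 * (LINT x|M. f x * g x)"
    using i by (simp add: L2_norm_sq)
  also have "\<dots> \<le> (L2_norm M f + L2_norm M g)\<^sup>2"
    using L2_Cauchy_Schwarz[OF assms] by (simp add: power2_sum)
  finally show ?thesis
    unfolding L2_norm_def[of M "\<lambda>x. f x + g x"]
    by (rule real_le_lsqrt[rotated]) (simp add: L2_norm_nonneg)
qed

lemma L2_norm_uminus: "L2_norm M (\<lambda>x. - f x) = L2_norm M f"
  by (simp add: L2_norm_def)

lemma L2_norm_tendsto:
  assumes F: "\<And>k. F k \<in> L2 M" and f: "f \<in> L2 M"
    and lim: "((\<lambda>k. L2_norm M (\<lambda>x. F k x - f x)) \<longlongrightarrow> 0) net"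
  shows "((\<lambda>k. L2_norm M (F k)) \<longlongrightarrow> L2_norm M f) net"
proof (rule Lim_null[THEN iffD2], rule Lim_null_comparison[OF _ lim])
  have "\<bar>L2_norm M (F k) - L2_norm M f\<bar> \<le> L2_norm M (\<lambda>x. F k x - f x)" for k
  proof -
    have "L2_norm M (\<lambda>x. f x - F k x) = L2_norm M (\<lambda>x. F k x - f x)"
      using L2_norm_uminus[of M "\<lambda>x. F k x - f x"] by simp
    then show ?thesis
      using L2_norm_triangle[OF L2_diff[OF F f] f, of k] L2_norm_triangle[OF L2_diff[OF f F] F, of k k] by simp
  qed
  then show "\<forall>\<^sub>F k in net. norm (L2_norm M (F k) - L2_norm M f) \<le> L2_norm M (\<lambda>x. F k x - f x)"
    by simp
qed

text \<open>Riesz--Fischer; the limit is the pointwise limit of an almost everywhere Cauchy subsequence.\<close>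

lemma (in finite_measure) L2_complete:
  fixes s :: "nat => 'a => real"
  assumes s: "\<And>n. s n \<in> L2 M"
    and cau: "\<And>e. e > 0 ==> \<exists>N. \<forall>i\<ge>N. \<forall>j\<ge>N. L2_norm M (\<lambda>x. s i x - s j x) < e"
  obtains f where "f \<in> L2 M" "(\<lambda>n. L2_norm M (\<lambda>x. s n x - f x)) \<longlonglongrightarrow> 0"
proof -
  note [measurable] = L2_measurable[OF s]
  have int: "integrable M (s n)" for n by (rule L2_integrable[OF s])
  \<comment> \<open>On a finite measure space L2-Cauchy implies L1-Cauchy, and an L1-Cauchy sequence
    has an almost everywhere Cauchy subsequence. The summand 1 in \<open>?c\<close> keeps the
    divisor positive on a null space.\<close>
  have cau1: "\<exists>N. \<forall>i\<ge>N. \<forall>j\<ge>N. (LINT x|M. norm (s i x - s j x)) < e" if e: "e > 0" for e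
  proof -
    let ?c = "sqrt (measure M (space M)) + 1"
    have c: "?c > 0" by (simp add: add_nonneg_pos)
    obtain N where N: "\<And>i j. i \<ge> N ==> j \<ge> N ==> L2_norm M (\<lambda>x. s i x - s j x) < e / ?c"
      using cau[OF divide_pos_pos[OF e c]] by blast
    have "(LINT x|M. norm (s i x - s j x)) < e" if "i \<ge> N" "j \<ge> N" for i j
    proof -
      have "(LINT x|M. norm (s i x - s j x)) \<le> L2_norm M (\<lambda>x. s i x - s j x) * sqrt (measure M (space M))"
        using L1_le_L2[OF L2_diff[OF s s]] by simp
      also have "\<dots> \<le> L2_norm M (\<lambda>x. s i x - s j x) * ?c"
        by (intro mult_left_mono L2_norm_nonneg) simp
      also have "\<dots> < e" using N[OF that] c by (simp add: field_simps)
      finally show ?thesis .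
    qed
    then show ?thesis by blast
  qed
  obtain r where r: "strict_mono r" "AE x in M. Cauchy (\<lambda>i. s (r i) x)"
    by (rule cauchy_L1_AE_cauchy_subseq[OF int cau1]) auto
  define f where "f x = lim (\<lambda>i. s (r i) x)" for x
  have [measurable]: "f \<in> borel_measurable M" unfolding f_def[abs_def] by measurable
  have f: "AE x in M. (\<lambda>i. s (r i) x) \<longlonglongrightarrow> f x"
    using r(2) by eventually_elim (simp add: f_def convergent_LIMSEQ_iff[symmetric] Cauchy_convergent_iff)
  \<comment> \<open>Fatou's lemma along the subsequence carries the Cauchy bound for
    \<open>s n - s j\<close> over to \<open>s n - f\<close>. It needs no integrability of
    \<open>f\<close>, which is a consequence.\<close>
  have fatou: "(\<integral>\<^sup>+x. ennreal ((s n x - f x)\<^sup>2) \<partial>M) \<le> ennreal (e\<^sup>2)"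
    if N: "\<And>j. j \<ge> N ==> L2_norm M (\<lambda>x. s n x - s j x) < e" for n N e
  proof -
    have "(\<integral>\<^sup>+x. ennreal ((s n x - f x)\<^sup>2) \<partial>M) = (\<integral>\<^sup>+x. liminf (\<lambda>i. ennreal ((s n x - s (r i) x)\<^sup>2)) \<partial>M)"
    proof (rule nn_integral_cong_AE)
      show "AE x in M. ennreal ((s n x - f x)\<^sup>2) = liminf (\<lambda>i. ennreal ((s n x - s (r i) x)\<^sup>2))"
        using f
      proof eventually_elim
        case (elim x)
        then have "(\<lambda>i. ennreal ((s n x - s (r i) x)\<^sup>2)) \<longlonglongrightarrow> ennreal ((s n x - f x)\<^sup>2)"
          by (intro tendsto_intros) 
        then show ?case by (rule lim_imp_Liminf[symmetric, rotated]) simp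
      qed
    qed
    also have "\<dots> \<le> liminf (\<lambda>i. \<integral>\<^sup>+x. ennreal ((s n x - s (r i) x)\<^sup>2) \<partial>M)"
      by (rule nn_integral_liminf) measurable
    also have "\<dots> \<le> ennreal (e\<^sup>2)"
    proof (rule Liminf_le)
      have "(\<integral>\<^sup>+x. ennreal ((s n x - s (r i) x)\<^sup>2) \<partial>M) \<le> ennreal (e\<^sup>2)" if "i \<ge> N" for i
      proof -
        have "r i \<ge> N" using r(1) that by (meson le_trans seq_suble)
        then have "(L2_norm M (\<lambda>x. s n x - s (r i) x))\<^sup>2 \<le> e\<^sup>2"
          using N[of "r i"] by (intro power_mono L2_norm_nonneg) simp
        then show ?thesis
          using nn_integral_eq_integral[OF L2_integrable_square[OF L2_diff[OF s s]]] by (simp add: L2_norm_sq ennreal_leI)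
      qed
      then show "\<forall>\<^sub>F i in sequentially. (\<integral>\<^sup>+x. ennreal ((s n x - s (r i) x)\<^sup>2) \<partial>M) \<le> ennreal (e\<^sup>2)"
        by (auto simp: eventually_sequentially)
    qed simp
    finally show ?thesis .
  qed
  have diff: "(\<lambda>x. s n x - f x) \<in> L2 M \<and> L2_norm M (\<lambda>x. s n x - f x) \<le> e"
    if N: "\<And>j. j \<ge> N ==> L2_norm M (\<lambda>x. s n x - s j x) < e" for n N e
  proof -
    have e: "0 \<le> e" using N[of N] L2_norm_nonneg[of M "\<lambda>x. s n x - s N x"] by simp
    have ft: "(\<integral>\<^sup>+x. ennreal ((s n x - f x)\<^sup>2) \<partial>M) \<le> ennreal (e\<^sup>2)"
      by (rule fatou[of N]) (rule N)
    have i: "integrable M (\<lambda>x. (s n x - f x)\<^sup>2)"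
    proof (rule integrableI_bounded)
      show "(\<integral>\<^sup>+x. ennreal (norm ((s n x - f x)\<^sup>2)) \<partial>M) < \<infinity>"
        using ft ennreal_less_top[of "e\<^sup>2"] by (simp add: le_less_trans)
    qed measurable
    then have "ennreal (LINT x|M. (s n x - f x)\<^sup>2) \<le> ennreal (e\<^sup>2)"
      using ft by (simp add: nn_integral_eq_integral)
    then have "(LINT x|M. (s n x - f x)\<^sup>2) \<le> e\<^sup>2" by (simp add: ennreal_le_iff)
    then have "L2_norm M (\<lambda>x. s n x - f x) \<le> e"
      unfolding L2_norm_def using e real_le_lsqrt by blast
    then show ?thesis using i by (simp add: L2_def)
  qed
  have ev: "\<exists>N. \<forall>n\<ge>N. (\<lambda>x. s n x - f x) \<in> L2 M \<and> L2_norm M (\<lambda>x. s n x - f x) \<le> e" if "e > 0" for e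
    using cau[OF that] diff by meson
  obtain n where "(\<lambda>x. s n x - f x) \<in> L2 M" using ev[of 1] by auto
  from L2_diff[OF s this, of n] have fL2: "f \<in> L2 M" by simp
  have "(\<lambda>n. L2_norm M (\<lambda>x. s n x - f x)) \<longlonglongrightarrow> 0"
  proof (rule LIMSEQ_I)
    fix e :: real assume "e > 0"
    then obtain N where "\<forall>n\<ge>N. L2_norm M (\<lambda>x. s n x - f x) \<le> e / 2" using ev[of "e/2"] by auto
    then show "\<exists>N. \<forall>n\<ge>N. norm (L2_norm M (\<lambda>x. s n x - f x) - 0) < e"
      using \<open>e > 0\<close> by (intro exI[of _ N]) (auto simp: L2_norm_nonneg intro: le_less_trans)
  qed
  with fL2 show ?thesis by (rule that)
qed

section \<open>Weak derivatives\<close>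

lemma integrable_lebesgue_on_subset:
  fixes f :: "'a::euclidean_space => real"
  assumes "integrable (lebesgue_on S) f" "T \<subseteq> S" "S \<in> sets lebesgue" "T \<in> sets lebesgue"
  shows "integrable (lebesgue_on T) f"
  using assms set_integrable_subset[of lebesgue S f T] by (simp add: integrable_restrict_space set_integrable_def)

lemma integral_lebesgue_on_eq:
  fixes f :: "'a::euclidean_space => real"
  assumes "S \<in> sets lebesgue"
  shows "(LINT x|lebesgue_on S. f x) = (LINT x|lebesgue. indicator S x * f x)"
  using assms by (simp add: integral_restrict_space)

section \<open>Bump functions and test functions\<close>

lemma smooth_step_affine: "smooth_on UNIV (\<lambda>x. smooth_step (c * (x \<bullet> b) + d))"
  by (rule smooth_on_compose[OF open_UNIV open_UNIV _ smooth_smooth_step])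
    (auto intro!: smooth_on_add smooth_on_mult smooth_on_const smooth_on_inner)

text \<open>Each factor is \<open>smooth_step\<close> of \<open>n\<close> times the signed distance
  to one face of the box, so the function reaches 1 at distance \<open>1 / n\<close> from all faces
  and tends to the indicator of the open box. Expanding the argument into an affine form lets
  \<open>smooth_step_affine\<close> apply.\<close>

definition box_bump :: "nat => 'a::euclidean_space => 'a => 'a => real" where
  "box_bump n a b x = (\<Prod>i\<in>Basis. smooth_step (real n * (x \<bullet> i) + (- real n * (a \<bullet> i))) *
     smooth_step ((- real n) * (x \<bullet> i) + real n * (b \<bullet> i)))"

lemma smooth_box_bump: "smooth_on UNIV (box_bump n a b)"
  unfolding box_bump_def[abs_def] by (intro smooth_on_prod smooth_on_mult smooth_step_affine open_UNIV)

lemma box_bump_outside: "x \<notin> box a b ==> box_bump n a b x = 0"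
proof -
  assume "x \<notin> box a b"
  then obtain i where i: "i \<in> Basis" "x \<bullet> i \<le> a \<bullet> i \<or> b \<bullet> i \<le> x \<bullet> i"
    by (auto simp: mem_box not_less)
  then have "real n * (x \<bullet> i) + (- real n * (a \<bullet> i)) \<le> 0 \<or> (- real n) * (x \<bullet> i) + real n * (b \<bullet> i) \<le> 0"
    by (auto simp: mult_left_mono)
  then show ?thesis
    unfolding box_bump_def using i(1) smooth_step_le_0
    by (intro prod_zero[OF finite_Basis] bexI[OF _ i(1)]) (auto simp only: mult_zero_left mult_zero_right)
qed

lemma box_bump_bounds: "0 \<le> box_bump n a b x" "box_bump n a b x \<le> 1"
  unfolding box_bump_def by (auto intro!: prod_nonneg prod_le_1 mult_nonneg_nonneg mult_le_one smooth_step_bounds)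

lemma box_bump_limit: "(\<lambda>n. box_bump n a b x) \<longlonglongrightarrow> indicator (box a b) x"
proof (cases "x \<in> box a b")
  case False
  then show ?thesis by (simp add: box_bump_outside)
next
  case True
  have "\<forall>\<^sub>F n in sequentially. smooth_step (real n * (x \<bullet> i) + (- real n * (a \<bullet> i))) *
     smooth_step ((- real n) * (x \<bullet> i) + real n * (b \<bullet> i)) = 1" if i: "i \<in> Basis" for i
  proof -
    define d where "d = min (x \<bullet> i - a \<bullet> i) (b \<bullet> i - x \<bullet> i)"
    have d: "d > 0" using True i by (auto simp: d_def mem_box)
    have "\<forall>\<^sub>F n in sequentially. 1 / d \<le> real n"
      using filterlim_real_sequentially by (simp add: filterlim_at_top)
    then show ?thesis
    proof eventually_elim
      case (elim n)
      then have "1 \<le> real n * d" using d by (simp add: field_simps)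
      moreover have "real n * d \<le> real n * (x \<bullet> i - a \<bullet> i)" "real n * d \<le> real n * (b \<bullet> i - x \<bullet> i)"
        by (intro mult_left_mono; simp add: d_def)+
      ultimately have "1 \<le> real n * (x \<bullet> i) + (- real n * (a \<bullet> i))" "1 \<le> (- real n) * (x \<bullet> i) + real n * (b \<bullet> i)"
        by (simp_all add: algebra_simps)
      then show ?case by (simp only: smooth_step_ge_1)
    qed
  qed
  then have "\<forall>\<^sub>F n in sequentially. \<forall>i\<in>Basis. smooth_step (real n * (x \<bullet> i) + (- real n * (a \<bullet> i))) *
     smooth_step ((- real n) * (x \<bullet> i) + real n * (b \<bullet> i)) = 1"
    by (simp only: eventually_ball_finite_distrib[OF finite_Basis]) blast
  then have "\<forall>\<^sub>F n in sequentially. box_bump n a b x = 1"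
    by eventually_elim (unfold box_bump_def, rule prod.neutral)
  then show ?thesis using True by (simp add: tendsto_eventually)
qed

lemma test_functionI:
  assumes "smooth_on UNIV f" "compact K" "K \<subseteq> \<Omega>" "\<And>x. x \<notin> K ==> f x = 0"
  shows "test_function \<Omega> f"
proof -
  have sub: "{x. f x \<noteq> 0} \<subseteq> K" using assms(4) by blast
  then have "closure {x. f x \<noteq> 0} \<subseteq> K" using assms(2) by (intro closure_minimal compact_imp_closed)
  moreover have "compact (closure {x. f x \<noteq> 0})"
    using bounded_subset[OF compact_imp_bounded[OF assms(2)] sub] by (simp only: compact_closure)
  ultimately show ?thesis using assms(1,3) unfolding test_function_def by blast
qed

lemma test_function_zero: "test_function \<Omega> \<eta> ==> x \<notin> \<Omega> ==> \<eta> x = 0"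
  unfolding test_function_def using closure_subset[of "{x. \<eta> x \<noteq> 0}"] by blast

lemma test_function_smooth_mult:
  assumes "test_function \<Omega> \<eta>" "smooth_on UNIV F"
  shows "test_function \<Omega> (\<lambda>x. F x * \<eta> x)"
  using assms closure_subset[of "{x. \<eta> x \<noteq> 0}"]
  by (intro test_functionI[of _ "closure {x. \<eta> x \<noteq> 0}"] smooth_on_mult)
    (auto simp: test_function_def)

lemma test_function_measurable:
  "test_function \<Omega> (\<eta>::'a::euclidean_space => real) ==> \<eta> \<in> borel_measurable borel"
  unfolding test_function_def by (intro borel_measurable_continuous_onI smooth_on_continuous) auto

lemma compact_support_bounded:
  fixes f :: "'a::euclidean_space => real"
  assumes "continuous_on UNIV f" "compact K" "\<And>x. x \<notin> K ==> f x = 0"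
  obtains C where "\<And>x. \<bar>f x\<bar> \<le> C" "C \<ge> 0"
proof -
  have "bounded (f ` K)"
    using assms by (intro compact_imp_bounded compact_continuous_image) (auto intro: continuous_on_subset)
  then obtain C where C: "\<And>x. x \<in> K ==> \<bar>f x\<bar> \<le> C" "C > 0" by (auto simp: bounded_pos)
  then have "\<bar>f x\<bar> \<le> C" for x using assms(3)[of x] by (cases "x \<in> K") auto
  then show ?thesis using that C(2) by (meson less_imp_le)
qed

lemma partial_derivative_zero:
  assumes "test_function \<Omega> \<eta>" "x \<notin> closure {x. \<eta> x \<noteq> 0}"
  shows "partial_derivative b \<eta> x = 0"
proof -
  have "partial_derivative b \<eta> x = partial_derivative b (\<lambda>x. 0) x"
    using assms(2) closure_subset[of "{x. \<eta> x \<noteq> 0}"]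
    by (intro partial_derivative_cong[of "- closure {x. \<eta> x \<noteq> 0}"]) auto
  also have "\<dots> = 0" by (rule partial_derivative_eq[OF has_derivative_const])
  finally show ?thesis .
qed

lemma test_function_bounded:
  assumes "test_function \<Omega> \<eta>"
  obtains C where "\<And>x. \<bar>\<eta> x\<bar> \<le> C" "C \<ge> 0"
proof (rule compact_support_bounded[of \<eta> "closure {x. \<eta> x \<noteq> 0}"])
  show "continuous_on UNIV \<eta>" "compact (closure {x. \<eta> x \<noteq> 0})"
    using assms by (auto simp: test_function_def intro: smooth_on_continuous)
  show "\<eta> x = 0" if "x \<notin> closure {x. \<eta> x \<noteq> 0}" for x
    using that closure_subset[of "{x. \<eta> x \<noteq> 0}"] by blast
qed (use that in blast)

lemma test_function_partial:
  assumes "test_function \<Omega> \<eta>" "b \<in> Basis"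
  shows "test_function \<Omega> (partial_derivative b \<eta>)"
  using assms partial_derivative_zero[OF assms(1)]
  by (intro test_functionI[of _ "closure {x. \<eta> x \<noteq> 0}"] smooth_on_partial)
    (auto simp: test_function_def)

lemma test_function_mono: "test_function S \<eta> ==> S \<subseteq> T ==> test_function T \<eta>"
  by (auto simp: test_function_def)

text \<open>On the compact support of \<open>\<eta>\<close> the first factor is integrable and the
  second bounded; elsewhere the product vanishes.\<close>

lemma integrable_locally_mult:
  assumes g: "locally_integrable \<Omega> g" and \<eta>: "test_function \<Omega> \<eta>" and \<Omega>: "open \<Omega>"
  shows "integrable (lebesgue_on \<Omega>) (\<lambda>x. g x * \<eta> x)"
proof -
  let ?K = "closure {x. \<eta> x \<noteq> 0}"
  have K: "compact ?K" "?K \<subseteq> \<Omega>" using \<eta> by (auto simp: test_function_def)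
  obtain C where C: "\<And>x. \<bar>\<eta> x\<bar> \<le> C" "C \<ge> 0" using test_function_bounded[OF \<eta>] by blast
  have m: "?K \<in> sets lebesgue" "\<Omega> \<in> sets lebesgue" using K \<Omega> by (auto intro: lmeasurable_compact fmeasurableD)
  have gi: "integrable (lebesgue_on ?K) g" using g K unfolding locally_integrable_def by blast
  have "\<eta> \<in> borel_measurable (lebesgue_on ?K)"
    using test_function_measurable[OF \<eta>] by (intro measurable_restrict_space1 measurable_completion) simp
  then have "integrable (lebesgue_on ?K) (\<lambda>x. g x * \<eta> x)"
    using gi C(2) mult_right_mono[OF C(1) abs_ge_zero]
    by (intro Bochner_Integration.integrable_bound[of _ "\<lambda>x. C * g x" "\<lambda>x. g x * \<eta> x"])
      (auto simp: abs_mult mult.commute[of "\<bar>g _\<bar>"])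
  then have "integrable lebesgue (\<lambda>x. indicator ?K x * (g x * \<eta> x))"
    using m by (simp add: integrable_restrict_space)
  also have "(\<lambda>x. indicator ?K x * (g x * \<eta> x)) = (\<lambda>x. indicator \<Omega> x * (g x * \<eta> x))"
    using K(2) closure_subset[of "{x. \<eta> x \<noteq> 0}"] by (auto simp: indicator_def fun_eq_iff)
  finally show ?thesis using m by (simp add: integrable_restrict_space)
qed

text \<open>Testing against smooth approximations of indicators of boxes shows that \<open>g\<close> has integral 0 over
  every box in \<open>\<Omega>\<close>; Lebesgue's differentiation theorem concludes.\<close>

lemma fundamental_lemma:
  fixes g :: "'a::euclidean_space => real"
  assumes \<Omega>: "open \<Omega>" and g: "locally_integrable \<Omega> g"
    and zero: "\<And>\<eta>. test_function \<Omega> \<eta> ==> (LINT x|lebesgue_on \<Omega>. g x * \<eta> x) = 0"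
  shows "AE x in lebesgue_on \<Omega>. g x = 0"
proof -
  have \<Omega>m: "\<Omega> \<in> sets lebesgue" using \<Omega> by auto
  have gint: "integrable (lebesgue_on (cbox a b)) g" if "cbox a b \<subseteq> \<Omega>" for a b
    using g[unfolded locally_integrable_def, rule_format, of "cbox a b"] that by simp
  have boxzero: "integral (cbox a b) g = 0" if sub: "cbox a b \<subseteq> \<Omega>" for a b
  proof -
    have gi: "integrable lebesgue (\<lambda>x. indicator (cbox a b) x * g x)"
      using gint[OF sub] by (simp add: integrable_restrict_space)
    have test: "test_function \<Omega> (box_bump n a b)" for n
      by (rule test_functionI[OF smooth_box_bump compact_cbox sub])
        (use box_subset_cbox box_bump_outside in blast)
    have mb: "box_bump n a b \<in> borel_measurable lebesgue" for n
      using test_function_measurable[OF test] by (intro measurable_completion) simp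
    have eq: "indicator \<Omega> x * (g x * box_bump n a b x) = (indicator (cbox a b) x * g x) * box_bump n a b x" for x n
      using sub box_bump_outside[of x a b n] box_subset_cbox[of a b] by (auto simp: indicator_def)
    have mi: "(\<lambda>x. indicator (cbox a b) x * g x * indicat_real (box a b) x) \<in> borel_measurable lebesgue"
      by (rule borel_measurable_times[OF borel_measurable_integrable[OF gi]])
        (intro borel_measurable_indicator sets_completionI_sets, simp)
    have "(\<lambda>n. LINT x|lebesgue. (indicator (cbox a b) x * g x) * box_bump n a b x)
        \<longlonglongrightarrow> (LINT x|lebesgue. (indicator (cbox a b) x * g x) * indicator (box a b) x)"
    proof (rule integral_dominated_convergence[where w = "\<lambda>x. norm (indicator (cbox a b) x * g x)"])
      show "AE x in lebesgue. (\<lambda>n. (indicator (cbox a b) x * g x) * box_bump n a b x)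
          \<longlonglongrightarrow> (indicator (cbox a b) x * g x) * indicator (box a b) x"
        by (intro AE_I2 tendsto_mult_left box_bump_limit)
      show "AE x in lebesgue. norm (indicator (cbox a b) x * g x * box_bump n a b x) \<le> norm (indicator (cbox a b) x * g x)" for n
        using box_bump_bounds[of n a b] by (auto simp: abs_mult intro!: mult_left_le)
    qed (use gi mb mi in \<open>auto intro: borel_measurable_integrable\<close>)
    moreover have "(LINT x|lebesgue. (indicator (cbox a b) x * g x) * box_bump n a b x) = 0" for n
      using zero[OF test, of n] by (simp only: integral_lebesgue_on_eq[OF \<Omega>m] eq)
    ultimately have "(LINT x|lebesgue. (indicator (cbox a b) x * g x) * indicator (box a b) x) = 0"
      by (simp add: LIMSEQ_const_iff)
    also have "(LINT x|lebesgue. (indicator (cbox a b) x * g x) * indicator (box a b) x)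
       = (LINT x|lebesgue. indicator (cbox a b) x * g x)"
    proof (rule integral_cong_AE)
      have "AE x in lebesgue. x \<notin> cbox a b - box a b"
        by (intro AE_not_in null_sets_completionI null_sets_cbox_Diff_box)
      then show "AE x in lebesgue. (indicator (cbox a b) x * g x) * indicator (box a b) x = indicator (cbox a b) x * g x"
        by eventually_elim (auto simp: indicator_def)
    qed (use gi mi in \<open>auto intro: borel_measurable_integrable\<close>)
    finally show ?thesis
      using lebesgue_integral_eq_integral[OF gint[OF sub]] by (simp add: integral_lebesgue_on_eq)
  qed
  have ae: "AE x in lebesgue. x \<in> cbox A B \<longrightarrow> g x = 0" if AB: "cbox A B \<subseteq> \<Omega>" for A B
  proof -
    define f where "f x = indicator (cbox A B) x * g x" for x
    have "integrable lebesgue f"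
      using gint[OF AB] unfolding f_def[abs_def] by (simp add: integrable_restrict_space)
    then have "f integrable_on UNIV" by (rule integrable_on_lebesgue)
    then have "f integrable_on cbox a b" for a b by (rule integrable_on_subcbox) auto
    then obtain N where N: "negligible N" "\<And>x e. \<lbrakk>x \<notin> N; 0 < e\<rbrakk> \<Longrightarrow>
        \<exists>d>0. \<forall>h. 0 < h \<and> h < d \<longrightarrow> norm (integral (cbox x (x + h *\<^sub>R One)) f /\<^sub>R h ^ DIM('a) - f x) < e"
      using integrable_ccontinuous_explicit[of f] by metis
    have fz: "f x = 0" if x: "x \<in> box A B" "x \<notin> N" for x
    proof (rule ccontr)
      assume "f x \<noteq> 0"
      then obtain d where d: "d > 0" "\<And>h. 0 < h ==> h < d ==>
          norm (integral (cbox x (x + h *\<^sub>R One)) f /\<^sub>R h ^ DIM('a) - f x) < norm (f x)"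
        using N(2)[OF x(2), of "norm (f x)"] by auto
      obtain e where e: "e > 0" "cball x e \<subseteq> box A B"
        using x(1) open_contains_cball[of "box A B"] open_box by blast
      \<comment> \<open>A cube of side \<open>h\<close> lies in the ball of radius
        \<open>h * DIM('a)\<close> by the l1 bound on the norm; \<open>d / 2\<close> ensures the
        strict inequality \<open>h < d\<close>.\<close>
      define h where "h = min (d / 2) (e / real DIM('a))"
      have h: "0 < h" "h < d" "h * real DIM('a) \<le> e" using d(1) e(1) by (auto simp: h_def min_def field_simps)
      have "cbox x (x + h *\<^sub>R One) \<subseteq> cball x e"
      proof
        fix y assume "y \<in> cbox x (x + h *\<^sub>R One)"
        then have "\<bar>(y - x) \<bullet> i\<bar> \<le> h" if "i \<in> Basis" for i
          using that by (auto simp: mem_box inner_diff_left inner_add_left)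
        then have "(\<Sum>i\<in>Basis. \<bar>(y - x) \<bullet> i\<bar>) \<le> (\<Sum>i\<in>(Basis::'a set). h)" by (intro sum_mono)
        then have "norm (y - x) \<le> h * real DIM('a)"
          using norm_le_l1[of "y - x"] by (simp add: mult.commute)
        then show "y \<in> cball x e" using h(3) by (simp add: dist_norm norm_minus_commute)
      qed
      then have sub: "cbox x (x + h *\<^sub>R One) \<subseteq> cbox A B" using e(2) box_subset_cbox by blast
      have "integral (cbox x (x + h *\<^sub>R One)) f = integral (cbox x (x + h *\<^sub>R One)) g"
        using sub by (intro integral_cong) (auto simp: f_def)
      also have "\<dots> = 0" using sub AB by (intro boxzero) blast
      finally show False using d(2)[OF h(1,2)] by simp
    qed
    have "AE x in lebesgue. x \<notin> N"
      using N(1) by (intro AE_not_in) (simp only: negligible_iff_null_sets)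
    moreover have "AE x in lebesgue. x \<notin> cbox A B - box A B"
      by (intro AE_not_in null_sets_completionI null_sets_cbox_Diff_box)
    ultimately    show ?thesis
      by eventually_elim (use fz in \<open>auto simp: f_def indicator_def box_subset_cbox[THEN subsetD]\<close>)
  qed
  obtain D where D: "countable D" "D \<subseteq> Pow \<Omega>" "\<And>X. X \<in> D ==> \<exists>a b. X = cbox a b" "\<Union>D = \<Omega>"
    using open_countable_Union_open_cbox[OF \<Omega>] by metis
  have "AE x in lebesgue. \<forall>X\<in>D. x \<in> X \<longrightarrow> g x = 0"
    unfolding AE_ball_countable[OF D(1)] using ae D(2,3) by blast
  then have "AE x in lebesgue. x \<in> \<Omega> \<longrightarrow> g x = 0"
    by eventually_elim (use D(4) in blast)
  then show ?thesis using \<Omega>m by (simp add: AE_restrict_space_iff)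
qed

section \<open>Directional derivatives and their integrals\<close>

lemma DERIV_line:
  fixes f :: "'a::euclidean_space => real"
  assumes "f differentiable (at (x + t *\<^sub>R b))"
  shows "((\<lambda>t. f (x + t *\<^sub>R b)) has_real_derivative partial_derivative b f (x + t *\<^sub>R b)) (at t)"
proof -
  let ?D = "frechet_derivative f (at (x + t *\<^sub>R b))"
  have D: "(f has_derivative ?D) (at (x + t *\<^sub>R b))"
    using assms frechet_derivative_works by blast
  have "((\<lambda>t. x + t *\<^sub>R b) has_derivative (\<lambda>h. h *\<^sub>R b)) (at t)"
    by (auto intro!: derivative_eq_intros)
  from has_derivative_compose[OF this D]
  have "((\<lambda>t. f (x + t *\<^sub>R b)) has_derivative (\<lambda>h. ?D (h *\<^sub>R b))) (at t)" .
  moreover have "(\<lambda>h. ?D (h *\<^sub>R b)) = (*) (?D b)"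
    using linear_cmul[OF has_derivative_linear[OF D]] by (auto simp: fun_eq_iff)
  ultimately show ?thesis by (simp add: has_field_derivative_def partial_derivative_def)
qed

text \<open>The integral of a difference quotient vanishes by translation invariance.\<close>

lemma integral_partial_test_function:
  fixes \<phi> :: "'a::euclidean_space => real"
  assumes \<phi>: "test_function UNIV \<phi>" and b: "b \<in> Basis"
  shows "(LINT x|lebesgue. partial_derivative b \<phi> x) = 0"
proof -
  have sm: "smooth_on UNIV \<phi>" using \<phi> by (simp add: test_function_def)
  have diff: "\<phi> differentiable (at x)" for x
    by (rule smooth_on_differentiable[OF sm open_UNIV]) simp
  have [measurable]: "\<phi> \<in> borel_measurable borel" "partial_derivative b \<phi> \<in> borel_measurable borel"
    using test_function_measurable \<phi> test_function_partial[OF \<phi> b] by blast+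
  obtain C where C: "\<And>x. \<bar>partial_derivative b \<phi> x\<bar> \<le> C" "C \<ge> 0"
    using test_function_bounded[OF test_function_partial[OF \<phi> b]] by blast
  obtain C0 where C0: "\<And>x. \<bar>\<phi> x\<bar> \<le> C0" "C0 \<ge> 0"
    using test_function_bounded[OF \<phi>] by blast
  have "bounded {x. \<phi> x \<noteq> 0}" using \<phi> by (simp add: test_function_def)
  then obtain R where R: "\<And>x. \<phi> x \<noteq> 0 ==> norm x \<le> R" by (auto simp: bounded_iff)
  define h where "h n = inverse (real (Suc n))" for n
  have h: "0 < h n" "h n \<le> 1" for n by (auto simp: h_def field_simps)
  define D where "D n x = (\<phi> (x + h n *\<^sub>R b) - \<phi> x) / h n" for n x
  have \<phi>int: "integrable lborel \<phi>"
  proof (rule integrableI_bounded_set[where A = "cball 0 R" and B = C0])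
    show "AE x in lborel. x \<in> cball 0 R \<longrightarrow> norm (\<phi> x) \<le> C0" using C0 by simp
    show "AE x in lborel. x \<notin> cball 0 R \<longrightarrow> \<phi> x = 0" using R by (intro AE_I2) auto
    show "emeasure lborel (cball (0::'a) R) < \<infinity>" by (rule emeasure_lborel_cball_finite)
  qed auto
  have D0: "(LINT x|lborel. D n x) = 0" for n
  proof -
    have "(LINT x|lborel. \<phi> x) = (LINT x|distr lborel borel ((+) (h n *\<^sub>R b)). \<phi> x)"
      by (simp only: lborel_distr_plus)
    also have "\<dots> = (LINT x|lborel. \<phi> (x + h n *\<^sub>R b))"
      by (subst integral_distr) (simp_all add: add.commute)
    finally have eq: "(LINT x|lborel. \<phi> (x + h n *\<^sub>R b)) = (LINT x|lborel. \<phi> x)" by simp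
    have "integrable (distr lborel borel ((+) (h n *\<^sub>R b))) \<phi>"
      using \<phi>int by (simp only: lborel_distr_plus)
    then have "integrable lborel (\<lambda>x. \<phi> (h n *\<^sub>R b + x))" by (subst (asm) integrable_distr_eq) simp_all
    then have "integrable lborel (\<lambda>x. \<phi> (x + h n *\<^sub>R b))" by (simp add: add.commute)
    then show ?thesis unfolding D_def using \<phi>int eq by simp
  qed
  \<comment> \<open>By the mean value theorem the difference quotients inherit the bound on the
    partial derivative, and shifts of length at most 1 enlarge the support to radius at most
    \<open>R + 1\<close>.\<close>
  have "(\<lambda>n. LINT x|lborel. D n x) \<longlonglongrightarrow> (LINT x|lborel. partial_derivative b \<phi> x)"
  proof (rule integral_dominated_convergence[where w = "\<lambda>x. C * indicator (cball 0 (R + 1)) x"])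
    show "integrable lborel (\<lambda>x. C * indicat_real (cball (0::'a) (R + 1)) x)"
      using emeasure_lborel_cball_finite[of "0::'a" "R + 1"] by (intro integrable_mult_right) simp
    show "AE x in lborel. (\<lambda>n. D n x) \<longlonglongrightarrow> partial_derivative b \<phi> x"
    proof (rule AE_I2)
      fix x
      have "((\<lambda>t. \<phi> (x + t *\<^sub>R b)) has_real_derivative partial_derivative b \<phi> (x + 0 *\<^sub>R b)) (at 0)"
        by (rule DERIV_line) (rule diff)
      then have "((\<lambda>t. (\<phi> (x + t *\<^sub>R b) - \<phi> x) / t) \<longlongrightarrow> partial_derivative b \<phi> x) (at 0)"
        by (simp add: has_field_derivative_iff)
      moreover have "filterlim h (at 0) sequentially"
        using h(1) LIMSEQ_inverse_real_of_nat unfolding h_def[abs_def] filterlim_at by auto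
      ultimately show "(\<lambda>n. D n x) \<longlonglongrightarrow> partial_derivative b \<phi> x"
        unfolding D_def by (rule filterlim_compose)
    qed
    show "AE x in lborel. norm (D n x) \<le> C * indicator (cball 0 (R + 1)) x" for n
    proof (rule AE_I2)
      fix x
      obtain z where "\<phi> (x + h n *\<^sub>R b) - \<phi> (x + 0 *\<^sub>R b) = (h n - 0) * partial_derivative b \<phi> (x + z *\<^sub>R b)"
        using MVT2[of 0 "h n" "\<lambda>t. \<phi> (x + t *\<^sub>R b)" "\<lambda>t. partial_derivative b \<phi> (x + t *\<^sub>R b)"]
          h(1)[of n] DERIV_line[OF diff] by blast
      then have "D n x = partial_derivative b \<phi> (x + z *\<^sub>R b)" using h(1)[of n] by (simp add: D_def)
      then have le: "\<bar>D n x\<bar> \<le> C" using C(1) by simp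
      show "norm (D n x) \<le> C * indicator (cball 0 (R + 1)) x"
      proof (cases "x \<in> cball 0 (R + 1)")
        case False
        then have x: "norm x > R + 1" by simp
        have "norm x \<le> norm (x + h n *\<^sub>R b) + norm (h n *\<^sub>R b)"
          using norm_triangle_ineq4[of "x + h n *\<^sub>R b" "h n *\<^sub>R b"] by simp
        then have "norm (x + h n *\<^sub>R b) > R" using x h[of n] b by simp
        then have "\<phi> (x + h n *\<^sub>R b) = 0" "\<phi> x = 0" using R[of x] R[of "x + h n *\<^sub>R b"] x by fastforce+
        then have "D n x = 0" by (simp add: D_def)
        then show ?thesis using C(2) by simp
      qed (use le in simp)
    qed
  qed (auto simp: D_def)
  then have "(LINT x|lborel. partial_derivative b \<phi> x) = 0" using D0 by (simp add: LIMSEQ_const_iff)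
  then show ?thesis by (subst integral_completion) auto
qed

text \<open>Completeness of Lebesgue measure. It is needed for objects such as
  \<open>weak_partial\<close> that are fixed only up to null sets.\<close>

lemma borel_measurable_lebesgue_on_AE:
  fixes f g :: "'a::euclidean_space => real"
  assumes "f \<in> borel_measurable (lebesgue_on S)" "AE x in lebesgue_on S. f x = g x" "S \<in> sets lebesgue"
  shows "g \<in> borel_measurable (lebesgue_on S)"
proof -
  have "(\<lambda>x. indicator S x *\<^sub>R f x) \<in> borel_measurable lebesgue"
    using assms(1,3) by (subst (asm) borel_measurable_restrict_space_iff) auto
  moreover have "AE x in lebesgue. indicator S x *\<^sub>R f x = indicator S x *\<^sub>R g x"
    using assms(2,3) by (auto simp: AE_restrict_space_iff indicator_def elim: AE_mp)
  ultimately have "(\<lambda>x. indicator S x *\<^sub>R g x) \<in> borel_measurable lebesgue"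
    by (rule borel_measurable_AE)
  then show ?thesis using assms(3) by (subst borel_measurable_restrict_space_iff) auto
qed

lemma L2_cong_AE:
  fixes f g :: "'a::euclidean_space => real"
  assumes "f \<in> L2 (lebesgue_on S)" "AE x in lebesgue_on S. f x = g x" "S \<in> sets lebesgue"
  shows "g \<in> L2 (lebesgue_on S)"
  by (rule L2_bound[OF assms(1) borel_measurable_lebesgue_on_AE[OF L2_measurable[OF assms(1)] assms(2,3)]])
    (use assms(2) in auto)

section \<open>Linearity and uniqueness of weak derivatives\<close>

lemma has_weak_partialD:
  assumes "has_weak_partial \<Omega> b f g"
  shows "locally_integrable \<Omega> f" "locally_integrable \<Omega> g"
    "test_function \<Omega> \<eta> ==> (LINT x|lebesgue_on \<Omega>. f x * partial_derivative b \<eta> x) = - (LINT x|lebesgue_on \<Omega>. g x * \<eta> x)"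
  using assms unfolding has_weak_partial_def by blast+

lemma locally_integrable_lincomb:
  "locally_integrable \<Omega> f ==> locally_integrable \<Omega> g ==> locally_integrable \<Omega> (\<lambda>x. c * f x + d * g x)"
  unfolding locally_integrable_def
  by (intro allI impI Bochner_Integration.integrable_add integrable_mult_right) auto

lemma has_weak_partial_lincomb:
  assumes \<Omega>: "open \<Omega>" and b: "b \<in> Basis" and fg: "has_weak_partial \<Omega> b f g" "has_weak_partial \<Omega> b f' g'"
  shows "has_weak_partial \<Omega> b (\<lambda>x. c * f x + d * f' x) (\<lambda>x. c * g x + d * g' x)"
  unfolding has_weak_partial_def
proof (intro conjI allI impI locally_integrable_lincomb has_weak_partialD[OF fg(1)] has_weak_partialD[OF fg(2)])
  fix \<eta> assume t: "test_function \<Omega> \<eta>"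
  have 1: "integrable (lebesgue_on \<Omega>) (\<lambda>x. h x * \<theta> x)" if "locally_integrable \<Omega> h" "test_function \<Omega> \<theta>" for h \<theta>
    by (rule integrable_locally_mult[OF that \<Omega>])
  note i = 1[OF has_weak_partialD(1)[OF fg(1)] test_function_partial[OF t b]]
    1[OF has_weak_partialD(1)[OF fg(2)] test_function_partial[OF t b]]
    1[OF has_weak_partialD(2)[OF fg(1)] t] 1[OF has_weak_partialD(2)[OF fg(2)] t]
  show "(LINT x|lebesgue_on \<Omega>. (c * f x + d * f' x) * partial_derivative b \<eta> x) =
      - (LINT x|lebesgue_on \<Omega>. (c * g x + d * g' x) * \<eta> x)"
    using i has_weak_partialD(3)[OF fg(1) t] has_weak_partialD(3)[OF fg(2) t]
    by (simp add: distrib_right mult.assoc)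
qed

lemma has_weak_partial_unique:
  assumes \<Omega>: "open \<Omega>" and fg: "has_weak_partial \<Omega> b f g" "has_weak_partial \<Omega> b f g'"
  shows "AE x in lebesgue_on \<Omega>. g x = g' x"
proof -
  have "AE x in lebesgue_on \<Omega>. 1 * g x + (-1) * g' x = 0"
  proof (rule fundamental_lemma[OF \<Omega>])
    show "locally_integrable \<Omega> (\<lambda>x. 1 * g x + (-1) * g' x)"
      by (intro locally_integrable_lincomb has_weak_partialD[OF fg(1)] has_weak_partialD[OF fg(2)])
    fix \<eta> assume t: "test_function \<Omega> \<eta>"
    have i: "integrable (lebesgue_on \<Omega>) (\<lambda>x. g x * \<eta> x)" "integrable (lebesgue_on \<Omega>) (\<lambda>x. g' x * \<eta> x)"
      by (intro integrable_locally_mult[OF _ t \<Omega>] has_weak_partialD[OF fg(1)] has_weak_partialD[OF fg(2)])+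
    have "(LINT x|lebesgue_on \<Omega>. (1 * g x + (-1) * g' x) * \<eta> x)
        = (LINT x|lebesgue_on \<Omega>. g x * \<eta> x) - (LINT x|lebesgue_on \<Omega>. g' x * \<eta> x)"
      using i by (simp add: left_diff_distrib)
    then show "(LINT x|lebesgue_on \<Omega>. (1 * g x + (-1) * g' x) * \<eta> x) = 0"
      using has_weak_partialD(3)[OF fg(1) t] has_weak_partialD(3)[OF fg(2) t] by simp
  qed
  then show ?thesis by eventually_elim simp
qed

section \<open>First-order Sobolev functions on a bounded open set\<close>

locale bounded_open =
  fixes \<Omega> :: "'a::euclidean_space set"
  assumes open_dom: "open \<Omega>" and bounded_dom: "bounded \<Omega>"
begin

lemma dom_sets: "\<Omega> \<in> sets lebesgue"
  using open_dom by auto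

sublocale finite_measure "lebesgue_on \<Omega>"
  by (rule finite_measure_lebesgue_on[OF lmeasurable_open[OF bounded_dom open_dom]])

lemma L2_locally_integrable: "f \<in> L2 (lebesgue_on \<Omega>) ==> locally_integrable \<Omega> f"
  unfolding locally_integrable_def
  by (intro allI impI integrable_lebesgue_on_subset[OF L2_integrable] dom_sets)
    (auto intro: fmeasurableD lmeasurable_compact)

lemma continuous_L2:
  assumes "continuous_on UNIV F"
  shows "F \<in> L2 (lebesgue_on \<Omega>)" "\<exists>C\<ge>0. \<forall>x\<in>\<Omega>. \<bar>F x\<bar> \<le> (C::real)"
proof -
  have "bounded (F ` closure \<Omega>)"
    using assms bounded_dom by (intro compact_imp_bounded compact_continuous_image) (auto intro: continuous_on_subset)
  then obtain C where C: "C > 0" "\<And>x. x \<in> closure \<Omega> ==> \<bar>F x\<bar> \<le> C" by (auto simp: bounded_pos)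
  then have C': "\<And>x. x \<in> \<Omega> ==> \<bar>F x\<bar> \<le> C" using closure_subset by blast
  then show "\<exists>C\<ge>0. \<forall>x\<in>\<Omega>. \<bar>F x\<bar> \<le> C" using C(1) by (meson less_imp_le)
  have "F \<in> borel_measurable borel" using assms by (rule borel_measurable_continuous_onI)
  then have "F \<in> borel_measurable (lebesgue_on \<Omega>)"
    by (intro measurable_restrict_space1 measurable_completion) simp
  then show "F \<in> L2 (lebesgue_on \<Omega>)"
    by (rule L2_bounded[of _ C]) (use C' in \<open>auto intro!: AE_I2 simp: space_restrict_space\<close>)
qed

text \<open>The product \<open>F * \<eta>\<close> is again a test function, so its partial
  derivative integrates to 0 over the whole space; the product rule splits this into the two
  sides.\<close>

lemma smooth_weak_partial:
  assumes F: "smooth_on UNIV F" and b: "b \<in> Basis"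
  shows "has_weak_partial \<Omega> b F (partial_derivative b F)"
  unfolding has_weak_partial_def
proof (intro conjI allI impI)
  have F2: "F \<in> L2 (lebesgue_on \<Omega>)" "partial_derivative b F \<in> L2 (lebesgue_on \<Omega>)"
    using continuous_L2(1)[OF smooth_on_continuous[OF F]]
      continuous_L2(1)[OF smooth_on_continuous[OF smooth_on_partial[OF F b]]] by auto
  then show l: "locally_integrable \<Omega> F" "locally_integrable \<Omega> (partial_derivative b F)"
    by (auto intro: L2_locally_integrable)
  fix \<eta> assume t: "test_function \<Omega> \<eta>"
  have sm: "smooth_on UNIV \<eta>" using t by (simp add: test_function_def)
  have i: "integrable (lebesgue_on \<Omega>) (\<lambda>x. F x * partial_derivative b \<eta> x)"
     "integrable (lebesgue_on \<Omega>) (\<lambda>x. partial_derivative b F x * \<eta> x)"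
    by (rule integrable_locally_mult[OF l(1) test_function_partial[OF t b] open_dom]
        integrable_locally_mult[OF l(2) t open_dom])+
  have tt: "test_function \<Omega> (\<lambda>x. F x * \<eta> x)" by (rule test_function_smooth_mult[OF t F])
  have pd: "partial_derivative b (\<lambda>x. F x * \<eta> x) x = partial_derivative b F x * \<eta> x + F x * partial_derivative b \<eta> x" for x
    by (intro partial_derivative_mult smooth_on_differentiable[OF _ open_UNIV] F sm UNIV_I)
  have "(LINT x|lebesgue_on \<Omega>. partial_derivative b F x * \<eta> x + F x * partial_derivative b \<eta> x)
      = (LINT x|lebesgue. indicator \<Omega> x * partial_derivative b (\<lambda>x. F x * \<eta> x) x)"
    by (simp only: integral_lebesgue_on_eq[OF dom_sets] pd)
  also have "\<dots> = (LINT x|lebesgue. partial_derivative b (\<lambda>x. F x * \<eta> x) x)"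
    using test_function_zero[OF test_function_partial[OF tt b]]
    by (intro Bochner_Integration.integral_cong refl) (auto simp: indicator_def)
  also have "\<dots> = 0"
    by (rule integral_partial_test_function[OF test_function_mono[OF tt] b]) simp
  finally show "(LINT x|lebesgue_on \<Omega>. F x * partial_derivative b \<eta> x) = - (LINT x|lebesgue_on \<Omega>. partial_derivative b F x * \<eta> x)"
    using i by simp
qed

lemma H1_L2: "f \<in> H1 \<Omega> ==> f \<in> L2 (lebesgue_on \<Omega>)"
  by (simp add: H1_def)

text \<open>Existence of some weak derivative makes the choice in \<open>weak_partial\<close>
  legitimate, and uniqueness identifies the chosen one almost everywhere. Later computations with
  \<open>weak_partial\<close> pass through this.\<close>

lemma weak_partial_eq:
  assumes "has_weak_partial \<Omega> b f g"
  shows "has_weak_partial \<Omega> b f (weak_partial \<Omega> b f)" "AE x in lebesgue_on \<Omega>. weak_partial \<Omega> b f x = g x"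
proof -
  show 1: "has_weak_partial \<Omega> b f (weak_partial \<Omega> b f)"
    unfolding weak_partial_def by (rule someI[of _ g]) (rule assms)
  show "AE x in lebesgue_on \<Omega>. weak_partial \<Omega> b f x = g x"
    by (rule has_weak_partial_unique[OF open_dom 1 assms])
qed

lemma H1_weak_partial:
  assumes "f \<in> H1 \<Omega>" "b \<in> Basis"
  shows "has_weak_partial \<Omega> b f (weak_partial \<Omega> b f)" "weak_partial \<Omega> b f \<in> L2 (lebesgue_on \<Omega>)"
proof -
  obtain g where g: "g \<in> L2 (lebesgue_on \<Omega>)" "has_weak_partial \<Omega> b f g"
    using assms unfolding H1_def by blast
  show "has_weak_partial \<Omega> b f (weak_partial \<Omega> b f)" by (rule weak_partial_eq(1)[OF g(2)])
  have "AE x in lebesgue_on \<Omega>. g x = weak_partial \<Omega> b f x"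
    using weak_partial_eq(2)[OF g(2)] by eventually_elim simp
  then show "weak_partial \<Omega> b f \<in> L2 (lebesgue_on \<Omega>)" by (rule L2_cong_AE[OF g(1) _ dom_sets])
qed

lemma H1I:
  assumes "f \<in> L2 (lebesgue_on \<Omega>)" "\<And>b. b \<in> Basis ==> g b \<in> L2 (lebesgue_on \<Omega>)"
    "\<And>b. b \<in> Basis ==> has_weak_partial \<Omega> b f (g b)"
  shows "f \<in> H1 \<Omega>"
  using assms unfolding H1_def by blast

lemma H1_lincomb:
  assumes f: "f \<in> H1 \<Omega>" and g: "g \<in> H1 \<Omega>"
  shows "(\<lambda>x. c * f x + d * g x) \<in> H1 \<Omega>"
    "b \<in> Basis ==> AE x in lebesgue_on \<Omega>. weak_partial \<Omega> b (\<lambda>x. c * f x + d * g x) x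
      = c * weak_partial \<Omega> b f x + d * weak_partial \<Omega> b g x"
proof -
  have h: "has_weak_partial \<Omega> b (\<lambda>x. c * f x + d * g x) (\<lambda>x. c * weak_partial \<Omega> b f x + d * weak_partial \<Omega> b g x)"
    if "b \<in> Basis" for b
    by (rule has_weak_partial_lincomb[OF open_dom that H1_weak_partial(1)[OF f that] H1_weak_partial(1)[OF g that]])
  show "(\<lambda>x. c * f x + d * g x) \<in> H1 \<Omega>"
    by (rule H1I[OF _ _ h]) (intro L2_add L2_cmult H1_L2 f g H1_weak_partial(2); assumption)+
  show "AE x in lebesgue_on \<Omega>. weak_partial \<Omega> b (\<lambda>x. c * f x + d * g x) x
      = c * weak_partial \<Omega> b f x + d * weak_partial \<Omega> b g x" if "b \<in> Basis"
    by (rule weak_partial_eq(2)[OF h[OF that]])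
qed

lemma H1_diff:
  assumes f: "f \<in> H1 \<Omega>" and g: "g \<in> H1 \<Omega>"
  shows "(\<lambda>x. f x - g x) \<in> H1 \<Omega>"
    "b \<in> Basis ==> AE x in lebesgue_on \<Omega>. weak_partial \<Omega> b (\<lambda>x. f x - g x) x
      = weak_partial \<Omega> b f x - weak_partial \<Omega> b g x"
  using H1_lincomb[OF f g, where c = 1 and d = "-1"] by simp_all

text \<open>Sobolev regularity depends on the class modulo null sets only. This moves it from the
  initial datum to the initial value of the solution, which agree merely almost everywhere.\<close>

lemma H1_cong_AE:
  assumes f: "f \<in> H1 \<Omega>" and eq: "AE x in lebesgue_on \<Omega>. f x = g x"
  shows "g \<in> H1 \<Omega>" "b \<in> Basis ==> AE x in lebesgue_on \<Omega>. weak_partial \<Omega> b g x = weak_partial \<Omega> b f x"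
proof -
  have g: "g \<in> L2 (lebesgue_on \<Omega>)" by (rule L2_cong_AE[OF H1_L2[OF f] eq dom_sets])
  have h: "has_weak_partial \<Omega> b g (weak_partial \<Omega> b f)" if b: "b \<in> Basis" for b
    unfolding has_weak_partial_def
  proof (intro conjI allI impI L2_locally_integrable g H1_weak_partial(2)[OF f b])
    fix \<eta> assume t: "test_function \<Omega> \<eta>"
    have "(LINT x|lebesgue_on \<Omega>. g x * partial_derivative b \<eta> x) = (LINT x|lebesgue_on \<Omega>. f x * partial_derivative b \<eta> x)"
      by (intro integral_cong_AE borel_measurable_integrable integrable_locally_mult L2_locally_integrable g
          H1_L2[OF f] test_function_partial[OF t b] open_dom) (use eq in auto)
    then show "(LINT x|lebesgue_on \<Omega>. g x * partial_derivative b \<eta> x) = - (LINT x|lebesgue_on \<Omega>. weak_partial \<Omega> b f x * \<eta> x)"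
      using has_weak_partialD(3)[OF H1_weak_partial(1)[OF f b] t] by simp
  qed
  show "g \<in> H1 \<Omega>" by (rule H1I[OF g H1_weak_partial(2)[OF f] h])
  show "AE x in lebesgue_on \<Omega>. weak_partial \<Omega> b g x = weak_partial \<Omega> b f x" if "b \<in> Basis"
    by (rule weak_partial_eq(2)[OF h[OF that]])
qed

lemma smooth_H1: "smooth_on UNIV F ==> F \<in> H1 \<Omega>"
  by (rule H1I[OF _ _ smooth_weak_partial]) (intro continuous_L2 smooth_on_continuous smooth_on_partial; assumption)+

text \<open>\<open>H1_norm\<close> involves the chosen weak derivative of the difference
  \<open>F k - f\<close>. Linearity and uniqueness replace it by the classical derivative of
  \<open>F k\<close> minus the weak one of \<open>f\<close>, the form in which limits are
  taken.\<close>

lemma smooth_approx: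
  assumes F: "\<And>k. smooth_on UNIV (F k)" and f: "f \<in> H1 \<Omega>"
    and lim: "(\<lambda>k. H1_norm \<Omega> (\<lambda>x. F k x - f x)) \<longlonglongrightarrow> 0"
  shows "(\<lambda>k. L2_norm (lebesgue_on \<Omega>) (\<lambda>x. F k x - f x)) \<longlonglongrightarrow> 0"
    "b \<in> Basis ==> (\<lambda>k. L2_norm (lebesgue_on \<Omega>) (\<lambda>x. partial_derivative b (F k) x - weak_partial \<Omega> b f x)) \<longlonglongrightarrow> 0"
proof -
  let ?n = "L2_norm (lebesgue_on \<Omega>)"
  have le: "?n f \<le> H1_norm \<Omega> f" for f
    unfolding H1_norm_def by (rule real_le_rsqrt) (simp add: sum_nonneg)
  have le': "?n (weak_partial \<Omega> b f) \<le> H1_norm \<Omega> f" if "b \<in> Basis" for f b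
  proof -
    have "(?n (weak_partial \<Omega> b f))\<^sup>2 \<le> (\<Sum>b\<in>Basis. (?n (weak_partial \<Omega> b f))\<^sup>2)"
      by (rule member_le_sum) (use that in auto)
    then show ?thesis unfolding H1_norm_def using zero_le_power2[of "?n f"] by (intro real_le_rsqrt) linarith
  qed
  show "(\<lambda>k. ?n (\<lambda>x. F k x - f x)) \<longlonglongrightarrow> 0"
    by (rule tendsto_sandwich[OF _ _ tendsto_const lim]) (auto simp: L2_norm_nonneg le)
  show "(\<lambda>k. ?n (\<lambda>x. partial_derivative b (F k) x - weak_partial \<Omega> b f x)) \<longlonglongrightarrow> 0" if b: "b \<in> Basis"
  proof -
    have "?n (\<lambda>x. partial_derivative b (F k) x - weak_partial \<Omega> b f x) = ?n (weak_partial \<Omega> b (\<lambda>x. F k x - f x))" for k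
    proof (rule L2_norm_cong_AE)
      have p: "partial_derivative b (F k) \<in> L2 (lebesgue_on \<Omega>)"
        by (intro continuous_L2 smooth_on_continuous smooth_on_partial F b)
      show "(\<lambda>x. partial_derivative b (F k) x - weak_partial \<Omega> b f x) \<in> borel_measurable (lebesgue_on \<Omega>)"
        using H1_weak_partial(2)[OF f b] p by (intro L2_measurable L2_diff)
      show "weak_partial \<Omega> b (\<lambda>x. F k x - f x) \<in> borel_measurable (lebesgue_on \<Omega>)"
        by (intro L2_measurable H1_weak_partial(2) H1_diff smooth_H1 F f b)
      show "AE x in lebesgue_on \<Omega>. partial_derivative b (F k) x - weak_partial \<Omega> b f x = weak_partial \<Omega> b (\<lambda>x. F k x - f x) x"
        using H1_diff(2)[OF smooth_H1[OF F[of k]] f b] weak_partial_eq(2)[OF smooth_weak_partial[OF F[of k] b]]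
        by eventually_elim simp
    qed
    then show ?thesis
      by (intro tendsto_sandwich[OF _ _ tendsto_const lim]) (auto simp: L2_norm_nonneg le'[OF b])
  qed
qed

end

section \<open>Geometry of the boundary\<close>

lemma nn_integral_measure_mono:
  assumes sets: "sets M = sets N" and le: "\<And>A. A \<in> sets M ==> emeasure M A \<le> emeasure N A"
  shows "nn_integral M f \<le> nn_integral N f"
proof -
  have sp: "space M = space N" using sets by (rule sets_eq_imp_space_eq)
  have sf: "simple_function M g = simple_function N g" for g :: "'a => ennreal"
    using sets sp by (simp add: simple_function_def)
  have "integral\<^sup>S M g \<le> integral\<^sup>S N g" if "simple_function M g" for g
    unfolding simple_integral_def using that sp
    by (auto intro!: sum_mono mult_left_mono le simp: simple_function_def)
  then show ?thesis
    unfolding nn_integral_def using sf by (intro SUP_mono) auto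
qed

text \<open>The definition fixes only the sign of \<open>\<rho>\<close> on \<open>\<Omega>\<close>.
  A boundary point lies outside the open set \<open>\<Omega>\<close>, which excludes negative
  values, and a positive value would persist in a neighbourhood that misses
  \<open>\<Omega>\<close>.\<close>

lemma frontier_defining_function:
  assumes loc: "local_defining_function \<Omega> x U \<rho>" and \<Omega>: "open \<Omega>" and y: "y \<in> U" "y \<in> frontier \<Omega>"
  shows "\<rho> y = 0"
proof -
  have U: "open U" "smooth_on U \<rho>" "\<Omega> \<inter> U = {y \<in> U. \<rho> y < 0}"
    using loc by (auto simp: local_defining_function_def)
  have "y \<notin> \<Omega>" using y(2) \<Omega> by (simp add: frontier_def interior_open)
  then have 1: "0 \<le> \<rho> y" using U(3) y(1) by force
  moreover have "\<not> 0 < \<rho> y"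
  proof
    assume p: "0 < \<rho> y"
    have "open {z \<in> U. \<rho> z \<in> {0<..}}"
      using continuous_open_preimage[OF smooth_on_continuous[OF U(2)] U(1) open_greaterThan[of 0]]
      by (simp add: vimage_def Int_def)
    moreover have "y \<in> {z \<in> U. \<rho> z \<in> {0<..}}" using p y by simp
    moreover have "y \<in> closure \<Omega>" using y(2) by (simp add: frontier_def)
    ultimately obtain z where "z \<in> \<Omega>" "z \<in> {z \<in> U. \<rho> z \<in> {0<..}}"
      by (meson closure_iff_nhds_not_empty disjoint_iff order_refl)
    then show False using U(3) by force
  qed
  ultimately show ?thesis by simp
qed

text \<open>Inside the ball of radius \<open>2 r\<close> the defining function \<open>\<rho>\<close> increases in the coordinate
  direction \<open>\<sigma> b\<^sub>0\<close> at rate at least \<open>c\<close>.\<close>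

locale boundary_chart = bounded_open \<Omega> for \<Omega> :: "'a::euclidean_space set" +
  fixes x0 :: 'a and U :: "'a set" and \<rho> :: "'a => real" and b0 :: 'a and \<sigma> c r G :: real
  assumes loc: "local_defining_function \<Omega> x0 U \<rho>" and r: "0 < r" and sub: "cball x0 (2 * r) \<subseteq> U"
    and b0: "b0 \<in> Basis" and \<sigma>: "\<bar>\<sigma>\<bar> = 1" and c: "0 < c"
    and lower: "\<And>y. y \<in> cball x0 (2 * r) ==> c \<le> \<sigma> * partial_derivative b0 \<rho> y"
    and upper: "\<And>y b. y \<in> cball x0 (2 * r) ==> b \<in> Basis ==> \<bar>partial_derivative b \<rho> y\<bar> \<le> G"
begin

section \<open>Moving along the direction \<open>s\<close> towards the boundary\<close>

definition s :: 'a where "s = \<sigma> *\<^sub>R b0"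

lemma chart: "open U" "smooth_on U \<rho>" "\<Omega> \<inter> U = {y \<in> U. \<rho> y < 0}"
  using loc by (auto simp: local_defining_function_def)

lemma ball_sub: "ball x0 (2 * r) \<subseteq> U" "ball x0 r \<subseteq> U"
  using sub r by (auto simp: subset_iff)

lemma norm_s: "norm s = 1"
  using \<sigma> b0 by (simp add: s_def)

lemma partial_s:
  assumes "f differentiable (at x)"
  shows "partial_derivative s f x = \<sigma> * partial_derivative b0 f x"
proof -
  have "(f has_derivative frechet_derivative f (at x)) (at x)"
    using assms frechet_derivative_works by blast
  from linear_cmul[OF has_derivative_linear[OF this]] show ?thesis
    by (simp add: partial_derivative_def s_def)
qed

lemma differentiable_rho: "x \<in> U ==> \<rho> differentiable (at x)"
  by (rule smooth_on_differentiable[OF chart(2,1)])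

lemma frontier_zero: "y \<in> U ==> y \<in> frontier \<Omega> ==> \<rho> y = 0"
  by (rule frontier_defining_function[OF loc open_dom])

lemma segment_in_ball:
  assumes "x \<in> ball x0 (2 * r)" "x + t *\<^sub>R v \<in> ball x0 (2 * r)" "0 \<le> a" "a \<le> t"
  shows "x + a *\<^sub>R v \<in> ball x0 (2 * r)"
proof (cases "t = 0")
  case False
  have "(1 - a / t) *\<^sub>R x + (a / t) *\<^sub>R (x + t *\<^sub>R v) \<in> ball x0 (2 * r)"
    using assms False by (intro convexD[OF convex_ball]) (auto simp: field_simps)
  moreover have "(1 - a / t) *\<^sub>R x + (a / t) *\<^sub>R (x + t *\<^sub>R v) = x + a *\<^sub>R v"
    using False by (simp add: algebra_simps)
  ultimately show ?thesis by simp
qed (use assms in auto)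

lemma increasing:
  assumes x: "x \<in> ball x0 (2 * r)" "x + t *\<^sub>R s \<in> ball x0 (2 * r)" and t: "0 \<le> t"
  shows "\<rho> x + c * t \<le> \<rho> (x + t *\<^sub>R s)"
proof (cases "t = 0")
  case False
  have seg: "x + a *\<^sub>R s \<in> ball x0 (2 * r)" if "0 \<le> a" "a \<le> t" for a
    by (rule segment_in_ball[OF x that])
  have D: "((\<lambda>a. \<rho> (x + a *\<^sub>R s)) has_real_derivative partial_derivative s \<rho> (x + a *\<^sub>R s)) (at a)"
    if "0 \<le> a" "a \<le> t" for a
    using seg[OF that] ball_sub by (intro DERIV_line differentiable_rho) blast
  obtain z where z: "0 < z" "z < t" "\<rho> (x + t *\<^sub>R s) - \<rho> (x + 0 *\<^sub>R s) = (t - 0) * partial_derivative s \<rho> (x + z *\<^sub>R s)"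
    using MVT2[of 0 t "\<lambda>a. \<rho> (x + a *\<^sub>R s)" "\<lambda>a. partial_derivative s \<rho> (x + a *\<^sub>R s)"] D t False by auto
  have zb: "x + z *\<^sub>R s \<in> ball x0 (2 * r)" using seg[of z] z by simp
  then have "c \<le> partial_derivative s \<rho> (x + z *\<^sub>R s)"
    using lower[of "x + z *\<^sub>R s"] ball_sub by (subst partial_s) (auto intro: differentiable_rho)
  then have "t * c \<le> t * partial_derivative s \<rho> (x + z *\<^sub>R s)" using t by (intro mult_left_mono)
  then show ?thesis using z(3) by (simp add: mult.commute)
qed simp

text \<open>The threshold \<open>- c * d\<close> is chosen so that travelling the distance
  \<open>d\<close> along \<open>s\<close>, where \<open>\<rho>\<close> grows at rate at least
  \<open>c\<close>, reaches nonnegative values. Two radii are in use: starting points in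
  \<open>ball x0 r\<close> stay in \<open>ball x0 (2 * r)\<close> during such a trip when
  \<open>d \<le> r\<close>.\<close>

definition layer :: "real => real => 'a set" where
  "layer R d = {x \<in> \<Omega> \<inter> ball x0 R. - c * d < \<rho> x}"

lemma open_layer: "R \<le> 2 * r ==> open (layer R d)"
proof -
  assume R: "R \<le> 2 * r"
  have "open (\<rho> -` {- c * d <..} \<inter> (\<Omega> \<inter> ball x0 R))"
    using R ball_sub open_dom
    by (subst Int_commute, intro continuous_open_preimage continuous_on_subset[OF smooth_on_continuous[OF chart(2)]]) auto
  then show ?thesis by (simp add: layer_def Int_def vimage_def conj_commute)
qed

lemma layer_neg: "x \<in> layer R d ==> R \<le> 2 * r ==> \<rho> x < 0"
  using chart(3) ball_sub(1) by (force simp: layer_def)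

lemma shift_in_ball: "x \<in> ball x0 r ==> 0 \<le> t ==> t \<le> r ==> x + t *\<^sub>R s \<in> ball x0 (2 * r)"
proof -
  assume x: "x \<in> ball x0 r" "0 \<le> t" "t \<le> r"
  have "dist x0 (x + t *\<^sub>R s) \<le> dist x0 x + dist x (x + t *\<^sub>R s)" by (rule dist_triangle)
  also have "dist x (x + t *\<^sub>R s) = t" using x norm_s by (simp add: dist_norm)
  finally show ?thesis using x by simp
qed

text \<open>\<open>\<rho>\<close> is negative at \<open>x\<close> and, by \<open>increasing\<close>,
  nonnegative after the distance \<open>d\<close>; the intermediate value theorem gives a
  zero.\<close>

lemma hit_exists:
  assumes d: "0 < d" "d \<le> r" and x: "x \<in> layer r d"
  shows "\<exists>t. 0 \<le> t \<and> t \<le> d \<and> \<rho> (x + t *\<^sub>R s) = 0"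
proof -
  have xb: "x \<in> ball x0 r" "- c * d < \<rho> x" and neg: "\<rho> x < 0"
    using x layer_neg[OF x] r by (auto simp: layer_def)
  have inb: "x + t *\<^sub>R s \<in> ball x0 (2 * r)" if "0 \<le> t" "t \<le> d" for t
    using shift_in_ball[OF xb(1)] that d by simp
  have "x \<in> ball x0 (2 * r)" using xb r by simp
  from increasing[OF this inb[of d]] have "0 \<le> \<rho> (x + d *\<^sub>R s)" using xb d by simp
  moreover have "continuous_on {0..d} (\<lambda>t. \<rho> (x + t *\<^sub>R s))"
  proof (rule continuous_on_compose2[OF smooth_on_continuous[OF chart(2)]])
    show "(\<lambda>t. x + t *\<^sub>R s) ` {0..d} \<subseteq> U" using inb ball_sub by fastforce
  qed (intro continuous_intros)
  ultimately obtain t where "t \<ge> 0" "t \<le> d" "\<rho> (x + t *\<^sub>R s) = 0"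
    using IVT'[of "\<lambda>t. \<rho> (x + t *\<^sub>R s)" 0 0 d] neg d by auto
  then show ?thesis by blast
qed

text \<open>Exit time from \<open>\<Omega>\<close> along \<open>s\<close>. The zero chosen is the
  only one in \<open>{0..d}\<close>, by strict growth of \<open>\<rho>\<close>. The default 0
  outside the layer keeps \<open>hit d\<close> between 0 and \<open>d\<close> everywhere.\<close>

definition hit :: "real => 'a => real" where
  "hit d x = (if x \<in> layer r d then SOME t. 0 \<le> t \<and> t \<le> d \<and> \<rho> (x + t *\<^sub>R s) = 0 else 0)"

definition foot :: "real => 'a => 'a" where
  "foot d x = x + hit d x *\<^sub>R s"

context
  fixes d assumes d: "0 < d" "d \<le> r"
begin

lemma hit: "x \<in> layer r d ==> 0 \<le> hit d x \<and> hit d x \<le> d \<and> \<rho> (foot d x) = 0"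
  unfolding hit_def foot_def using someI_ex[OF hit_exists[OF d]] by simp

lemma layer_ball: "x \<in> layer r d ==> x \<in> ball x0 r" "x \<in> layer r d ==> x \<in> ball x0 (2 * r)"
  using r by (auto simp: layer_def)

lemma shift_layer:
  assumes x: "x \<in> layer r d" and t: "0 \<le> t" "t \<le> d"
  shows "x + t *\<^sub>R s \<in> ball x0 (2 * r)" "\<rho> x + c * t \<le> \<rho> (x + t *\<^sub>R s)"
proof -
  show 1: "x + t *\<^sub>R s \<in> ball x0 (2 * r)" using shift_in_ball[OF layer_ball(1)[OF x]] t d by simp
  show "\<rho> x + c * t \<le> \<rho> (x + t *\<^sub>R s)" by (rule increasing[OF layer_ball(2)[OF x] 1 t(1)])
qed

text \<open>Strict growth of \<open>\<rho>\<close> along \<open>s\<close> replaces the choice in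
  \<open>hit\<close> by a sign condition. Measurability of \<open>foot\<close> and its position on
  the frontier both rest on it.\<close>

lemma before_hit:
  assumes x: "x \<in> layer r d" and t: "0 \<le> t" "t \<le> d"
  shows "\<rho> (x + t *\<^sub>R s) < 0 \<longleftrightarrow> t < hit d x"
proof -
  note h = hit[OF x]
  have inb: "x + t *\<^sub>R s \<in> ball x0 (2 * r)" "x + hit d x *\<^sub>R s \<in> ball x0 (2 * r)"
    using shift_layer(1)[OF x t] shift_layer(1)[OF x, of "hit d x"] h by auto
  have eq: "(x + a *\<^sub>R s) + (b - a) *\<^sub>R s = x + b *\<^sub>R s" for a b
    by (simp add: scaleR_left_diff_distrib)
  show ?thesis
  proof (cases "t < hit d x")
    case True
    have "\<rho> (x + t *\<^sub>R s) + c * (hit d x - t) \<le> \<rho> ((x + t *\<^sub>R s) + (hit d x - t) *\<^sub>R s)"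
      using True inb by (intro increasing) (simp_all only: eq)
    moreover have "0 < c * (hit d x - t)" using True c by simp
    ultimately have "\<rho> (x + t *\<^sub>R s) < 0" using h by (simp only: eq, simp add: foot_def)
    then show ?thesis using True by simp
  next
    case False
    have "\<rho> (x + hit d x *\<^sub>R s) + c * (t - hit d x) \<le> \<rho> ((x + hit d x *\<^sub>R s) + (t - hit d x) *\<^sub>R s)"
      using False inb by (intro increasing) (simp_all only: eq)
    moreover have "0 \<le> c * (t - hit d x)" using False c by simp
    ultimately have "0 \<le> \<rho> (x + t *\<^sub>R s)" using h by (simp only: eq, simp add: foot_def)
    then show ?thesis using False by simp
  qed
qed

lemma shift_in_layer:
  assumes x: "x \<in> layer r d" and t: "0 \<le> t" "t < hit d x"
  shows "x + t *\<^sub>R s \<in> layer (2 * r) d"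
proof -
  have td: "t \<le> d" using t hit[OF x] by simp
  have "\<rho> (x + t *\<^sub>R s) < 0" using before_hit[OF x t(1) td] t by simp
  then have "x + t *\<^sub>R s \<in> \<Omega>" using chart(3) shift_layer(1)[OF x t(1) td] ball_sub by blast
  moreover have "- c * d < \<rho> (x + t *\<^sub>R s)"
  proof -
    have "- c * d < \<rho> x" using x by (simp add: layer_def)
    moreover have "0 \<le> c * t" using c t by simp
    ultimately show ?thesis using shift_layer(2)[OF x t(1) td] by linarith
  qed
  ultimately show ?thesis using shift_layer(1)[OF x t(1) td] by (simp add: layer_def)
qed

lemma hit_pos: "x \<in> layer r d ==> 0 < hit d x"
  using before_hit[of x 0] layer_neg[of x r d] d r by simp

text \<open>The value \<open>\<rho> = 0\<close> keeps the foot out of \<open>\<Omega>\<close>, while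
  the points just before the hit lie in \<open>\<Omega>\<close> and converge to it.\<close>

lemma foot_frontier:
  assumes x: "x \<in> layer r d"
  shows "foot d x \<in> frontier \<Omega>" "foot d x \<in> ball x0 (2 * r)"
proof -
  note h = hit[OF x]
  show b: "foot d x \<in> ball x0 (2 * r)" using shift_layer[OF x] h by (simp add: foot_def)
  have "foot d x \<notin> \<Omega>" using chart(3) b ball_sub h by force
  moreover have "foot d x \<in> closure \<Omega>"
  proof (rule closed_sequentially[OF closed_closure])
    let ?t = "\<lambda>n. hit d x * (1 - inverse (real (Suc n)))"
    have "(\<lambda>n. hit d x * (1 - inverse (real (Suc n)))) \<longlonglongrightarrow> hit d x * (1 - 0)"
      by (intro tendsto_intros LIMSEQ_inverse_real_of_nat)
    then show "(\<lambda>n. x + ?t n *\<^sub>R s) \<longlonglongrightarrow> foot d x" unfolding foot_def by (intro tendsto_intros) simp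
    fix n
    have "?t n < hit d x" "0 \<le> ?t n" using hit_pos[OF x] by (auto simp: field_simps)
    then have "x + ?t n *\<^sub>R s \<in> layer (2 * r) d" by (intro shift_in_layer[OF x])
    then show "x + ?t n *\<^sub>R s \<in> closure \<Omega>" using closure_subset by (auto simp: layer_def)
  qed
  ultimately show "foot d x \<in> frontier \<Omega>" using open_dom by (simp add: frontier_def interior_open)
qed

text \<open>By \<open>before_hit\<close> a superlevel set of \<open>hit d\<close> at height
  \<open>a\<close> in \<open>{0..d}\<close> is the set of layer points with
  \<open>\<rho> (w + a *\<^sub>R s) < 0\<close>, which is open.\<close>

lemma measurable_foot [measurable]: "foot d \<in> borel_measurable borel"
proof -
  have "hit d \<in> borel_measurable borel"
    unfolding borel_measurable_iff_greater
  proof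
    fix a
    consider "a < 0" | "0 \<le> a" "a \<le> d" | "d < a" by linarith
    then show "{w \<in> space borel. a < hit d w} \<in> sets borel"
    proof cases
      case 1
      have "0 \<le> hit d w" for w using hit[of w] by (cases "w \<in> layer r d") (auto simp: hit_def)
      then have "{w \<in> space borel. a < hit d w} = UNIV" using 1 by (auto intro: less_le_trans)
      then show ?thesis by simp
    next
      case 2
      have "{w \<in> space borel. a < hit d w} = {w \<in> layer r d. \<rho> (w + a *\<^sub>R s) < 0}"
        using 2 before_hit[of _ a] by (auto simp: hit_def split: if_splits)
      also have "\<dots> = layer r d \<inter> (\<lambda>w. \<rho> (w + a *\<^sub>R s)) -` {..<0}" by auto
      also have "open \<dots>"
      proof (rule continuous_open_preimage[OF _ open_layer open_lessThan])
        show "continuous_on (layer r d) (\<lambda>w. \<rho> (w + a *\<^sub>R s))"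
        proof (rule continuous_on_compose2[OF smooth_on_continuous[OF chart(2)]])
          show "(\<lambda>w. w + a *\<^sub>R s) ` layer r d \<subseteq> U" using shift_layer(1)[OF _ 2] ball_sub by auto
        qed (intro continuous_intros)
      qed (use r in simp)
      finally show ?thesis by (simp only: borel_open)
    next
      case 3
      have "hit d w \<le> d" for w using hit[of w] d by (cases "w \<in> layer r d") (auto simp: hit_def)
      then have "{w \<in> space borel. a < hit d w} = {}" using 3 by (auto simp: not_less intro: order_trans less_imp_le)
      then show ?thesis by (simp only: sets.empty_sets)
    qed
  qed
  then show ?thesis unfolding foot_def[abs_def] by measurable
qed

end

end

section \<open>Comparison of volume and surface measure in a chart\<close>

context boundary_chart begin

definition dim1 :: nat where "dim1 = DIM('a) - 1"

text \<open>The quotient of the box volume \<open>4 * d * (2 * \<delta>) ^ dim1\<close> and the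
  gauge \<open>unit_ball_vol (real dim1) * (\<delta> / 2) ^ dim1\<close> of a set of diameter
  \<open>\<delta>\<close>, up to the factor \<open>d\<close>.\<close>

definition KH :: real where "KH = 4 * 4 ^ dim1 / unit_ball_vol (real dim1)"

lemma KH_pos: "0 < KH"
  by (simp add: KH_def unit_ball_vol_pos)

text \<open>Half-width \<open>\<delta>\<close> catches the feet in a covering set of diameter
  \<open>\<delta>\<close>; the additional \<open>d\<close> in direction \<open>b0\<close> catches
  the layer points that have these feet. As \<open>\<delta> \<le> d\<close>, that side is at most
  \<open>4 * d\<close>.\<close>

lemma emeasure_box_diameter:
  fixes y :: 'a
  assumes "0 \<le> \<delta>" "\<delta> \<le> d"
  defines "w \<equiv> \<Sum>b\<in>Basis. (\<delta> + (if b = b0 then d else 0)) *\<^sub>R b"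
  shows "emeasure lborel (cbox (y - w) (y + w)) \<le> ennreal (4 * d * (2 * \<delta>) ^ dim1)"
proof -
  have wb: "w \<bullet> b = \<delta> + (if b = b0 then d else 0)" if "b \<in> Basis" for b
    using that unfolding w_def by (simp add: inner_sum_left_Basis)
  have le: "\<forall>b\<in>Basis. (y - w) \<bullet> b \<le> (y + w) \<bullet> b"
    using wb assms(1,2) by (auto simp: inner_diff_left inner_add_left)
  have "emeasure lborel (cbox (y - w) (y + w)) = ennreal (\<Prod>b\<in>Basis. ((y + w) - (y - w)) \<bullet> b)"
    using le by (simp add: emeasure_lborel_cbox_eq)
  also have "(\<Prod>b\<in>Basis. ((y + w) - (y - w)) \<bullet> b) = (\<Prod>b\<in>Basis. 2 * (\<delta> + (if b = b0 then d else 0)))"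
    using wb by (intro prod.cong refl) (simp add: inner_diff_left inner_add_left)
  also have "\<dots> = 2 * (\<delta> + d) * (\<Prod>b\<in>Basis - {b0}. 2 * \<delta>)"
    using b0 by (subst prod.remove[of _ b0]) (auto intro!: arg_cong2[where f = "(*)"] prod.cong)
  also have "\<dots> = 2 * (\<delta> + d) * (2 * \<delta>) ^ dim1"
    using b0 by (simp add: dim1_def)
  also have "\<dots> \<le> 4 * d * (2 * \<delta>) ^ dim1"
    using assms by (intro mult_right_mono) auto
  finally show ?thesis by (simp add: ennreal_leI)
qed

text \<open>A covering of \<open>S\<close> by sets of diameter at most \<open>d\<close> induces a covering of the points of the layer with
  foot in \<open>S\<close> by boxes whose height is comparable to \<open>d\<close>.\<close>

lemma emeasure_foot_le:
  assumes d: "0 < d" "d \<le> r" and S: "S \<in> sets borel"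
  shows "emeasure lborel {x \<in> layer r d. foot d x \<in> S}
    \<le> ennreal (KH * d) * hausdorff_outer dim1 (S \<inter> frontier \<Omega>)"
proof -
  let ?A = "{x \<in> layer r d. foot d x \<in> S}" and ?K = "ennreal (KH * d)"
  have K: "0 < KH * d" using KH_pos d by simp
  have "inverse (ennreal q) * ennreal q = 1" if "0 < q" for q
    using that by (simp add: inverse_ennreal ennreal_mult[symmetric])
  from this[OF K] have inv: "inverse ?K * ?K = 1" .
  have cover: "emeasure lborel ?A \<le> ?K * (\<Sum>n. hausdorff_gauge dim1 (V n))"
    if V: "S \<inter> frontier \<Omega> \<subseteq> (\<Union>n. V n)" "\<And>n. bounded (V n)" "\<And>n. diameter (V n) \<le> d" for V :: "nat => 'a set"
  proof -
    define w where "w n = (\<Sum>b\<in>Basis. (diameter (V n) + (if b = b0 then d else 0)) *\<^sub>R b)" for n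
    define y where "y n = (SOME y. y \<in> V n)" for n
    define Q where "Q n = cbox (y n - w n) (y n + w n)" for n
    have "?A \<subseteq> (\<Union>n. Q n)"
    proof
      fix x assume x: "x \<in> ?A"
      then have xl: "x \<in> layer r d" by simp
      then obtain n where n: "foot d x \<in> V n" using V(1) foot_frontier(1)[OF d xl] x by blast
      then have y: "y n \<in> V n" unfolding y_def by (rule someI)
      have dist: "dist (foot d x) (y n) \<le> diameter (V n)"
        by (rule diameter_bounded_bound[OF V(2) n y])
      have "\<bar>(x - y n) \<bullet> b\<bar> \<le> w n \<bullet> b" if b: "b \<in> Basis" for b
      proof -
        have "(x - y n) \<bullet> b = (foot d x - y n) \<bullet> b - hit d x * (s \<bullet> b)"
          by (simp add: foot_def inner_diff_left inner_add_left)
        moreover have "\<bar>(foot d x - y n) \<bullet> b\<bar> \<le> diameter (V n)"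
          using Basis_le_norm[OF b, of "foot d x - y n"] dist by (simp add: dist_norm)
        moreover have "\<bar>hit d x * (s \<bullet> b)\<bar> \<le> (if b = b0 then d else 0)"
          using hit[OF d xl] b b0 \<sigma> by (auto simp: s_def inner_Basis abs_mult)
        moreover have "w n \<bullet> b = diameter (V n) + (if b = b0 then d else 0)"
          using b unfolding w_def by (simp add: inner_sum_left_Basis)
        ultimately show ?thesis by linarith
      qed
      then have "x \<in> Q n" unfolding Q_def mem_box by (force simp: inner_diff_left inner_add_left abs_le_iff)
      then show "x \<in> (\<Union>n. Q n)" by blast
    qed
    then have "emeasure lborel ?A \<le> emeasure lborel (\<Union>n. Q n)"
      by (intro emeasure_mono) (auto simp: Q_def)
    also have "\<dots> \<le> (\<Sum>n. emeasure lborel (Q n))"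
      by (rule emeasure_subadditive_countably) (auto simp: Q_def)
    also have "\<dots> \<le> (\<Sum>n. ?K * hausdorff_gauge dim1 (V n))"
    proof (rule suminf_le[OF _ summableI summableI])
      fix n
      have dn: "0 \<le> diameter (V n)" by (rule diameter_ge_0[OF V(2)])
      have "emeasure lborel (Q n) \<le> ennreal (4 * d * (2 * diameter (V n)) ^ dim1)"
        unfolding Q_def w_def by (rule emeasure_box_diameter[OF dn V(3)])
      also have "4 * d * (2 * diameter (V n)) ^ dim1 = (KH * d) * (unit_ball_vol (real dim1) * (diameter (V n) / 2) ^ dim1)"
      proof -
        have ub: "unit_ball_vol (real dim1) \<noteq> 0" by (metis less_irrefl of_nat_0_le_iff unit_ball_vol_pos)
        have "(2 * diameter (V n)) ^ dim1 = 4 ^ dim1 * (diameter (V n) / 2) ^ dim1"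
          by (simp only: power_mult_distrib[symmetric]) simp
        then show ?thesis using ub by (simp add: KH_def)
      qed
      finally show "emeasure lborel (Q n) \<le> ?K * hausdorff_gauge dim1 (V n)"
        using K dn by (simp add: hausdorff_gauge_def ennreal_mult[symmetric] unit_ball_vol_nonneg)
    qed
    also have "\<dots> = ?K * (\<Sum>n. hausdorff_gauge dim1 (V n))" by (rule ennreal_suminf_cmult)
    finally show ?thesis .
  qed
  \<comment> \<open>Coverings of mesh \<open>d\<close> suffice, since \<open>hausdorff_outer\<close>
    is the supremum over all mesh sizes. Dividing by \<open>?K\<close> first allows passing to the
    infimum over coverings.\<close>
  have "inverse ?K * emeasure lborel ?A \<le> hausdorff_pre dim1 d (S \<inter> frontier \<Omega>)"
    unfolding hausdorff_pre_def
  proof (rule INF_greatest)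
    fix V :: "nat => 'a set"
    assume "V \<in> {V. S \<inter> frontier \<Omega> \<subseteq> (\<Union>n. V n) \<and> (\<forall>n. bounded (V n) \<and> diameter (V n) \<le> d)}"
    then have "inverse ?K * emeasure lborel ?A \<le> inverse ?K * (?K * (\<Sum>n. hausdorff_gauge dim1 (V n)))"
      by (intro mult_left_mono cover) auto
    then show "inverse ?K * emeasure lborel ?A \<le> (\<Sum>n. hausdorff_gauge dim1 (V n))"
      by (simp add: mult.assoc[symmetric] inv)
  qed
  also have "\<dots> \<le> hausdorff_outer dim1 (S \<inter> frontier \<Omega>)"
    unfolding hausdorff_outer_def using d by (intro SUP_upper) auto
  finally have "?K * (inverse ?K * emeasure lborel ?A) \<le> ?K * hausdorff_outer dim1 (S \<inter> frontier \<Omega>)"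
    by (rule mult_left_mono) simp
  then show ?thesis using inv by (simp add: mult.assoc[symmetric] mult.commute[of ?K])
qed

text \<open>The image of volume on the layer under \<open>foot\<close> is dominated by
  \<open>KH * d\<close> times surface measure: this is \<open>emeasure_foot_le\<close> for sets,
  extended to functions by comparing two measures.\<close>

lemma layer_integral_foot:
  assumes dim: "2 \<le> DIM('a)" and d: "0 < d" "d \<le> r" and f: "f \<in> borel_measurable borel"
  shows "(\<integral>\<^sup>+x. f (foot d x) * indicator (layer r d) x \<partial>lborel)
    \<le> ennreal (KH * d) * (\<integral>\<^sup>+x. f x \<partial>surface_measure \<Omega>)"
proof -
  have k: "0 < dim1" using dim by (simp add: dim1_def)
  have fm: "frontier \<Omega> \<in> sets borel" by simp
  have lay: "layer r d \<in> sets borel" using open_layer[of r d] r by simp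
  note [measurable] = f measurable_foot[OF d] lay
  let ?M = "distr (density lborel (indicator (layer r d))) borel (foot d)"
  let ?N = "scale_measure (ennreal (KH * d)) (density (hausdorff_measure dim1) (indicator (frontier \<Omega>))) :: 'a measure"
  have sH: "sets (hausdorff_measure dim1 :: 'a measure) = sets borel" "space (hausdorff_measure dim1 :: 'a measure) = UNIV"
    unfolding hausdorff_measure_def
    using sets.sigma_sets_eq[of "borel :: 'a measure"]
    by (auto simp: space_measure_of sets_measure_of)
  have "nn_integral ?M f \<le> nn_integral ?N f"
  proof (rule nn_integral_measure_mono)
    show "sets ?M = sets ?N" by (simp add: sH)
    fix A assume "A \<in> sets ?M"
    then have A: "A \<in> sets borel" by simp
    have vA: "foot d -` A \<in> sets borel" using measurable_sets[OF measurable_foot[OF d] A] by simp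
    have "{x \<in> layer r d. foot d x \<in> A} = layer r d \<inter> foot d -` A" by auto
    then have lA: "{x \<in> layer r d. foot d x \<in> A} \<in> sets lborel" using lay vA by simp
    have "emeasure ?M A = (\<integral>\<^sup>+x. indicator (layer r d) x * indicator (foot d -` A) x \<partial>lborel)"
    proof -
      have "emeasure ?M A = emeasure (density lborel (indicator (layer r d))) (foot d -` A)"
        using A by (subst emeasure_distr) auto
      also have "\<dots> = (\<integral>\<^sup>+x. indicator (layer r d) x * indicator (foot d -` A) x \<partial>lborel)"
        using vA by (intro emeasure_density) auto
      finally show ?thesis .
    qed
    also have "\<dots> = (\<integral>\<^sup>+x. indicator {x \<in> layer r d. foot d x \<in> A} x \<partial>lborel)"
      by (intro nn_integral_cong) (auto simp: indicator_def)
    also have "\<dots> = emeasure lborel {x \<in> layer r d. foot d x \<in> A}"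
      by (rule nn_integral_indicator[OF lA])
    also have "\<dots> \<le> ennreal (KH * d) * hausdorff_outer dim1 (A \<inter> frontier \<Omega>)"
      by (rule emeasure_foot_le[OF d A])
    also have "hausdorff_outer dim1 (A \<inter> frontier \<Omega>) = emeasure (hausdorff_measure dim1) (A \<inter> frontier \<Omega>)"
      using A fm k by (intro emeasure_hausdorff_measure[symmetric]) auto
    also have "\<dots> = emeasure (density (hausdorff_measure dim1) (indicator (frontier \<Omega>))) A"
      using A fm by (subst emeasure_density) (auto simp: sH indicator_inter_arith[symmetric] Int_commute cong: measurable_cong_sets)
    finally show "emeasure ?M A \<le> emeasure ?N A" by simp
  qed
  moreover have "nn_integral ?M f = (\<integral>\<^sup>+x. f (foot d x) * indicator (layer r d) x \<partial>lborel)"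
    by (subst nn_integral_distr) (auto simp: nn_integral_density mult.commute)
  moreover have "nn_integral ?N f = ennreal (KH * d) * (\<integral>\<^sup>+x. f x \<partial>surface_measure \<Omega>)"
  proof -
    have fH: "f \<in> borel_measurable (hausdorff_measure dim1)" using f by (simp add: sH cong: measurable_cong_sets)
    have "nn_integral ?N f = ennreal (KH * d) * nn_integral (density (hausdorff_measure dim1) (indicator (frontier \<Omega>))) f"
      using fH by (intro nn_integral_scale_measure) simp
    also have "nn_integral (density (hausdorff_measure dim1) (indicator (frontier \<Omega>))) f
        = (\<integral>\<^sup>+x. f x * indicator (frontier \<Omega>) x \<partial>hausdorff_measure dim1)"
      using fH fm by (subst nn_integral_density) (auto simp: sH mult.commute intro!: borel_measurable_indicator)
    also have "\<dots> = (\<integral>\<^sup>+x. f x \<partial>surface_measure \<Omega>)"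
      unfolding surface_measure_def dim1_def[symmetric]
      using fm by (subst nn_integral_restrict_space) (auto simp: sH)
    finally show ?thesis .
  qed
  ultimately show ?thesis by simp
qed

text \<open>The fundamental theorem of calculus on the segment from \<open>x\<close> to its foot.
  The segment is enlarged to length \<open>d\<close>, with an indicator in the integrand, so that
  the range of integration no longer depends on \<open>x\<close>.\<close>

lemma pointwise_foot_bound:
  assumes d: "0 < d" "d \<le> r" and x: "x \<in> layer r d"
    and W: "\<And>y. y \<in> U ==> W differentiable (at y)" and cont: "continuous_on U (partial_derivative b0 W)"
  shows "ennreal \<bar>W x\<bar> \<le> ennreal \<bar>W (foot d x)\<bar>
    + (\<integral>\<^sup>+a. indicator {0..d} a * (ennreal \<bar>partial_derivative b0 W (x + a *\<^sub>R s)\<bar> * indicator (layer (2 * r) d) (x + a *\<^sub>R s)) \<partial>lborel)"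
proof -
  let ?g = "\<lambda>a. \<sigma> * partial_derivative b0 W (x + a *\<^sub>R s)" and ?t = "hit d x"
  have t: "0 \<le> ?t" "?t \<le> d" using hit[OF d x] by auto
  have inU: "x + a *\<^sub>R s \<in> U" if "0 \<le> a" "a \<le> ?t" for a
    using shift_layer(1)[OF d x, of a] that t ball_sub by auto
  have cg: "continuous_on {0..?t} ?g"
  proof (intro continuous_on_mult continuous_on_const)
    show "continuous_on {0..?t} (\<lambda>a. partial_derivative b0 W (x + a *\<^sub>R s))"
      by (rule continuous_on_compose2[OF cont]) (use inU in \<open>auto intro!: continuous_intros\<close>)
  qed
  have int: "integral\<^sup>L lborel (\<lambda>a. indicator {0..?t} a *\<^sub>R ?g a) = W (x + ?t *\<^sub>R s) - W (x + 0 *\<^sub>R s)"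
  proof (rule integral_FTC_atLeastAtMost[OF t(1) _ cg])
    fix a assume a: "0 \<le> a" "a \<le> ?t"
    have "((\<lambda>a. W (x + a *\<^sub>R s)) has_real_derivative ?g a) (at a)"
      using DERIV_line[OF W[OF inU[OF a]]] partial_s[OF W[OF inU[OF a]]] by simp
    then show "((\<lambda>a. W (x + a *\<^sub>R s)) has_vector_derivative ?g a) (at a within {0..?t})"
      by (simp add: has_real_derivative_iff_has_vector_derivative has_vector_derivative_at_within)
  qed
  have integ: "integrable lborel (\<lambda>a. indicator {0..?t} a *\<^sub>R ?g a)"
    using borel_integrable_atLeastAtMost'[OF cg] by (simp add: set_integrable_def)
  have "ennreal \<bar>W (foot d x) - W x\<bar> = ennreal (norm (integral\<^sup>L lborel (\<lambda>a. indicator {0..?t} a *\<^sub>R ?g a)))"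
    using int by (simp add: foot_def)
  also have "\<dots> \<le> (\<integral>\<^sup>+a. ennreal (norm (indicator {0..?t} a *\<^sub>R ?g a)) \<partial>lborel)"
    by (rule integral_norm_bound_ennreal[OF integ])
  also have "\<dots> \<le> (\<integral>\<^sup>+a. indicator {0..d} a * (ennreal \<bar>partial_derivative b0 W (x + a *\<^sub>R s)\<bar> * indicator (layer (2 * r) d) (x + a *\<^sub>R s)) \<partial>lborel)"
  proof (rule nn_integral_mono_AE)
    \<comment> \<open>The end point of the segment is the foot, which lies on the frontier and not
      in the layer.\<close>
    have "AE a in lborel. a \<noteq> ?t" by (rule AE_lborel_singleton)
    then show "AE a in lborel. ennreal (norm (indicator {0..?t} a *\<^sub>R ?g a)) \<le>
       indicator {0..d} a * (ennreal \<bar>partial_derivative b0 W (x + a *\<^sub>R s)\<bar> * indicator (layer (2 * r) d) (x + a *\<^sub>R s))"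
    proof eventually_elim
      case (elim a)
      show ?case
      proof (cases "a \<in> {0..?t}")
        case True
        then have "x + a *\<^sub>R s \<in> layer (2 * r) d" using elim by (intro shift_in_layer[OF d x]) auto
        then show ?thesis using True t \<sigma> by (simp add: abs_mult)
      qed simp
    qed
  qed
  finally have 1: "ennreal \<bar>W (foot d x) - W x\<bar> \<le> (\<integral>\<^sup>+a. indicator {0..d} a * (ennreal \<bar>partial_derivative b0 W (x + a *\<^sub>R s)\<bar> * indicator (layer (2 * r) d) (x + a *\<^sub>R s)) \<partial>lborel)" .
  have "\<bar>W x\<bar> \<le> \<bar>W (foot d x)\<bar> + \<bar>W (foot d x) - W x\<bar>" by linarith
  then have "ennreal \<bar>W x\<bar> \<le> ennreal \<bar>W (foot d x)\<bar> + ennreal \<bar>W (foot d x) - W x\<bar>"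
    by (simp add: ennreal_plus[symmetric] ennreal_leI del: ennreal_plus)
  also have "\<dots> \<le> ennreal \<bar>W (foot d x)\<bar> + (\<integral>\<^sup>+a. indicator {0..d} a * (ennreal \<bar>partial_derivative b0 W (x + a *\<^sub>R s)\<bar> * indicator (layer (2 * r) d) (x + a *\<^sub>R s)) \<partial>lborel)"
    by (intro add_left_mono 1)
  finally show ?thesis .
qed

text \<open>Integrates \<open>pointwise_foot_bound\<close> over the layer. The boundary term is
  handled by \<open>layer_integral_foot\<close>; in the other term Fubini and translation invariance
  make each shift by \<open>a\<close> contribute the same amount, which gives the factor
  \<open>d\<close>.\<close>

lemma layer_estimate:
  assumes dim: "2 \<le> DIM('a)" and d: "0 < d" "d \<le> r"
    and W: "\<And>y. y \<in> U ==> W differentiable (at y)" and cont: "continuous_on U (partial_derivative b0 W)"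
  shows "(\<integral>\<^sup>+x. ennreal \<bar>W x\<bar> * indicator (layer r d) x \<partial>lborel)
    \<le> ennreal (KH * d) * (\<integral>\<^sup>+x. ennreal \<bar>W x\<bar> * indicator (ball x0 (2 * r)) x \<partial>surface_measure \<Omega>)
      + ennreal d * (\<integral>\<^sup>+x. ennreal \<bar>partial_derivative b0 W x\<bar> * indicator (layer (2 * r) d) x \<partial>lborel)"
proof -
  define V where "V x = ennreal \<bar>partial_derivative b0 W x\<bar> * indicator (layer (2 * r) d) x" for x
  define f where "f x = ennreal \<bar>W x\<bar> * indicator (ball x0 (2 * r)) x" for x
  have lay: "layer r d \<in> sets borel" "layer (2 * r) d \<in> sets borel"
    using open_layer[of r d] open_layer[of "2 * r" d] r by auto
  have Wc: "continuous_on U W"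
    using W by (auto intro!: continuous_at_imp_continuous_on differentiable_imp_continuous_within)
  have "(\<lambda>x. indicator (layer (2 * r) d) x *\<^sub>R partial_derivative b0 W x) \<in> borel_measurable borel"
    using ball_sub by (intro borel_measurable_continuous_on_indicator lay continuous_on_subset[OF cont]) (auto simp: layer_def)
  then have "(\<lambda>x. ennreal \<bar>indicator (layer (2 * r) d) x *\<^sub>R partial_derivative b0 W x\<bar>) \<in> borel_measurable borel" by measurable
  also have "(\<lambda>x. ennreal \<bar>indicator (layer (2 * r) d) x *\<^sub>R partial_derivative b0 W x\<bar>) = V"
    by (auto simp: V_def indicator_def)
  finally have [measurable]: "V \<in> borel_measurable borel" .
  have "(\<lambda>x. indicator (ball x0 (2 * r)) x *\<^sub>R W x) \<in> borel_measurable borel"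
    using ball_sub by (intro borel_measurable_continuous_on_indicator continuous_on_subset[OF Wc]) auto
  then have "(\<lambda>x. ennreal \<bar>indicator (ball x0 (2 * r)) x *\<^sub>R W x\<bar>) \<in> borel_measurable borel" by measurable
  also have "(\<lambda>x. ennreal \<bar>indicator (ball x0 (2 * r)) x *\<^sub>R W x\<bar>) = f"
    by (auto simp: f_def indicator_def)
  finally have [measurable]: "f \<in> borel_measurable borel" .
  note [measurable] = lay measurable_foot[OF d]
  have "(\<integral>\<^sup>+x. ennreal \<bar>W x\<bar> * indicator (layer r d) x \<partial>lborel)
     \<le> (\<integral>\<^sup>+x. (f (foot d x) + (\<integral>\<^sup>+a. indicator {0..d} a * V (x + a *\<^sub>R s) \<partial>lborel)) * indicator (layer r d) x \<partial>lborel)"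
  proof (rule nn_integral_mono)
    fix x
    show "ennreal \<bar>W x\<bar> * indicator (layer r d) x \<le> (f (foot d x) + (\<integral>\<^sup>+a. indicator {0..d} a * V (x + a *\<^sub>R s) \<partial>lborel)) * indicator (layer r d) x"
    proof (cases "x \<in> layer r d")
      case True
      then show ?thesis
        using pointwise_foot_bound[OF d True W cont] foot_frontier(2)[OF d True] by (simp add: V_def f_def)
    qed simp
  qed
  also have "\<dots> \<le> (\<integral>\<^sup>+x. f (foot d x) * indicator (layer r d) x + (\<integral>\<^sup>+a. indicator {0..d} a * V (x + a *\<^sub>R s) \<partial>lborel) \<partial>lborel)"
    by (intro nn_integral_mono) (auto simp: indicator_def)
  also have "\<dots> = (\<integral>\<^sup>+x. f (foot d x) * indicator (layer r d) x \<partial>lborel) + (\<integral>\<^sup>+x. \<integral>\<^sup>+a. indicator {0..d} a * V (x + a *\<^sub>R s) \<partial>lborel \<partial>lborel)"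
    by (intro nn_integral_add) measurable
  also have "(\<integral>\<^sup>+x. \<integral>\<^sup>+a. indicator {0..d} a * V (x + a *\<^sub>R s) \<partial>lborel \<partial>lborel)
      = (\<integral>\<^sup>+a. \<integral>\<^sup>+x. indicator {0..d} a * V (x + a *\<^sub>R s) \<partial>lborel \<partial>lborel)"
    by (rule lborel_pair.Fubini') measurable
  also have "\<dots> = (\<integral>\<^sup>+a. indicator {0..d} a * (\<integral>\<^sup>+x. V x \<partial>lborel) \<partial>lborel)"
  proof (rule nn_integral_cong)
    fix a
    have "(\<integral>\<^sup>+x. V x \<partial>lborel) = (\<integral>\<^sup>+x. V x \<partial>distr lborel borel ((+) (a *\<^sub>R s)))"
      by (simp only: lborel_distr_plus)
    also have "\<dots> = (\<integral>\<^sup>+x. V (x + a *\<^sub>R s) \<partial>lborel)"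
      by (subst nn_integral_distr) (auto simp: add.commute)
    finally show "(\<integral>\<^sup>+x. indicator {0..d} a * V (x + a *\<^sub>R s) \<partial>lborel) = indicator {0..d} a * (\<integral>\<^sup>+x. V x \<partial>lborel)"
      by (simp add: nn_integral_cmult)
  qed
  also have "\<dots> = ennreal d * (\<integral>\<^sup>+x. V x \<partial>lborel)"
    using d by (simp add: nn_integral_multc)
  also have "(\<integral>\<^sup>+x. f (foot d x) * indicator (layer r d) x \<partial>lborel) \<le> ennreal (KH * d) * (\<integral>\<^sup>+x. f x \<partial>surface_measure \<Omega>)"
    by (rule layer_integral_foot[OF dim d]) simp
  finally show ?thesis unfolding V_def f_def by (simp add: add_right_mono)
qed

text \<open>Between two zeros of \<open>\<rho>\<close> the mean value theorem yields a point where
  the gradient is orthogonal to \<open>y - x\<close>. As the \<open>b0\<close> component of the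
  gradient is at least \<open>c\<close> in modulus, the boundary is a Lipschitz graph over the other
  coordinates.\<close>

lemma frontier_lipschitz:
  assumes x: "x \<in> frontier \<Omega> \<inter> ball x0 (2 * r)" and y: "y \<in> frontier \<Omega> \<inter> ball x0 (2 * r)"
  shows "c * \<bar>(y - x) \<bullet> b0\<bar> \<le> G * (\<Sum>b\<in>Basis - {b0}. \<bar>(y - x) \<bullet> b\<bar>)"
proof -
  have seg: "x + a *\<^sub>R (y - x) \<in> ball x0 (2 * r)" if "0 \<le> a" "a \<le> 1" for a
    using segment_in_ball[of x 1 "y - x" a] x y that by simp
  have D: "((\<lambda>a. \<rho> (x + a *\<^sub>R (y - x))) has_real_derivative partial_derivative (y - x) \<rho> (x + a *\<^sub>R (y - x))) (at a)"
    if "0 \<le> a" "a \<le> 1" for a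
    using seg[OF that] ball_sub by (intro DERIV_line differentiable_rho) blast
  obtain z where z: "0 < z" "z < 1" "\<rho> (x + 1 *\<^sub>R (y - x)) - \<rho> (x + 0 *\<^sub>R (y - x)) = (1 - 0) * partial_derivative (y - x) \<rho> (x + z *\<^sub>R (y - x))"
    using MVT2[of 0 1 "\<lambda>a. \<rho> (x + a *\<^sub>R (y - x))" "\<lambda>a. partial_derivative (y - x) \<rho> (x + a *\<^sub>R (y - x))"] D by auto
  let ?p = "x + z *\<^sub>R (y - x)"
  have p: "?p \<in> ball x0 (2 * r)" "?p \<in> U" using seg[of z] z ball_sub by auto
  have "\<rho> x = 0" "\<rho> y = 0" using frontier_zero x y ball_sub by blast+
  then have "0 = partial_derivative (y - x) \<rho> ?p" using z(3) by simp
  also have "\<dots> = (\<Sum>b\<in>Basis. ((y - x) \<bullet> b) * partial_derivative b \<rho> ?p)"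
    by (rule partial_derivative_eq[OF has_derivative_partial[OF differentiable_rho[OF p(2)]]])
  also have "\<dots> = ((y - x) \<bullet> b0) * partial_derivative b0 \<rho> ?p + (\<Sum>b\<in>Basis - {b0}. ((y - x) \<bullet> b) * partial_derivative b \<rho> ?p)"
    using b0 by (simp add: sum.remove)
  finally have eq: "\<bar>((y - x) \<bullet> b0) * partial_derivative b0 \<rho> ?p\<bar> = \<bar>\<Sum>b\<in>Basis - {b0}. ((y - x) \<bullet> b) * partial_derivative b \<rho> ?p\<bar>"
    by linarith
  have "c \<le> \<bar>partial_derivative b0 \<rho> ?p\<bar>"
    using lower[of ?p] p(1) \<sigma> abs_mult[of \<sigma> "partial_derivative b0 \<rho> ?p"] by auto
  then have "c * \<bar>(y - x) \<bullet> b0\<bar> \<le> \<bar>partial_derivative b0 \<rho> ?p\<bar> * \<bar>(y - x) \<bullet> b0\<bar>" by (rule mult_right_mono) simp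
  also have "\<dots> = \<bar>\<Sum>b\<in>Basis - {b0}. ((y - x) \<bullet> b) * partial_derivative b \<rho> ?p\<bar>"
    using eq by (simp add: abs_mult mult.commute)
  also have "\<dots> \<le> (\<Sum>b\<in>Basis - {b0}. \<bar>((y - x) \<bullet> b) * partial_derivative b \<rho> ?p\<bar>)" by (rule sum_abs)
  also have "\<dots> \<le> (\<Sum>b\<in>Basis - {b0}. \<bar>(y - x) \<bullet> b\<bar> * G)"
    unfolding abs_mult using p(1) by (intro sum_mono mult_left_mono upper) auto
  also have "\<dots> = G * (\<Sum>b\<in>Basis - {b0}. \<bar>(y - x) \<bullet> b\<bar>)" by (simp add: sum_distrib_left mult.commute)
  finally show ?thesis .
qed

text \<open>A grid of \<open>n ^ dim1\<close> cells in the coordinates other than \<open>b0\<close>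
  cuts the boundary piece into parts of diameter at most \<open>E / n\<close>. The gauges then add
  up to a bound that does not depend on \<open>n\<close>.\<close>

lemma hausdorff_frontier_finite:
  assumes dim: "2 \<le> DIM('a)"
  shows "hausdorff_outer dim1 (frontier \<Omega> \<inter> ball x0 r) < \<infinity>"
proof -
  have k: "0 < dim1" using dim by (simp add: dim1_def)
  have G: "0 \<le> G" using upper[of x0 b0] b0 r by auto
  \<comment> \<open>Each of the \<open>dim1\<close> grid coordinates varies by at most
    \<open>2 * r / n\<close> in a cell, and by \<open>frontier_lipschitz\<close> the coordinate
    \<open>b0\<close> varies by at most \<open>G / c\<close> times their sum.\<close>
  define E where "E = 2 * r * real dim1 * (1 + G / c)"
  have E: "0 \<le> E" using r c G by (simp add: E_def)
  let ?B = "Basis - {b0} :: 'a set"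
  have cB: "card ?B = dim1" using b0 by (simp add: dim1_def)
  have "hausdorff_pre dim1 \<delta> (frontier \<Omega> \<inter> ball x0 r) \<le> ennreal (unit_ball_vol (real dim1) * (E / 2) ^ dim1)"
    if \<delta>: "0 < \<delta>" for \<delta>
  proof -
    obtain n :: nat where n0: "E / \<delta> < real n" using reals_Archimedean2 by blast
    then have n: "0 < n" "E / real n \<le> \<delta>"
    proof -
      have "0 \<le> E / \<delta>" using E \<delta> by simp
      then show "0 < n" using n0 by (cases n) auto
      then show "E / real n \<le> \<delta>" using n0 \<delta> by (simp add: field_simps)
    qed
    define J where "J = (\<Pi>\<^sub>E b\<in>?B. {..<n})"
    have J: "finite J" "card J = n ^ dim1"
      unfolding J_def by (auto simp: finite_PiE card_PiE cB)
    define cell where "cell j = {x \<in> frontier \<Omega> \<inter> ball x0 r. \<forall>b\<in>?B.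
        2 * r * real (j b) / real n \<le> (x - x0) \<bullet> b + r \<and> (x - x0) \<bullet> b + r \<le> 2 * r * (real (j b) + 1) / real n}" for j :: "'a => nat"
    have cover: "\<exists>j\<in>J. x \<in> cell j" if x: "x \<in> frontier \<Omega> \<inter> ball x0 r" for x
    proof
      define j where "j = (\<lambda>b\<in>?B. nat \<lfloor>((x - x0) \<bullet> b + r) * real n / (2 * r)\<rfloor>)"
      have bd: "0 \<le> ((x - x0) \<bullet> b + r) * real n / (2 * r)" "((x - x0) \<bullet> b + r) * real n / (2 * r) < real n" if b: "b \<in> ?B" for b
      proof -
        have "\<bar>(x - x0) \<bullet> b\<bar> < r"
          using Basis_le_norm[of b "x - x0"] b x by (auto simp: dist_norm norm_minus_commute)
        then have q: "0 \<le> (x - x0) \<bullet> b + r" "(x - x0) \<bullet> b + r < 2 * r" by auto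
        show "0 \<le> ((x - x0) \<bullet> b + r) * real n / (2 * r)"
          using q(1) r by (intro divide_nonneg_pos mult_nonneg_nonneg) auto
        have "((x - x0) \<bullet> b + r) * real n < 2 * r * real n" using q(2) n(1) by (intro mult_strict_right_mono) auto
        then show "((x - x0) \<bullet> b + r) * real n / (2 * r) < real n"
          using r by (simp add: pos_divide_less_eq mult.commute)
      qed
      show "j \<in> J"
        unfolding J_def j_def using bd by (auto simp: PiE_iff floor_less_iff nat_less_iff)
      show "x \<in> cell j"
        unfolding cell_def
      proof (intro CollectI conjI ballI x)
        fix b assume b: "b \<in> ?B"
        let ?q = "((x - x0) \<bullet> b + r) * real n / (2 * r)"
        have jb: "real (j b) = of_int \<lfloor>?q\<rfloor>" using b bd(1)[OF b] by (simp add: j_def)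
        have "real (j b) \<le> ?q" "?q \<le> real (j b) + 1" unfolding jb by linarith+
        then show "2 * r * real (j b) / real n \<le> (x - x0) \<bullet> b + r" "(x - x0) \<bullet> b + r \<le> 2 * r * (real (j b) + 1) / real n"
          using r n(1) by (simp_all add: field_simps)
      qed
    qed
    have diam: "diameter (cell j) \<le> E / real n" for j
    proof (rule diameter_le)
      show "cell j \<noteq> {} \<or> 0 \<le> E / real n" using E by simp
      fix x y assume xy: "x \<in> cell j" "y \<in> cell j"
      have b: "\<bar>(x - y) \<bullet> b\<bar> \<le> 2 * r / real n" if b: "b \<in> ?B" for b
      proof -
        have "2 * r * real (j b) / real n \<le> (x - x0) \<bullet> b + r" "(x - x0) \<bullet> b + r \<le> 2 * r * (real (j b) + 1) / real n"
          "2 * r * real (j b) / real n \<le> (y - x0) \<bullet> b + r" "(y - x0) \<bullet> b + r \<le> 2 * r * (real (j b) + 1) / real n"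
          using xy b unfolding cell_def by blast+
        moreover have "2 * r * (real (j b) + 1) / real n = 2 * r * real (j b) / real n + 2 * r / real n"
          by (simp add: algebra_simps add_divide_distrib)
        ultimately show ?thesis by (simp add: inner_diff_left abs_le_iff)
      qed
      have sm: "(\<Sum>b\<in>?B. \<bar>(x - y) \<bullet> b\<bar>) \<le> real dim1 * (2 * r / real n)"
        using sum_mono[of ?B "\<lambda>b. \<bar>(x - y) \<bullet> b\<bar>" "\<lambda>_. 2 * r / real n"] b cB by simp
      have "c * \<bar>(x - y) \<bullet> b0\<bar> \<le> G * (\<Sum>b\<in>?B. \<bar>(x - y) \<bullet> b\<bar>)"
        using xy r by (intro frontier_lipschitz) (auto simp: cell_def)
      also have "\<dots> \<le> G * (real dim1 * (2 * r / real n))" by (rule mult_left_mono[OF sm G])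
      finally have le: "c * \<bar>(x - y) \<bullet> b0\<bar> \<le> G * (real dim1 * (2 * r / real n))" .
      have gen: "a \<le> (g / c) * z" if "c * a \<le> g * z" for a g z
        using that c by (simp add: field_simps)
      have b0': "\<bar>(x - y) \<bullet> b0\<bar> \<le> (G / c) * (real dim1 * (2 * r / real n))"
        by (rule gen[OF le])
      have "norm (x - y) \<le> (\<Sum>b\<in>Basis. \<bar>(x - y) \<bullet> b\<bar>)" by (rule norm_le_l1)
      also have "\<dots> = \<bar>(x - y) \<bullet> b0\<bar> + (\<Sum>b\<in>?B. \<bar>(x - y) \<bullet> b\<bar>)" using b0 by (simp add: sum.remove)
      also have "\<dots> \<le> (G / c) * (real dim1 * (2 * r / real n)) + real dim1 * (2 * r / real n)"
        by (rule add_mono[OF b0' sm])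
      also have "\<dots> = E / real n" by (simp add: E_def algebra_simps add_divide_distrib)
      finally show "norm (x - y) \<le> E / real n" .
    qed
    obtain e where e: "bij_betw e {0..<card J} J" using ex_bij_betw_nat_finite[OF J(1)] by blast
    define V where "V i = (if i < card J then cell (e i) else {})" for i
    have "hausdorff_pre dim1 \<delta> (frontier \<Omega> \<inter> ball x0 r) \<le> (\<Sum>i. hausdorff_gauge dim1 (V i))"
      unfolding hausdorff_pre_def
    proof (rule INF_lower, intro CollectI conjI allI subsetI)
      fix x assume "x \<in> frontier \<Omega> \<inter> ball x0 r"
      then obtain j where j: "j \<in> J" "x \<in> cell j" using cover by blast
      then have "j \<in> e ` {0..<card J}" using bij_betw_imp_surj_on[OF e] by simp
      then obtain i where "i < card J" "e i = j" by auto
      then show "x \<in> (\<Union>i. V i)" using j by (auto simp: V_def)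
    next
      fix i
      show "bounded (V i)" unfolding V_def cell_def by (auto intro: bounded_subset[OF bounded_ball])
      show "diameter (V i) \<le> \<delta>" using diam[of "e i"] n(2) \<delta> by (auto simp: V_def)
    qed
    also have "\<dots> = (\<Sum>i<card J. hausdorff_gauge dim1 (V i))"
      by (rule suminf_finite) (auto simp: V_def hausdorff_gauge_empty[OF k])
    also have "\<dots> \<le> (\<Sum>i<card J. ennreal (unit_ball_vol (real dim1) * (E / real n / 2) ^ dim1))"
    proof (rule sum_mono)
      fix i assume "i \<in> {..<card J}"
      have bd: "bounded (V i)" unfolding V_def cell_def by (auto intro: bounded_subset[OF bounded_ball])
      have "diameter (V i) \<le> E / real n" using diam[of "e i"] E by (auto simp: V_def)
      then show "hausdorff_gauge dim1 (V i) \<le> ennreal (unit_ball_vol (real dim1) * (E / real n / 2) ^ dim1)"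
        unfolding hausdorff_gauge_def
        by (intro ennreal_leI mult_left_mono power_mono divide_right_mono) (auto simp: unit_ball_vol_nonneg diameter_ge_0[OF bd])
    qed
    also have "\<dots> = ennreal (real (n ^ dim1) * (unit_ball_vol (real dim1) * (E / real n / 2) ^ dim1))"
      using E by (simp add: J(2) ennreal_of_nat_eq_real_of_nat ennreal_mult' unit_ball_vol_nonneg)
    also have "real (n ^ dim1) * (unit_ball_vol (real dim1) * (E / real n / 2) ^ dim1) = unit_ball_vol (real dim1) * (E / 2) ^ dim1"
      using n(1) by (simp add: power_divide)
    finally show ?thesis .
  qed
  then have "hausdorff_outer dim1 (frontier \<Omega> \<inter> ball x0 r) \<le> ennreal (unit_ball_vol (real dim1) * (E / 2) ^ dim1)"
    unfolding hausdorff_outer_def by (intro SUP_least) auto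
  then show ?thesis by (simp add: le_less_trans)
qed

end

section \<open>Uniqueness of the outward normal\<close>

lemma local_defining_at:
  "local_defining_function \<Omega> x U \<rho> ==> y \<in> U ==> local_defining_function \<Omega> y U \<rho>"
  by (auto simp: local_defining_function_def)

lemma inner_gradient_vector:
  "v \<bullet> gradient f x = (\<Sum>b\<in>Basis. (v \<bullet> b) * partial_derivative b f x)"
  unfolding gradient_def by (simp add: inner_sum_right mult.commute)

lemma defining_function_descent:
  assumes loc: "local_defining_function \<Omega> y U \<rho>" and \<Omega>: "open \<Omega>" and y: "y \<in> frontier \<Omega>"
    and v: "v \<bullet> gradient \<rho> y < 0"
  shows "\<exists>e>0. \<forall>t. 0 < t \<and> t < e \<longrightarrow> \<rho> (y + t *\<^sub>R v) < 0"
proof -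
  have U: "open U" "smooth_on U \<rho>" "y \<in> U" using loc by (auto simp: local_defining_function_def)
  have \<rho>0: "\<rho> y = 0" by (rule frontier_defining_function[OF loc \<Omega> U(3) y])
  have diff: "\<rho> differentiable (at (y + 0 *\<^sub>R v))" using smooth_on_differentiable[OF U(2,1)] U(3) by simp
  have "partial_derivative v \<rho> y = v \<bullet> gradient \<rho> y"
    using partial_derivative_eq[OF has_derivative_partial[of \<rho> y], of v] diff by (simp add: inner_gradient_vector)
  then have "((\<lambda>t. \<rho> (y + t *\<^sub>R v)) has_real_derivative v \<bullet> gradient \<rho> y) (at 0)"
    using DERIV_line[OF diff] by simp
  from DERIV_neg_dec_right[OF this v] show ?thesis using \<rho>0 by auto
qed

text \<open>If the unit vectors \<open>n\<close> and \<open>n'\<close> differ, then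
  \<open>v = n' - n\<close> points strictly into \<open>\<Omega>\<close> according to
  \<open>\<rho>\<close> and strictly out of it according to \<open>\<rho>'\<close>, so that
  \<open>y + t *\<^sub>R v\<close> with small positive \<open>t\<close> gives a
  contradiction.\<close>

lemma normalized_gradient_unique:
  assumes 1: "local_defining_function \<Omega> y U \<rho>" and 2: "local_defining_function \<Omega> y U' \<rho>'"
    and \<Omega>: "open \<Omega>" and y: "y \<in> frontier \<Omega>"
  shows "gradient \<rho> y /\<^sub>R norm (gradient \<rho> y) = gradient \<rho>' y /\<^sub>R norm (gradient \<rho>' y)"
proof (rule ccontr)
  let ?g = "gradient \<rho> y" and ?g' = "gradient \<rho>' y"
  define n n' where "n = ?g /\<^sub>R norm ?g" and "n' = ?g' /\<^sub>R norm ?g'"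
  assume "\<not> ?thesis"
  then have ne: "n \<noteq> n'" by (simp add: n_def n'_def)
  have g0: "?g \<noteq> 0" "?g' \<noteq> 0" using 1 2 by (auto simp: local_defining_function_def)
  have "norm n = 1" "norm n' = 1" using g0 by (simp_all add: n_def n'_def)
  then have nn: "n \<bullet> n = 1" "n' \<bullet> n' = 1" by (simp_all add: norm_eq_1)
  have "0 < (n - n') \<bullet> (n - n')" using ne by simp
  then have lt: "n \<bullet> n' < 1" using nn by (simp add: inner_diff_left inner_diff_right inner_commute)
  have g: "?g = norm ?g *\<^sub>R n" "?g' = norm ?g' *\<^sub>R n'" using g0 by (simp_all add: n_def n'_def)
  define v where "v = n' - n"
  have "v \<bullet> ?g = norm ?g * (n \<bullet> n' - 1)"
    by (subst g(1)) (simp add: v_def inner_diff_left inner_diff_right nn inner_commute)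
  then have v1: "v \<bullet> ?g < 0" using g0 lt by (simp add: mult_pos_neg)
  have "v \<bullet> ?g' = norm ?g' * (1 - n \<bullet> n')"
    by (subst g(2)) (simp add: v_def inner_diff_left inner_diff_right nn inner_commute)
  then have v2: "v \<bullet> ?g' > 0" using g0 lt by simp
  obtain e1 where e1: "e1 > 0" "\<And>t. 0 < t ==> t < e1 ==> \<rho> (y + t *\<^sub>R v) < 0"
    using defining_function_descent[OF 1 \<Omega> y v1] by blast
  have U: "open U" "open U'" "y \<in> U" "y \<in> U'" "\<Omega> \<inter> U = {y \<in> U. \<rho> y < 0}" "\<Omega> \<inter> U' = {y \<in> U'. \<rho>' y < 0}" "smooth_on U' \<rho>'"
    using 1 2 by (auto simp: local_defining_function_def)
  have diff: "\<rho>' differentiable (at (y + 0 *\<^sub>R v))" using smooth_on_differentiable[OF U(7,2)] U(4) by simp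
  have "partial_derivative v \<rho>' y = v \<bullet> ?g'"
    using partial_derivative_eq[OF has_derivative_partial[of \<rho>' y], of v] diff by (simp add: inner_gradient_vector)
  then have D: "((\<lambda>t. \<rho>' (y + t *\<^sub>R v)) has_real_derivative v \<bullet> ?g') (at 0)"
    using DERIV_line[OF diff] by simp
  have \<rho>0: "\<rho>' y = 0" by (rule frontier_defining_function[OF 2 \<Omega> U(4) y])
  obtain e2 where e2: "e2 > 0" "\<And>t. 0 < t ==> t < e2 ==> 0 < \<rho>' (y + t *\<^sub>R v)"
    using DERIV_pos_inc_right[OF D v2] \<rho>0 by auto
  have "open (U \<inter> U')" using U by blast
  then obtain e3 where e3: "e3 > 0" "ball y e3 \<subseteq> U \<inter> U'" using U(3,4) open_contains_ball by blast
  have v0: "norm v > 0" using v1 by auto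
  define m where "m = min (min e1 e2) (e3 / norm v)"
  define t where "t = m / 2"
  have m: "0 < m" "m \<le> e1" "m \<le> e2" "m \<le> e3 / norm v"
    using e1(1) e2(1) e3(1) v0 by (auto simp: m_def)
  have "t * norm v < m * norm v" using m(1) v0 by (simp add: t_def)
  also have "m * norm v \<le> e3" using m(4) v0 by (simp add: field_simps)
  finally have t: "0 < t" "t < e1" "t < e2" "t * norm v < e3"
    using m by (auto simp: t_def)
  have "y + t *\<^sub>R v \<in> ball y e3" using t by (simp add: dist_norm)
  then have "y + t *\<^sub>R v \<in> U \<inter> U'" using e3 by blast
  then have "y + t *\<^sub>R v \<in> \<Omega>" "y + t *\<^sub>R v \<in> U'" using e1(2)[OF t(1,2)] U(5) by auto
  then have "\<rho>' (y + t *\<^sub>R v) < 0" using U(6) by blast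
  then show False using e2(2)[OF t(1,3)] by simp
qed

text \<open>Uniqueness of the normalised gradient makes the \<open>THE\<close> in
  \<open>outward_normal\<close> well defined; from here on the normal is computed from the
  chart.\<close>

lemma outward_normal_eq:
  assumes loc: "local_defining_function \<Omega> x U \<rho>" and \<Omega>: "open \<Omega>" and y: "y \<in> U" "y \<in> frontier \<Omega>"
  shows "outward_normal \<Omega> y = gradient \<rho> y /\<^sub>R norm (gradient \<rho> y)"
  unfolding outward_normal_def
proof (rule the_equality)
  note l = local_defining_at[OF loc y(1)]
  show "\<exists>U \<rho>'. local_defining_function \<Omega> y U \<rho>' \<and> gradient \<rho> y /\<^sub>R norm (gradient \<rho> y) = gradient \<rho>' y /\<^sub>R norm (gradient \<rho>' y)"
    using l by blast
  fix n assume "\<exists>U \<rho>. local_defining_function \<Omega> y U \<rho> \<and> n = gradient \<rho> y /\<^sub>R norm (gradient \<rho> y)"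
  then show "n = gradient \<rho> y /\<^sub>R norm (gradient \<rho> y)"
    using normalized_gradient_unique[OF l _ \<Omega> y(2)] by metis
qed

section \<open>Existence of charts and finiteness of the surface measure\<close>

lemma bounded_on_cball:
  fixes f :: "'a::euclidean_space => real"
  assumes "continuous_on U f" "cball x r \<subseteq> U"
  shows "\<exists>C\<ge>0. \<forall>y\<in>cball x r. \<bar>f y\<bar> \<le> C"
proof -
  have "bounded (f ` cball x r)"
    using assms by (intro compact_imp_bounded compact_continuous_image) (auto intro: continuous_on_subset)
  then obtain C where "C > 0" "\<And>y. y \<in> cball x r ==> \<bar>f y\<bar> \<le> C" by (auto simp: bounded_pos)
  then show ?thesis by (meson less_imp_le)
qed

text \<open>Some partial derivative of \<open>\<rho>\<close> is nonzero at \<open>x0\<close>;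
  \<open>\<sigma>\<close> is its sign and \<open>c\<close> half its modulus, so that by continuity
  the lower bound \<open>c\<close> persists on a ball. Its radius \<open>e\<close> is twice the
  \<open>r\<close> of the chart.\<close>

lemma boundary_chart_exists:
  fixes \<Omega> :: "'a::euclidean_space set"
  assumes dom: "smooth_bounded_domain \<Omega>" and x0: "x0 \<in> frontier \<Omega>"
  shows "\<exists>U \<rho> b0 \<sigma> c r G. boundary_chart \<Omega> x0 U \<rho> b0 \<sigma> c r G"
proof -
  obtain U \<rho> where loc: "local_defining_function \<Omega> x0 U \<rho>"
    using dom[unfolded smooth_bounded_domain_def] x0 by blast
  have U: "open U" "x0 \<in> U" "smooth_on U \<rho>" "gradient \<rho> x0 \<noteq> 0"
    using loc by (auto simp: local_defining_function_def)
  obtain b0 where b0: "b0 \<in> Basis" "partial_derivative b0 \<rho> x0 \<noteq> 0"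
    using U(4) unfolding gradient_def by (metis (no_types, lifting) scale_zero_left sum.neutral)
  define \<sigma> where "\<sigma> = sgn (partial_derivative b0 \<rho> x0)"
  define c where "c = \<bar>partial_derivative b0 \<rho> x0\<bar> / 2"
  have c: "0 < c" using b0 by (simp add: c_def)
  have s: "\<bar>\<sigma>\<bar> = 1" using b0 by (simp add: \<sigma>_def abs_sgn_eq)
  have cont: "continuous_on U (\<lambda>y. \<sigma> * partial_derivative b0 \<rho> y)"
    by (intro continuous_on_mult continuous_on_const smooth_on_continuous smooth_on_partial U b0)
  have "open (U \<inter> (\<lambda>y. \<sigma> * partial_derivative b0 \<rho> y) -` {c<..})"
    by (rule continuous_open_preimage[OF cont U(1) open_greaterThan])
  moreover have "x0 \<in> U \<inter> (\<lambda>y. \<sigma> * partial_derivative b0 \<rho> y) -` {c<..}"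
    using U(2) c by (simp add: \<sigma>_def c_def sgn_mult_self_eq mult.commute[of "sgn _"] abs_sgn[symmetric])
  ultimately obtain e where e: "e > 0" "cball x0 e \<subseteq> U \<inter> (\<lambda>y. \<sigma> * partial_derivative b0 \<rho> y) -` {c<..}"
    using open_contains_cball by blast
  have "continuous_on U (\<lambda>y. \<Sum>b\<in>Basis. \<bar>partial_derivative b \<rho> y\<bar>)"
    by (intro continuous_on_sum continuous_on_rabs smooth_on_continuous smooth_on_partial U)
  then obtain G where G: "\<And>y. y \<in> cball x0 e ==> \<bar>\<Sum>b\<in>Basis. \<bar>partial_derivative b \<rho> y\<bar>\<bar> \<le> G"
    using bounded_on_cball[of U _ x0 e] e(2) by blast
  have "boundary_chart \<Omega> x0 U \<rho> b0 \<sigma> c (e / 2) G"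
  proof
    show "open \<Omega>" "bounded \<Omega>" using dom by (auto simp: smooth_bounded_domain_def)
    fix y b :: 'a assume y: "y \<in> cball x0 (2 * (e / 2))"
    then show "c \<le> \<sigma> * partial_derivative b0 \<rho> y" using e(2) by (force intro: less_imp_le)
    assume b: "b \<in> Basis"
    have "\<bar>partial_derivative b \<rho> y\<bar> \<le> (\<Sum>b\<in>Basis. \<bar>partial_derivative b \<rho> y\<bar>)"
      by (rule member_le_sum[OF b]) auto
    then show "\<bar>partial_derivative b \<rho> y\<bar> \<le> G" using G[of y] y by simp
  qed (use loc e s c b0 in auto)
  then show ?thesis by blast
qed

lemma sets_surface_measure:
  "f \<in> borel_measurable borel ==> f \<in> borel_measurable (surface_measure \<Omega>)"
  unfolding surface_measure_def hausdorff_measure_def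
  by (intro measurable_restrict_space1) (simp add: measurable_def sets_measure_of space_measure_of sets.sigma_sets_eq[of borel, simplified])

lemma space_surface_measure: "space (surface_measure \<Omega>) = frontier \<Omega>"
  unfolding surface_measure_def hausdorff_measure_def by (simp add: space_restrict_space space_measure_of)

text \<open>Compactness of the boundary reduces this to the charts. Finiteness is what turns the L2
  convergence of traces into L1 convergence on the boundary.\<close>

lemma finite_surface_measure:
  fixes \<Omega> :: "'a::euclidean_space set"
  assumes dim: "2 \<le> DIM('a)" and dom: "smooth_bounded_domain \<Omega>"
  shows "finite_measure (surface_measure \<Omega>)"
proof -
  let ?k = "DIM('a) - 1" and ?H = "hausdorff_outer (DIM('a) - 1) :: 'a set => ennreal"
  have k: "0 < ?k" using dim by simp
  have "\<exists>r>0. ?H (frontier \<Omega> \<inter> ball x r) < \<infinity>" if x: "x \<in> frontier \<Omega>" for x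
  proof -
    obtain U \<rho> b0 \<sigma> c r G where "boundary_chart \<Omega> x U \<rho> b0 \<sigma> c r G"
      using boundary_chart_exists[OF dom x] by blast
    then interpret boundary_chart \<Omega> x U \<rho> b0 \<sigma> c r G .
    show ?thesis using hausdorff_frontier_finite[OF dim] r by (auto simp: dim1_def)
  qed
  then obtain R where R: "\<And>x. x \<in> frontier \<Omega> ==> R x > 0" "\<And>x. x \<in> frontier \<Omega> ==> ?H (frontier \<Omega> \<inter> ball x (R x)) < \<infinity>"
    by metis
  have "compact (frontier \<Omega>)" using dom by (simp add: smooth_bounded_domain_def compact_frontier_bounded)
  then obtain C where C: "C \<subseteq> frontier \<Omega>" "finite C" "frontier \<Omega> \<subseteq> (\<Union>x\<in>C. ball x (R x))"
    by (rule compactE_image[of _ "frontier \<Omega>" "\<lambda>x. ball x (R x)"]) (use R(1) in auto)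
  have fin: "?H (\<Union>x\<in>D. frontier \<Omega> \<inter> ball x (R x)) < \<infinity>" if "finite D" "D \<subseteq> frontier \<Omega>" for D
    using that
  proof (induction D)
    case empty then show ?case using hausdorff_outer_empty[OF k, where 'a='a] by simp
  next
    case (insert x D)
    have "?H (\<Union>x\<in>insert x D. frontier \<Omega> \<inter> ball x (R x)) \<le> ?H (frontier \<Omega> \<inter> ball x (R x)) + ?H (\<Union>x\<in>D. frontier \<Omega> \<inter> ball x (R x))"
      using hausdorff_outer_subadditive[OF k] by simp
    also have "\<dots> < \<infinity>" using insert R(2)[of x] by simp
    finally show ?case .
  qed
  have "?H (frontier \<Omega>) \<le> ?H (\<Union>x\<in>C. frontier \<Omega> \<inter> ball x (R x))"
    by (rule hausdorff_outer_mono) (use C(3) in blast)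
  then have "?H (frontier \<Omega>) < \<infinity>" using fin[OF C(2,1)] by simp
  moreover have "emeasure (surface_measure \<Omega>) (space (surface_measure \<Omega>)) = ?H (frontier \<Omega>)"
  proof -
    have fs: "frontier \<Omega> \<inter> space (hausdorff_measure ?k) \<in> sets (hausdorff_measure ?k)"
      by (simp add: hausdorff_measure_def space_measure_of sets_measure_of)
    show ?thesis
      unfolding space_surface_measure unfolding surface_measure_def
      by (subst emeasure_restrict_space[OF fs order_refl]) (rule emeasure_hausdorff_measure[OF k], simp)
  qed
  ultimately show ?thesis by (intro finite_measureI) simp
qed

section \<open>Green's formula\<close>

lemma tendsto_zero_ennreal_le:
  assumes "\<And>k. A \<le> ennreal (e k) + B" "e \<longlonglongrightarrow> 0"
  shows "A \<le> B"
proof -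
  have "(\<lambda>k. ennreal (e k) + B) \<longlonglongrightarrow> ennreal 0 + B"
    by (intro tendsto_add tendsto_const tendsto_ennrealI assms(2))
  then have "A \<le> ennreal 0 + B" by (rule LIMSEQ_le_const) (use assms(1) in auto)
  then show ?thesis by simp
qed

text \<open>\<open>X\<close> plays the role of \<open>\<nabla>u\<close>; \<open>F b k\<close> are smooth approximations of its components.\<close>

locale green_field = bounded_open \<Omega> for \<Omega> :: "'a::euclidean_space set" +
  fixes X :: "'a => 'a => real" and F :: "'a => nat => 'a => real" and v :: "'a => real" and Mv :: real
  assumes X: "b \<in> Basis ==> X b \<in> H1 \<Omega>"
    and F: "b \<in> Basis ==> smooth_on UNIV (F b k)"
    and FX: "b \<in> Basis ==> (\<lambda>k. H1_norm \<Omega> (\<lambda>x. F b k x - X b x)) \<longlonglongrightarrow> 0"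
    and v: "v \<in> H1 \<Omega>" and vb: "AE x in lebesgue_on \<Omega>. \<bar>v x\<bar> \<le> Mv" and Mv: "0 \<le> Mv"
begin

text \<open>The product rule for the derivative of \<open>v * \<theta> * X b\<close> in direction
  \<open>b\<close>; summed over \<open>b\<close>, it is the divergence of
  \<open>\<theta> * v * X\<close>.\<close>

definition integrand :: "('a => real) => 'a => 'a => real" where
  "integrand \<theta> b x = v x * \<theta> x * weak_partial \<Omega> b (X b) x + \<theta> x * X b x * weak_partial \<Omega> b v x
     + v x * X b x * partial_derivative b \<theta> x"

text \<open>Formally the flux of \<open>\<theta> * v * X\<close> through the boundary. Green's
  formula is the case \<open>\<theta> = 1\<close> of its vanishing; localisation in
  \<open>\<theta>\<close> makes the charts available.\<close>

definition defect :: "('a => real) => real" where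
  "defect \<theta> = (\<Sum>b\<in>Basis. LINT x|lebesgue_on \<Omega>. integrand \<theta> b x)"

lemma X2: "b \<in> Basis ==> X b \<in> L2 (lebesgue_on \<Omega>)" "b \<in> Basis ==> b' \<in> Basis ==> weak_partial \<Omega> b' (X b) \<in> L2 (lebesgue_on \<Omega>)"
  using X H1_L2 H1_weak_partial by blast+

lemma v2: "v \<in> L2 (lebesgue_on \<Omega>)" "b \<in> Basis ==> weak_partial \<Omega> b v \<in> L2 (lebesgue_on \<Omega>)"
  using v H1_L2 H1_weak_partial by blast+

lemma smooth_mult_L2:
  assumes "smooth_on UNIV \<theta>" "g \<in> L2 (lebesgue_on \<Omega>)"
  shows "(\<lambda>x. \<theta> x * g x) \<in> L2 (lebesgue_on \<Omega>)"
proof -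
  obtain C where C: "\<forall>x\<in>\<Omega>. \<bar>\<theta> x\<bar> \<le> C" using continuous_L2(2)[OF smooth_on_continuous[OF assms(1)]] by blast
  show ?thesis
    by (rule L2_bounded_mult[OF assms(2) L2_measurable[OF continuous_L2(1)[OF smooth_on_continuous[OF assms(1)]]]])
      (use C in \<open>auto intro!: AE_I2 simp: space_restrict_space\<close>)
qed

lemma integrable_terms:
  assumes "smooth_on UNIV \<theta>" "b \<in> Basis"
  shows "integrable (lebesgue_on \<Omega>) (\<lambda>x. v x * \<theta> x * weak_partial \<Omega> b (X b) x)"
    "integrable (lebesgue_on \<Omega>) (\<lambda>x. \<theta> x * X b x * weak_partial \<Omega> b v x)"
    "integrable (lebesgue_on \<Omega>) (\<lambda>x. v x * X b x * partial_derivative b \<theta> x)"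
  using L2_integrable_mult[OF v2(1) smooth_mult_L2[OF assms(1) X2(2)[OF assms(2) assms(2)]]]
    L2_integrable_mult[OF smooth_mult_L2[OF assms(1) X2(1)[OF assms(2)]] v2(2)[OF assms(2)]]
    L2_integrable_mult[OF v2(1) smooth_mult_L2[OF smooth_on_partial[OF assms] X2(1)[OF assms(2)]]]
  by (simp_all add: mult.assoc mult.commute[of "partial_derivative b \<theta> _"])

lemma integrable_integrand: "smooth_on UNIV \<theta> ==> b \<in> Basis ==> integrable (lebesgue_on \<Omega>) (integrand \<theta> b)"
  unfolding integrand_def[abs_def] using integrable_terms by (intro Bochner_Integration.integrable_add)

text \<open>Since \<open>F b k * \<kappa>\<close> is a test function, it may be inserted into the definition of the weak derivative of \<open>v\<close>.\<close>

lemma defect_test_function: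
  assumes \<kappa>: "test_function \<Omega> \<kappa>"
  shows "defect \<kappa> = 0"
proof -
  have sm: "smooth_on UNIV \<kappa>" using \<kappa> by (simp add: test_function_def)
  have "(LINT x|lebesgue_on \<Omega>. integrand \<kappa> b x) = 0" if b: "b \<in> Basis" for b
  proof -
    let ?I = "\<lambda>f. LINT x|lebesgue_on \<Omega>. f x"
    note conv = smooth_approx[OF F[OF b] X[OF b] FX[OF b]]
    have F2: "F b k \<in> L2 (lebesgue_on \<Omega>)" "partial_derivative b (F b k) \<in> L2 (lebesgue_on \<Omega>)" for k
      using continuous_L2(1)[OF smooth_on_continuous[OF F[OF b]]]
        continuous_L2(1)[OF smooth_on_continuous[OF smooth_on_partial[OF F[OF b] b]]] by auto
    note g = smooth_mult_L2[OF sm v2(1)] smooth_mult_L2[OF sm v2(2)[OF b]] smooth_mult_L2[OF smooth_on_partial[OF sm b] v2(1)]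
    have eq: "?I (\<lambda>x. partial_derivative b (F b k) x * (\<kappa> x * v x)) + ?I (\<lambda>x. F b k x * (\<kappa> x * weak_partial \<Omega> b v x))
       + ?I (\<lambda>x. F b k x * (partial_derivative b \<kappa> x * v x)) = 0" for k
    proof -
      have tt: "test_function \<Omega> (\<lambda>x. F b k x * \<kappa> x)" by (rule test_function_smooth_mult[OF \<kappa> F[OF b]])
      have pd: "partial_derivative b (\<lambda>x. F b k x * \<kappa> x) x = partial_derivative b (F b k) x * \<kappa> x + F b k x * partial_derivative b \<kappa> x" for x
        by (intro partial_derivative_mult smooth_on_differentiable[OF _ open_UNIV] F[OF b] sm UNIV_I)
      have "?I (\<lambda>x. v x * partial_derivative b (\<lambda>x. F b k x * \<kappa> x) x) = - ?I (\<lambda>x. weak_partial \<Omega> b v x * (F b k x * \<kappa> x))"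
        by (rule has_weak_partialD(3)[OF H1_weak_partial(1)[OF v b] tt])
      moreover have "?I (\<lambda>x. v x * partial_derivative b (\<lambda>x. F b k x * \<kappa> x) x)
          = ?I (\<lambda>x. partial_derivative b (F b k) x * (\<kappa> x * v x) + F b k x * (partial_derivative b \<kappa> x * v x))"
        by (intro Bochner_Integration.integral_cong refl) (simp only: pd, simp add: algebra_simps)
      moreover have "\<dots> = ?I (\<lambda>x. partial_derivative b (F b k) x * (\<kappa> x * v x)) + ?I (\<lambda>x. F b k x * (partial_derivative b \<kappa> x * v x))"
        by (intro Bochner_Integration.integral_add L2_integrable_mult F2 g)
      moreover have "?I (\<lambda>x. weak_partial \<Omega> b v x * (F b k x * \<kappa> x)) = ?I (\<lambda>x. F b k x * (\<kappa> x * weak_partial \<Omega> b v x))"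
        by (intro Bochner_Integration.integral_cong refl) (simp add: algebra_simps)
      ultimately show ?thesis by simp
    qed
    have "(\<lambda>k. ?I (\<lambda>x. partial_derivative b (F b k) x * (\<kappa> x * v x)) + ?I (\<lambda>x. F b k x * (\<kappa> x * weak_partial \<Omega> b v x))
       + ?I (\<lambda>x. F b k x * (partial_derivative b \<kappa> x * v x))) \<longlonglongrightarrow>
       ?I (\<lambda>x. weak_partial \<Omega> b (X b) x * (\<kappa> x * v x)) + ?I (\<lambda>x. X b x * (\<kappa> x * weak_partial \<Omega> b v x))
       + ?I (\<lambda>x. X b x * (partial_derivative b \<kappa> x * v x))"
      by (intro tendsto_add L2_tendsto_inner F2 g X2 b conv)
    then have "?I (\<lambda>x. weak_partial \<Omega> b (X b) x * (\<kappa> x * v x)) + ?I (\<lambda>x. X b x * (\<kappa> x * weak_partial \<Omega> b v x))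
       + ?I (\<lambda>x. X b x * (partial_derivative b \<kappa> x * v x)) = 0"
      unfolding eq by (simp add: LIMSEQ_const_iff)
    moreover have "?I (integrand \<kappa> b) = ?I (\<lambda>x. weak_partial \<Omega> b (X b) x * (\<kappa> x * v x)) + ?I (\<lambda>x. X b x * (\<kappa> x * weak_partial \<Omega> b v x))
       + ?I (\<lambda>x. X b x * (partial_derivative b \<kappa> x * v x))"
    proof -
      have "?I (integrand \<kappa> b) = ?I (\<lambda>x. (weak_partial \<Omega> b (X b) x * (\<kappa> x * v x) + X b x * (\<kappa> x * weak_partial \<Omega> b v x))
         + X b x * (partial_derivative b \<kappa> x * v x))"
        by (intro Bochner_Integration.integral_cong refl) (simp add: integrand_def algebra_simps)
      then show ?thesis
        using L2_integrable_mult[OF X2(2)[OF b b] g(1)] L2_integrable_mult[OF X2(1)[OF b] g(2)] L2_integrable_mult[OF X2(1)[OF b] g(3)]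
        by simp
    qed
    ultimately show ?thesis by simp
  qed
  then show ?thesis by (simp add: defect_def)
qed

lemma defect_add:
  assumes "smooth_on UNIV \<theta>" "smooth_on UNIV \<eta>"
  shows "defect (\<lambda>x. \<theta> x + \<eta> x) = defect \<theta> + defect \<eta>"
proof -
  have "(LINT x|lebesgue_on \<Omega>. integrand (\<lambda>x. \<theta> x + \<eta> x) b x)
     = (LINT x|lebesgue_on \<Omega>. integrand \<theta> b x) + (LINT x|lebesgue_on \<Omega>. integrand \<eta> b x)" if b: "b \<in> Basis" for b
  proof -
    have "partial_derivative b (\<lambda>x. \<theta> x + \<eta> x) x = partial_derivative b \<theta> x + partial_derivative b \<eta> x" for x
    proof -
      have "(\<theta> has_derivative frechet_derivative \<theta> (at x)) (at x)" "(\<eta> has_derivative frechet_derivative \<eta> (at x)) (at x)"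
        using smooth_on_differentiable[OF assms(1) open_UNIV UNIV_I] smooth_on_differentiable[OF assms(2) open_UNIV UNIV_I]
          frechet_derivative_works by blast+
      from partial_derivative_eq[OF has_derivative_add[OF this]] show ?thesis by (simp add: partial_derivative_def)
    qed
    then have "integrand (\<lambda>x. \<theta> x + \<eta> x) b x = integrand \<theta> b x + integrand \<eta> b x" for x
      by (simp add: integrand_def algebra_simps)
    then show ?thesis using integrable_integrand[OF assms(1) b] integrable_integrand[OF assms(2) b] by simp
  qed
  then show ?thesis by (simp add: defect_def sum.distrib)
qed

lemma defect_cong:
  assumes "\<And>x. x \<in> \<Omega> ==> \<theta> x = \<eta> x"
  shows "defect \<theta> = defect \<eta>"
  unfolding defect_def integrand_def
  using assms partial_derivative_cong[OF open_dom _ assms]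
  by (intro sum.cong Bochner_Integration.integral_cong refl) (simp add: space_restrict_space)

end

text \<open>The traces \<open>g b\<close> of the components have vanishing normal component.\<close>

locale green_trace = green_field \<Omega> X F v Mv for \<Omega> :: "'a::euclidean_space set" and X F v Mv +
  fixes g :: "'a => 'a => real"
  assumes dim: "2 \<le> DIM('a)" and smooth_dom: "smooth_bounded_domain \<Omega>"
    and g: "b \<in> Basis ==> g b \<in> L2 (surface_measure \<Omega>)"
    and Fg: "b \<in> Basis ==> (\<lambda>k. L2_norm (surface_measure \<Omega>) (\<lambda>x. F b k x - g b x)) \<longlonglongrightarrow> 0"
    and normal: "AE x in surface_measure \<Omega>. (\<Sum>b\<in>Basis. g b x * (outward_normal \<Omega> x \<bullet> b)) = 0"

section \<open>Vanishing of the defect near a boundary point\<close>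

locale green_chart = green_trace \<Omega> X F v Mv g + boundary_chart \<Omega> x0 U \<rho> b0 \<sigma> c r G
  for \<Omega> :: "'a::euclidean_space set" and X F v Mv g x0 U \<rho> b0 \<sigma> c r G
begin

text \<open>\<open>W k\<close> and \<open>Y\<close> are the smooth approximation and the exact field
  \<open>X\<close>, paired with the gradient of \<open>\<rho>\<close>. Up to the length of that
  gradient this extends the normal component from the boundary into the interior.\<close>

definition W :: "nat => 'a => real" where
  "W k x = (\<Sum>b\<in>Basis. F b k x * partial_derivative b \<rho> x)"

definition Y :: "'a => real" where
  "Y x = (\<Sum>b\<in>Basis. X b x * partial_derivative b \<rho> x)"

text \<open>The weak derivative of \<open>Y\<close> in direction \<open>b0\<close>, expanded by the
  product rule.\<close>

definition Z :: "'a => real" where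
  "Z x = (\<Sum>b\<in>Basis. weak_partial \<Omega> b0 (X b) x * partial_derivative b \<rho> x
     + X b x * partial_derivative b0 (partial_derivative b \<rho>) x)"

lemma G_nonneg: "0 \<le> G"
  using upper[of x0 b0] b0 r by auto

lemma smooth_W: "smooth_on U (W k)"
  unfolding W_def[abs_def]
  by (intro smooth_on_sum smooth_on_mult chart smooth_on_partial smooth_on_subset[OF F]) auto

lemma partial_W: "x \<in> U ==> partial_derivative b0 (W k) x =
   (\<Sum>b\<in>Basis. partial_derivative b0 (F b k) x * partial_derivative b \<rho> x + F b k x * partial_derivative b0 (partial_derivative b \<rho>) x)"
proof -
  assume x: "x \<in> U"
  have d: "(\<lambda>x. F b k x * partial_derivative b \<rho> x) differentiable (at x)" if b: "b \<in> Basis" for b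
    by (rule smooth_on_differentiable[OF _ chart(1) x])
      (intro smooth_on_mult chart smooth_on_partial b smooth_on_subset[OF F[OF b]] subset_UNIV)
  have "(W k has_derivative (\<lambda>h. \<Sum>b\<in>Basis. frechet_derivative (\<lambda>x. F b k x * partial_derivative b \<rho> x) (at x) h)) (at x)"
    unfolding W_def[abs_def] by (rule has_derivative_sum) (use d frechet_derivative_works in blast)
  then have "partial_derivative b0 (W k) x = (\<Sum>b\<in>Basis. partial_derivative b0 (\<lambda>x. F b k x * partial_derivative b \<rho> x) x)"
    by (subst partial_derivative_eq) (auto simp: partial_derivative_def)
  also have "\<dots> = (\<Sum>b\<in>Basis. partial_derivative b0 (F b k) x * partial_derivative b \<rho> x + F b k x * partial_derivative b0 (partial_derivative b \<rho>) x)"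
    by (intro sum.cong refl partial_derivative_mult smooth_on_differentiable[OF F open_UNIV] UNIV_I
        smooth_on_differentiable[OF smooth_on_partial[OF chart(2)] chart(1) x])
  finally show ?thesis .
qed

text \<open>On the boundary \<open>normal\<close> says that the traces \<open>g\<close> paired with
  the gradient of \<open>\<rho>\<close> vanish. So \<open>W k\<close> there equals the pairing of
  the differences \<open>F b k - g b\<close>, which tends to 0 in L2 and, the measure being finite,
  in L1.\<close>

lemma surface_limit:
  "\<exists>e. e \<longlonglongrightarrow> 0 \<and> (\<forall>k. (\<integral>\<^sup>+x. ennreal \<bar>W k x\<bar> * indicator (ball x0 (2 * r)) x \<partial>surface_measure \<Omega>) \<le> ennreal (e k))"
proof -
  interpret S: finite_measure "surface_measure \<Omega>" by (rule finite_surface_measure[OF dim smooth_dom])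
  let ?S = "surface_measure \<Omega>"
  define e where "e k = (\<Sum>b\<in>Basis. G * (L2_norm ?S (\<lambda>x. F b k x - g b x) * sqrt (measure ?S (space ?S))))" for k
  have "e \<longlonglongrightarrow> (\<Sum>b\<in>(Basis :: 'a set). G * (0 * sqrt (measure ?S (space ?S))))"
    unfolding e_def[abs_def] by (intro tendsto_sum tendsto_mult tendsto_const Fg)
  then have "e \<longlonglongrightarrow> 0" by simp
  moreover have "(\<integral>\<^sup>+x. ennreal \<bar>W k x\<bar> * indicator (ball x0 (2 * r)) x \<partial>?S) \<le> ennreal (e k)" for k
  proof -
    have F2: "F b k \<in> L2 ?S" if b: "b \<in> Basis" for b
    proof -
      have "compact (frontier \<Omega>)" using bounded_dom by (simp add: compact_frontier_bounded)
      then have "bounded (F b k ` frontier \<Omega>)"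
        by (intro compact_imp_bounded compact_continuous_image continuous_on_subset[OF smooth_on_continuous[OF F[OF b]]]) auto
      then obtain C where C: "\<And>x. x \<in> frontier \<Omega> ==> \<bar>F b k x\<bar> \<le> C" by (auto simp: bounded_iff)
      have "F b k \<in> borel_measurable borel"
        by (intro borel_measurable_continuous_onI smooth_on_continuous F b)
      then show ?thesis
        by (intro S.L2_bounded[of _ C] sets_surface_measure) (use C in \<open>auto intro!: AE_I2 simp: space_surface_measure\<close>)
    qed
    have d2: "(\<lambda>x. F b k x - g b x) \<in> L2 ?S" if "b \<in> Basis" for b
      using that by (intro L2_diff F2 g)
    have "(\<integral>\<^sup>+x. ennreal \<bar>W k x\<bar> * indicator (ball x0 (2 * r)) x \<partial>?S) \<le> (\<integral>\<^sup>+x. ennreal (\<Sum>b\<in>Basis. G * \<bar>F b k x - g b x\<bar>) \<partial>?S)"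
    proof (rule nn_integral_mono_AE)
      have "AE x in ?S. x \<in> frontier \<Omega>" by (intro AE_I2) (simp add: space_surface_measure)
      with normal show "AE x in ?S. ennreal \<bar>W k x\<bar> * indicator (ball x0 (2 * r)) x \<le> ennreal (\<Sum>b\<in>Basis. G * \<bar>F b k x - g b x\<bar>)"
      proof eventually_elim
        case (elim x)
        show ?case
        proof (cases "x \<in> ball x0 (2 * r)")
          case True
          then have xU: "x \<in> U" using ball_sub by blast
          have nz: "gradient \<rho> x \<noteq> 0" using loc xU by (auto simp: local_defining_function_def)
          have "(\<Sum>b\<in>Basis. g b x * (outward_normal \<Omega> x \<bullet> b)) = (\<Sum>b\<in>Basis. g b x * partial_derivative b \<rho> x) / norm (gradient \<rho> x)"
            unfolding outward_normal_eq[OF loc open_dom xU elim(2)] sum_divide_distrib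
            by (intro sum.cong refl) (simp add: inner_gradient divide_inverse mult_ac)
          then have "(\<Sum>b\<in>Basis. g b x * partial_derivative b \<rho> x) = 0" using elim(1) nz by simp
          then have "W k x = (\<Sum>b\<in>Basis. (F b k x - g b x) * partial_derivative b \<rho> x)"
            by (simp add: W_def left_diff_distrib sum_subtractf)
          also have "\<bar>\<dots>\<bar> \<le> (\<Sum>b\<in>Basis. \<bar>(F b k x - g b x) * partial_derivative b \<rho> x\<bar>)" by (rule sum_abs)
          also have "\<dots> \<le> (\<Sum>b\<in>Basis. \<bar>F b k x - g b x\<bar> * G)"
            unfolding abs_mult using True by (intro sum_mono mult_left_mono upper) auto
          finally show ?thesis using True by (simp add: mult.commute ennreal_leI)
        qed simp
      qed
    qed
    also have "\<dots> = ennreal (LINT x|?S. (\<Sum>b\<in>Basis. G * \<bar>F b k x - g b x\<bar>))"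
      using G_nonneg S.L2_integrable[OF d2]
      by (intro nn_integral_eq_integral AE_I2 sum_nonneg) auto
    also have "(LINT x|?S. (\<Sum>b\<in>Basis. G * \<bar>F b k x - g b x\<bar>)) = (\<Sum>b\<in>Basis. G * (LINT x|?S. \<bar>F b k x - g b x\<bar>))"
      using S.L2_integrable[OF d2] by (subst Bochner_Integration.integral_sum) auto
    also have "\<dots> \<le> e k"
      unfolding e_def using G_nonneg by (intro sum_mono mult_left_mono S.L1_le_L2 d2)
    finally show ?thesis by (simp add: ennreal_leI)
  qed
  ultimately show ?thesis by blast
qed

lemma layer_sets: "d \<le> 2 * r ==> layer d e \<in> sets lebesgue"
  using open_layer[of d e] by auto

text \<open>Replacing \<open>X\<close> by its approximations produces errors that are pointwise
  linear in functions small in L2; on the bounded domain they are then small in L1.\<close>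

lemma L1_dom_bound:
  assumes f: "\<And>i. i \<in> I ==> f i \<in> L2 (lebesgue_on \<Omega>)" and C: "\<And>i. i \<in> I ==> 0 \<le> C i" and A: "A \<subseteq> \<Omega>"
    and h: "\<And>x. x \<in> A ==> \<bar>h x\<bar> \<le> (\<Sum>i\<in>I. C i * \<bar>f i x\<bar>)"
  shows "(\<integral>\<^sup>+x. ennreal \<bar>h x\<bar> * indicator A x \<partial>lebesgue)
    \<le> ennreal (\<Sum>i\<in>I. C i * (L2_norm (lebesgue_on \<Omega>) (f i) * sqrt (measure (lebesgue_on \<Omega>) (space (lebesgue_on \<Omega>)))))"
proof -
  have "(\<integral>\<^sup>+x. ennreal \<bar>h x\<bar> * indicator A x \<partial>lebesgue) \<le> (\<integral>\<^sup>+x. ennreal (\<Sum>i\<in>I. C i * \<bar>f i x\<bar>) * indicator \<Omega> x \<partial>lebesgue)"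
    using A h by (intro nn_integral_mono) (auto simp: indicator_def intro!: ennreal_leI)
  also have "\<dots> = (\<integral>\<^sup>+x. ennreal (\<Sum>i\<in>I. C i * \<bar>f i x\<bar>) \<partial>lebesgue_on \<Omega>)"
    using dom_sets by (subst nn_integral_restrict_space) auto
  also have "\<dots> = ennreal (LINT x|lebesgue_on \<Omega>. (\<Sum>i\<in>I. C i * \<bar>f i x\<bar>))"
    using C L2_integrable[OF f]
    by (intro nn_integral_eq_integral AE_I2 sum_nonneg) auto
  also have "(LINT x|lebesgue_on \<Omega>. (\<Sum>i\<in>I. C i * \<bar>f i x\<bar>)) = (\<Sum>i\<in>I. C i * (LINT x|lebesgue_on \<Omega>. \<bar>f i x\<bar>))"
    using L2_integrable[OF f] by (subst Bochner_Integration.integral_sum) auto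
  also have "\<dots> \<le> (\<Sum>i\<in>I. C i * (L2_norm (lebesgue_on \<Omega>) (f i) * sqrt (measure (lebesgue_on \<Omega>) (space (lebesgue_on \<Omega>)))))"
    using C by (intro sum_mono mult_left_mono L1_le_L2 f)
  finally show ?thesis by (simp add: ennreal_leI)
qed

lemma second_bound: "\<exists>G2\<ge>0. \<forall>y\<in>cball x0 (2 * r). \<forall>b\<in>Basis. \<bar>partial_derivative b0 (partial_derivative b \<rho>) y\<bar> \<le> G2"
proof -
  have "continuous_on U (\<lambda>y. \<Sum>b\<in>Basis. \<bar>partial_derivative b0 (partial_derivative b \<rho>) y\<bar>)"
    by (intro continuous_on_sum continuous_on_rabs smooth_on_continuous smooth_on_partial chart b0)
  then obtain C where C: "C \<ge> 0" "\<And>y. y \<in> cball x0 (2 * r) ==> \<bar>\<Sum>b\<in>Basis. \<bar>partial_derivative b0 (partial_derivative b \<rho>) y\<bar>\<bar> \<le> C"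
    using bounded_on_cball[OF _ sub] by blast
  have "\<bar>partial_derivative b0 (partial_derivative b \<rho>) y\<bar> \<le> C" if "y \<in> cball x0 (2 * r)" "b \<in> Basis" for y b
    using member_le_sum[OF that(2), of "\<lambda>b. \<bar>partial_derivative b0 (partial_derivative b \<rho>) y\<bar>"] C(2)[OF that(1)] by simp
  then show ?thesis using C(1) by blast
qed

lemma measurable_abs_indicator:
  fixes h :: "'a => real"
  assumes "h \<in> borel_measurable (lebesgue_on A)" "A \<in> sets lebesgue"
  shows "(\<lambda>x. ennreal \<bar>h x\<bar> * indicator A x) \<in> borel_measurable lebesgue"
proof -
  have "(\<lambda>x. indicator A x *\<^sub>R h x) \<in> borel_measurable lebesgue"
    using assms by (subst (asm) borel_measurable_restrict_space_iff) auto
  then have "(\<lambda>x. ennreal \<bar>indicator A x *\<^sub>R h x\<bar>) \<in> borel_measurable lebesgue" by measurable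
  also have "(\<lambda>x. ennreal \<bar>indicator A x *\<^sub>R h x\<bar>) = (\<lambda>x. ennreal \<bar>h x\<bar> * indicator A x)" by (auto simp: indicator_def)
  finally show ?thesis .
qed

lemma chart_measurable:
  fixes h :: "'a => real"
  assumes "continuous_on U h" "A \<subseteq> U" "A \<in> sets lebesgue"
  shows "h \<in> borel_measurable (lebesgue_on A)"
  using assms by (intro continuous_imp_measurable_on_sets_lebesgue continuous_on_subset[OF assms(1)]) auto

lemma domain_measurable: "h \<in> L2 (lebesgue_on \<Omega>) ==> A \<subseteq> \<Omega> ==> h \<in> borel_measurable (lebesgue_on A)"
  using measurable_restrict_mono[OF L2_measurable] .

lemma measurable_YZ:
  assumes "A \<subseteq> \<Omega>" "A \<subseteq> U" "A \<in> sets lebesgue"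
  shows "Y \<in> borel_measurable (lebesgue_on A)" "Z \<in> borel_measurable (lebesgue_on A)"
proof -
  show "Y \<in> borel_measurable (lebesgue_on A)"
    unfolding Y_def[abs_def] using assms
    by (intro borel_measurable_sum borel_measurable_times domain_measurable X2
        chart_measurable[OF smooth_on_continuous[OF smooth_on_partial[OF chart(2)]]])
  show "Z \<in> borel_measurable (lebesgue_on A)"
    unfolding Z_def[abs_def] using assms b0
    by (intro borel_measurable_add borel_measurable_sum borel_measurable_times domain_measurable X2
        chart_measurable[OF smooth_on_continuous[OF smooth_on_partial[OF chart(2)]]]
        chart_measurable[OF smooth_on_continuous[OF smooth_on_partial[OF smooth_on_partial[OF chart(2)]]]])
qed

text \<open>\<open>layer_estimate\<close> for \<open>W k\<close> as \<open>k\<close> tends to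
  infinity; its boundary term disappears by \<open>surface_limit\<close>. The gain is a full factor
  \<open>d\<close>, and since \<open>Z\<close> is integrated over a layer that shrinks with
  \<open>d\<close>, the right-hand side is o(d).\<close>

lemma layer_limit_estimate:
  assumes d: "0 < d" "d \<le> r"
  shows "(\<integral>\<^sup>+x. ennreal \<bar>Y x\<bar> * indicator (layer r d) x \<partial>lebesgue)
    \<le> ennreal d * (\<integral>\<^sup>+x. ennreal \<bar>Z x\<bar> * indicator (layer (2 * r) d) x \<partial>lebesgue)"
proof -
  let ?n = "L2_norm (lebesgue_on \<Omega>)" and ?m = "sqrt (measure (lebesgue_on \<Omega>) (space (lebesgue_on \<Omega>)))"
  obtain G2 where G2: "G2 \<ge> 0" "\<And>y b. y \<in> cball x0 (2 * r) ==> b \<in> Basis ==> \<bar>partial_derivative b0 (partial_derivative b \<rho>) y\<bar> \<le> G2"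
    using second_bound by blast
  obtain e where e: "e \<longlonglongrightarrow> 0" "\<And>k. (\<integral>\<^sup>+x. ennreal \<bar>W k x\<bar> * indicator (ball x0 (2 * r)) x \<partial>surface_measure \<Omega>) \<le> ennreal (e k)"
    using surface_limit by blast
  define f1 where "f1 k b x = F b k x - X b x" for k b x
  define f2 where "f2 k b x = partial_derivative b0 (F b k) x - weak_partial \<Omega> b0 (X b) x" for k b x
  have F2: "F b k \<in> L2 (lebesgue_on \<Omega>)" "partial_derivative b0 (F b k) \<in> L2 (lebesgue_on \<Omega>)" if b: "b \<in> Basis" for b k
    using continuous_L2(1)[OF smooth_on_continuous[OF F[OF b]]]
      continuous_L2(1)[OF smooth_on_continuous[OF smooth_on_partial[OF F[OF b] b0]]] by auto
  have f12: "f1 k b \<in> L2 (lebesgue_on \<Omega>)" "f2 k b \<in> L2 (lebesgue_on \<Omega>)" if "b \<in> Basis" for b k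
    unfolding f1_def[abs_def] f2_def[abs_def] using that b0 by (intro L2_diff F2 X2; simp)+
  have lim: "(\<lambda>k. ?n (f1 k b)) \<longlonglongrightarrow> 0" "(\<lambda>k. ?n (f2 k b)) \<longlonglongrightarrow> 0" if b: "b \<in> Basis" for b
    unfolding f1_def[abs_def] f2_def[abs_def]
    using smooth_approx(1)[OF F[OF b] X[OF b] FX[OF b]] smooth_approx(2)[OF F[OF b] X[OF b] FX[OF b] b0]
    by auto
  define e1 where "e1 k = (\<Sum>b\<in>Basis. G * (?n (f1 k b) * ?m))" for k
  define e2 where "e2 k = (\<Sum>b\<in>Basis. G2 * (?n (f1 k b) * ?m)) + (\<Sum>b\<in>Basis. G * (?n (f2 k b) * ?m))" for k
  have l1: "e1 \<longlonglongrightarrow> (\<Sum>b\<in>(Basis :: 'a set). G * (0 * ?m))"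
    unfolding e1_def[abs_def] by (intro tendsto_sum tendsto_mult tendsto_const lim)
  have l2: "e2 \<longlonglongrightarrow> (\<Sum>b\<in>(Basis :: 'a set). G2 * (0 * ?m)) + (\<Sum>b\<in>(Basis :: 'a set). G * (0 * ?m))"
    unfolding e2_def[abs_def] by (intro tendsto_add tendsto_sum tendsto_mult tendsto_const lim)
  have e12: "0 \<le> e1 k" "0 \<le> e2 k" for k
    unfolding e1_def e2_def using G_nonneg G2(1)
    by (auto intro!: add_nonneg_nonneg sum_nonneg mult_nonneg_nonneg L2_norm_nonneg)
  have layers: "layer r d \<subseteq> \<Omega>" "layer (2 * r) d \<subseteq> \<Omega>" "layer r d \<subseteq> cball x0 (2 * r)" "layer (2 * r) d \<subseteq> cball x0 (2 * r)" "layer (2 * r) d \<subseteq> U"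
    using r ball_sub by (auto simp: layer_def)
  have sets: "layer r d \<in> sets lebesgue" "layer (2 * r) d \<in> sets lebesgue" using r by (auto intro: layer_sets)
  have Wm: "(\<lambda>x. ennreal \<bar>W k x\<bar> * indicator (layer r d) x) \<in> borel_measurable lebesgue" for k
    using layers ball_sub by (intro measurable_abs_indicator chart_measurable smooth_on_continuous[OF smooth_W] sets) (auto simp: layer_def)
  have WYm: "(\<lambda>x. ennreal \<bar>Y x - W k x\<bar> * indicator (layer r d) x) \<in> borel_measurable lebesgue" for k
    unfolding Y_def W_def using layers ball_sub
    by (intro measurable_abs_indicator borel_measurable_diff borel_measurable_sum borel_measurable_times domain_measurable X2 F2 sets
        chart_measurable[OF smooth_on_continuous[OF smooth_on_partial[OF chart(2)]]]) (auto simp: layer_def)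
  have Zm0: "Z \<in> borel_measurable (lebesgue_on (layer (2 * r) d))"
    by (rule measurable_YZ(2)[OF layers(2,5) sets(2)])
  have W'm0: "partial_derivative b0 (W k) \<in> borel_measurable (lebesgue_on (layer (2 * r) d))" for k
    using layers by (intro chart_measurable smooth_on_continuous[OF smooth_on_partial[OF smooth_W b0]] sets) auto
  have Zm: "(\<lambda>x. ennreal \<bar>Z x\<bar> * indicator (layer (2 * r) d) x) \<in> borel_measurable lebesgue"
    by (intro measurable_abs_indicator Zm0 sets)
  have WZm: "(\<lambda>x. ennreal \<bar>partial_derivative b0 (W k) x - Z x\<bar> * indicator (layer (2 * r) d) x) \<in> borel_measurable lebesgue" for k
    by (intro measurable_abs_indicator borel_measurable_diff W'm0 Zm0 sets)
  let ?B = "\<integral>\<^sup>+x. ennreal \<bar>Z x\<bar> * indicator (layer (2 * r) d) x \<partial>lebesgue"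
  have main: "(\<integral>\<^sup>+x. ennreal \<bar>Y x\<bar> * indicator (layer r d) x \<partial>lebesgue)
      \<le> ennreal (e1 k + KH * d * \<bar>e k\<bar> + d * e2 k) + ennreal d * ?B" for k
  proof -
    have "(\<integral>\<^sup>+x. ennreal \<bar>Y x\<bar> * indicator (layer r d) x \<partial>lebesgue)
       \<le> (\<integral>\<^sup>+x. ennreal \<bar>Y x - W k x\<bar> * indicator (layer r d) x + ennreal \<bar>W k x\<bar> * indicator (layer r d) x \<partial>lebesgue)"
    proof (rule nn_integral_mono)
      fix x
      have "\<bar>Y x\<bar> \<le> \<bar>Y x - W k x\<bar> + \<bar>W k x\<bar>" by linarith
      then show "ennreal \<bar>Y x\<bar> * indicator (layer r d) x \<le> ennreal \<bar>Y x - W k x\<bar> * indicator (layer r d) x + ennreal \<bar>W k x\<bar> * indicator (layer r d) x"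
        by (cases "x \<in> layer r d") (auto simp: ennreal_plus[symmetric] ennreal_leI simp del: ennreal_plus)
    qed
    also have "\<dots> = (\<integral>\<^sup>+x. ennreal \<bar>Y x - W k x\<bar> * indicator (layer r d) x \<partial>lebesgue) + (\<integral>\<^sup>+x. ennreal \<bar>W k x\<bar> * indicator (layer r d) x \<partial>lebesgue)"
      by (rule nn_integral_add[OF WYm Wm])
    also have "(\<integral>\<^sup>+x. ennreal \<bar>Y x - W k x\<bar> * indicator (layer r d) x \<partial>lebesgue) \<le> ennreal (e1 k)"
      unfolding e1_def
    proof (rule L1_dom_bound[OF f12(1) _ layers(1)])
      fix x assume x: "x \<in> layer r d"
      have "Y x - W k x = (\<Sum>b\<in>Basis. - f1 k b x * partial_derivative b \<rho> x)"
        by (simp add: Y_def W_def f1_def sum_subtractf[symmetric] left_diff_distrib)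
      also have "\<bar>\<dots>\<bar> \<le> (\<Sum>b\<in>Basis. \<bar>- f1 k b x * partial_derivative b \<rho> x\<bar>)" by (rule sum_abs)
      also have "\<dots> \<le> (\<Sum>b\<in>Basis. \<bar>f1 k b x\<bar> * G)"
        unfolding abs_mult abs_minus_cancel using x layers(3) by (intro sum_mono mult_left_mono upper) auto
      finally show "\<bar>Y x - W k x\<bar> \<le> (\<Sum>b\<in>Basis. G * \<bar>f1 k b x\<bar>)" by (simp add: mult.commute)
    qed (use G_nonneg in auto)
    also have "(\<integral>\<^sup>+x. ennreal \<bar>W k x\<bar> * indicator (layer r d) x \<partial>lebesgue)
       = (\<integral>\<^sup>+x. ennreal \<bar>W k x\<bar> * indicator (layer r d) x \<partial>lborel)" by (rule nn_integral_completion)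
    also have "\<dots> \<le> ennreal (KH * d) * (\<integral>\<^sup>+x. ennreal \<bar>W k x\<bar> * indicator (ball x0 (2 * r)) x \<partial>surface_measure \<Omega>)
      + ennreal d * (\<integral>\<^sup>+x. ennreal \<bar>partial_derivative b0 (W k) x\<bar> * indicator (layer (2 * r) d) x \<partial>lborel)"
      by (rule layer_estimate[OF dim d smooth_on_differentiable[OF smooth_W chart(1)] smooth_on_continuous[OF smooth_on_partial[OF smooth_W b0]]])
    also have "(\<integral>\<^sup>+x. ennreal \<bar>W k x\<bar> * indicator (ball x0 (2 * r)) x \<partial>surface_measure \<Omega>) \<le> ennreal \<bar>e k\<bar>"
      using e(2)[of k] by (rule order_trans) (simp add: ennreal_leI)
    also have "(\<integral>\<^sup>+x. ennreal \<bar>partial_derivative b0 (W k) x\<bar> * indicator (layer (2 * r) d) x \<partial>lborel)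
      = (\<integral>\<^sup>+x. ennreal \<bar>partial_derivative b0 (W k) x\<bar> * indicator (layer (2 * r) d) x \<partial>lebesgue)" by (rule nn_integral_completion[symmetric])
    also have "\<dots> \<le> (\<integral>\<^sup>+x. ennreal \<bar>partial_derivative b0 (W k) x - Z x\<bar> * indicator (layer (2 * r) d) x + ennreal \<bar>Z x\<bar> * indicator (layer (2 * r) d) x \<partial>lebesgue)"
    proof (rule nn_integral_mono)
      fix x
      have "\<bar>partial_derivative b0 (W k) x\<bar> \<le> \<bar>partial_derivative b0 (W k) x - Z x\<bar> + \<bar>Z x\<bar>" by linarith
      then show "ennreal \<bar>partial_derivative b0 (W k) x\<bar> * indicator (layer (2 * r) d) x \<le>
          ennreal \<bar>partial_derivative b0 (W k) x - Z x\<bar> * indicator (layer (2 * r) d) x + ennreal \<bar>Z x\<bar> * indicator (layer (2 * r) d) x"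
        by (cases "x \<in> layer (2 * r) d") (auto simp: ennreal_plus[symmetric] ennreal_leI simp del: ennreal_plus)
    qed
    also have "\<dots> = (\<integral>\<^sup>+x. ennreal \<bar>partial_derivative b0 (W k) x - Z x\<bar> * indicator (layer (2 * r) d) x \<partial>lebesgue) + ?B"
      by (rule nn_integral_add[OF WZm Zm])
    also have "(\<integral>\<^sup>+x. ennreal \<bar>partial_derivative b0 (W k) x - Z x\<bar> * indicator (layer (2 * r) d) x \<partial>lebesgue) \<le> ennreal (e2 k)"
    proof -
      \<comment> \<open>Indexing by a boolean and a basis vector packs the two families
        \<open>f1\<close> and \<open>f2\<close> into one application of
        \<open>L1_dom_bound\<close>.\<close>
      have cart: "(\<Sum>i\<in>(UNIV :: bool set) \<times> (Basis :: 'a set). H (fst i) (snd i)) = (\<Sum>b\<in>Basis. H True b) + (\<Sum>b\<in>Basis. H False b)"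
        for H :: "bool => 'a => real"
      proof -
        have "(\<Sum>i\<in>(UNIV :: bool set) \<times> (Basis :: 'a set). H (fst i) (snd i)) = (\<Sum>a\<in>UNIV. \<Sum>b\<in>Basis. H a b)"
          unfolding sum.cartesian_product by (intro sum.cong refl) (simp add: split_def)
        then show ?thesis by (simp add: UNIV_bool)
      qed
      have e2: "e2 k = (\<Sum>(i::bool,b)\<in>UNIV \<times> Basis. (if i then G2 else G) * (?n (if i then f1 k b else f2 k b) * ?m))"
        by (simp add: e2_def sum.cartesian_product[symmetric] UNIV_bool)
      show ?thesis
        unfolding e2 case_prod_beta
      proof (rule L1_dom_bound[OF _ _ layers(2)])
        fix x assume x: "x \<in> layer (2 * r) d"
        have xU: "x \<in> U" and xc: "x \<in> cball x0 (2 * r)" using x layers(4,5) by auto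
        have diff: "partial_derivative b0 (W k) x - Z x = (\<Sum>b\<in>Basis. f2 k b x * partial_derivative b \<rho> x + f1 k b x * partial_derivative b0 (partial_derivative b \<rho>) x)"
          unfolding partial_W[OF xU] Z_def sum_subtractf[symmetric]
          by (intro sum.cong refl) (simp add: f1_def f2_def algebra_simps)
        have "\<bar>partial_derivative b0 (W k) x - Z x\<bar> \<le> (\<Sum>b\<in>Basis. \<bar>f2 k b x * partial_derivative b \<rho> x + f1 k b x * partial_derivative b0 (partial_derivative b \<rho>) x\<bar>)" unfolding diff by (rule sum_abs)
        also have "\<dots> \<le> (\<Sum>b\<in>Basis. \<bar>f2 k b x\<bar> * G + \<bar>f1 k b x\<bar> * G2)"
        proof (rule sum_mono)
          fix b :: 'a assume b: "b \<in> Basis"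
          have "\<bar>f2 k b x * partial_derivative b \<rho> x\<bar> \<le> \<bar>f2 k b x\<bar> * G" "\<bar>f1 k b x * partial_derivative b0 (partial_derivative b \<rho>) x\<bar> \<le> \<bar>f1 k b x\<bar> * G2"
            unfolding abs_mult
            by (rule mult_left_mono[OF upper[OF xc b] abs_ge_zero], rule mult_left_mono[OF G2(2)[OF xc b] abs_ge_zero])
          then show "\<bar>f2 k b x * partial_derivative b \<rho> x + f1 k b x * partial_derivative b0 (partial_derivative b \<rho>) x\<bar> \<le> \<bar>f2 k b x\<bar> * G + \<bar>f1 k b x\<bar> * G2"
            by (rule order_trans[OF abs_triangle_ineq add_mono])
        qed
        also have "\<dots> = (\<Sum>i\<in>UNIV \<times> Basis. (if fst i then G2 else G) * \<bar>(if fst i then f1 k (snd i) else f2 k (snd i)) x\<bar>)"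
          by (subst cart[of "\<lambda>i b. (if i then G2 else G) * \<bar>(if i then f1 k b else f2 k b) x\<bar>"])
            (simp add: sum.distrib mult.commute)
        finally show "\<bar>partial_derivative b0 (W k) x - Z x\<bar> \<le> (\<Sum>i\<in>UNIV \<times> Basis. (if fst i then G2 else G) * \<bar>(if fst i then f1 k (snd i) else f2 k (snd i)) x\<bar>)" .
      qed (use G_nonneg G2 f12 in auto)
    qed
    finally have "(\<integral>\<^sup>+x. ennreal \<bar>Y x\<bar> * indicator (layer r d) x \<partial>lebesgue)
      \<le> ennreal (e1 k) + (ennreal (KH * d) * ennreal \<bar>e k\<bar> + ennreal d * (ennreal (e2 k) + ?B))"
      by (simp add: add_left_mono add_right_mono mult_left_mono add_mono)
    also have "\<dots> = ennreal (e1 k + KH * d * \<bar>e k\<bar> + d * e2 k) + ennreal d * ?B"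
      using e12[of k] d KH_pos by (simp add: ennreal_mult[symmetric] distrib_left ennreal_plus[symmetric] add.assoc[symmetric] del: ennreal_plus)
    finally show ?thesis .
  qed
  have "(\<lambda>k. e1 k + KH * d * \<bar>e k\<bar> + d * e2 k) \<longlonglongrightarrow> 0 + KH * d * \<bar>0\<bar> + d * 0"
    using l1 l2 by (intro tendsto_add tendsto_mult tendsto_const tendsto_rabs e(1)) simp_all
  then show ?thesis using tendsto_zero_ennreal_le[OF main] by simp
qed

lemma Z_integrable: "(\<integral>\<^sup>+x. ennreal \<bar>Z x\<bar> * indicator (layer (2 * r) e) x \<partial>lebesgue) < \<infinity>"
proof -
  obtain G2 where G2: "G2 \<ge> 0" "\<And>y b. y \<in> cball x0 (2 * r) ==> b \<in> Basis ==> \<bar>partial_derivative b0 (partial_derivative b \<rho>) y\<bar> \<le> G2"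
    using second_bound by blast
  define f where "f b x = G * \<bar>weak_partial \<Omega> b0 (X b) x\<bar> + G2 * \<bar>X b x\<bar>" for b x
  have L2_abs: "(\<lambda>x. \<bar>h x\<bar>) \<in> L2 (lebesgue_on \<Omega>)" if "h \<in> L2 (lebesgue_on \<Omega>)" for h :: "'a => real"
    using L2_measurable[OF that] by (intro L2_bound[OF that]) auto
  have "(\<integral>\<^sup>+x. ennreal \<bar>Z x\<bar> * indicator (layer (2 * r) e) x \<partial>lebesgue)
     \<le> ennreal (\<Sum>b\<in>Basis. 1 * (L2_norm (lebesgue_on \<Omega>) (f b) * sqrt (measure (lebesgue_on \<Omega>) (space (lebesgue_on \<Omega>)))))"
  proof (rule L1_dom_bound)
    show "layer (2 * r) e \<subseteq> \<Omega>" by (auto simp: layer_def)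
    show "f b \<in> L2 (lebesgue_on \<Omega>)" if "b \<in> Basis" for b
      unfolding f_def[abs_def] by (intro L2_add L2_cmult L2_abs X2 that b0)
    fix x assume x: "x \<in> layer (2 * r) e"
    then have xc: "x \<in> cball x0 (2 * r)" by (auto simp: layer_def)
    have "\<bar>Z x\<bar> \<le> (\<Sum>b\<in>Basis. \<bar>weak_partial \<Omega> b0 (X b) x * partial_derivative b \<rho> x + X b x * partial_derivative b0 (partial_derivative b \<rho>) x\<bar>)"
      unfolding Z_def by (rule sum_abs)
    also have "\<dots> \<le> (\<Sum>b\<in>Basis. 1 * \<bar>f b x\<bar>)"
    proof (rule sum_mono)
      fix b :: 'a assume b: "b \<in> Basis"
      have "\<bar>weak_partial \<Omega> b0 (X b) x * partial_derivative b \<rho> x\<bar> \<le> \<bar>weak_partial \<Omega> b0 (X b) x\<bar> * G"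
        "\<bar>X b x * partial_derivative b0 (partial_derivative b \<rho>) x\<bar> \<le> \<bar>X b x\<bar> * G2"
        unfolding abs_mult
        by (rule mult_left_mono[OF upper[OF xc b] abs_ge_zero], rule mult_left_mono[OF G2(2)[OF xc b] abs_ge_zero])
      then have "\<bar>weak_partial \<Omega> b0 (X b) x * partial_derivative b \<rho> x + X b x * partial_derivative b0 (partial_derivative b \<rho>) x\<bar>
          \<le> \<bar>weak_partial \<Omega> b0 (X b) x\<bar> * G + \<bar>X b x\<bar> * G2"
        by (rule order_trans[OF abs_triangle_ineq add_mono])
      also have "\<dots> \<le> \<bar>f b x\<bar>" by (simp add: f_def mult.commute)
      finally show "\<bar>weak_partial \<Omega> b0 (X b) x * partial_derivative b \<rho> x + X b x * partial_derivative b0 (partial_derivative b \<rho>) x\<bar> \<le> 1 * \<bar>f b x\<bar>"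
        by simp
    qed
    finally show "\<bar>Z x\<bar> \<le> (\<Sum>b\<in>Basis. 1 * \<bar>f b x\<bar>)" .
  qed simp
  then show ?thesis by (rule le_less_trans) simp
qed

end

lemma smooth_step_derivative:
  obtains S1 where "0 \<le> S1" "\<And>t. \<bar>partial_derivative 1 smooth_step t\<bar> \<le> S1"
    "\<And>t. t < 0 \<or> 1 < t ==> partial_derivative 1 smooth_step t = 0"
proof -
  have z: "partial_derivative 1 smooth_step t = 0" if "t < 0 \<or> 1 < t" for t
  proof -
    have c: "partial_derivative 1 (\<lambda>x::real. a) t = 0" for a :: real
      by (rule partial_derivative_eq[OF has_derivative_const])
    show ?thesis
      using that
    proof
      assume "t < 0"
      then have "partial_derivative 1 smooth_step t = partial_derivative 1 (\<lambda>x::real. 0) t"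
        by (intro partial_derivative_cong[of "{..<0}"]) (auto simp: smooth_step_le_0)
      then show ?thesis using c by simp
    next
      assume "1 < t"
      then have "partial_derivative 1 smooth_step t = partial_derivative 1 (\<lambda>x::real. 1) t"
        by (intro partial_derivative_cong[of "{1<..}"]) (auto simp: smooth_step_ge_1)
      then show ?thesis using c by simp
    qed
  qed
  have "continuous_on UNIV (partial_derivative 1 smooth_step)"
    by (intro smooth_on_continuous smooth_on_partial smooth_smooth_step) simp
  then obtain C where "\<And>t. \<bar>partial_derivative 1 smooth_step t\<bar> \<le> C" "C \<ge> 0"
    by (rule compact_support_bounded[of _ "{0..1}"]) (use z in auto)
  then show ?thesis using that z by blast
qed

lemma partial_derivative_compose_real:
  fixes h :: "real => real"
  assumes "f differentiable (at x)" "h differentiable (at (f x))"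
  shows "partial_derivative b (\<lambda>x. h (f x)) x = partial_derivative 1 h (f x) * partial_derivative b f x"
proof -
  have "(f has_derivative frechet_derivative f (at x)) (at x)"
     "(h has_derivative (\<lambda>v. \<Sum>b\<in>Basis. (v \<bullet> b) * partial_derivative b h (f x))) (at (f x))"
    using assms frechet_derivative_works has_derivative_partial by blast+
  from partial_derivative_eq[OF has_derivative_compose[OF this], of b] show ?thesis
    by (simp add: mult.commute partial_derivative_def)
qed

context green_chart begin

text \<open>A cut-off turns \<open>\<theta>\<close> into test functions \<open>\<kappa> n\<close>,
  whose defect is 0. The error is \<open>R n\<close>, a multiple of \<open>Y\<close> of size
  proportional to \<open>1 / d n\<close> and supported in a layer of width parameter
  \<open>d n\<close>; \<open>layer_limit_estimate\<close> compensates that factor.\<close>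

lemma defect_local:
  assumes \<theta>: "smooth_on UNIV \<theta>" and supp: "\<And>x. x \<notin> cball x0 (r / 2) ==> \<theta> x = 0"
  shows "defect \<theta> = 0"
proof -
  let ?C = "cball x0 (r / 2)"
  have CU: "?C \<subseteq> U" "?C \<subseteq> ball x0 r" using sub r by (auto simp: subset_iff)
  obtain S1 where S1: "0 \<le> S1" "\<And>t. \<bar>partial_derivative 1 smooth_step t\<bar> \<le> S1"
    "\<And>t. t < 0 \<or> 1 < t ==> partial_derivative 1 smooth_step t = 0"
    using smooth_step_derivative by blast
  obtain \<Theta> where \<Theta>: "\<And>x. \<bar>\<theta> x\<bar> \<le> \<Theta>" "\<Theta> \<ge> 0"
    using compact_support_bounded[OF smooth_on_continuous[OF \<theta>] compact_cball supp] by blast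
  define d where "d n = r / real (Suc n)" for n
  have d: "0 < d n" "d n \<le> r" for n using r by (auto simp: d_def field_simps)
  \<comment> \<open>\<open>q n\<close> is at most 0 where \<open>\<rho> \<ge> - c * d n / 4\<close>
    and at least 1 where \<open>\<rho> \<le> - c * d n / 2\<close>. Hence the cut-off vanishes near
    the boundary, and its derivative vanishes where \<open>\<rho> \<le> - c * d n\<close>, that is,
    off the layer.\<close>
  define q where "q n x = (- (4 / (c * d n))) * \<rho> x + (- 1)" for n x
  \<comment> \<open>The indicator of \<open>U\<close> makes the step function globally measurable;
    \<open>\<theta>\<close> lives inside \<open>U\<close>, so nothing is lost.\<close>
  define hh where "hh n x = indicator U x *\<^sub>R smooth_step (q n x)" for n x
  define \<kappa> where "\<kappa> n x = (if x \<in> U then \<theta> x * smooth_step (q n x) else 0)" for n x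
  define I where "I x = (\<Sum>b\<in>Basis. integrand \<theta> b x)" for x
  define R where "R n x = (\<Sum>b\<in>Basis. integrand (\<kappa> n) b x) - hh n x * I x" for n x
  have cover: "UNIV = U \<union> - ?C" using CU by auto
  have smq: "smooth_on U (q n)" for n
    unfolding q_def[abs_def] by (intro smooth_on_add smooth_on_mult smooth_on_const chart)
  have smh: "smooth_on U (\<lambda>x. smooth_step (q n x))" for n
    by (rule smooth_on_compose[OF chart(1) open_UNIV _ smooth_smooth_step smq]) simp
  have sm\<kappa>: "smooth_on UNIV (\<kappa> n)" for n
    unfolding cover
  proof (rule smooth_on_Un[OF chart(1)])
    show "smooth_on U (\<kappa> n)"
      by (rule smooth_on_cong[OF chart(1) _ smooth_on_mult[OF chart(1) smooth_on_subset[OF \<theta> subset_UNIV] smh[of n]]])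
        (simp add: \<kappa>_def)
    show "smooth_on (- ?C) (\<kappa> n)"
      by (rule smooth_on_cong[OF _ _ smooth_on_const[of _ 0]]) (auto simp: \<kappa>_def supp)
  qed auto
  have test: "test_function \<Omega> (\<kappa> n)" for n
  proof (rule test_functionI[OF sm\<kappa>, of "?C \<inter> \<rho> -` {.. - (c * d n / 4)}"])
    have "closed (?C \<inter> \<rho> -` {.. - (c * d n / 4)})"
      by (intro continuous_closed_preimage continuous_on_subset[OF smooth_on_continuous[OF chart(2)]] CU) auto
    then show "compact (?C \<inter> \<rho> -` {.. - (c * d n / 4)})"
      unfolding compact_eq_bounded_closed using bounded_subset[OF bounded_cball[of x0 "r / 2"]] by blast
    show "?C \<inter> \<rho> -` {.. - (c * d n / 4)} \<subseteq> \<Omega>"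
    proof
      fix x assume x: "x \<in> ?C \<inter> \<rho> -` {.. - (c * d n / 4)}"
      have "0 < c * d n / 4" using c d by simp
      then have "\<rho> x < 0" using x by simp
      then show "x \<in> \<Omega>" using x CU(1) chart(3) by blast
    qed
    fix x assume x: "x \<notin> ?C \<inter> \<rho> -` {.. - (c * d n / 4)}"
    show "\<kappa> n x = 0"
    proof (cases "x \<in> ?C")
      case True
      then have "- (c * d n / 4) < \<rho> x" using x by simp
      then have "q n x \<le> 0" using c d[of n] by (simp add: q_def field_simps)
      then show ?thesis by (simp add: \<kappa>_def smooth_step_le_0)
    qed (simp add: \<kappa>_def supp)
  qed
  have Iint: "integrable (lebesgue_on \<Omega>) I"
    unfolding I_def[abs_def] by (intro Bochner_Integration.integrable_sum integrable_integrand \<theta>)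
  have \<kappa>int: "integrable (lebesgue_on \<Omega>) (\<lambda>x. \<Sum>b\<in>Basis. integrand (\<kappa> n) b x)" for n
    by (intro Bochner_Integration.integrable_sum integrable_integrand sm\<kappa>)
  have defI: "defect \<theta> = (LINT x|lebesgue_on \<Omega>. I x)"
    unfolding I_def defect_def by (rule Bochner_Integration.integral_sum[symmetric]) (rule integrable_integrand[OF \<theta>])
  have def\<kappa>: "(LINT x|lebesgue_on \<Omega>. (\<Sum>b\<in>Basis. integrand (\<kappa> n) b x)) = 0" for n
    using defect_test_function[OF test, of n] integrable_integrand[OF sm\<kappa>]
    by (simp add: defect_def Bochner_Integration.integral_sum)
  have hhm: "hh n \<in> borel_measurable (lebesgue_on \<Omega>)" for n
  proof -
    have "hh n \<in> borel_measurable borel"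
      unfolding hh_def[abs_def]
      by (intro borel_measurable_continuous_on_indicator smooth_on_continuous[OF smh]) (use chart(1) in simp)
    then show ?thesis by (intro measurable_restrict_space1 measurable_completion) simp
  qed
  have hhb: "\<bar>hh n x\<bar> \<le> 1" for n x
    using smooth_step_bounds[of "q n x"] by (simp add: hh_def indicator_def)
  have hIint: "integrable (lebesgue_on \<Omega>) (\<lambda>x. hh n x * I x)" for n
  proof (rule Bochner_Integration.integrable_bound[OF Iint])
    show "(\<lambda>x. hh n x * I x) \<in> borel_measurable (lebesgue_on \<Omega>)"
      by (intro borel_measurable_times hhm borel_measurable_integrable Iint)
    show "AE x in lebesgue_on \<Omega>. norm (hh n x * I x) \<le> norm (I x)"
      using hhb[of n] by (intro AE_I2) (simp add: abs_mult mult_left_le_one_le)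
  qed
  have Rint: "integrable (lebesgue_on \<Omega>) (R n)" for n
    unfolding R_def[abs_def] by (intro Bochner_Integration.integrable_diff \<kappa>int hIint)
  have Rval: "(LINT x|lebesgue_on \<Omega>. R n x) = - (LINT x|lebesgue_on \<Omega>. hh n x * I x)" for n
    unfolding R_def using \<kappa>int[of n] hIint[of n] def\<kappa>[of n] by simp
  have outside: "integrand \<theta> b x = 0" "integrand (\<kappa> n) b x = 0" if "x \<notin> ?C" for b x n
  proof -
    have "partial_derivative b f x = 0" if "\<And>x. x \<notin> ?C ==> f x = 0" for f :: "'a => real"
    proof -
      have "partial_derivative b f x = partial_derivative b (\<lambda>x. 0) x"
        using \<open>x \<notin> ?C\<close> that by (intro partial_derivative_cong[of "- ?C"]) auto
      also have "\<dots> = 0" by (rule partial_derivative_eq[OF has_derivative_const])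
      finally show ?thesis .
    qed
    from this[of \<theta>] this[of "\<kappa> n"] show "integrand \<theta> b x = 0" "integrand (\<kappa> n) b x = 0"
      using supp that by (auto simp: integrand_def \<kappa>_def)
  qed
  \<comment> \<open>Bounds for \<open>v\<close>, for \<open>\<theta>\<close> and for the derivative
    of \<open>smooth_step\<close>, and the factor \<open>4 / (c * d n)\<close> of \<open>q n\<close>
    with \<open>1 / d n\<close> split off.\<close>
  define K where "K = Mv * \<Theta> * S1 * (4 / c)"
  have K: "0 \<le> K" using Mv \<Theta> S1 c by (simp add: K_def)
  have Rb: "AE x in lebesgue_on \<Omega>. \<bar>R n x\<bar> \<le> (K / d n) * (\<bar>Y x\<bar> * indicator (layer r (d n)) x)" for n
  proof -
    have "AE x in lebesgue_on \<Omega>. x \<in> \<Omega>" by (intro AE_I2) (simp add: space_restrict_space)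
    with vb show ?thesis
    proof eventually_elim
      case (elim x)
      show ?case
      proof (cases "x \<in> ?C")
        case False
        then have "R n x = 0" using outside[OF False] by (simp add: R_def I_def)
        then show ?thesis using K d(1)[of n] by simp
      next
        case True
        then have xU: "x \<in> U" using CU by blast
        let ?s = "partial_derivative 1 smooth_step (q n x)"
        have dq: "partial_derivative b (q n) x = - (4 / (c * d n)) * partial_derivative b \<rho> x" for b
        proof -
          have "(\<rho> has_derivative frechet_derivative \<rho> (at x)) (at x)"
            using differentiable_rho[OF xU] frechet_derivative_works by blast
          then have "((\<lambda>x. k * \<rho> x + (- 1)) has_derivative (\<lambda>h. k * frechet_derivative \<rho> (at x) h)) (at x)" for k
            by (auto intro!: derivative_eq_intros)
          then have "(q n has_derivative (\<lambda>h. (- (4 / (c * d n))) * frechet_derivative \<rho> (at x) h)) (at x)"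
            unfolding q_def[abs_def] .
          from partial_derivative_eq[OF this] show ?thesis by (simp add: partial_derivative_def)
        qed
        have ds: "partial_derivative b (\<lambda>x. smooth_step (q n x)) x = ?s * (- (4 / (c * d n)) * partial_derivative b \<rho> x)" for b
          unfolding dq[symmetric]
          by (intro partial_derivative_compose_real smooth_on_differentiable[OF smq chart(1) xU]
              smooth_on_differentiable[OF smooth_smooth_step open_UNIV] UNIV_I)
        have dk: "partial_derivative b (\<kappa> n) x = partial_derivative b \<theta> x * smooth_step (q n x)
            + \<theta> x * (?s * (- (4 / (c * d n)) * partial_derivative b \<rho> x))" for b
        proof -
          have "partial_derivative b (\<kappa> n) x = partial_derivative b (\<lambda>x. \<theta> x * smooth_step (q n x)) x"
            by (rule partial_derivative_cong[OF chart(1) xU]) (simp add: \<kappa>_def)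
          also have "\<dots> = partial_derivative b \<theta> x * smooth_step (q n x) + \<theta> x * partial_derivative b (\<lambda>x. smooth_step (q n x)) x"
            by (intro partial_derivative_mult smooth_on_differentiable[OF \<theta> open_UNIV] UNIV_I
                smooth_on_differentiable[OF smh chart(1) xU])
          finally show ?thesis by (simp only: ds)
        qed
        define E where "E = v x * \<theta> x * ?s * (- (4 / (c * d n)))"
        have "integrand (\<kappa> n) b x = hh n x * integrand \<theta> b x + E * (X b x * partial_derivative b \<rho> x)" for b
          unfolding integrand_def dk using xU by (simp add: \<kappa>_def hh_def E_def algebra_simps)
        then have Rx: "R n x = E * Y x"
          by (simp add: R_def I_def Y_def sum.distrib sum_distrib_left)
        show ?thesis
        proof (cases "x \<in> layer r (d n)")
          case True
          have "\<bar>E\<bar> = \<bar>v x\<bar> * \<bar>\<theta> x\<bar> * \<bar>?s\<bar> * (4 / (c * d n))"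
            using c d(1)[of n] by (simp add: abs_mult E_def)
          also have "\<dots> \<le> Mv * \<Theta> * S1 * (4 / (c * d n))"
            using elim(1) \<Theta> S1 Mv c d(1)[of n] by (intro mult_right_mono mult_mono) auto
          also have "\<dots> = K / d n" by (simp add: K_def)
          finally have "\<bar>R n x\<bar> \<le> (K / d n) * \<bar>Y x\<bar>"
            unfolding Rx abs_mult[of _ "Y x"] by (rule mult_right_mono) simp
          then show ?thesis using True by simp
        next
          case False
          have "x \<in> \<Omega> \<inter> ball x0 r" using elim(2) True CU(2) by blast
          then have "\<rho> x \<le> - c * d n" using False by (simp add: layer_def)
          then have "4 \<le> - (4 / (c * d n)) * \<rho> x" using c d(1)[of n] by (simp add: field_simps)
          then have "1 < q n x" by (simp add: q_def)
          then have "R n x = 0" using Rx S1(3) by (simp add: E_def)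
          then show ?thesis using K d(1)[of n] by simp
        qed
      qed
    qed
  qed
  define B where "B n = (\<integral>\<^sup>+x. ennreal \<bar>Z x\<bar> * indicator (layer (2 * r) (d n)) x \<partial>lebesgue)" for n
  have layers: "layer e a \<subseteq> \<Omega>" "layer e a \<subseteq> U" "layer e a \<in> sets lebesgue" if "e \<le> 2 * r" for a e
    using that ball_sub layer_sets[OF that] by (auto simp: layer_def)
  have Rn: "ennreal \<bar>LINT x|lebesgue_on \<Omega>. R n x\<bar> \<le> ennreal K * B n" for n
  proof -
    have rr: "r \<le> 2 * r" using r by simp
    have Ymm: "(\<lambda>x. ennreal \<bar>Y x\<bar> * indicator (layer r (d n)) x) \<in> borel_measurable lebesgue"
      by (intro measurable_abs_indicator measurable_YZ(1) layers rr)
    have "ennreal \<bar>LINT x|lebesgue_on \<Omega>. R n x\<bar> \<le> (\<integral>\<^sup>+x. ennreal \<bar>R n x\<bar> \<partial>lebesgue_on \<Omega>)"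
      using integral_norm_bound_ennreal[OF Rint[of n]] by simp
    also have "\<dots> \<le> (\<integral>\<^sup>+x. ennreal (K / d n) * (ennreal \<bar>Y x\<bar> * indicator (layer r (d n)) x) \<partial>lebesgue_on \<Omega>)"
    proof (rule nn_integral_mono_AE)
      show "AE x in lebesgue_on \<Omega>. ennreal \<bar>R n x\<bar> \<le> ennreal (K / d n) * (ennreal \<bar>Y x\<bar> * indicator (layer r (d n)) x)"
        using Rb[of n]
      proof eventually_elim
        case (elim x)
        then show ?case
          using K d(1)[of n] by (cases "x \<in> layer r (d n)") (auto simp: ennreal_mult[symmetric] intro!: ennreal_leI)
      qed
    qed
    also have "\<dots> \<le> (\<integral>\<^sup>+x. ennreal (K / d n) * (ennreal \<bar>Y x\<bar> * indicator (layer r (d n)) x) \<partial>lebesgue)"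
      using dom_sets by (subst nn_integral_restrict_space) (auto intro!: nn_integral_mono simp: indicator_def)
    also have "\<dots> = ennreal (K / d n) * (\<integral>\<^sup>+x. ennreal \<bar>Y x\<bar> * indicator (layer r (d n)) x \<partial>lebesgue)"
      by (rule nn_integral_cmult[OF Ymm])
    also have "\<dots> \<le> ennreal (K / d n) * (ennreal (d n) * B n)"
      unfolding B_def by (intro mult_left_mono layer_limit_estimate d) simp
    also have "\<dots> = ennreal K * B n"
      using K d(1)[of n] by (simp add: mult.assoc[symmetric] ennreal_mult[symmetric])
    finally show ?thesis .
  qed
  have dlim: "d \<longlonglongrightarrow> 0"
    using tendsto_mult[OF tendsto_const[of r] LIMSEQ_inverse_real_of_nat] by (simp add: d_def[abs_def] divide_inverse)
  \<comment> \<open>The layers shrink to the empty set because \<open>\<rho>\<close> is negative on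
    them; the largest layer, with \<open>d = r\<close>, supplies the dominating function.\<close>
  have Blim: "B \<longlonglongrightarrow> (\<integral>\<^sup>+x. 0 \<partial>(lebesgue :: 'a measure))"
    unfolding B_def[abs_def]
  proof (rule nn_integral_dominated_convergence[where w = "\<lambda>x. ennreal \<bar>Z x\<bar> * indicator (layer (2 * r) r) x"])
    show "(\<lambda>x. ennreal \<bar>Z x\<bar> * indicator (layer (2 * r) a) x) \<in> borel_measurable lebesgue" for a
      by (intro measurable_abs_indicator measurable_YZ(2) layers order_refl)
    then show "(\<lambda>x. ennreal \<bar>Z x\<bar> * indicator (layer (2 * r) r) x) \<in> borel_measurable lebesgue" .
    have "layer (2 * r) (d n) \<subseteq> layer (2 * r) r" for n
    proof -
      have "c * d n \<le> c * r" using c d(2)[of n] by simp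
      then show ?thesis by (auto simp: layer_def)
    qed
    then show "AE x in lebesgue. ennreal \<bar>Z x\<bar> * indicator (layer (2 * r) (d n)) x \<le> ennreal \<bar>Z x\<bar> * indicator (layer (2 * r) r) x" for n
      by (intro AE_I2 mult_left_mono) (auto simp: indicator_def)
    show "AE x in lebesgue. (\<lambda>n. ennreal \<bar>Z x\<bar> * indicator (layer (2 * r) (d n)) x) \<longlonglongrightarrow> 0"
    proof (intro AE_I2 tendsto_eventually)
      fix x :: 'a
      show "\<forall>\<^sub>F n in sequentially. ennreal \<bar>Z x\<bar> * indicator (layer (2 * r) (d n)) x = 0"
      proof (cases "x \<in> \<Omega> \<inter> ball x0 (2 * r)")
        case True
        then have "\<rho> x < 0" using chart(3) ball_sub by blast
        then have "0 < - \<rho> x / c" using c by (simp add: divide_neg_pos)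
        from order_tendstoD(2)[OF dlim this] show ?thesis
          by eventually_elim (use c in \<open>auto simp: layer_def indicator_def field_simps\<close>)
      next
        case False
        then have "x \<notin> layer (2 * r) (d n)" for n by (auto simp: layer_def)
        then show ?thesis by simp
      qed
    qed
  qed (use Z_integrable in auto)
  have "(\<lambda>n. ennreal \<bar>LINT x|lebesgue_on \<Omega>. R n x\<bar>) \<longlonglongrightarrow> 0"
  proof (rule tendsto_sandwich[OF _ _ tendsto_const])
    show "(\<lambda>n. ennreal K * B n) \<longlonglongrightarrow> 0"
      using ennreal_tendsto_cmult[OF _ Blim, of "ennreal K"] by simp
  qed (use Rn in auto)
  then have "(\<lambda>n. \<bar>LINT x|lebesgue_on \<Omega>. R n x\<bar>) \<longlonglongrightarrow> 0"
    by (subst (asm) ennreal_0[symmetric], subst (asm) tendsto_ennreal_iff) auto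
  then have lim0: "(\<lambda>n. LINT x|lebesgue_on \<Omega>. hh n x * I x) \<longlonglongrightarrow> 0"
    unfolding Rval by (simp add: tendsto_rabs_zero_iff)
  have "(\<lambda>n. LINT x|lebesgue_on \<Omega>. hh n x * I x) \<longlonglongrightarrow> (LINT x|lebesgue_on \<Omega>. I x)"
  proof (rule integral_dominated_convergence[where w = "\<lambda>x. \<bar>I x\<bar>"])
    show "AE x in lebesgue_on \<Omega>. norm (hh n x * I x) \<le> \<bar>I x\<bar>" for n
      using hhb[of n] by (intro AE_I2) (simp add: abs_mult mult_left_le_one_le)
    show "AE x in lebesgue_on \<Omega>. (\<lambda>n. hh n x * I x) \<longlonglongrightarrow> I x"
    proof (rule AE_I2)
      fix x assume "x \<in> space (lebesgue_on \<Omega>)"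
      then have x: "x \<in> \<Omega>" by (simp add: space_restrict_space)
      show "(\<lambda>n. hh n x * I x) \<longlonglongrightarrow> I x"
      proof (cases "x \<in> ?C")
        case False
        then have "I x = 0" using outside(1) by (simp add: I_def)
        then show ?thesis by simp
      next
        case True
        then have xU: "x \<in> U" using CU by blast
        then have neg: "\<rho> x < 0" using chart(3) x by blast
        then have "0 < - \<rho> x / (2 * c)" using c by (simp add: divide_neg_pos)
        from order_tendstoD(2)[OF dlim this] have "\<forall>\<^sub>F n in sequentially. hh n x * I x = I x"
        proof eventually_elim
          case (elim n)
          have "c * d n * 2 < - \<rho> x" using elim c by (simp add: field_simps)
          then have "c * d n * 2 \<le> - 4 * \<rho> x" using neg by linarith
          then have "1 \<le> q n x" using c d(1)[of n] by (simp add: q_def field_simps)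
          then show ?case using xU by (simp add: hh_def smooth_step_ge_1)
        qed
        then show ?thesis by (rule tendsto_eventually)
      qed
    qed
  qed (use Iint hIint in \<open>auto intro: borel_measurable_integrable\<close>)
  then show ?thesis using LIMSEQ_unique[OF _ lim0] defI by simp
qed

end

section \<open>From local to global vanishing of the defect\<close>

context green_trace begin

lemma defect_boundary:
  assumes x: "x \<in> frontier \<Omega>"
  shows "\<exists>r>0. \<forall>\<theta>. smooth_on UNIV \<theta> \<and> (\<forall>y. y \<notin> cball x (r / 2) \<longrightarrow> \<theta> y = 0) \<longrightarrow> defect \<theta> = 0"
proof -
  obtain U \<rho> b0 \<sigma> c r G where "boundary_chart \<Omega> x U \<rho> b0 \<sigma> c r G"
    using boundary_chart_exists[OF smooth_dom x] by blast
  then interpret B: boundary_chart \<Omega> x U \<rho> b0 \<sigma> c r G .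
  interpret green_chart \<Omega> X F v Mv g x U \<rho> b0 \<sigma> c r G ..
  show ?thesis using defect_local B.r by blast
qed

text \<open>Localisation by the telescoping identity
  \<open>1 = \<zeta>\<^sub>1 + (1 - \<zeta>\<^sub>1) \<zeta>\<^sub>2 + \<dots> + \<Prod>\<^sub>i (1 - \<zeta>\<^sub>i)\<close> for a cover of the boundary; the last term is a test function on \<open>\<Omega>\<close>.\<close>

lemma defect_one: "defect (\<lambda>x. 1) = 0"
proof -
  obtain R where R: "\<And>x. x \<in> frontier \<Omega> ==> R x > 0"
    "\<And>x \<theta>. x \<in> frontier \<Omega> ==> smooth_on UNIV \<theta> ==> (\<And>y. y \<notin> cball x (R x / 2) ==> \<theta> y = 0) ==> defect \<theta> = 0"
    using defect_boundary by metis
  have "compact (frontier \<Omega>)" using bounded_dom by (simp add: compact_frontier_bounded)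
  then obtain C where C: "C \<subseteq> frontier \<Omega>" "finite C" "frontier \<Omega> \<subseteq> (\<Union>x\<in>C. ball x (R x / 4))"
    by (rule compactE_image[of _ "frontier \<Omega>" "\<lambda>x. ball x (R x / 4)"]) (use R(1) in auto)
  \<comment> \<open>The constants make the argument at least 1 for
    \<open>dist x y \<le> R x / 4\<close> and at most 0 for \<open>dist x y \<ge> R x / 2\<close>.
    The squared distance is written in coordinates to make smoothness immediate.\<close>
  define \<zeta> where "\<zeta> x y = smooth_step ((16 / (3 * (R x)\<^sup>2)) * ((R x)\<^sup>2 / 4 - (\<Sum>b\<in>Basis. (y \<bullet> b - x \<bullet> b) * (y \<bullet> b - x \<bullet> b))))" for x y
  have nrm: "(\<Sum>b\<in>Basis. (y \<bullet> b - x \<bullet> b) * (y \<bullet> b - x \<bullet> b)) = (dist x y)\<^sup>2" for x y :: 'a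
  proof -
    have "(dist x y)\<^sup>2 = (y - x) \<bullet> (y - x)" by (subst dist_commute) (simp add: dist_norm power2_norm_eq_inner)
    also have "\<dots> = (\<Sum>b\<in>Basis. ((y - x) \<bullet> b) * ((y - x) \<bullet> b))" by (rule euclidean_inner)
    finally show ?thesis by (simp add: inner_diff_left)
  qed
  have sm: "smooth_on UNIV (\<zeta> x)" for x
    unfolding \<zeta>_def[abs_def]
    by (rule smooth_on_compose[OF open_UNIV open_UNIV _ smooth_smooth_step])
      (intro subset_UNIV smooth_on_mult smooth_on_diff smooth_on_sum smooth_on_const smooth_on_inner open_UNIV)+
  have z0: "\<zeta> x y = 0" if "y \<notin> cball x (R x / 2)" "x \<in> frontier \<Omega>" for x y
  proof -
    have "(R x / 2)\<^sup>2 \<le> (dist x y)\<^sup>2" using that R(1)[of x] by (intro power_mono) auto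
    then have "(16 / (3 * (R x)\<^sup>2)) * ((R x)\<^sup>2 / 4 - (dist x y)\<^sup>2) \<le> 0"
      by (intro mult_nonneg_nonpos) (auto simp: power_divide)
    then show ?thesis unfolding \<zeta>_def nrm by (rule smooth_step_le_0)
  qed
  have z1: "\<zeta> x y = 1" if "y \<in> ball x (R x / 4)" "x \<in> frontier \<Omega>" for x y
  proof -
    have "(dist x y)\<^sup>2 \<le> (R x / 4)\<^sup>2" using that by (intro power_mono) auto
    then have "(16 / (3 * (R x)\<^sup>2)) * ((3 / 16) * (R x)\<^sup>2) \<le> (16 / (3 * (R x)\<^sup>2)) * ((R x)\<^sup>2 / 4 - (dist x y)\<^sup>2)"
      by (intro mult_left_mono) (auto simp: power_divide)
    moreover have eq1: "(16 / (3 * (R x)\<^sup>2)) * ((3 / 16) * (R x)\<^sup>2) = 1" using R(1)[OF that(2)] by simp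
    ultimately have "1 \<le> (16 / (3 * (R x)\<^sup>2)) * ((R x)\<^sup>2 / 4 - (dist x y)\<^sup>2)" by (simp only: eq1)
    then show ?thesis unfolding \<zeta>_def nrm by (rule smooth_step_ge_1)
  qed
  define P where "P D y = (\<Prod>x\<in>D. 1 - \<zeta> x y)" for D y
  have smP: "smooth_on UNIV (P D)" for D
    unfolding P_def[abs_def] by (intro smooth_on_prod smooth_on_diff smooth_on_const sm open_UNIV)
  have tele: "defect (P D) = defect (\<lambda>x. 1)" if "finite D" "D \<subseteq> frontier \<Omega>" for D
    using that
  proof (induction D)
    case (insert x D)
    have s: "smooth_on UNIV (\<lambda>y. P D y * \<zeta> x y)" by (intro smooth_on_mult smP sm open_UNIV)
    have "P D = (\<lambda>y. P (insert x D) y + P D y * \<zeta> x y)"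
      using insert by (auto simp: P_def algebra_simps)
    then have "defect (P D) = defect (\<lambda>y. P (insert x D) y + P D y * \<zeta> x y)" by simp
    also have "\<dots> = defect (P (insert x D)) + defect (\<lambda>y. P D y * \<zeta> x y)"
      by (rule defect_add[OF smP s])
    also have "defect (\<lambda>y. P D y * \<zeta> x y) = 0"
      using insert z0[of _ x] by (intro R(2)[of x] s) auto
    finally show ?case using insert by simp
  qed (simp add: P_def[abs_def])
  \<comment> \<open>\<open>P C\<close> vanishes on the neighbourhood \<open>V\<close> of the
    boundary, so cutting it to 0 outside \<open>\<Omega>\<close> keeps it smooth.\<close>
  define Q where "Q y = (if y \<in> \<Omega> then P C y else 0)" for y
  define V where "V = (\<Union>x\<in>C. ball x (R x / 4))"
  have PV: "P C y = 0" if "y \<in> V" for y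
    using that C(1,2) z1 unfolding P_def V_def by (intro prod_zero) auto
  have clo: "closure \<Omega> = \<Omega> \<union> frontier \<Omega>" by (simp add: closure_Un_frontier)
  have "test_function \<Omega> Q"
  proof (rule test_functionI[of _ "closure \<Omega> - V"])
    have cov: "UNIV = \<Omega> \<union> (V \<union> - closure \<Omega>)" using C(3) clo by (auto simp: V_def)
    have oV: "open V" by (auto simp: V_def)
    then have oVc: "open (V \<union> - closure \<Omega>)" by (intro open_Un) auto
    show "smooth_on UNIV Q"
      unfolding cov
    proof (rule smooth_on_Un[OF open_dom])
      show "smooth_on \<Omega> Q"
        by (rule smooth_on_cong[OF open_dom _ smooth_on_subset[OF smP subset_UNIV]]) (simp add: Q_def)
      show "smooth_on (V \<union> - closure \<Omega>) Q"
        by (rule smooth_on_cong[OF oVc _ smooth_on_const[of _ 0]]) (use PV clo in \<open>auto simp: Q_def\<close>)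
    qed (rule oVc)
    show "compact (closure \<Omega> - V)" using bounded_dom oV by (intro compact_diff) auto
    show "closure \<Omega> - V \<subseteq> \<Omega>" using C(3) clo by (auto simp: V_def)
    show "Q y = 0" if "y \<notin> closure \<Omega> - V" for y
      using that PV clo by (auto simp: Q_def)
  qed
  then have "defect Q = 0" by (rule defect_test_function)
  moreover have "defect Q = defect (P C)" by (rule defect_cong) (simp add: Q_def)
  ultimately show ?thesis using tele[OF C(2,1)] by simp
qed

end

text \<open>\<open>defect_one\<close> for the field of weak derivatives of \<open>u\<close>. The
  bound on \<open>v\<close> controls the cut-off error near the boundary; in the application
  \<open>v\<close> is a difference of functions with values in the unit interval.\<close>

theorem green_formula:
  fixes \<Omega> :: "'a::euclidean_space set"
  assumes dim: "2 \<le> DIM('a)" and dom: "smooth_bounded_domain \<Omega>" and u: "u \<in> H2 \<Omega>"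
    and nd: "has_normal_derivative \<Omega> u h" and h: "AE x in surface_measure \<Omega>. h x = 0"
    and v: "v \<in> H1 \<Omega>" and vb: "AE x in lebesgue_on \<Omega>. \<bar>v x\<bar> \<le> Mv" and Mv: "0 \<le> Mv"
  shows "(LINT x|lebesgue_on \<Omega>. weak_laplacian \<Omega> u x * v x)
    = - (\<Sum>b\<in>Basis. LINT x|lebesgue_on \<Omega>. weak_partial \<Omega> b u x * weak_partial \<Omega> b v x)"
proof -
  obtain g where g: "\<And>b. b \<in> Basis ==> has_trace \<Omega> (weak_partial \<Omega> b u) (g b)"
    "\<And>x. h x = (\<Sum>b\<in>Basis. g b x * (outward_normal \<Omega> x \<bullet> b))"
    using nd unfolding has_normal_derivative_def by blast
  define P where "P b F \<longleftrightarrow> (\<forall>k. smooth_on UNIV (F k)) \<and>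
        (\<lambda>k. H1_norm \<Omega> (\<lambda>x. F k x - weak_partial \<Omega> b u x)) \<longlonglongrightarrow> 0 \<and>
        (\<lambda>k. L2_norm (surface_measure \<Omega>) (\<lambda>x. F k x - g b x)) \<longlonglongrightarrow> 0"
    for b and F :: "nat => 'a => real"
  have "\<forall>b\<in>Basis. \<exists>F. P b F"
    using g(1) by (simp add: has_trace_def P_def)
  then obtain F where PF: "\<forall>b\<in>Basis. P b (F b)"
    by (rule bchoice[THEN exE])
  then have F: "\<And>b k. b \<in> Basis ==> smooth_on UNIV (F b k)"
    "\<And>b. b \<in> Basis ==> (\<lambda>k. H1_norm \<Omega> (\<lambda>x. F b k x - weak_partial \<Omega> b u x)) \<longlonglongrightarrow> 0"
    "\<And>b. b \<in> Basis ==> (\<lambda>k. L2_norm (surface_measure \<Omega>) (\<lambda>x. F b k x - g b x)) \<longlonglongrightarrow> 0"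
    unfolding P_def by auto
  interpret green_trace \<Omega> "\<lambda>b. weak_partial \<Omega> b u" F v Mv g
  proof
    show "open \<Omega>" "bounded \<Omega>" using dom by (auto simp: smooth_bounded_domain_def)
    show "AE x in surface_measure \<Omega>. (\<Sum>b\<in>Basis. g b x * (outward_normal \<Omega> x \<bullet> b)) = 0"
      using h by (simp add: g(2))
    show "weak_partial \<Omega> b u \<in> H1 \<Omega>" if "b \<in> Basis" for b
      using u that by (simp add: H2_def)
    show "g b \<in> L2 (surface_measure \<Omega>)" if "b \<in> Basis" for b
      using g(1)[OF that] by (simp add: has_trace_def)
  qed (use F v vb Mv dim dom in auto)
  have pd1: "partial_derivative b (\<lambda>x. 1) x = 0" for b x :: 'a
    by (rule partial_derivative_eq[OF has_derivative_const])
  have int: "integrable (lebesgue_on \<Omega>) (\<lambda>x. v x * weak_partial \<Omega> b (weak_partial \<Omega> b u) x)"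
    "integrable (lebesgue_on \<Omega>) (\<lambda>x. weak_partial \<Omega> b u x * weak_partial \<Omega> b v x)" if "b \<in> Basis" for b
    using that by (intro L2_integrable_mult v2 X2; assumption)+
  have "0 = (\<Sum>b\<in>Basis. LINT x|lebesgue_on \<Omega>. v x * weak_partial \<Omega> b (weak_partial \<Omega> b u) x + weak_partial \<Omega> b u x * weak_partial \<Omega> b v x)"
    using defect_one by (simp add: defect_def integrand_def pd1)
  also have "\<dots> = (\<Sum>b\<in>Basis. LINT x|lebesgue_on \<Omega>. v x * weak_partial \<Omega> b (weak_partial \<Omega> b u) x)
      + (\<Sum>b\<in>Basis. LINT x|lebesgue_on \<Omega>. weak_partial \<Omega> b u x * weak_partial \<Omega> b v x)"
    using int by (simp add: sum.distrib)
  also have "(\<Sum>b\<in>Basis. LINT x|lebesgue_on \<Omega>. v x * weak_partial \<Omega> b (weak_partial \<Omega> b u) x)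
      = (LINT x|lebesgue_on \<Omega>. (\<Sum>b\<in>Basis. v x * weak_partial \<Omega> b (weak_partial \<Omega> b u) x))"
    by (rule Bochner_Integration.integral_sum[symmetric]) (rule int(1))
  also have "\<dots> = (LINT x|lebesgue_on \<Omega>. weak_laplacian \<Omega> u x * v x)"
    by (simp add: weak_laplacian_def sum_distrib_left[symmetric] mult.commute)
  finally show ?thesis by simp
qed

section \<open>Lower semicontinuity of the Dirichlet energy\<close>

lemma L2_norm_midpoint:
  assumes "f \<in> L2 M" "g \<in> L2 M"
  shows "(L2_norm M (\<lambda>x. (1/2) * f x + (1/2) * g x))\<^sup>2
    = (L2_norm M f)\<^sup>2 / 2 + (L2_norm M g)\<^sup>2 / 2 - (L2_norm M (\<lambda>x. f x - g x))\<^sup>2 / 4"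
proof -
  have i: "integrable M (\<lambda>x. (f x)\<^sup>2)" "integrable M (\<lambda>x. (g x)\<^sup>2)" "integrable M (\<lambda>x. (f x - g x)\<^sup>2)"
    using assms by (auto intro: L2_integrable_square L2_diff)
  have "((1/2) * f x + (1/2) * g x)\<^sup>2 = (f x)\<^sup>2 / 2 + (g x)\<^sup>2 / 2 - (f x - g x)\<^sup>2 / 4" for x
    by (simp add: power2_eq_square field_simps)
  then show ?thesis using i by (simp add: L2_norm_sq)
qed

text \<open>Instead of extracting a weakly convergent subsequence of gradients, the proof takes near-minimisers
  \<open>v n\<close> of \<open>J n\<close>: by the parallelogram law their gradients form a Cauchy sequence.\<close>

lemma (in bounded_open) H1_lsc:
  fixes f :: "'i => 'a => real" and s :: "nat => 'i => 'a => real"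
  assumes I: "finite I" and f: "\<And>i. i \<in> I ==> f i \<in> L2 (lebesgue_on \<Omega>)"
    and s: "\<And>k i. i \<in> I ==> s k i \<in> H1 \<Omega>"
    and lim: "\<And>i. i \<in> I ==> (\<lambda>k. L2_norm (lebesgue_on \<Omega>) (\<lambda>x. s k i x - f i x)) \<longlonglongrightarrow> 0"
    and R: "\<And>k. (\<Sum>i\<in>I. \<Sum>b\<in>Basis. (L2_norm (lebesgue_on \<Omega>) (weak_partial \<Omega> b (s k i)))\<^sup>2) \<le> R"
  shows "(\<forall>i\<in>I. f i \<in> H1 \<Omega>) \<and> (\<Sum>i\<in>I. \<Sum>b\<in>Basis. (L2_norm (lebesgue_on \<Omega>) (weak_partial \<Omega> b (f i)))\<^sup>2) \<le> R"
proof -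
  let ?n = "L2_norm (lebesgue_on \<Omega>)"
  define D where "D v = (\<Sum>i\<in>I. \<Sum>b\<in>Basis. (?n (weak_partial \<Omega> b (v i)))\<^sup>2)" for v
  define E where "E v = (\<Sum>i\<in>I. (?n (\<lambda>x. v i x - f i x))\<^sup>2)" for v
  define DD where "DD v w = (\<Sum>i\<in>I. \<Sum>b\<in>Basis. (?n (\<lambda>x. weak_partial \<Omega> b (v i) x - weak_partial \<Omega> b (w i) x))\<^sup>2)" for v w
  \<comment> \<open>A penalised Dirichlet energy. The \<open>s k\<close> show that its infimum
    \<open>j n\<close> never exceeds \<open>R\<close>, whereas the weight \<open>n\<close> forces
    near-minimisers towards \<open>f\<close>.\<close>
  define J where "J n v = D v + real n * E v" for n v
  define Adm where "Adm = {v. \<forall>i\<in>I. v i \<in> H1 \<Omega>}"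
  define j where "j n = (INF v\<in>Adm. J n v)" for n
  define mid where "mid v w i x = (1/2) * v i x + (1/2) * w i x" for v w :: "'i => 'a => real" and i x
  have D0: "0 \<le> D v" and E0: "0 \<le> E v" and DD0: "0 \<le> DD v w" for v w
    by (auto simp: D_def E_def DD_def intro!: sum_nonneg)
  have J0: "0 \<le> J n v" for n v using D0 E0 by (simp add: J_def)
  have bdd: "bdd_below (J n ` Adm)" for n using J0 by (intro bdd_belowI2[of _ 0])
  have sAdm: "s k \<in> Adm" for k using s by (simp add: Adm_def)
  have ne: "Adm \<noteq> {}" using sAdm by blast
  have jle: "j n \<le> J n v" if "v \<in> Adm" for n v
    unfolding j_def by (rule cINF_lower[OF bdd that])
  have jR: "j n \<le> R" for n
  proof (rule LIMSEQ_le_const)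
    have "(\<lambda>k. R + real n * E (s k)) \<longlonglongrightarrow> R + real n * (\<Sum>i\<in>I. 0\<^sup>2)"
      unfolding E_def by (intro tendsto_add tendsto_mult tendsto_const tendsto_sum tendsto_power lim)
    then show "(\<lambda>k. R + real n * E (s k)) \<longlonglongrightarrow> R" by simp
    have "j n \<le> R + real n * E (s k)" for k
      using jle[OF sAdm, of n k] R[of k] by (simp add: J_def D_def)
    then show "\<exists>N. \<forall>k\<ge>N. j n \<le> R + real n * E (s k)" by blast
  qed
  have jmono: "j n \<le> j m" if "n \<le> m" for n m
    unfolding j_def[of m]
  proof (rule cINF_greatest[OF ne])
    fix v assume v: "v \<in> Adm"
    have "real n * E v \<le> real m * E v" using that E0 by (intro mult_right_mono) auto
    then show "j n \<le> J m v" using jle[OF v, of n] by (simp add: J_def)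
  qed
  have "\<exists>v\<in>Adm. J n v < j n + 1 / real (Suc n)" for n
    using cINF_less_iff[OF ne bdd, of n "j n + 1 / real (Suc n)"] by (simp add: j_def)
  then obtain v where v: "\<And>n. v n \<in> Adm" "\<And>n. J n (v n) < j n + 1 / real (Suc n)" by metis
  have vH: "v n i \<in> H1 \<Omega>" if "i \<in> I" for n i using v(1)[of n] that by (simp add: Adm_def)
  \<comment> \<open>The midpoint of \<open>v n\<close> and \<open>v m\<close> competes for
    \<open>j n\<close>. The parallelogram law puts its Dirichlet term below the average by a quarter
    of \<open>DD\<close>, and \<open>J n\<close> is below \<open>J m\<close> for
    \<open>n \<le> m\<close>. As \<open>j\<close> is monotone and bounded, the right-hand side tends
    to 0.\<close>
  have DDle: "DD (v n) (v m) \<le> 2 * (j m - j n + 1 / real (Suc n) + 1 / real (Suc m))" if nm: "n \<le> m" for n m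
  proof -
    let ?w = "mid (v n) (v m)"
    have midH: "?w i \<in> H1 \<Omega>" "b \<in> Basis ==> ?n (weak_partial \<Omega> b (?w i)) = ?n (\<lambda>x. (1/2) * weak_partial \<Omega> b (v n i) x + (1/2) * weak_partial \<Omega> b (v m i) x)"
      if i: "i \<in> I" for i b
    proof -
      note h = H1_lincomb[OF vH[OF i, of n] vH[OF i, of m], where c = "1/2" and d = "1/2"]
      show H: "?w i \<in> H1 \<Omega>" using h(1) by (simp add: mid_def[abs_def])
      show "?n (weak_partial \<Omega> b (?w i)) = ?n (\<lambda>x. (1/2) * weak_partial \<Omega> b (v n i) x + (1/2) * weak_partial \<Omega> b (v m i) x)" if b: "b \<in> Basis"
      proof (rule L2_norm_cong_AE)
        show "weak_partial \<Omega> b (?w i) \<in> borel_measurable (lebesgue_on \<Omega>)"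
          by (intro L2_measurable H1_weak_partial(2) H b)
        show "(\<lambda>x. (1/2) * weak_partial \<Omega> b (v n i) x + (1/2) * weak_partial \<Omega> b (v m i) x) \<in> borel_measurable (lebesgue_on \<Omega>)"
          by (intro L2_measurable L2_add L2_cmult H1_weak_partial(2) vH i b)
        show "AE x in lebesgue_on \<Omega>. weak_partial \<Omega> b (?w i) x = (1/2) * weak_partial \<Omega> b (v n i) x + (1/2) * weak_partial \<Omega> b (v m i) x"
          using h(2)[OF b] by (simp add: mid_def[abs_def])
      qed
    qed
    have Dm: "D ?w = D (v n) / 2 + D (v m) / 2 - DD (v n) (v m) / 4"
      unfolding D_def DD_def sum_divide_distrib sum.distrib[symmetric] sum_subtractf[symmetric]
      using midH L2_norm_midpoint[OF H1_weak_partial(2)[OF vH] H1_weak_partial(2)[OF vH]]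
      by (intro sum.cong refl) simp
    have Em: "E ?w \<le> E (v n) / 2 + E (v m) / 2"
      unfolding E_def sum_divide_distrib sum.distrib[symmetric]
    proof (rule sum_mono)
      fix i assume i: "i \<in> I"
      have eq: "(\<lambda>x. ?w i x - f i x) = (\<lambda>x. (1/2) * (v n i x - f i x) + (1/2) * (v m i x - f i x))"
        by (simp add: mid_def fun_eq_iff field_simps)
      have d: "(\<lambda>x. v k i x - f i x) \<in> L2 (lebesgue_on \<Omega>)" for k by (intro L2_diff H1_L2 vH f i)
      show "(?n (\<lambda>x. ?w i x - f i x))\<^sup>2 \<le> (?n (\<lambda>x. v n i x - f i x))\<^sup>2 / 2 + (?n (\<lambda>x. v m i x - f i x))\<^sup>2 / 2"
        unfolding eq L2_norm_midpoint[OF d d] by simp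
    qed
    have "?w \<in> Adm" using midH(1) by (simp add: Adm_def)
    then have "j n \<le> D ?w + real n * E ?w" using jle[of ?w n] by (simp add: J_def)
    also have "\<dots> \<le> (D (v n) / 2 + D (v m) / 2 - DD (v n) (v m) / 4) + real n * (E (v n) / 2 + E (v m) / 2)"
      using Em by (simp add: Dm mult_left_mono)
    also have "\<dots> = J n (v n) / 2 + J n (v m) / 2 - DD (v n) (v m) / 4" by (simp add: J_def field_simps)
    finally have "j n \<le> J n (v n) / 2 + J n (v m) / 2 - DD (v n) (v m) / 4" .
    moreover have "J n (v m) \<le> J m (v m)" using nm E0 by (simp add: J_def mult_right_mono)
    moreover have "d \<le> 2 * (y - x + p + q)"
      if "x \<le> a / 2 + b / 2 - d / 4" "b \<le> z" "a < x + p" "z < y + q" for a b d p q x y z :: real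
      using that by argo
    ultimately show ?thesis using v(2)[of n] v(2)[of m] by blast
  qed
  have "incseq j" using jmono by (simp add: incseq_def)
  then obtain L where "j \<longlonglongrightarrow> L" using incseq_convergent[of j R] jR by blast
  then have jC: "Cauchy j" by (rule LIMSEQ_imp_Cauchy)
  have DDC: "\<exists>K. \<forall>n\<ge>K. \<forall>m\<ge>K. DD (v n) (v m) < e" if e: "0 < e" for e
  proof -
    obtain K1 where K1: "\<And>m n. m \<ge> K1 ==> n \<ge> K1 ==> dist (j m) (j n) < e / 8"
      using jC e unfolding Cauchy_def by (meson divide_pos_pos zero_less_numeral)
    obtain K2 :: nat where K2: "8 / e < real K2" using reals_Archimedean2 by blast
    have inv: "1 / real (Suc n) < e / 8" if "n \<ge> K2" for n
    proof -
      have "8 / e < real (Suc n)" using K2 that by linarith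
      then show ?thesis using e by (simp add: field_simps)
    qed
    have half: "DD (v n) (v m) < e" if "n \<le> m" "n \<ge> max K1 K2" for n m
    proof -
      have gen: "a < e" if "a \<le> 2 * (y - x + p + q)" "\<bar>y - x\<bar> < e / 8" "p < e / 8" "q < e / 8" for a x y p q :: real
      proof -
        have "y - x < e / 8" using that(2) by (rule le_less_trans[OF abs_ge_self])
        then show ?thesis using that(1,3,4) e by argo
      qed
      show ?thesis
        by (rule gen[OF DDle[OF that(1)] K1[of m n, unfolded dist_real_def] inv inv]) (use that in auto)
    qed
    have sym: "DD (v n) (v m) = DD (v m) (v n)" for n m
      unfolding DD_def L2_norm_sq by (intro sum.cong refl Bochner_Integration.integral_cong power2_commute)
    have "DD (v n) (v m) < e" if "n \<ge> max K1 K2" "m \<ge> max K1 K2" for n m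
      using half[of n m] half[of m n] sym[of n m] that by (cases "n \<le> m") auto
    then show ?thesis by blast
  qed
  have comp: "(?n (\<lambda>x. weak_partial \<Omega> b (v n i) x - weak_partial \<Omega> b (v m i) x))\<^sup>2 \<le> DD (v n) (v m)"
    if "i \<in> I" "b \<in> Basis" for i b n m
  proof -
    have "(?n (\<lambda>x. weak_partial \<Omega> b (v n i) x - weak_partial \<Omega> b (v m i) x))\<^sup>2
       \<le> (\<Sum>b\<in>Basis. (?n (\<lambda>x. weak_partial \<Omega> b (v n i) x - weak_partial \<Omega> b (v m i) x))\<^sup>2)"
      by (rule member_le_sum[OF that(2)]) auto
    also have "\<dots> \<le> DD (v n) (v m)"
      unfolding DD_def using I by (intro member_le_sum[OF that(1)] sum_nonneg) auto
    finally show ?thesis .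
  qed
  have "\<exists>g. g \<in> L2 (lebesgue_on \<Omega>) \<and> (\<lambda>n. ?n (\<lambda>x. weak_partial \<Omega> b (v n i) x - g x)) \<longlonglongrightarrow> 0"
    if ib: "i \<in> I" "b \<in> Basis" for i b
  proof (rule L2_complete[of "\<lambda>n. weak_partial \<Omega> b (v n i)"])
    show "weak_partial \<Omega> b (v n i) \<in> L2 (lebesgue_on \<Omega>)" for n by (intro H1_weak_partial(2) vH ib)
    fix e :: real assume e: "0 < e"
    then obtain K where K: "\<forall>n\<ge>K. \<forall>m\<ge>K. DD (v n) (v m) < e\<^sup>2" using DDC[of "e\<^sup>2"] by auto
    have "?n (\<lambda>x. weak_partial \<Omega> b (v n i) x - weak_partial \<Omega> b (v m i) x) < e" if "n \<ge> K" "m \<ge> K" for n m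
    proof -
      have "(?n (\<lambda>x. weak_partial \<Omega> b (v n i) x - weak_partial \<Omega> b (v m i) x))\<^sup>2 < e\<^sup>2"
        using comp[OF ib, of n m] K that by (meson le_less_trans)
      then show ?thesis by (rule power2_less_imp_less) (use e in simp)
    qed
    then show "\<exists>N. \<forall>n\<ge>N. \<forall>m\<ge>N. ?n (\<lambda>x. weak_partial \<Omega> b (v n i) x - weak_partial \<Omega> b (v m i) x) < e" by blast
  qed blast
  then have "\<forall>p\<in>I \<times> Basis. \<exists>g. g \<in> L2 (lebesgue_on \<Omega>)
      \<and> (\<lambda>n. ?n (\<lambda>x. weak_partial \<Omega> (snd p) (v n (fst p)) x - g x)) \<longlonglongrightarrow> 0" by auto
  then obtain g' where g': "\<forall>p\<in>I \<times> Basis. g' p \<in> L2 (lebesgue_on \<Omega>)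
      \<and> (\<lambda>n. ?n (\<lambda>x. weak_partial \<Omega> (snd p) (v n (fst p)) x - g' p x)) \<longlonglongrightarrow> 0"
    by (rule bchoice[THEN exE])
  define g where "g i b = g' (i, b)" for i b
  have g: "g i b \<in> L2 (lebesgue_on \<Omega>)" "(\<lambda>n. ?n (\<lambda>x. weak_partial \<Omega> b (v n i) x - g i b x)) \<longlonglongrightarrow> 0"
    if "i \<in> I" "b \<in> Basis" for i b
    using bspec[OF g', of "(i, b)"] that by (auto simp: g_def)
  have Elim: "(\<lambda>n. E (v n)) \<longlonglongrightarrow> 0"
  proof (rule tendsto_sandwich[OF _ _ tendsto_const])
    have "E (v n) \<le> (R + 1) * (1 / real n)" if "n \<ge> 1" for n
    proof -
      have "1 / real (Suc n) \<le> 1" by simp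
      then have "real n * E (v n) \<le> R + 1" using v(2)[of n] jR[of n] D0[of "v n"] unfolding J_def by linarith
      then show ?thesis using that by (simp add: field_simps)
    qed
    then show "\<forall>\<^sub>F n in sequentially. E (v n) \<le> (R + 1) * (1 / real n)"
      unfolding eventually_sequentially by blast
    show "(\<lambda>n. (R + 1) * (1 / real n)) \<longlonglongrightarrow> 0"
      using tendsto_mult[OF tendsto_const[of "R + 1"] lim_1_over_n] by simp
  qed (use E0 in auto)
  have vf: "(\<lambda>n. ?n (\<lambda>x. v n i x - f i x)) \<longlonglongrightarrow> 0" if i: "i \<in> I" for i
  proof -
    have "(\<lambda>n. (?n (\<lambda>x. v n i x - f i x))\<^sup>2) \<longlonglongrightarrow> 0"
    proof (rule tendsto_sandwich[OF _ _ tendsto_const Elim])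
      show "\<forall>\<^sub>F n in sequentially. (?n (\<lambda>x. v n i x - f i x))\<^sup>2 \<le> E (v n)"
        unfolding E_def using I by (intro always_eventually allI member_le_sum[OF i]) auto
    qed simp
    from tendsto_real_sqrt[OF this] show ?thesis by (simp add: L2_norm_nonneg)
  qed
  \<comment> \<open>The relation between a function and its weak derivative is closed under L2
    convergence of both.\<close>
  have wp: "has_weak_partial \<Omega> b (f i) (g i b)" if ib: "i \<in> I" "b \<in> Basis" for i b
    unfolding has_weak_partial_def
  proof (intro conjI allI impI L2_locally_integrable f g ib)
    fix \<eta> assume t: "test_function \<Omega> \<eta>"
    have t2: "\<eta> \<in> L2 (lebesgue_on \<Omega>)" "partial_derivative b \<eta> \<in> L2 (lebesgue_on \<Omega>)"
      using t test_function_partial[OF t ib(2)]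
      by (auto simp: test_function_def intro!: continuous_L2 smooth_on_continuous)
    have "(\<lambda>n. LINT x|lebesgue_on \<Omega>. v n i x * partial_derivative b \<eta> x) \<longlonglongrightarrow> (LINT x|lebesgue_on \<Omega>. f i x * partial_derivative b \<eta> x)"
      by (intro L2_tendsto_inner H1_L2 vH f vf t2 ib)
    moreover have "(\<lambda>n. - (LINT x|lebesgue_on \<Omega>. weak_partial \<Omega> b (v n i) x * \<eta> x)) \<longlonglongrightarrow> - (LINT x|lebesgue_on \<Omega>. g i b x * \<eta> x)"
      by (intro tendsto_minus L2_tendsto_inner H1_weak_partial(2) vH g t2 ib)
    moreover have "(LINT x|lebesgue_on \<Omega>. v n i x * partial_derivative b \<eta> x) = - (LINT x|lebesgue_on \<Omega>. weak_partial \<Omega> b (v n i) x * \<eta> x)" for n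
      by (rule has_weak_partialD(3)[OF H1_weak_partial(1)[OF vH[OF ib(1)] ib(2)] t])
    ultimately show "(LINT x|lebesgue_on \<Omega>. f i x * partial_derivative b \<eta> x) = - (LINT x|lebesgue_on \<Omega>. g i b x * \<eta> x)"
      by (simp add: LIMSEQ_unique)
  qed
  have fH: "f i \<in> H1 \<Omega>" if "i \<in> I" for i
    using that by (intro H1I[of _ "g i"] f g wp)
  have Df: "D f = (\<Sum>i\<in>I. \<Sum>b\<in>Basis. (?n (g i b))\<^sup>2)"
    unfolding D_def
  proof (intro sum.cong refl)
    fix i and b :: 'a assume ib: "i \<in> I" "b \<in> Basis"
    have "?n (weak_partial \<Omega> b (f i)) = ?n (g i b)"
      by (rule L2_norm_cong_AE[OF _ _ weak_partial_eq(2)[OF wp[OF ib]]])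
        (intro L2_measurable H1_weak_partial(2) fH g ib)+
    then show "(?n (weak_partial \<Omega> b (f i)))\<^sup>2 = (?n (g i b))\<^sup>2" by simp
  qed
  have "(\<lambda>n. D (v n)) \<longlonglongrightarrow> D f"
    unfolding Df unfolding D_def
    by (intro tendsto_sum tendsto_power L2_norm_tendsto H1_weak_partial(2) vH g)
  moreover have "(\<lambda>n. R + 1 / real (Suc n)) \<longlonglongrightarrow> R + 0"
    by (intro tendsto_add tendsto_const) (use LIMSEQ_inverse_real_of_nat in \<open>simp add: inverse_eq_divide\<close>)
  moreover have "D (v n) \<le> R + 1 / real (Suc n)" for n
  proof -
    have "0 \<le> real n * E (v n)" using E0 by simp
    then show ?thesis using v(2)[of n] jR[of n] unfolding J_def by linarith
  qed
  ultimately have "D f \<le> R + 0" by (intro LIMSEQ_le) auto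
  then show ?thesis using fH by (simp add: D_def)
qed

section \<open>Continuity of translations\<close>

lemma L2_lborel_translate:
  fixes g :: "'a::euclidean_space => real"
  assumes g: "g \<in> L2 lborel"
  shows "(\<lambda>p. g (p + a)) \<in> L2 lborel" "L2_norm lborel (\<lambda>p. g (p + a)) = L2_norm lborel g"
proof -
  have [measurable]: "g \<in> borel_measurable borel" using L2_measurable[OF g] by simp
  have d: "distr lborel borel ((+) a) = (lborel :: 'a measure)" by (rule lborel_distr_plus)
  have "integrable (distr lborel borel ((+) a)) (\<lambda>p. (g p)\<^sup>2)"
    unfolding d using g by (rule L2_integrable_square)
  then have "integrable lborel (\<lambda>p. (g (a + p))\<^sup>2)" by (subst (asm) integrable_distr_eq) simp_all
  then show "(\<lambda>p. g (p + a)) \<in> L2 lborel" by (simp add: L2_def add.commute)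
  have "(LINT p|distr lborel borel ((+) a). (g p)\<^sup>2) = (LINT p|lborel. (g (a + p))\<^sup>2)"
    by (subst integral_distr) simp_all
  then show "L2_norm lborel (\<lambda>p. g (p + a)) = L2_norm lborel g"
    unfolding d by (simp add: L2_norm_def add.commute)
qed

text \<open>Truncation in the argument and in the value leaves bounded functions with bounded
  support. These are almost everywhere limits of continuous functions by
  \<open>measurable_on\<close>; clamping to the range from \<open>- k\<close> to \<open>k\<close>
  and multiplying by the plateau function \<open>c\<close> supplies a dominating function without
  changing the limit.\<close>

lemma L2_dense_compact_support:
  fixes f :: "'a::euclidean_space => real"
  assumes f: "f \<in> L2 lborel" and e: "0 < e"
  shows "\<exists>\<phi> R B. continuous_on UNIV \<phi> \<and> (\<forall>p. \<bar>\<phi> p\<bar> \<le> B) \<and> (\<forall>p. norm p > R \<longrightarrow> \<phi> p = 0) \<and> \<phi> \<in> L2 lborel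
    \<and> L2_norm lborel (\<lambda>p. f p - \<phi> p) < e"
proof -
  have fm [measurable]: "f \<in> borel_measurable borel" using L2_measurable[OF f] by simp
  define t where "t k p = (if norm p \<le> real k \<and> \<bar>f p\<bar> \<le> real k then f p else 0)" for k p
  have tm [measurable]: "t k \<in> borel_measurable borel" for k unfolding t_def[abs_def] by measurable
  have tb: "\<bar>t k p\<bar> \<le> \<bar>f p\<bar>" "\<bar>t k p\<bar> \<le> real k" "norm p > real k ==> t k p = 0" for k p by (auto simp: t_def)
  have t2: "t k \<in> L2 lborel" for k using tb by (intro L2_bound[OF f]) auto
  have "(\<lambda>k. LINT p|lborel. (f p - t k p)\<^sup>2) \<longlonglongrightarrow> (LINT p|(lborel :: 'a measure). 0)"
  proof (rule integral_dominated_convergence[where w = "\<lambda>p. (f p)\<^sup>2"])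
    show "integrable lborel (\<lambda>p. (f p)\<^sup>2)" by (rule L2_integrable_square[OF f])
    show "AE p in lborel. norm ((f p - t k p)\<^sup>2) \<le> (f p)\<^sup>2" for k by (auto simp: t_def)
    show "AE p in lborel. (\<lambda>k. (f p - t k p)\<^sup>2) \<longlonglongrightarrow> 0"
    proof (intro AE_I2 tendsto_eventually)
      fix p
      obtain K :: nat where K: "max (norm p) \<bar>f p\<bar> < real K" using reals_Archimedean2 by blast
      have "(f p - t k p)\<^sup>2 = 0" if "k \<ge> K" for k
      proof -
        have "norm p \<le> real k" "\<bar>f p\<bar> \<le> real k" using K that by auto
        then show ?thesis by (simp add: t_def)
      qed
      then show "\<forall>\<^sub>F k in sequentially. (f p - t k p)\<^sup>2 = 0" unfolding eventually_sequentially by blast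
    qed
  qed auto
  then have "(\<lambda>k. L2_norm lborel (\<lambda>p. f p - t k p)) \<longlonglongrightarrow> 0"
    unfolding L2_norm_def using tendsto_real_sqrt by fastforce
  then obtain k where k: "L2_norm lborel (\<lambda>p. f p - t k p) < e / 2"
    using order_tendstoD(2)[of _ 0 sequentially "e/2"] e by (auto simp: eventually_sequentially)
  have "t k \<in> borel_measurable (lebesgue_on UNIV)"
    using measurable_completion[of "t k" lborel borel] by simp
  then have "t k measurable_on UNIV" by (simp add: measurable_on_iff_borel_measurable)
  then obtain N g where N: "negligible N" "\<And>n. continuous_on UNIV (g n)" "\<And>p. p \<notin> N ==> (\<lambda>n. g n p) \<longlonglongrightarrow> t k p"
    unfolding measurable_on_def by (auto simp: cong: if_cong)
  define c where "c p = max 0 (min 1 (real k + 1 - norm p))" for p :: 'a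
  define \<phi> where "\<phi> n p = max (- real k) (min (real k) (g n p)) * c p" for n p
  have cb: "0 \<le> c p" "c p \<le> 1" "norm p \<ge> real k + 1 ==> c p = 0" "norm p \<le> real k ==> c p = 1" for p by (auto simp: c_def)
  have \<phi>c: "continuous_on UNIV (\<phi> n)" for n
    unfolding \<phi>_def[abs_def] c_def by (intro continuous_intros N(2))
  have \<phi>b: "\<bar>\<phi> n p\<bar> \<le> real k" for n p
  proof -
    have "\<bar>max (- real k) (min (real k) (g n p))\<bar> * \<bar>c p\<bar> \<le> real k * 1"
      using cb[of p] by (intro mult_mono) auto
    then show ?thesis by (simp add: \<phi>_def abs_mult)
  qed
  have \<phi>0: "\<phi> n p = 0" if "norm p > real k + 1" for n p using cb(3)[of p] that by (simp add: \<phi>_def)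
  have \<phi>m [measurable]: "\<phi> n \<in> borel_measurable borel" for n by (rule borel_measurable_continuous_onI[OF \<phi>c])
  have bint: "integrable lborel (\<lambda>p. C * indicator (cball (0::'a) (real k + 1)) p)" for C :: real
    using emeasure_lborel_cball_finite[of "0::'a" "real k + 1"] by (intro integrable_mult_right) simp
  have sqle: "x\<^sup>2 \<le> C\<^sup>2" if "\<bar>x\<bar> \<le> C" for x C :: real
  proof -
    have "\<bar>x\<bar> \<le> \<bar>C\<bar>" using that by linarith
    then show ?thesis by (simp only: abs_le_square_iff)
  qed
  have \<phi>2: "\<phi> n \<in> L2 lborel" for n
  proof -
    have "integrable lborel (\<lambda>p. (\<phi> n p)\<^sup>2)"
    proof (rule Bochner_Integration.integrable_bound[OF bint[of "(real k)\<^sup>2"]])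
      show "AE p in lborel. norm ((\<phi> n p)\<^sup>2) \<le> norm ((real k)\<^sup>2 * indicator (cball (0::'a) (real k + 1)) p)"
      proof (rule AE_I2)
        fix p
        show "norm ((\<phi> n p)\<^sup>2) \<le> norm ((real k)\<^sup>2 * indicator (cball (0::'a) (real k + 1)) p)"
          using \<phi>0[of p n] sqle[OF \<phi>b[of n p]] by (cases "norm p > real k + 1") auto
      qed
    qed auto
    then show ?thesis by (simp add: L2_def)
  qed
  have "(\<lambda>n. LINT p|lborel. (t k p - \<phi> n p)\<^sup>2) \<longlonglongrightarrow> (LINT p|(lborel :: 'a measure). 0)"
  proof (rule integral_dominated_convergence[where w = "\<lambda>p. (2 * real k)\<^sup>2 * indicator (cball (0::'a) (real k + 1)) p"])
    show "AE p in lborel. norm ((t k p - \<phi> n p)\<^sup>2) \<le> (2 * real k)\<^sup>2 * indicator (cball (0::'a) (real k + 1)) p" for n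
    proof (rule AE_I2)
      fix p
      have "\<bar>t k p - \<phi> n p\<bar> \<le> 2 * real k" using tb(2)[of k p] \<phi>b[of n p] by linarith
      from sqle[OF this] show "norm ((t k p - \<phi> n p)\<^sup>2) \<le> (2 * real k)\<^sup>2 * indicator (cball (0::'a) (real k + 1)) p"
        using \<phi>0[of p n] tb(3)[of k p] by (cases "norm p > real k + 1") auto
    qed
    have Nae: "AE p in lborel. p \<notin> N"
    proof -
      have "AE p in lebesgue. p \<notin> N" using N(1) by (intro AE_not_in) (simp only: negligible_iff_null_sets)
      then show ?thesis by (simp add: AE_completion_iff)
    qed
    then show "AE p in lborel. (\<lambda>n. (t k p - \<phi> n p)\<^sup>2) \<longlonglongrightarrow> 0"
    proof eventually_elim
      case (elim p)
      have "(\<lambda>n. (t k p - \<phi> n p)\<^sup>2) \<longlonglongrightarrow> (t k p - max (- real k) (min (real k) (t k p)) * c p)\<^sup>2"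
        unfolding \<phi>_def by (intro tendsto_intros N(3)[OF elim])
      moreover have "max (- real k) (min (real k) (t k p)) * c p = t k p"
        using tb(2)[of k p] tb(3)[of k p] cb(4)[of p] by (cases "norm p \<le> real k") (auto simp: max_def min_def)
      ultimately show ?case by simp
    qed
  qed (use bint in auto)
  then have "(\<lambda>n. L2_norm lborel (\<lambda>p. t k p - \<phi> n p)) \<longlonglongrightarrow> 0"
    unfolding L2_norm_def using tendsto_real_sqrt by fastforce
  then obtain n where n: "L2_norm lborel (\<lambda>p. t k p - \<phi> n p) < e / 2"
    using order_tendstoD(2)[of _ 0 sequentially "e/2"] e by (auto simp: eventually_sequentially)
  have "L2_norm lborel (\<lambda>p. (f p - t k p) + (t k p - \<phi> n p)) \<le> L2_norm lborel (\<lambda>p. f p - t k p) + L2_norm lborel (\<lambda>p. t k p - \<phi> n p)"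
    by (intro L2_norm_triangle L2_diff f t2 \<phi>2)
  then have "L2_norm lborel (\<lambda>p. f p - \<phi> n p) < e" using k n by simp
  then show ?thesis using \<phi>c[of n] \<phi>b[of n] \<phi>0[of _ n] \<phi>2[of n] by blast
qed

text \<open>After replacing \<open>f\<close> by a continuous \<open>\<phi>\<close> of bounded
  support, translation invariance moves the shift from \<open>g\<close> to \<open>\<phi>\<close>,
  where pointwise convergence and domination are evident.\<close>

lemma L2_translation_continuous:
  fixes f g :: "'a::euclidean_space => real"
  assumes f: "f \<in> L2 lborel" and g: "g \<in> L2 lborel" and a: "a \<longlonglongrightarrow> 0"
  shows "(\<lambda>n. LINT p|lborel. f p * g (p + a n)) \<longlonglongrightarrow> (LINT p|lborel. f p * g p)"
proof (rule LIMSEQ_I)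
  fix e :: real assume e: "0 < e"
  \<comment> \<open>The error budget is \<open>e / 4\<close> for each of the two replacements of
    \<open>f\<close> by \<open>\<phi>\<close> and \<open>e / 2\<close> for the limit; the summand 1
    makes \<open>K\<close> a positive divisor.\<close>
  define K where "K = L2_norm lborel g + 1"
  have K: "0 < K" "L2_norm lborel g \<le> K" using L2_norm_nonneg[of lborel g] by (simp_all add: K_def)
  have "0 < e / (4 * K)" using e K by simp
  from L2_dense_compact_support[OF f this] obtain \<phi> R B where
    \<phi>: "continuous_on UNIV \<phi>" "\<And>p. \<bar>\<phi> p\<bar> \<le> B" "\<And>p. norm p > R ==> \<phi> p = 0" "\<phi> \<in> L2 lborel"
    and d: "L2_norm lborel (\<lambda>p. f p - \<phi> p) < e / (4 * K)" by blast
  note [measurable] = L2_measurable[OF g, simplified] L2_measurable[OF f, simplified] borel_measurable_continuous_onI[OF \<phi>(1)]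
  have B: "0 \<le> B" using \<phi>(2)[of 0] by linarith
  have shift: "(LINT p|lborel. \<phi> p * g (p + b)) = (LINT p|lborel. \<phi> (p - b) * g p)" for b
  proof -
    have "(LINT p|lborel. \<phi> (p - b) * g p) = (LINT p|distr lborel borel ((+) b). \<phi> (p - b) * g p)"
      by (simp only: lborel_distr_plus)
    also have "\<dots> = (LINT p|lborel. \<phi> p * g (p + b))" by (subst integral_distr) (simp_all add: add.commute)
    finally show ?thesis by simp
  qed
  have "(\<lambda>n. LINT p|lborel. \<phi> (p - a n) * g p) \<longlonglongrightarrow> (LINT p|lborel. \<phi> (p - 0) * g p)"
  proof -
    obtain n0 where n0: "\<And>n. n \<ge> n0 ==> norm (a n) < 1" using LIMSEQ_D[OF a, of 1] by auto
    have "(\<lambda>n. LINT p|lborel. \<phi> (p - a (n + n0)) * g p) \<longlonglongrightarrow> (LINT p|lborel. \<phi> (p - 0) * g p)"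
    proof (rule integral_dominated_convergence[where w = "\<lambda>p. B * (indicator (cball (0::'a) (R + 1)) p * \<bar>g p\<bar>)"])
      have "(\<lambda>p. (indicat_real (cball (0::'a) (R + 1)) p)\<^sup>2) = indicat_real (cball 0 (R + 1))"
        by (auto simp: indicator_def)
      then have "(\<lambda>p. indicat_real (cball (0::'a) (R + 1)) p) \<in> L2 lborel"
        using emeasure_lborel_cball_finite[of "0::'a" "R + 1"] by (auto simp: L2_def intro!: borel_measurable_indicator)
      moreover have "(\<lambda>p. \<bar>g p\<bar>) \<in> L2 lborel" by (rule L2_bound[OF g]) auto
      ultimately show "integrable lborel (\<lambda>p. B * (indicator (cball (0::'a) (R + 1)) p * \<bar>g p\<bar>))"
        by (intro integrable_mult_right L2_integrable_mult)
      show "AE p in lborel. (\<lambda>n. \<phi> (p - a (n + n0)) * g p) \<longlonglongrightarrow> \<phi> (p - 0) * g p"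
      proof (intro AE_I2 tendsto_mult tendsto_const)
        fix p
        have "(\<lambda>n. p - a (n + n0)) \<longlonglongrightarrow> p - 0" by (intro tendsto_diff tendsto_const LIMSEQ_ignore_initial_segment a)
        moreover have "isCont \<phi> (p - 0)" using \<phi>(1) by (simp add: continuous_on_eq_continuous_at)
        ultimately show "(\<lambda>n. \<phi> (p - a (n + n0))) \<longlonglongrightarrow> \<phi> (p - 0)" by (rule isCont_tendsto_compose[rotated])
      qed
      show "AE p in lborel. norm (\<phi> (p - a (n + n0)) * g p) \<le> B * (indicator (cball (0::'a) (R + 1)) p * \<bar>g p\<bar>)" for n
      proof (rule AE_I2)
        fix p
        show "norm (\<phi> (p - a (n + n0)) * g p) \<le> B * (indicator (cball (0::'a) (R + 1)) p * \<bar>g p\<bar>)"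
        proof (cases "p \<in> cball 0 (R + 1)")
          case True
          then show ?thesis using mult_right_mono[OF \<phi>(2)[of "p - a (n + n0)"] abs_ge_zero[of "g p"]] by (simp add: abs_mult)
        next
          case False
          have "norm p \<le> norm (p - a (n + n0)) + norm (a (n + n0))" using norm_triangle_ineq[of "p - a (n + n0)" "a (n + n0)"] by simp
          then have "norm (p - a (n + n0)) > R" using False n0[of "n + n0"] by simp
          then show ?thesis using \<phi>(3) B by simp
        qed
      qed
    qed auto
    then show ?thesis by (rule LIMSEQ_offset)
  qed
  then obtain n1 where n1: "\<And>n. n \<ge> n1 ==> \<bar>(LINT p|lborel. \<phi> p * g (p + a n)) - (LINT p|lborel. \<phi> p * g p)\<bar> < e / 2"
    using LIMSEQ_D[of _ _ "e / 2"] e by (fastforce simp: shift)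
  have "\<bar>(LINT p|lborel. f p * g (p + b)) - (LINT p|lborel. \<phi> p * g (p + b))\<bar> \<le> e / 4" for b
  proof -
    note g' = L2_lborel_translate[OF g, of b]
    have "(LINT p|lborel. f p * g (p + b)) - (LINT p|lborel. \<phi> p * g (p + b)) = (LINT p|lborel. (f p - \<phi> p) * g (p + b))"
      using L2_integrable_mult[OF f g'(1)] L2_integrable_mult[OF \<phi>(4) g'(1)] by (simp add: left_diff_distrib)
    also have "\<bar>\<dots>\<bar> \<le> L2_norm lborel (\<lambda>p. f p - \<phi> p) * L2_norm lborel (\<lambda>p. g (p + b))"
      by (intro L2_Cauchy_Schwarz L2_diff f \<phi> g')
    also have "\<dots> \<le> e / (4 * K) * K"
      unfolding g'(2) using d K e by (intro mult_mono) (auto simp: L2_norm_nonneg)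
    finally show ?thesis using K by simp
  qed
  note close = this
  have "norm ((LINT p|lborel. f p * g (p + a n)) - (LINT p|lborel. f p * g p)) < e" if "n \<ge> n1" for n
    using close[of "a n"] close[of 0, simplified] n1[OF that] by (simp only: real_norm_def) argo
  then show "\<exists>no. \<forall>n\<ge>no. norm ((LINT p|lborel. f p * g (p + a n)) - (LINT p|lborel. f p * g p)) < e" by blast
qed

section \<open>The chain rule inequality in time\<close>

lemma section_L2:
  fixes F :: "real \<times> 'a::euclidean_space => real"
  assumes F: "F \<in> L2 lborel"
  shows "AE t in lborel. (\<lambda>x. F (t, x)) \<in> L2 lborel"
    "integrable lborel (\<lambda>t. LINT x|lborel. (F (t, x))\<^sup>2)"
    "(LINT t|lborel. LINT x|lborel. (F (t, x))\<^sup>2) = (L2_norm lborel F)\<^sup>2"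
proof -
  have [measurable]: "F \<in> borel_measurable (lborel \<Otimes>\<^sub>M lborel)" using L2_measurable[OF F] by (simp add: lborel_prod)
  have i: "integrable (lborel \<Otimes>\<^sub>M lborel) (\<lambda>p. (F p)\<^sup>2)" using L2_integrable_square[OF F] by (simp add: lborel_prod)
  have "AE t in lborel. integrable lborel (\<lambda>x. (F (t, x))\<^sup>2)" by (rule lborel_pair.AE_integrable_fst'[OF i])
  then show "AE t in lborel. (\<lambda>x. F (t, x)) \<in> L2 lborel" by (simp add: L2_def)
  show "integrable lborel (\<lambda>t. LINT x|lborel. (F (t, x))\<^sup>2)" by (rule lborel_pair.integrable_fst'[OF i])
  show "(LINT t|lborel. LINT x|lborel. (F (t, x))\<^sup>2) = (L2_norm lborel F)\<^sup>2"
    using lborel_pair.integral_fst'[OF i] by (simp add: lborel_prod L2_norm_sq)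
qed

lemma integral_mult_fst:
  fixes F H :: "real \<times> 'a::euclidean_space => real"
  assumes "F \<in> L2 lborel" "H \<in> L2 lborel"
  shows "integrable lborel (\<lambda>t. LINT x|lborel. F (t, x) * H (t, x))"
    "(LINT t|lborel. LINT x|lborel. F (t, x) * H (t, x)) = (LINT p|lborel. F p * H p)"
proof -
  have i: "integrable (lborel \<Otimes>\<^sub>M lborel) (\<lambda>p. F p * H p)" using L2_integrable_mult[OF assms] by (simp add: lborel_prod)
  show "integrable lborel (\<lambda>t. LINT x|lborel. F (t, x) * H (t, x))" by (rule lborel_pair.integrable_fst'[OF i])
  show "(LINT t|lborel. LINT x|lborel. F (t, x) * H (t, x)) = (LINT p|lborel. F p * H p)"
    using lborel_pair.integral_fst'[OF i] by (simp add: lborel_prod)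
qed

lemma abs_integral_mult_le:
  assumes "f \<in> L2 M" "g \<in> L2 M"
  shows "\<bar>LINT x|M. f x * g x\<bar> \<le> ((LINT x|M. (f x)\<^sup>2) + (LINT x|M. (g x)\<^sup>2)) / 2"
proof -
  have "L2_norm M f * L2_norm M g \<le> ((L2_norm M f)\<^sup>2 + (L2_norm M g)\<^sup>2) / 2"
    using zero_le_power2[of "L2_norm M f - L2_norm M g"] by (simp add: power2_eq_square algebra_simps)
  then show ?thesis using L2_Cauchy_Schwarz[OF assms] by (simp add: L2_norm_sq)
qed

lemma indefinite_integral:
  fixes b :: "real => real"
  assumes b: "integrable lborel b"
  defines "\<Phi> \<equiv> \<lambda>s. LINT r|lborel. indicator {0..s} r * b r"
  shows "continuous_on UNIV \<Phi>" "0 \<le> s ==> s \<le> t ==> \<Phi> t - \<Phi> s = (LINT r|lborel. indicator {s<..t} r * b r)"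
proof -
  have i: "integrable lborel (\<lambda>r. indicator A r * b r)" if "A \<in> sets borel" for A
    using that integrable_mult_indicator[OF _ b, of A] by simp
  have [measurable]: "b \<in> borel_measurable borel" using b by simp
  show "continuous_on UNIV \<Phi>"
    unfolding continuous_on_sequentially
  proof (intro allI ballI impI; elim conjE)
    fix \<sigma> :: "nat => real" and a assume \<sigma>: "\<sigma> \<longlonglongrightarrow> a"
    have "(\<lambda>n. LINT r|lborel. indicator {0..\<sigma> n} r * b r) \<longlonglongrightarrow> (LINT r|lborel. indicator {0..a} r * b r)"
    proof (rule integral_dominated_convergence[where w = "\<lambda>r. \<bar>b r\<bar>"])
      have "AE r in lborel. r \<noteq> a" by (rule AE_lborel_singleton)
      then show "AE r in lborel. (\<lambda>n. indicator {0..\<sigma> n} r * b r) \<longlonglongrightarrow> indicator {0..a} r * b r"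
      proof eventually_elim
        case (elim r)
        then consider "r < a" | "a < r" by linarith
        then have "\<forall>\<^sub>F n in sequentially. indicat_real {0..\<sigma> n} r = indicator {0..a} r"
        proof cases
          case 1
          from order_tendstoD(1)[OF \<sigma> this] show ?thesis by eventually_elim (use 1 in \<open>auto simp: indicator_def\<close>)
        next
          case 2
          from order_tendstoD(2)[OF \<sigma> this] show ?thesis by eventually_elim (use 2 in \<open>auto simp: indicator_def\<close>)
        qed
        then show ?case by (intro tendsto_mult tendsto_const tendsto_eventually)
      qed
    qed (use b in \<open>auto simp: indicator_def\<close>)
    then show "(\<Phi> \<circ> \<sigma>) \<longlonglongrightarrow> \<Phi> a" by (simp add: \<Phi>_def comp_def)
  qed
  show "\<Phi> t - \<Phi> s = (LINT r|lborel. indicator {s<..t} r * b r)" if "0 \<le> s" "s \<le> t"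
  proof -
    have "\<Phi> t - \<Phi> s = (LINT r|lborel. indicator {0..t} r * b r - indicator {0..s} r * b r)"
      unfolding \<Phi>_def by (rule Bochner_Integration.integral_diff[symmetric]) (auto intro: i)
    also have "\<dots> = (LINT r|lborel. indicator {s<..t} r * b r)"
      using that by (intro Bochner_Integration.integral_cong refl) (auto simp: indicator_def)
    finally show ?thesis .
  qed
qed

lemma integrable_indicat_real_bounded:
  fixes S :: "real set"
  assumes "bounded S" "S \<in> sets borel"
  shows "integrable lborel (indicat_real S)"
  using assms emeasure_bounded_finite[OF assms(1)] by (intro integrable_real_indicator) auto

lemma AE_lborel_shift:
  fixes h :: real
  assumes "AE t in lborel. Q t"
  shows "AE t in lborel. Q (t - h)"
proof -
  from AE_E[OF assms] obtain S where S: "{x. \<not> Q x} \<subseteq> S" "emeasure lborel S = 0" "S \<in> sets borel" by auto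
  have "AE t in lborel. t \<notin> S" using S by (intro AE_not_in) (auto simp: null_sets_def)
  then have "AE t in lborel. - h + 1 * t \<notin> S" using S(3) by (intro AE_borel_affine) auto
  then show ?thesis by eventually_elim (use S(1) in auto)
qed

locale time_chain =
  fixes N :: nat and T Mf :: real and \<Xi> Z :: "nat => real \<times> 'a::euclidean_space => real" and f :: "real => real" and G :: "real set"
    and P :: "real => real => real"
  assumes \<Xi>: "i < N ==> \<Xi> i \<in> L2 lborel" and Z: "i < N ==> Z i \<in> L2 lborel"
    and G: "G \<in> sets borel" "G \<subseteq> {0<..<T}" "AE t in lborel. t \<in> {0<..<T} \<longrightarrow> t \<in> G"
    and fb: "t \<in> G ==> \<bar>f t\<bar> \<le> Mf"
    and P: "P t s = (\<Sum>i<N. LINT r|lborel. indicator {0..s} r * (LINT x|lborel. \<Xi> i (t, x) * Z i (r, x)))"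
    and sec: "t \<in> G ==> i < N ==> (\<lambda>x. \<Xi> i (t, x)) \<in> L2 lborel"
    and sub: "t \<in> G ==> s \<in> insert 0 G ==> f t - f s \<le> P t t - P t s"
begin

definition k where "k i t r = (LINT x|lborel. \<Xi> i (t, x) * Z i (r, x))"
text \<open>Young's inequality bounds the pairings \<open>k i t r\<close>, summed over
  \<open>i\<close>, by \<open>\<alpha> t + \<beta> r\<close>. The primitives \<open>A\<close> and
  \<open>B\<close> are continuous, so error terms over short intervals vanish.\<close>

definition \<alpha> where "\<alpha> t = (\<Sum>i<N. LINT x|lborel. (\<Xi> i (t, x))\<^sup>2) / 2"
definition \<beta> where "\<beta> t = (\<Sum>i<N. LINT x|lborel. (Z i (t, x))\<^sup>2) / 2"
definition A where "A s = (LINT r|lborel. indicator {0..s} r * \<alpha> r)"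
definition B where "B s = (LINT r|lborel. indicator {0..s} r * \<beta> r)"
definition fG where "fG t = (if t \<in> G then f t else 0)"

lemma meas [measurable]:
  "i < N ==> \<Xi> i \<in> borel_measurable (borel \<Otimes>\<^sub>M borel)" "i < N ==> Z i \<in> borel_measurable (borel \<Otimes>\<^sub>M borel)"
  using L2_measurable[OF \<Xi>] L2_measurable[OF Z] by (simp_all add: borel_prod)

lemma k_measurable: "i < N ==> (\<lambda>(t, r). k i t r) \<in> borel_measurable (borel \<Otimes>\<^sub>M borel)"
proof -
  assume i: "i < N"
  note [measurable] = meas[OF i]
  have "(\<lambda>p. LINT x|lborel. \<Xi> i (fst p, x) * Z i (snd p, x)) \<in> borel_measurable (borel \<Otimes>\<^sub>M borel)"
    by (rule lborel.borel_measurable_lebesgue_integral) measurable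
  then show ?thesis by (simp add: k_def split_def)
qed

lemma int_alpha: "integrable lborel \<alpha>" and int_beta: "integrable lborel \<beta>"
  unfolding \<alpha>_def[abs_def] \<beta>_def[abs_def]
  by (intro integrable_divide Bochner_Integration.integrable_sum section_L2(2)[OF \<Xi>] section_L2(2)[OF Z]; simp)+

lemma beta_nonneg: "0 \<le> \<beta> t" and alpha_nonneg: "0 \<le> \<alpha> t"
  unfolding \<alpha>_def \<beta>_def by (auto intro!: sum_nonneg divide_nonneg_pos)

lemma Z_sections: "AE r in lborel. \<forall>i<N. (\<lambda>x. Z i (r, x)) \<in> L2 lborel"
  using section_L2(1)[OF Z] by (simp add: AE_all_countable)

lemma k_bound:
  assumes "i < N" "(\<lambda>x. \<Xi> i (t, x)) \<in> L2 lborel" "(\<lambda>x. Z i (r, x)) \<in> L2 lborel"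
  shows "\<bar>k i t r\<bar> \<le> ((LINT x|lborel. (\<Xi> i (t, x))\<^sup>2) + (LINT x|lborel. (Z i (r, x))\<^sup>2)) / 2"
  unfolding k_def by (rule abs_integral_mult_le[OF assms(2,3)])

lemma k_integrable:
  assumes t: "t \<in> G" and i: "i < N" and S: "S \<in> sets borel" "bounded S"
  shows "integrable lborel (\<lambda>r. indicator S r * k i t r)"
proof -
  let ?a = "LINT x|lborel. (\<Xi> i (t, x))\<^sup>2" and ?b = "\<lambda>r. LINT x|lborel. (Z i (r, x))\<^sup>2"
  have fin: "emeasure lborel S < \<infinity>" using emeasure_bounded_finite[OF S(2)] by simp
  have [measurable]: "(\<lambda>r. k i t r) \<in> borel_measurable borel"
    using measurable_compose[OF _ k_measurable[OF i], of "\<lambda>r. (t, r)" borel] by simp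
  have bi: "integrable lborel (\<lambda>r. indicator S r * ((?a + ?b r) / 2))"
  proof -
    have "integrable lborel (\<lambda>r. indicator S r * (?a / 2) + indicator S r * (?b r / 2))"
      using S fin integrable_mult_indicator[OF _ section_L2(2)[OF Z[OF i]], of S]
      by (intro Bochner_Integration.integrable_add) (auto simp: integrable_mult_left)
    then show ?thesis by (simp add: distrib_left add_divide_distrib)
  qed
  show ?thesis
  proof (rule Bochner_Integration.integrable_bound[OF bi])
    show "AE r in lborel. norm (indicator S r * k i t r) \<le> norm (indicator S r * ((?a + ?b r) / 2))"
      using Z_sections
    proof eventually_elim
      case (elim r)
      then show ?case using k_bound[OF i sec[OF t i], of r] i by (cases "r \<in> S") auto
    qed
  qed (use S in measurable)
qed

lemma P_diff:
  assumes t: "t \<in> G" and s: "0 \<le> s" "s \<le> s'"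
  shows "P t s' - P t s = (\<Sum>i<N. LINT r|lborel. indicator {s<..s'} r * k i t r)"
proof -
  have "(LINT r|lborel. indicator {0..s'} r * k i t r) - (LINT r|lborel. indicator {0..s} r * k i t r)
      = (LINT r|lborel. indicator {s<..s'} r * k i t r)" if i: "i < N" for i
  proof -
    have "(LINT r|lborel. indicator {0..s'} r * k i t r) - (LINT r|lborel. indicator {0..s} r * k i t r)
       = (LINT r|lborel. indicator {0..s'} r * k i t r - indicator {0..s} r * k i t r)"
      by (intro Bochner_Integration.integral_diff[symmetric] k_integrable t i) auto
    also have "\<dots> = (LINT r|lborel. indicator {s<..s'} r * k i t r)"
      using s by (intro Bochner_Integration.integral_cong refl) (auto simp: indicator_def)
    finally show ?thesis .
  qed
  then show ?thesis unfolding P k_def[symmetric] sum_subtractf[symmetric] by (intro sum.cong) auto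
qed

lemma P_bound:
  assumes t: "t \<in> G" and s: "0 \<le> s" "s \<le> s'"
  shows "\<bar>P t s' - P t s\<bar> \<le> (s' - s) * \<alpha> t + (B s' - B s)"
proof -
  have "\<bar>LINT r|lborel. indicator {s<..s'} r * k i t r\<bar>
      \<le> (s' - s) * ((LINT x|lborel. (\<Xi> i (t, x))\<^sup>2) / 2) + (LINT r|lborel. indicator {s<..s'} r * ((LINT x|lborel. (Z i (r, x))\<^sup>2) / 2))" if i: "i < N" for i
  proof -
    let ?a = "LINT x|lborel. (\<Xi> i (t, x))\<^sup>2" and ?b = "\<lambda>r. LINT x|lborel. (Z i (r, x))\<^sup>2"
    have ki: "integrable lborel (\<lambda>r. indicator {s<..s'} r * k i t r)" by (rule k_integrable[OF t i]) auto
    have i1: "integrable lborel (\<lambda>r. indicator {s<..s'} r * (?a / 2))" by (rule integrable_mult_left) (simp add: integrable_indicat_real_bounded)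
    have i2: "integrable lborel (\<lambda>r. indicator {s<..s'} r * (?b r / 2))"
      using integrable_mult_indicator[OF _ integrable_divide[OF section_L2(2)[OF Z[OF i]], of 2], of "{s<..s'}"] by simp
    have "\<bar>LINT r|lborel. indicator {s<..s'} r * k i t r\<bar> \<le> (LINT r|lborel. \<bar>indicator {s<..s'} r * k i t r\<bar>)"
      by (rule integral_abs_bound)
    also have "\<dots> \<le> (LINT r|lborel. indicator {s<..s'} r * (?a / 2) + indicator {s<..s'} r * (?b r / 2))"
    proof (rule integral_mono_AE)
      show "AE r in lborel. \<bar>indicator {s<..s'} r * k i t r\<bar> \<le> indicator {s<..s'} r * (?a / 2) + indicator {s<..s'} r * (?b r / 2)"
        using Z_sections
      proof eventually_elim
        case (elim r)
        then show ?case using k_bound[OF i sec[OF t i], of r] i by (cases "r \<in> {s<..s'}") (auto simp: add_divide_distrib)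
      qed
    qed (use ki i1 i2 in auto)
    also have "\<dots> = (s' - s) * (?a / 2) + (LINT r|lborel. indicator {s<..s'} r * (?b r / 2))"
      using i1 i2 s by simp
    finally show ?thesis .
  qed
  then have "\<bar>P t s' - P t s\<bar> \<le> (\<Sum>i<N. (s' - s) * ((LINT x|lborel. (\<Xi> i (t, x))\<^sup>2) / 2)
      + (LINT r|lborel. indicator {s<..s'} r * ((LINT x|lborel. (Z i (r, x))\<^sup>2) / 2)))"
    unfolding P_diff[OF assms] by (intro order_trans[OF sum_abs] sum_mono) auto
  also have "\<dots> = (s' - s) * \<alpha> t + (\<Sum>i<N. LINT r|lborel. indicator {s<..s'} r * ((LINT x|lborel. (Z i (r, x))\<^sup>2) / 2))"
    by (simp add: sum.distrib \<alpha>_def sum_distrib_left sum_divide_distrib)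
  also have "(\<Sum>i<N. LINT r|lborel. indicator {s<..s'} r * ((LINT x|lborel. (Z i (r, x))\<^sup>2) / 2))
     = (LINT r|lborel. (\<Sum>i<N. indicator {s<..s'} r * ((LINT x|lborel. (Z i (r, x))\<^sup>2) / 2)))"
  proof (rule Bochner_Integration.integral_sum[symmetric])
    fix i assume "i \<in> {..<N}"
    then show "integrable lborel (\<lambda>r. indicator {s<..s'} r * ((LINT x|lborel. (Z i (r, x))\<^sup>2) / 2))"
      using integrable_mult_indicator[OF _ integrable_divide[OF section_L2(2)[OF Z], of i 2], of "{s<..s'}"] by simp
  qed
  also have "\<dots> = (LINT r|lborel. indicator {s<..s'} r * \<beta> r)"
    by (simp add: \<beta>_def sum_distrib_left sum_divide_distrib)
  also have "\<dots> = B s' - B s" unfolding B_def by (rule indefinite_integral(2)[OF int_beta s, symmetric])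
  finally show ?thesis .
qed

lemma G_pos: "t \<in> insert 0 G ==> 0 \<le> t"
  using G(2) by auto

lemma B_mono: "0 \<le> s ==> s \<le> t ==> B s \<le> B t"
proof -
  assume st: "0 \<le> s" "s \<le> t"
  have "0 \<le> (LINT r|lborel. indicator {s<..t} r * \<beta> r)"
    by (intro Bochner_Integration.integral_nonneg mult_nonneg_nonneg beta_nonneg) simp
  then show ?thesis using indefinite_integral(2)[OF int_beta st] by (simp add: B_def)
qed

text \<open>A one-sided modulus of continuity. For fixed \<open>t\<close> the right-hand side is
  continuous in \<open>s\<close> and vanishes at \<open>s = t\<close>; it supplies the measurability
  of \<open>f\<close> and its behaviour at the end points of a time interval.\<close>

lemma sub_bound:
  assumes t: "t \<in> G" and s: "s \<in> insert 0 G"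
  shows "f t - f s \<le> \<bar>t - s\<bar> * \<alpha> t + \<bar>B t - B s\<bar>"
proof (cases "s \<le> t")
  case True
  then show ?thesis using sub[OF t s] P_bound[OF t, of s t] G_pos[OF s] B_mono[of s t] by auto
next
  case False
  then show ?thesis using sub[OF t s] P_bound[OF t, of t s] G_pos[of t] t B_mono[of t s] by auto
qed

lemma cont_AB: "continuous_on UNIV A" "continuous_on UNIV B"
  unfolding A_def[abs_def] B_def[abs_def] by (intro indefinite_integral(1) int_alpha int_beta)+

text \<open>\<open>sub_bound\<close> makes \<open>f\<close> lower semicontinuous along
  \<open>G\<close>: a value above \<open>a\<close> at \<open>t0\<close> forces values above
  \<open>a\<close> at all good times near \<open>t0\<close>. Superlevel sets are thus relatively
  open in the Borel set \<open>G\<close>.\<close>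

lemma fG_measurable [measurable]: "fG \<in> borel_measurable borel"
  unfolding borel_measurable_iff_greater
proof
  fix a
  have "{t \<in> G. a < f t} = G \<inter> (\<Union>t0\<in>G. {s. a < f t0 - (\<bar>t0 - s\<bar> * \<alpha> t0 + \<bar>B t0 - B s\<bar>)})"
    using sub_bound by (auto intro: less_le_trans) (smt (verit) sub_bound insertCI)+
  also have "\<dots> \<in> sets borel"
  proof -
    have "open {s. a < f t0 - (\<bar>t0 - s\<bar> * \<alpha> t0 + \<bar>B t0 - B s\<bar>)}" for t0
      by (intro open_Collect_less continuous_intros cont_AB)
    then have "open (\<Union>t0\<in>G. {s. a < f t0 - (\<bar>t0 - s\<bar> * \<alpha> t0 + \<bar>B t0 - B s\<bar>)})" by (intro open_UN) auto
    then show ?thesis using G(1) by (intro sets.Int) auto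
  qed
  finally have m: "{t \<in> G. a < f t} \<in> sets borel" .
  have "{t \<in> space borel. a < fG t} = (if a < 0 then {t \<in> G. a < f t} \<union> - G else {t \<in> G. a < f t})"
    by (auto simp: fG_def)
  then show "{t \<in> space borel. a < fG t} \<in> sets borel" using m G(1) by auto
qed

lemma fG_bound: "\<bar>fG t\<bar> \<le> \<bar>Mf\<bar>"
  using fb[of t] by (auto simp: fG_def)

lemma fG_integrable: "bounded S ==> S \<in> sets borel ==> integrable lborel (\<lambda>t. indicator S t * fG t)"
  using emeasure_bounded_finite[of S] fG_bound
  by (intro integrableI_bounded_set[where A = S and B = "\<bar>Mf\<bar>"]) auto

lemma AE_G: "AE t in lborel. 0 < t \<and> t < T \<longrightarrow> t \<in> G"
  using G(3) by simp

section \<open>Averaging over small time steps between \<open>t1\<close> and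
  \<open>t2\<close>\<close>

context
  fixes t1 t2 :: real assumes t1: "t1 \<in> insert 0 G" and t2: "t2 \<in> G" and lt: "t1 < t2"
begin

lemma t12: "0 \<le> t1" "t2 < T"
  using G_pos[OF t1] G(2) t2 by auto

text \<open>Integrand for the mean of \<open>k i t\<close> over \<open>{t - h<..t}\<close> after the
  substitution \<open>r = t - h * y\<close>. The range of \<open>y\<close> is fixed, which allows
  \<open>h\<close> to tend to 0 under the integral.\<close>

definition q where "q i h y t = indicator {t1 + h..t2} t * (indicator {0..<1} y * k i t (t - h * y))"

text \<open>Young's inequality bounds the integrand by the squared norms at times \<open>t\<close>
  and \<open>t - h * y\<close>; by translation invariance the integral of this bound over
  \<open>t\<close> is the same for all \<open>y\<close>.\<close>

lemma q_integrable:
  assumes i: "i < N" and h: "0 < h"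
  shows "integrable (lborel \<Otimes>\<^sub>M lborel) (\<lambda>(y, t). q i h y t)"
proof (rule lborel_pair.Fubini_integrable)
  let ?a = "\<lambda>t. LINT x|lborel. (\<Xi> i (t, x))\<^sup>2" and ?b = "\<lambda>r. LINT x|lborel. (Z i (r, x))\<^sup>2"
  have km: "(\<lambda>p. k i (snd p) (snd p - h * fst p)) \<in> borel_measurable (borel \<Otimes>\<^sub>M borel)"
  proof -
    have "(\<lambda>p::real\<times>real. (snd p, snd p - h * fst p)) \<in> borel \<Otimes>\<^sub>M borel \<rightarrow>\<^sub>M borel \<Otimes>\<^sub>M borel" by measurable
    from measurable_compose[OF this k_measurable[OF i]] show ?thesis by simp
  qed
  then have qm [measurable]: "(\<lambda>(y, t). q i h y t) \<in> borel_measurable (borel \<Otimes>\<^sub>M borel)"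
    unfolding q_def split_def by measurable
  then show "(\<lambda>(y, t). q i h y t) \<in> borel_measurable (lborel \<Otimes>\<^sub>M lborel)" by (simp cong: measurable_cong_sets)
  have qy [measurable]: "(\<lambda>t. q i h y t) \<in> borel_measurable borel" for y
    using measurable_compose[OF _ qm, of "\<lambda>t. (y, t)" borel] by simp
  have bi: "integrable lborel (\<lambda>t. (?a t + ?b (t - h * y)) / 2)" and bv: "(LINT t|lborel. (?a t + ?b (t - h * y)) / 2) = ((L2_norm lborel (\<Xi> i))\<^sup>2 + (L2_norm lborel (Z i))\<^sup>2) / 2" for y
  proof -
    have s: "integrable lborel (\<lambda>t. ?b (t - h * y))"
      using lborel_integrable_real_affine[OF section_L2(2)[OF Z[OF i]], of 1 "- h * y"] by (simp add: algebra_simps)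
    then show "integrable lborel (\<lambda>t. (?a t + ?b (t - h * y)) / 2)"
      by (intro integrable_divide Bochner_Integration.integrable_add section_L2(2)[OF \<Xi>[OF i]])
    have "(LINT t|lborel. ?b (t - h * y)) = (LINT t|lborel. ?b t)"
      using lborel_integral_real_affine[of 1 ?b "- h * y"] by (simp add: algebra_simps)
    then show "(LINT t|lborel. (?a t + ?b (t - h * y)) / 2) = ((L2_norm lborel (\<Xi> i))\<^sup>2 + (L2_norm lborel (Z i))\<^sup>2) / 2"
      using s section_L2(2,3)[OF \<Xi>[OF i]] section_L2(3)[OF Z[OF i]] by simp
  qed
  have qb: "AE t in lborel. norm (q i h y t) \<le> indicator {0..<1} y * ((?a t + ?b (t - h * y)) / 2)" for y
    using section_L2(1)[OF \<Xi>[OF i]] AE_lborel_shift[OF section_L2(1)[OF Z[OF i]], of "h * y"]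
  proof eventually_elim
    case (elim t)
    have "0 \<le> (?a t + ?b (t - h * y)) / 2" by simp
    then show ?case using k_bound[OF i elim] by (auto simp: q_def indicator_def)
  qed
  have qi: "integrable lborel (\<lambda>t. q i h y t)" for y
    by (rule Bochner_Integration.integrable_bound[OF integrable_mult_right[OF bi, of "indicator {0..<1} y" y]])
      (use qb[of y] in \<open>auto intro: order_trans elim: AE_mp\<close>)
  then show "AE y in lborel. integrable lborel (\<lambda>t. case (y, t) of (y, t) => q i h y t)" by simp
  let ?c = "((L2_norm lborel (\<Xi> i))\<^sup>2 + (L2_norm lborel (Z i))\<^sup>2) / 2"
  have "integrable lborel (\<lambda>y. LINT t|lborel. norm (q i h y t))"
  proof (rule Bochner_Integration.integrable_bound[of lborel "\<lambda>y. indicator {0..<1} y * ?c"])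
    show "integrable lborel (\<lambda>y. indicator {0..<1::real} y * ?c)" by (rule integrable_mult_left) simp
    show "(\<lambda>y. LINT t|lborel. norm (q i h y t)) \<in> borel_measurable lborel"
    proof -
      have "(\<lambda>y. LINT t|lborel. norm (q i h y t)) \<in> borel_measurable borel"
        by (rule lborel.borel_measurable_lebesgue_integral) (use qm in measurable)
      then show ?thesis by simp
    qed
    have "(LINT t|lborel. norm (q i h y t)) \<le> indicator {0..<1} y * ?c" for y
    proof -
      have "(LINT t|lborel. norm (q i h y t)) \<le> (LINT t|lborel. indicator {0..<1} y * ((?a t + ?b (t - h * y)) / 2))"
        by (rule integral_mono_AE[OF integrable_norm[OF qi] integrable_mult_right[OF bi] qb])
      then show ?thesis using bv[of y] by simp
    qed
    then show "AE y in lborel. norm (LINT t|lborel. norm (q i h y t)) \<le> norm (indicator {0..<1} y * ?c)"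
      by (intro AE_I2) (simp add: order_trans[OF _ abs_ge_self])
  qed
  then show "integrable lborel (\<lambda>y. LINT t|lborel. norm (case (y, t) of (y, t) => q i h y t))" by simp
qed

text \<open>For fixed \<open>y\<close> this is continuity of translations in space-time L2, applied
  to a shift in the time direction alone. Removing the initial piece \<open>{t1..<t1 + h n}\<close>
  costs an L2 norm that tends to 0, and Cauchy-Schwarz gives a bound uniform in
  \<open>y\<close>.\<close>

lemma q_limit:
  assumes i: "i < N" and h: "\<And>n. 0 < h n" "h \<longlonglongrightarrow> 0"
  shows "(\<lambda>n. LINT y|lborel. LINT t|lborel. q i (h n) y t) \<longlonglongrightarrow> (LINT r|lborel. indicator {t1..t2} r * k i r r)"
proof -
  define X where "X p = indicator {t1..t2} (fst p) * \<Xi> i p" for p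
  define X' where "X' n p = indicator {t1..<t1 + h n} (fst p) * X p" for n p
  have indm: "(\<lambda>p::real\<times>'a. indicat_real S (fst p)) \<in> borel_measurable lborel" if "S \<in> sets borel" for S
    using that by (simp add: borel_prod[symmetric])
  have X2: "X \<in> L2 lborel" unfolding X_def[abs_def]
    by (rule L2_bounded_mult[OF \<Xi>[OF i] indm, of _ 1]) (auto simp: indicator_def)
  have X'2: "X' n \<in> L2 lborel" for n unfolding X'_def[abs_def]
    by (rule L2_bounded_mult[OF X2 indm, of _ 1]) (auto simp: indicator_def)
  have XX2: "(\<lambda>p. X p - X' n p) \<in> L2 lborel" for n by (intro L2_diff X2 X'2)
  have tr: "(\<lambda>p. Z i (p + a)) \<in> L2 lborel" "L2_norm lborel (\<lambda>p. Z i (p + a)) = L2_norm lborel (Z i)" for a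
    using L2_lborel_translate[OF Z[OF i]] by auto
  define D where "D n y = (LINT p|lborel. (X p - X' n p) * Z i (p + (- h n * y, 0)))" for n y
  have qD: "(LINT t|lborel. q i (h n) y t) = indicator {0..<1} y * D n y" for n y
  proof -
    have "q i (h n) y t = indicator {0..<1} y * (LINT x|lborel. (X (t, x) - X' n (t, x)) * Z i ((t, x) + (- h n * y, 0)))" for t
    proof -
      have "(X (t, x) - X' n (t, x)) * Z i ((t, x) + (- h n * y, 0)) = indicator {t1 + h n..t2} t * (\<Xi> i (t, x) * Z i (t - h n * y, x))" for x
        using h(1)[of n] by (auto simp: X_def X'_def indicator_def)
      then have "(LINT x|lborel. (X (t, x) - X' n (t, x)) * Z i ((t, x) + (- h n * y, 0))) = indicator {t1 + h n..t2} t * k i t (t - h n * y)"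
        unfolding k_def by (subst integral_mult_right_zero[symmetric]) (rule Bochner_Integration.integral_cong[OF refl])
      then show ?thesis by (simp only: q_def mult.left_commute)
    qed
    then have "(LINT t|lborel. q i (h n) y t) = indicator {0..<1} y * (LINT t|lborel. LINT x|lborel. (X (t, x) - X' n (t, x)) * Z i ((t, x) + (- h n * y, 0)))"
      by simp
    then show ?thesis unfolding D_def by (simp only: integral_mult_fst(2)[OF XX2 tr(1)])
  qed
  have X'lim: "(\<lambda>n. L2_norm lborel (X' n)) \<longlonglongrightarrow> 0"
  proof -
    have "(\<lambda>n. LINT p|lborel. (X' n p)\<^sup>2) \<longlonglongrightarrow> (LINT p|(lborel :: (real \<times> 'a) measure). 0)"
    proof (rule integral_dominated_convergence[where w = "\<lambda>p. (X p)\<^sup>2"])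
      show "AE p in lborel. norm ((X' n p)\<^sup>2) \<le> (X p)\<^sup>2" for n by (auto simp: X'_def indicator_def)
      have "AE t in lborel. t \<noteq> t1" by (rule AE_lborel_singleton)
      then have "AE t in lborel. AE x in (lborel :: 'a measure). fst (t, x) \<noteq> t1" by eventually_elim simp
      moreover have "{p \<in> space (lborel \<Otimes>\<^sub>M lborel). fst p \<noteq> t1} \<in> sets (lborel \<Otimes>\<^sub>M (lborel :: 'a measure))" by measurable
      ultimately have "AE p in lborel \<Otimes>\<^sub>M (lborel :: 'a measure). fst p \<noteq> t1"
        by (subst lborel_pair.AE_pair_iff[symmetric]) simp_all
      then have "AE p in (lborel :: (real \<times> 'a) measure). fst p \<noteq> t1" unfolding lborel_prod .
      then show "AE p in lborel. (\<lambda>n. (X' n p)\<^sup>2) \<longlonglongrightarrow> 0"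
      proof eventually_elim
        case (elim p)
        have "\<forall>\<^sub>F n in sequentially. X' n p = 0"
        proof (cases "fst p < t1")
          case True
          then show ?thesis by (simp add: X'_def)
        next
          case False
          then have "0 < fst p - t1" using elim by simp
          from order_tendstoD(2)[OF h(2) this] show ?thesis by eventually_elim (simp add: X'_def)
        qed
        then have "\<forall>\<^sub>F n in sequentially. (X' n p)\<^sup>2 = 0" by eventually_elim simp
        then show ?case by (rule tendsto_eventually)
      qed
    qed (use L2_integrable_square[OF X2] L2_measurable[OF X'2] in auto)
    then show ?thesis unfolding L2_norm_def using tendsto_real_sqrt by fastforce
  qed
  have Dlim: "(\<lambda>n. D n y) \<longlonglongrightarrow> (LINT p|lborel. X p * Z i p)" for y
  proof -
    have "(\<lambda>n. (- h n * y, 0::'a)) \<longlonglongrightarrow> (- 0 * y, 0)" by (intro tendsto_intros h(2))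
    then have a: "(\<lambda>n. (- h n * y, 0::'a)) \<longlonglongrightarrow> 0" by (simp add: zero_prod_def)
    have "(\<lambda>n. (LINT p|lborel. X p * Z i (p + (- h n * y, 0))) - (LINT p|lborel. X' n p * Z i (p + (- h n * y, 0))))
       \<longlonglongrightarrow> (LINT p|lborel. X p * Z i p) - 0"
    proof (rule tendsto_diff[OF L2_translation_continuous[OF X2 Z[OF i] a]])
      show "(\<lambda>n. LINT p|lborel. X' n p * Z i (p + (- h n * y, 0))) \<longlonglongrightarrow> 0"
      proof (rule Lim_null_comparison)
        show "(\<lambda>n. L2_norm lborel (X' n) * L2_norm lborel (Z i)) \<longlonglongrightarrow> 0" by (rule tendsto_mult_left_zero[OF X'lim])
        show "\<forall>\<^sub>F n in sequentially. norm (LINT p|lborel. X' n p * Z i (p + (- h n * y, 0))) \<le> L2_norm lborel (X' n) * L2_norm lborel (Z i)"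
          using L2_Cauchy_Schwarz[OF X'2 tr(1)] by (intro always_eventually allI) (simp add: tr(2))
      qed
    qed
    moreover have "D n y = (LINT p|lborel. X p * Z i (p + (- h n * y, 0))) - (LINT p|lborel. X' n p * Z i (p + (- h n * y, 0)))" for n
      unfolding D_def using L2_integrable_mult[OF X2 tr(1)] L2_integrable_mult[OF X'2 tr(1)] by (simp add: left_diff_distrib)
    ultimately show ?thesis by simp
  qed
  have Xle: "L2_norm lborel (\<lambda>p. X p - X' n p) \<le> L2_norm lborel X" for n
    unfolding L2_norm_def
  proof (intro real_sqrt_le_mono integral_mono L2_integrable_square XX2 X2)
    fix p show "(X p - X' n p)\<^sup>2 \<le> (X p)\<^sup>2" by (auto simp: X'_def indicator_def)
  qed
  have Db: "\<bar>D n y\<bar> \<le> L2_norm lborel X * L2_norm lborel (Z i)" for n y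
    unfolding D_def
    by (rule order_trans[OF L2_Cauchy_Schwarz[OF XX2 tr(1)]], unfold tr(2), rule mult_right_mono[OF Xle L2_norm_nonneg])
  have "(\<lambda>n. LINT y|lborel. indicator {0..<1} y * D n y) \<longlonglongrightarrow> (LINT y|lborel. indicator {0..<1::real} y * (LINT p|lborel. X p * Z i p))"
  proof (rule integral_dominated_convergence[where w = "\<lambda>y. indicator {0..<1::real} y * (L2_norm lborel X * L2_norm lborel (Z i))"])
    show "integrable lborel (\<lambda>y. indicator {0..<1::real} y * (L2_norm lborel X * L2_norm lborel (Z i)))"
      by (rule integrable_mult_left) simp
    show "(\<lambda>y. indicator {0..<1} y * D n y) \<in> borel_measurable lborel" for n
      using lborel_pair.integrable_fst'[OF q_integrable[OF i h(1)[of n]]] by (simp add: qD[symmetric] borel_measurable_integrable)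
    show "AE y in lborel. norm (indicator {0..<1} y * D n y) \<le> indicator {0..<1} y * (L2_norm lborel X * L2_norm lborel (Z i))" for n
      using Db by (intro AE_I2) (auto simp: indicator_def)
  qed (auto intro!: tendsto_mult Dlim)
  moreover have "(LINT y|lborel. indicator {0..<1::real} y * (LINT p|lborel. X p * Z i p)) = (LINT r|lborel. indicator {t1..t2} r * k i r r)"
    using integral_mult_fst(2)[OF X2 Z[OF i]] by (simp add: X_def k_def mult.assoc)
  ultimately show ?thesis by (simp add: qD)
qed

text \<open>The assumption \<open>sub\<close> is used for the pairs \<open>t\<close> and
  \<open>t - h\<close>, almost all of which are good, and integrated over \<open>t\<close>.\<close>

lemma averaged_difference:
  assumes h: "0 < h" "t1 + h < t2"
  shows "(LINT t|lborel. indicator {t1 + h..t2} t * (fG t - fG (t - h))) \<le> h * (\<Sum>i<N. LINT y|lborel. LINT t|lborel. q i h y t)"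
proof -
  have swap: "integrable lborel (\<lambda>t. LINT y|lborel. q i h y t)" "(LINT t|lborel. LINT y|lborel. q i h y t) = (LINT y|lborel. LINT t|lborel. q i h y t)" if "i < N" for i
    using lborel_pair.integrable_snd[OF q_integrable[OF that h(1)]] lborel_pair.Fubini_integral[OF q_integrable[OF that h(1)]] by auto
  have fi: "integrable lborel (\<lambda>t. indicator {t1 + h..t2} t * fG t)" by (rule fG_integrable) auto
  have fi': "integrable lborel (\<lambda>t. indicator {t1 + h..t2} t * fG (t - h))"
  proof -
    have "integrable lborel (\<lambda>t. indicator {t1..t2 - h} (t - h) * fG (t - h))"
      using lborel_integrable_real_affine[OF fG_integrable[of "{t1..t2 - h}"], of 1 "- h"] by simp
    also have "(\<lambda>t. indicator {t1..t2 - h} (t - h) * fG (t - h)) = (\<lambda>t. indicator {t1 + h..t2} t * fG (t - h))"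
      by (auto simp: indicator_def fun_eq_iff)
    finally show ?thesis .
  qed
  have "(LINT t|lborel. indicator {t1 + h..t2} t * (fG t - fG (t - h))) \<le> (LINT t|lborel. h * (\<Sum>i<N. LINT y|lborel. q i h y t))"
  proof (rule integral_mono_AE)
    show "integrable lborel (\<lambda>t. indicator {t1 + h..t2} t * (fG t - fG (t - h)))"
      using Bochner_Integration.integrable_diff[OF fi fi'] by (simp add: right_diff_distrib)
    show "integrable lborel (\<lambda>t. h * (\<Sum>i<N. LINT y|lborel. q i h y t))"
      using swap(1) by (intro integrable_mult_right Bochner_Integration.integrable_sum) auto
    have "AE t in lborel. t \<noteq> t1 + h" by (rule AE_lborel_singleton)
    with AE_G AE_lborel_shift[OF AE_G, of h]
    show "AE t in lborel. indicator {t1 + h..t2} t * (fG t - fG (t - h)) \<le> h * (\<Sum>i<N. LINT y|lborel. q i h y t)"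
    proof eventually_elim
      case (elim t)
      show ?case
      proof (cases "t \<in> {t1 + h..t2}")
        case False
        then show ?thesis by (simp add: q_def)
      next
        case True
        then have tG: "t \<in> G" "t - h \<in> G" using elim h t12 by auto
        have "fG t - fG (t - h) \<le> P t t - P t (t - h)"
          using sub[OF tG(1), of "t - h"] tG by (simp add: fG_def)
        also have "\<dots> = (\<Sum>i<N. LINT r|lborel. indicator {t - h<..t} r * k i t r)"
          using G_pos[of "t - h"] tG h by (intro P_diff) auto
        also have "\<dots> = (\<Sum>i<N. h * (LINT y|lborel. q i h y t))"
        proof (intro sum.cong refl)
          fix i
          have "(LINT r|lborel. indicator {t - h<..t} r * k i t r) = \<bar>- h\<bar> *\<^sub>R (LINT y|lborel. indicator {t - h<..t} (t + (- h) * y) * k i t (t + (- h) * y))"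
            using h by (intro lborel_integral_real_affine) simp
          also have "(LINT y|lborel. indicator {t - h<..t} (t + (- h) * y) * k i t (t + (- h) * y)) = (LINT y|lborel. q i h y t)"
          proof (intro Bochner_Integration.integral_cong refl)
            fix y :: real
            have "t + (- h) * y \<in> {t - h<..t} \<longleftrightarrow> y \<in> {0..<1}"
              using h by (auto simp: zero_le_mult_iff mult_less_cancel_left2)
            then show "indicator {t - h<..t} (t + (- h) * y) * k i t (t + (- h) * y) = q i h y t"
              using True by (simp add: q_def indicator_def)
          qed
          finally show "(LINT r|lborel. indicator {t - h<..t} r * k i t r) = h * (LINT y|lborel. q i h y t)" using h by simp
        qed
        finally show ?thesis using True by (simp add: sum_distrib_left)
      qed
    qed
  qed
  also have "\<dots> = h * (\<Sum>i<N. LINT t|lborel. LINT y|lborel. q i h y t)"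
    using swap(1) by (simp add: Bochner_Integration.integral_sum)
  also have "\<dots> = h * (\<Sum>i<N. LINT y|lborel. LINT t|lborel. q i h y t)" using swap(2) by simp
  finally show ?thesis .
qed

text \<open>The shifted integrals cancel except near the two ends, where \<open>sub_bound\<close>
  compares the remaining averages with \<open>f t2\<close> and \<open>f t1\<close>. Near
  \<open>t2\<close> the subgradient at \<open>t2\<close> is used, near \<open>t1\<close> those at
  the nearby times, so \<open>t1 = 0\<close> is allowed.\<close>

lemma averaged_difference_lower:
  assumes h: "0 < h" "t1 + h < t2"
  shows "h * (f t2 - f t1 - (h * \<alpha> t2 + (B t2 - B (t2 - h))) - ((A (t1 + h) - A t1) + (B (t1 + h) - B t1)))
    \<le> (LINT t|lborel. indicator {t1 + h..t2} t * (fG t - fG (t - h)))"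
proof -
  have fi: "integrable lborel (\<lambda>t. indicator {a..b} t * fG t)" for a b by (rule fG_integrable) auto
  have fs: "integrable lborel (\<lambda>t. indicator {t1 + h..t2} t * fG (t - h))" "(LINT t|lborel. indicator {t1 + h..t2} t * fG (t - h)) = (LINT t|lborel. indicator {t1..t2 - h} t * fG t)"
  proof -
    have eq: "(\<lambda>t. indicator {t1..t2 - h} (t - h) * fG (t - h)) = (\<lambda>t. indicator {t1 + h..t2} t * fG (t - h))"
      by (auto simp: indicator_def fun_eq_iff)
    show "integrable lborel (\<lambda>t. indicator {t1 + h..t2} t * fG (t - h))"
      using lborel_integrable_real_affine[OF fi[of t1 "t2 - h"], of 1 "- h"] by (simp add: eq)
    show "(LINT t|lborel. indicator {t1 + h..t2} t * fG (t - h)) = (LINT t|lborel. indicator {t1..t2 - h} t * fG t)"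
      using lborel_integral_real_affine[of 1 "\<lambda>t. indicator {t1..t2 - h} t * fG t" "- h"] by (simp add: eq)
  qed
  have "(LINT t|lborel. indicator {t1 + h..t2} t * (fG t - fG (t - h)))
      = (LINT t|lborel. indicator {t1 + h..t2} t * fG t) - (LINT t|lborel. indicator {t1..t2 - h} t * fG t)"
    using fi fs by (simp add: right_diff_distrib)
  also have "\<dots> = (LINT t|lborel. indicator {t1 + h..t2} t * fG t - indicator {t1..t2 - h} t * fG t)"
    using fi by simp
  also have "\<dots> = (LINT t|lborel. indicator {t2 - h..t2} t * fG t - indicator {t1..t1 + h} t * fG t)"
  proof (rule integral_cong_AE)
    have "AE t in lborel. t \<noteq> t1 + h" "AE t in lborel. t \<noteq> t2 - h" by (rule AE_lborel_singleton)+
    then show "AE t in lborel. indicator {t1 + h..t2} t * fG t - indicator {t1..t2 - h} t * fG t = indicator {t2 - h..t2} t * fG t - indicator {t1..t1 + h} t * fG t"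
      by eventually_elim (use h in \<open>auto simp: indicator_def\<close>)
  qed auto
  also have "\<dots> = (LINT t|lborel. indicator {t2 - h..t2} t * fG t) - (LINT t|lborel. indicator {t1..t1 + h} t * fG t)"
    using fi by simp
  finally have eq: "(LINT t|lborel. indicator {t1 + h..t2} t * (fG t - fG (t - h)))
    = (LINT t|lborel. indicator {t2 - h..t2} t * fG t) - (LINT t|lborel. indicator {t1..t1 + h} t * fG t)" .
  have ci: "integrable lborel (\<lambda>t. indicator {a..b} t * c)" and cv: "a \<le> b ==> (LINT t|lborel. indicator {a..b} t * c) = (b - a) * c" for a b c :: real
    by (auto intro!: integrable_mult_left integrable_indicat_real_bounded)
  define C2 where "C2 = f t2 - (h * \<alpha> t2 + (B t2 - B (t2 - h)))"
  have up: "h * C2 \<le> (LINT t|lborel. indicator {t2 - h..t2} t * fG t)"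
  proof -
    have "(LINT t|lborel. indicator {t2 - h..t2} t * C2) \<le> (LINT t|lborel. indicator {t2 - h..t2} t * fG t)"
    proof (rule integral_mono_AE[OF ci fi])
      show "AE t in lborel. indicator {t2 - h..t2} t * C2 \<le> indicator {t2 - h..t2} t * fG t"
        using AE_G
      proof eventually_elim
        case (elim t)
        show ?case
        proof (cases "t \<in> {t2 - h..t2}")
          case True
          then have tG: "t \<in> G" using elim h t12 by auto
          have "\<bar>t2 - t\<bar> * \<alpha> t2 \<le> h * \<alpha> t2" using True by (intro mult_right_mono alpha_nonneg) auto
          moreover have "B (t2 - h) \<le> B t" "B t \<le> B t2" using True h t12 by (auto intro!: B_mono)
          ultimately have "C2 \<le> f t" using sub_bound[OF t2, of t] tG by (simp add: C2_def)
          then show ?thesis using True tG by (simp add: fG_def)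
        qed simp
      qed
    qed
    then show ?thesis using h by (simp add: cv)
  qed
  define C1 where "C1 = f t1 + (B (t1 + h) - B t1)"
  have "(LINT t|lborel. indicator {t1..t1 + h} t * fG t) \<le> h * (C1 + (A (t1 + h) - A t1))"
  proof -
    have ai: "integrable lborel (\<lambda>t. indicator {t1<..t1 + h} t * \<alpha> t)"
      using integrable_mult_indicator[OF _ int_alpha, of "{t1<..t1 + h}"] by simp
    have "(LINT t|lborel. indicator {t1..t1 + h} t * fG t) \<le> (LINT t|lborel. indicator {t1..t1 + h} t * C1 + h * (indicator {t1<..t1 + h} t * \<alpha> t))"
    proof (rule integral_mono_AE[OF fi])
      show "integrable lborel (\<lambda>t. indicator {t1..t1 + h} t * C1 + h * (indicator {t1<..t1 + h} t * \<alpha> t))"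
        by (intro Bochner_Integration.integrable_add ci integrable_mult_right ai)
      have "AE t in lborel. t \<noteq> t1" by (rule AE_lborel_singleton)
      with AE_G show "AE t in lborel. indicator {t1..t1 + h} t * fG t \<le> indicator {t1..t1 + h} t * C1 + h * (indicator {t1<..t1 + h} t * \<alpha> t)"
      proof eventually_elim
        case (elim t)
        show ?case
        proof (cases "t \<in> {t1..t1 + h}")
          case True
          then have tG: "t \<in> G" "t1 < t" using elim h t12 by auto
          have "\<bar>t - t1\<bar> * \<alpha> t \<le> h * \<alpha> t" using True by (intro mult_right_mono alpha_nonneg) auto
          moreover have "B t1 \<le> B t" "B t \<le> B (t1 + h)" using True h t12 by (auto intro!: B_mono)
          ultimately have "f t \<le> C1 + h * \<alpha> t" using sub_bound[OF tG(1) t1] by (simp add: C1_def)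
          then show ?thesis using True tG by (simp add: fG_def)
        qed (use h in auto)
      qed
    qed
    also have "\<dots> = h * C1 + h * (A (t1 + h) - A t1)"
      using ai ci h t12 by (simp add: cv indefinite_integral(2)[OF int_alpha, folded A_def])
    finally show ?thesis by (simp add: distrib_left)
  qed
  then show ?thesis using up unfolding eq C1_def C2_def by (simp add: algebra_simps)
qed

text \<open>The two estimates of the averaged difference, divided by \<open>h\<close>, in the limit
  of small \<open>h\<close>. The error terms vanish because \<open>A\<close> and \<open>B\<close>
  are continuous.\<close>

theorem chain_inequality: "f t2 - f t1 \<le> (\<Sum>i<N. LINT r|lborel. indicator {t1..t2} r * (LINT x|lborel. \<Xi> i (r, x) * Z i (r, x)))"
proof -
  \<comment> \<open>With \<open>n + 2\<close> rather than \<open>n + 1\<close> the inequality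
    \<open>t1 + h n < t2\<close> is strict already for \<open>n = 0\<close>.\<close>
  define h where "h n = (t2 - t1) / real (n + 2)" for n
  have h: "0 < h n" "t1 + h n < t2" for n
  proof -
    show p: "0 < h n" using lt by (simp add: h_def)
    have "h n * real (n + 2) = t2 - t1" by (simp add: h_def)
    moreover have "h n * 1 < h n * real (n + 2)" by (intro mult_strict_left_mono p) simp
    ultimately show "t1 + h n < t2" by simp
  qed
  have hl: "h \<longlonglongrightarrow> 0"
  proof -
    have "(\<lambda>n. (t2 - t1) * inverse (real (Suc (n + 1)))) \<longlonglongrightarrow> (t2 - t1) * 0"
      by (intro tendsto_mult tendsto_const LIMSEQ_ignore_initial_segment LIMSEQ_inverse_real_of_nat)
    then show ?thesis by (simp add: h_def[abs_def] divide_inverse)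
  qed
  define L where "L n = f t2 - f t1 - (h n * \<alpha> t2 + (B t2 - B (t2 - h n))) - ((A (t1 + h n) - A t1) + (B (t1 + h n) - B t1))" for n
  have le: "L n \<le> (\<Sum>i<N. LINT y|lborel. LINT t|lborel. q i (h n) y t)" for n
    by (rule mult_left_le_imp_le[OF _ h(1)[of n]])
      (use order_trans[OF averaged_difference_lower[OF h] averaged_difference[OF h]] in \<open>simp add: L_def\<close>)
  have cA: "(\<lambda>n. A (c + h n)) \<longlonglongrightarrow> A (c + 0)" "(\<lambda>n. B (c + h n)) \<longlonglongrightarrow> B (c + 0)" "(\<lambda>n. B (c - h n)) \<longlonglongrightarrow> B (c - 0)" for c
    by (intro continuous_on_tendsto_compose[OF cont_AB(1)] continuous_on_tendsto_compose[OF cont_AB(2)] tendsto_intros hl; simp)+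
  have "L \<longlonglongrightarrow> f t2 - f t1 - (0 * \<alpha> t2 + (B t2 - B (t2 - 0))) - ((A (t1 + 0) - A t1) + (B (t1 + 0) - B t1))"
    unfolding L_def[abs_def] by (intro tendsto_intros hl cA)
  then have "L \<longlonglongrightarrow> f t2 - f t1" by simp
  moreover have "(\<lambda>n. \<Sum>i<N. LINT y|lborel. LINT t|lborel. q i (h n) y t) \<longlonglongrightarrow> (\<Sum>i<N. LINT r|lborel. indicator {t1..t2} r * k i r r)"
    using h(1) hl by (intro tendsto_sum q_limit) auto
  ultimately have "f t2 - f t1 \<le> (\<Sum>i<N. LINT r|lborel. indicator {t1..t2} r * k i r r)"
    using le by (intro LIMSEQ_le) auto
  then show ?thesis by (simp add: k_def)
qed

end

end

section \<open>Time derivatives in the weak sense\<close>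

lemma AE_lebesgue_on_iff:
  "S \<in> sets lebesgue ==> (AE x in lebesgue_on S. Q x) \<longleftrightarrow> (AE x in lborel. x \<in> S \<longrightarrow> Q x)"
  by (simp add: AE_restrict_space_iff AE_completion_iff)

text \<open>Fubini and translation arguments run on \<open>lborel\<close>, whereas the function
  spaces refer to Lebesgue measure on a subset. A Borel function that vanishes off the set is the
  bridge between the two.\<close>

lemma borel_representative:
  fixes g h :: "'a::euclidean_space => real"
  assumes S: "S \<in> sets lebesgue" and g: "g \<in> borel_measurable borel" and z: "\<And>x. x \<notin> S ==> g x = 0"
    and eq: "AE x in lebesgue_on S. g x = h x"
  shows "h \<in> borel_measurable (lebesgue_on S)" "integrable (lebesgue_on S) h \<longleftrightarrow> integrable lborel g"
    "(LINT x|lebesgue_on S. h x) = (LINT x|lborel. g x)"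
proof -
  have gm: "g \<in> borel_measurable lborel" using g by simp
  have gl: "g \<in> borel_measurable (lebesgue_on S)" by (rule measurable_restrict_space1[OF measurable_completion[OF gm]])
  show hm: "h \<in> borel_measurable (lebesgue_on S)" by (rule borel_measurable_lebesgue_on_AE[OF gl eq S])
  have ind: "(\<lambda>x. indicator S x * g x) = g" using z by (auto simp: indicator_def fun_eq_iff)
  have "integrable (lebesgue_on S) h \<longleftrightarrow> integrable (lebesgue_on S) g"
    by (rule integrable_cong_AE[OF hm gl]) (use eq in auto)
  also have "\<dots> \<longleftrightarrow> integrable lebesgue g" using S by (simp add: integrable_restrict_space ind)
  finally show "integrable (lebesgue_on S) h \<longleftrightarrow> integrable lborel g" using integrable_completion[OF gm] by simp
  have "(LINT x|lebesgue_on S. h x) = (LINT x|lebesgue_on S. g x)"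
    by (rule integral_cong_AE[OF hm gl]) (use eq in auto)
  also have "\<dots> = (LINT x|lebesgue. g x)" using S by (simp add: integral_restrict_space ind)
  finally show "(LINT x|lebesgue_on S. h x) = (LINT x|lborel. g x)" using integral_completion[OF gm] by simp
qed

lemma L2_borel_representative:
  fixes g h :: "'a::euclidean_space => real"
  assumes "S \<in> sets lebesgue" "g \<in> borel_measurable borel" "\<And>x. x \<notin> S ==> g x = 0" "AE x in lebesgue_on S. g x = h x"
  shows "h \<in> L2 (lebesgue_on S) \<longleftrightarrow> g \<in> L2 lborel"
proof -
  have "AE x in lebesgue_on S. (g x)\<^sup>2 = (h x)\<^sup>2" using assms(4) by eventually_elim simp
  with assms have "integrable (lebesgue_on S) (\<lambda>x. (h x)\<^sup>2) \<longleftrightarrow> integrable lborel (\<lambda>x. (g x)\<^sup>2)"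
    by (intro borel_representative(2)) auto
  then show ?thesis using borel_representative(1)[OF assms] assms(2) by (simp add: L2_def)
qed

text \<open>The exceptional set is enlarged to a Borel null set, so that Fubini's theorem for null
  sets applies in both orders.\<close>

lemma AE_pair_lborel:
  fixes Q :: "real \<times> 'a::euclidean_space => bool"
  assumes "AE p in lborel. Q p"
  shows "AE t in lborel. AE x in lborel. Q (t, x)" "AE x in lborel. AE t in lborel. Q (t, x)"
proof -
  from AE_E[OF assms] obtain S where S: "{p. \<not> Q p} \<subseteq> S" "emeasure lborel S = 0" "S \<in> sets borel" by auto
  have "AE p in lborel. p \<notin> S" using S by (intro AE_not_in) (auto simp: null_sets_def)
  then have 0: "AE p in lborel \<Otimes>\<^sub>M lborel. p \<notin> S" unfolding lborel_prod .
  have m: "{p \<in> space (lborel \<Otimes>\<^sub>M lborel). (fst p, snd p) \<notin> S} \<in> sets (lborel \<Otimes>\<^sub>M lborel)"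
    using S(3) unfolding lborel_prod by (simp add: Compl_eq[symmetric])
  have 1: "AE t in lborel. AE x in lborel. (t, x) \<notin> S" by (rule lborel_pair.AE_pair[OF 0])
  then show "AE t in lborel. AE x in lborel. Q (t, x)"
  proof eventually_elim
    case (elim t) then show ?case by eventually_elim (use S(1) in auto)
  qed
  have "AE x in lborel. AE t in lborel. (t, x) \<notin> S"
    using 1 lborel_pair.AE_commute[of "\<lambda>t x. (t, x) \<notin> S", OF m] by simp
  then show "AE x in lborel. AE t in lborel. Q (t, x)"
  proof eventually_elim
    case (elim x) then show ?case by eventually_elim (use S(1) in auto)
  qed
qed

section \<open>Borel representatives on the space-time cylinder\<close>

context bounded_open
begin

text \<open>Agreement is recorded in both iterated forms: for almost every time it serves the
  spatial estimates, for almost every point it serves the weak time derivative.\<close>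

lemma joint_representative:
  assumes f: "jointly_measurable \<Omega> T f"
  obtains F where "F \<in> borel_measurable borel" "\<And>p. p \<notin> {0<..<T} \<times> \<Omega> ==> F p = 0"
    "AE p in lebesgue_on ({0<..<T} \<times> \<Omega>). F p = (case p of (t, x) => f t x)"
    "AE t in lebesgue_on {0<..<T}. AE x in lebesgue_on \<Omega>. F (t, x) = f t x"
    "AE x in lebesgue_on \<Omega>. AE t in lebesgue_on {0<..<T}. F (t, x) = f t x"
proof -
  let ?S = "{0<..<T} \<times> \<Omega>"
  have So: "open ?S" by (intro open_Times open_dom) auto
  have Sl: "?S \<in> sets lebesgue" using So by (intro borel_open sets_completionI_sets) auto
  define g where "g p = indicator ?S p * (case p of (t, x) => f t x)" for p
  have "g \<in> borel_measurable lebesgue"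
    using f Sl unfolding jointly_measurable_def g_def by (subst (asm) borel_measurable_restrict_space_iff) auto
  from completion_ex_borel_measurable_real[OF this]
  obtain g' where g': "g' \<in> borel_measurable lborel" "AE p in lborel. g p = g' p" by blast
  define F where "F p = indicator ?S p * g' p" for p
  have Fm: "F \<in> borel_measurable borel" unfolding F_def[abs_def] using g'(1) So by (intro borel_measurable_times) auto
  have F: "AE p in lborel. p \<in> ?S \<longrightarrow> F p = (case p of (t, x) => f t x)"
    using g'(2)
  proof eventually_elim
    case (elim p) then show ?case by (cases p) (auto simp: g_def F_def)
  qed
  have i: "{0<..<T} \<in> sets lebesgue" by simp
  show ?thesis
  proof
    show "F \<in> borel_measurable borel" by (rule Fm)
    show "F p = 0" if "p \<notin> ?S" for p using that by (simp add: F_def)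
    show "AE p in lebesgue_on ?S. F p = (case p of (t, x) => f t x)" using F Sl by (simp add: AE_lebesgue_on_iff)
    have "AE t in lborel. t \<in> {0<..<T} \<longrightarrow> (AE x in lborel. x \<in> \<Omega> \<longrightarrow> F (t, x) = f t x)"
      using AE_pair_lborel(1)[OF F]
    proof eventually_elim
      case (elim t)
      show ?case
      proof
        assume t: "t \<in> {0<..<T}"
        from elim show "AE x in lborel. x \<in> \<Omega> \<longrightarrow> F (t, x) = f t x" by eventually_elim (use t in auto)
      qed
    qed
    then show "AE t in lebesgue_on {0<..<T}. AE x in lebesgue_on \<Omega>. F (t, x) = f t x"
      using i dom_sets by (simp add: AE_lebesgue_on_iff)
    have "AE x in lborel. x \<in> \<Omega> \<longrightarrow> (AE t in lborel. t \<in> {0<..<T} \<longrightarrow> F (t, x) = f t x)"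
      using AE_pair_lborel(2)[OF F]
    proof eventually_elim
      case (elim x)
      show ?case
      proof
        assume x: "x \<in> \<Omega>"
        from elim show "AE t in lborel. t \<in> {0<..<T} \<longrightarrow> F (t, x) = f t x" by eventually_elim (use x in auto)
      qed
    qed
    then show "AE x in lebesgue_on \<Omega>. AE t in lebesgue_on {0<..<T}. F (t, x) = f t x"
      using i dom_sets by (simp add: AE_lebesgue_on_iff)
  qed
qed

lemma L2_L2_representative:
  assumes f: "f \<in> L2_L2 \<Omega> T"
  obtains F where "F \<in> L2 lborel" "F \<in> borel_measurable borel" "\<And>p. p \<notin> {0<..<T} \<times> \<Omega> ==> F p = 0"
    "AE t in lebesgue_on {0<..<T}. AE x in lebesgue_on \<Omega>. F (t, x) = f t x"
    "AE x in lebesgue_on \<Omega>. AE t in lebesgue_on {0<..<T}. F (t, x) = f t x"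
proof -
  have f2: "(\<lambda>(t, x). f t x) \<in> L2 (lebesgue_on ({0<..<T} \<times> \<Omega>))" using f by (simp add: L2_L2_def)
  then have "jointly_measurable \<Omega> T f" unfolding jointly_measurable_def by (rule L2_measurable)
  then obtain F where F: "F \<in> borel_measurable borel" "\<And>p. p \<notin> {0<..<T} \<times> \<Omega> ==> F p = 0"
    "AE p in lebesgue_on ({0<..<T} \<times> \<Omega>). F p = (case p of (t, x) => f t x)"
    "AE t in lebesgue_on {0<..<T}. AE x in lebesgue_on \<Omega>. F (t, x) = f t x"
    "AE x in lebesgue_on \<Omega>. AE t in lebesgue_on {0<..<T}. F (t, x) = f t x"
    using joint_representative by blast
  have "open ({0<..<T} \<times> \<Omega>)" by (intro open_Times open_dom) auto
  then have "{0<..<T} \<times> \<Omega> \<in> sets lebesgue" by (intro borel_open sets_completionI_sets) auto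
  then have "F \<in> L2 lborel" using L2_borel_representative[OF _ F(1,2,3)] f2 by simp
  then show ?thesis using F that by blast
qed

text \<open>Meant for \<open>u\<close> itself, whose square integrability over the cylinder is
  deduced from its pointwise bounds.\<close>

lemma bounded_representative_L2:
  fixes T :: real
  assumes F: "F \<in> borel_measurable borel" "\<And>p. p \<notin> {0<..<T} \<times> \<Omega> ==> F p = 0"
    and b: "AE t in lebesgue_on {0<..<T}. AE x in lebesgue_on \<Omega>. \<bar>F (t, x)\<bar> \<le> C" and C: "0 \<le> C"
  shows "F \<in> L2 lborel"
proof -
  let ?S = "{0<..<T} \<times> \<Omega>"
  have [measurable]: "F \<in> borel_measurable (borel \<Otimes>\<^sub>M borel)" using F(1) by (simp add: borel_prod)
  have So: "?S \<in> sets borel" by (intro borel_open open_Times open_dom) auto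
  have bS: "bounded ?S" by (intro bounded_Times bounded_dom) simp
  have "AE t in lborel. t \<in> {0<..<T} \<longrightarrow> (AE x in lborel. x \<in> \<Omega> \<longrightarrow> \<bar>F (t, x)\<bar> \<le> C)"
    using b dom_sets by (simp add: AE_lebesgue_on_iff)
  then have "AE t in lborel. AE x in lborel. \<bar>F (t, x)\<bar> \<le> C"
  proof eventually_elim
    case (elim t)
    show ?case
    proof (cases "t \<in> {0<..<T}")
      case True
      with elim have "AE x in lborel. x \<in> \<Omega> \<longrightarrow> \<bar>F (t, x)\<bar> \<le> C" by blast
      then show ?thesis
      proof eventually_elim
        case (elim x)
        then show ?case using F(2)[of "(t, x)"] C by (cases "x \<in> \<Omega>") auto
      qed
    qed (use F(2) C in auto)
  qed
  moreover have "{p \<in> space (lborel \<Otimes>\<^sub>M lborel). \<bar>F (fst p, snd p)\<bar> \<le> C} \<in> sets (lborel \<Otimes>\<^sub>M (lborel :: 'a measure))" by measurable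
  ultimately have "AE p in lborel \<Otimes>\<^sub>M (lborel :: 'a measure). \<bar>F (fst p, snd p)\<bar> \<le> C"
    using lborel_pair.AE_pair_iff[of "\<lambda>t x. \<bar>F (t, x)\<bar> \<le> C"] by simp
  then have ae: "AE p in lborel. \<bar>F p\<bar> \<le> C" unfolding lborel_prod by simp
  have "(\<lambda>p. indicator ?S p * C) \<in> L2 lborel"
  proof -
    have "integrable lborel (indicat_real ?S)" using So emeasure_bounded_finite[OF bS] by (intro integrable_real_indicator) auto
    moreover have "(indicat_real ?S p * C)\<^sup>2 = indicat_real ?S p * C\<^sup>2" for p by (auto simp: indicator_def)
    ultimately show ?thesis using So by (auto simp: L2_def intro!: integrable_mult_left)
  qed
  then show ?thesis
  proof (rule L2_bound)
    show "AE p in lborel. \<bar>F p\<bar> \<le> \<bar>indicator ?S p * C\<bar>"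
      using ae by eventually_elim (use F(2) C in \<open>auto simp: indicator_def\<close>)
  qed (use F(1) in simp)
qed

end


text \<open>Tests with steep steps: a smooth function that rises at \<open>s\<close> and falls at
  \<open>t\<close> has a derivative that acts like the difference of point masses at
  \<open>s\<close> and \<open>t\<close>. Test functions do not see the end point 0, which is reached
  by continuity at the end.\<close>

lemma weak_derivative_increment:
  fixes \<beta> \<zeta> :: "real => real"
  assumes \<beta>: "continuous_on {0..T} \<beta>" and \<zeta>: "integrable lborel \<zeta>"
    and wk: "\<And>\<theta>. test_function {0<..<T} \<theta> ==>
      (LINT r|lborel. indicator {0<..<T} r * (\<beta> r * deriv \<theta> r)) = - (LINT r|lborel. \<zeta> r * \<theta> r)"
    and t: "0 \<le> t" "t < T"
  shows "\<beta> t - \<beta> 0 = (LINT r|lborel. indicator {0..t} r * \<zeta> r)"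
proof -
  obtain S1 where S1: "0 \<le> S1" "\<And>t. \<bar>partial_derivative 1 smooth_step t\<bar> \<le> S1"
    "\<And>t. t < 0 \<or> 1 < t ==> partial_derivative 1 smooth_step t = 0" using smooth_step_derivative by blast
  define D where "D = deriv smooth_step"
  have sd: "smooth_step differentiable (at x)" for x
    by (rule smooth_on_differentiable[OF smooth_smooth_step open_UNIV]) simp
  have Dpd: "partial_derivative 1 smooth_step = D" using partial_derivative_real[OF sd] by (auto simp: D_def)
  have D: "(smooth_step has_real_derivative D x) (at x)" for x
    using sd[of x] by (simp add: D_def DERIV_deriv_iff_real_differentiable)
  have Dc: "continuous_on UNIV D" unfolding Dpd[symmetric]
    by (rule smooth_on_continuous[OF smooth_on_partial[OF smooth_smooth_step]]) simp
  then have [measurable]: "D \<in> borel_measurable borel" by (rule borel_measurable_continuous_onI)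
  note Db = S1(2)[unfolded Dpd] and D0 = S1(3)[unfolded Dpd]
  have Dint: "(LINT y|lborel. indicator {0..1} y * D y) = 1"
  proof -
    have "(LBINT y. indicator {0..1} y *\<^sub>R D y) = smooth_step 1 - smooth_step 0"
      by (rule integral_FTC_Icc) (auto intro: has_field_derivative_at_within[OF D] simp: has_real_derivative_iff_has_vector_derivative[symmetric] continuous_on_subset[OF Dc])
    then show ?thesis by (simp add: smooth_step_le_0 smooth_step_ge_1)
  qed
  define b where "b r = indicator {0<..<T} r * \<beta> r" for r
  have bm [measurable]: "b \<in> borel_measurable borel"
  proof -
    have "continuous_on {0<..<T} \<beta>" by (rule continuous_on_subset[OF \<beta>]) auto
    then show ?thesis using borel_measurable_continuous_on_indicator[of "{0<..<T}" \<beta>] by (simp add: b_def[abs_def])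
  qed
  have "bounded (\<beta> ` {0..T})" using \<beta> by (intro compact_imp_bounded compact_continuous_image) auto
  then obtain M where M: "0 < M" "\<And>r. r \<in> {0..T} ==> \<bar>\<beta> r\<bar> \<le> M" by (auto simp: bounded_pos)
  have bM: "\<bar>b r\<bar> \<le> M" for r using M by (auto simp: b_def indicator_def)
  have bc: "(\<lambda>n. b (x n)) \<longlonglongrightarrow> \<beta> s" if "x \<longlonglongrightarrow> s" "0 < s" "s < T" for x s
  proof -
    have "continuous_on {0<..<T} \<beta>" by (rule continuous_on_subset[OF \<beta>]) auto
    then have "isCont \<beta> s" using that by (simp add: continuous_on_eq_continuous_at)
    then have "(\<lambda>n. \<beta> (x n)) \<longlonglongrightarrow> \<beta> s" using that(1) by (rule isCont_tendsto_compose)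
    moreover have "\<forall>\<^sub>F n in sequentially. \<beta> (x n) = b (x n)"
      using order_tendstoD(1)[OF that(1,2)] order_tendstoD(2)[OF that(1,3)] by eventually_elim (simp add: b_def)
    ultimately show ?thesis by (rule Lim_transform_eventually)
  qed
  \<comment> \<open>The scaled derivatives of \<open>smooth_step\<close> form an approximate
    identity: by \<open>Dint\<close> their mass is 1, and after rescaling they live on
    \<open>{0..1}\<close>.\<close>
  have lim: "(\<lambda>n. LINT r|lborel. b r * (real (Suc n) * D (real (Suc n) * (r - s)))) \<longlonglongrightarrow> \<beta> s" if s: "0 < s" "s < T" for s
  proof -
    have "(LINT r|lborel. b r * (real (Suc n) * D (real (Suc n) * (r - s))))
       = (LINT y|lborel. indicator {0..1} y * (b (s + y / real (Suc n)) * D y))" for n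
    proof -
      let ?c = "1 / real (Suc n)"
      have "(LINT r|lborel. b r * (real (Suc n) * D (real (Suc n) * (r - s))))
        = \<bar>?c\<bar> *\<^sub>R (LINT y|lborel. b (s + ?c * y) * (real (Suc n) * D (real (Suc n) * (s + ?c * y - s))))"
        by (rule lborel_integral_real_affine) simp
      also have "\<dots> = (LINT y|lborel. ?c * (b (s + ?c * y) * (real (Suc n) * D (real (Suc n) * (s + ?c * y - s)))))"
        by (subst integral_mult_right_zero) (simp only: real_scaleR_def abs_of_nonneg zero_le_divide_1_iff of_nat_0_le_iff)
      also have "\<dots> = (LINT y|lborel. indicator {0..1} y * (b (s + y / real (Suc n)) * D y))"
      proof (intro Bochner_Integration.integral_cong refl)
        fix y :: real
        have "real (Suc n) * (s + ?c * y - s) = y" by simp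
        then show "?c * (b (s + ?c * y) * (real (Suc n) * D (real (Suc n) * (s + ?c * y - s))))
           = indicator {0..1} y * (b (s + y / real (Suc n)) * D y)"
          using D0[of y] by (cases "y < 0 \<or> 1 < y") (auto simp: indicator_def)
      qed
      finally show ?thesis .
    qed
    moreover have "(\<lambda>n. LINT y|lborel. indicator {0..1} y * (b (s + y / real (Suc n)) * D y)) \<longlonglongrightarrow> (LINT y|lborel. indicator {0..1} y * (\<beta> s * D y))"
    proof (rule integral_dominated_convergence[where w = "\<lambda>y. indicator {0..1::real} y * (M * S1)"])
      show "integrable lborel (\<lambda>y. indicator {0..1::real} y * (M * S1))"
        by (rule integrable_mult_left) (simp add: integrable_indicat_real_bounded)
      show "AE y in lborel. norm (indicator {0..1} y * (b (s + y / real (Suc n)) * D y)) \<le> indicator {0..1} y * (M * S1)" for n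
        using mult_mono[OF bM Db] M(1) by (intro AE_I2) (auto simp: indicator_def abs_mult)
      show "AE y in lborel. (\<lambda>n. indicator {0..1} y * (b (s + y / real (Suc n)) * D y)) \<longlonglongrightarrow> indicator {0..1} y * (\<beta> s * D y)"
      proof (intro AE_I2 tendsto_mult tendsto_const bc s)
        fix y :: real
        have "(\<lambda>n. s + y * inverse (real (Suc n))) \<longlonglongrightarrow> s + y * 0" by (intro tendsto_intros LIMSEQ_inverse_real_of_nat)
        then show "(\<lambda>n. s + y / real (Suc n)) \<longlonglongrightarrow> s" by (simp add: divide_inverse)
      qed
    qed auto
    moreover have "(LINT y|lborel. indicator {0..1} y * (\<beta> s * D y)) = \<beta> s" using Dint by (simp add: mult.left_commute[of _ "\<beta> s"])
    ultimately show ?thesis by simp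
  qed
  have inc: "\<beta> t - \<beta> s = (LINT r|lborel. indicator {s<..t} r * \<zeta> r)" if s: "0 < s" "s < t" for s
  proof -
    \<comment> \<open>Tends to the indicator of \<open>{s<..t}\<close>. The falling step ends at
      \<open>t + inverse (real (Suc n))\<close>, which is below \<open>T\<close> only for large
      \<open>n\<close>; so \<open>\<theta> n\<close> is shown to be a test function
      eventually.\<close>
    define \<theta> where "\<theta> n r = smooth_step (real (Suc n) * (r - s)) - smooth_step (real (Suc n) * (r - t))" for n r
    have \<theta>b: "\<bar>\<theta> n r\<bar> \<le> 1" for n r
      using smooth_step_bounds[of "real (Suc n) * (r - s)"] smooth_step_bounds[of "real (Suc n) * (r - t)"] by (auto simp: \<theta>_def)
    have \<theta>s: "smooth_on UNIV (\<theta> n)" for n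
      using smooth_on_diff[OF open_UNIV smooth_step_affine[of "real (Suc n)" "1::real" "- real (Suc n) * s"] smooth_step_affine[of "real (Suc n)" "1::real" "- real (Suc n) * t"]]
      by (simp add: \<theta>_def[abs_def] algebra_simps)
    have \<theta>d: "deriv (\<theta> n) r = real (Suc n) * D (real (Suc n) * (r - s)) - real (Suc n) * D (real (Suc n) * (r - t))" for n r
      unfolding \<theta>_def[abs_def] by (rule DERIV_imp_deriv) (auto intro!: derivative_eq_intros DERIV_chain2[OF D] simp del: of_nat_Suc)
    have tf: "\<forall>\<^sub>F n in sequentially. test_function {0<..<T} (\<theta> n)"
    proof -
      have "\<forall>\<^sub>F n in sequentially. inverse (real (Suc n)) < T - t"
        using t by (intro order_tendstoD(2)[OF LIMSEQ_inverse_real_of_nat]) simp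
      then show ?thesis
      proof eventually_elim
        case (elim n)
        show ?case
        proof (rule test_functionI[OF \<theta>s, where K = "{s..t + inverse (real (Suc n))}"])
          fix x assume "x \<notin> {s..t + inverse (real (Suc n))}"
          then consider "x < s" | "inverse (real (Suc n)) < x - t" by fastforce
          then show "\<theta> n x = 0"
          proof cases
            case 1
            then have "real (Suc n) * (x - s) \<le> 0" "real (Suc n) * (x - t) \<le> 0" using that by (auto intro!: mult_nonneg_nonpos)
            then show ?thesis by (simp add: \<theta>_def smooth_step_le_0)
          next
            case 2
            then have "1 < real (Suc n) * (x - t)" by (simp add: inverse_eq_divide field_simps)
            moreover have "real (Suc n) * (x - t) \<le> real (Suc n) * (x - s)" using that by (intro mult_left_mono) auto
            ultimately have "1 \<le> real (Suc n) * (x - s)" "1 \<le> real (Suc n) * (x - t)" by linarith+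
            then show ?thesis by (simp add: \<theta>_def smooth_step_ge_1 del: of_nat_Suc)
          qed
        qed (use elim that in auto)
      qed
    qed
    have 1: "(\<lambda>n. LINT r|lborel. indicator {0<..<T} r * (\<beta> r * deriv (\<theta> n) r)) \<longlonglongrightarrow> \<beta> s - \<beta> t"
    proof -
      have bi: "integrable lborel (\<lambda>r. b r * (real (Suc n) * D (real (Suc n) * (r - c))))" for n c
      proof (rule Bochner_Integration.integrable_bound[of lborel "\<lambda>r. indicator {0<..<T} r * (M * (real (Suc n) * S1))"])
        show "integrable lborel (\<lambda>r. indicator {0<..<T} r * (M * (real (Suc n) * S1)))"
          by (rule integrable_mult_left) (simp add: integrable_indicat_real_bounded)
        have "\<bar>b r * (real (Suc n) * D (real (Suc n) * (r - c)))\<bar> \<le> \<bar>M * (real (Suc n) * S1)\<bar>" for r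
        proof -
          have "\<bar>b r\<bar> \<le> \<bar>M\<bar>" by (rule order_trans[OF bM abs_ge_self])
          moreover have "\<bar>D (real (Suc n) * (r - c))\<bar> \<le> \<bar>S1\<bar>" by (rule order_trans[OF Db abs_ge_self])
          ultimately show ?thesis unfolding abs_mult by (intro mult_mono[OF _ mult_left_mono]) simp_all
        qed
        moreover have "b r = 0" if "r \<notin> {0<..<T}" for r using that by (simp add: b_def)
        ultimately have "\<bar>b r * (real (Suc n) * D (real (Suc n) * (r - c)))\<bar> \<le> \<bar>indicator {0<..<T} r * (M * (real (Suc n) * S1))\<bar>" for r
          by (cases "r \<in> {0<..<T}") (simp_all del: of_nat_Suc)
        then show "AE r in lborel. norm (b r * (real (Suc n) * D (real (Suc n) * (r - c)))) \<le> norm (indicator {0<..<T} r * (M * (real (Suc n) * S1)))"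
          by (intro AE_I2) (simp only: real_norm_def)
      qed measurable
      have "(LINT r|lborel. indicator {0<..<T} r * (\<beta> r * deriv (\<theta> n) r))
        = (LINT r|lborel. b r * (real (Suc n) * D (real (Suc n) * (r - s)))) - (LINT r|lborel. b r * (real (Suc n) * D (real (Suc n) * (r - t))))" for n
        by (subst Bochner_Integration.integral_diff[OF bi bi, symmetric]) (simp add: \<theta>d b_def right_diff_distrib mult.assoc del: of_nat_Suc)
      then show ?thesis using tendsto_diff[OF lim[of s] lim[of t]] that t by simp
    qed
    have 2: "(\<lambda>n. LINT r|lborel. \<zeta> r * \<theta> n r) \<longlonglongrightarrow> (LINT r|lborel. indicator {s<..t} r * \<zeta> r)"
    proof (rule integral_dominated_convergence[where w = "\<lambda>r. \<bar>\<zeta> r\<bar>"])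
      show "AE r in lborel. norm (\<zeta> r * \<theta> n r) \<le> \<bar>\<zeta> r\<bar>" for n
        using mult_left_mono[OF \<theta>b, of "\<bar>\<zeta> _\<bar>"] by (intro AE_I2) (simp add: abs_mult)
      have st: "\<forall>\<^sub>F n in sequentially. smooth_step (real (Suc n) * (r - a)) = (if a < r then 1 else 0)" for r a :: real
      proof (cases "a < r")
        case True
        then have "\<forall>\<^sub>F n in sequentially. inverse (real (Suc n)) < r - a"
          by (intro order_tendstoD(2)[OF LIMSEQ_inverse_real_of_nat]) simp
        then show ?thesis
        proof eventually_elim
          case (elim n)
          then have "1 < real (Suc n) * (r - a)" by (simp add: inverse_eq_divide field_simps)
          then show ?case using True by (simp add: smooth_step_ge_1)
        qed
      next
        case False
        then have "real (Suc n) * (r - a) \<le> 0" for n by (intro mult_nonneg_nonpos) auto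
        then show ?thesis using False by (simp add: smooth_step_le_0)
      qed
      show "AE r in lborel. (\<lambda>n. \<zeta> r * \<theta> n r) \<longlonglongrightarrow> indicator {s<..t} r * \<zeta> r"
      proof (intro AE_I2 tendsto_eventually)
        fix r show "\<forall>\<^sub>F n in sequentially. \<zeta> r * \<theta> n r = indicator {s<..t} r * \<zeta> r"
          using st[of r s] st[of r t] by eventually_elim (use that in \<open>auto simp: \<theta>_def\<close>)
      qed
      have "\<theta> n \<in> borel_measurable borel" for n by (intro borel_measurable_continuous_onI smooth_on_continuous \<theta>s)
      then show "(\<lambda>r. \<zeta> r * \<theta> n r) \<in> borel_measurable lborel" for n using \<zeta> by auto
    qed (use \<zeta> in auto)
    have "\<forall>\<^sub>F n in sequentially. (LINT r|lborel. indicator {0<..<T} r * (\<beta> r * deriv (\<theta> n) r)) = - (LINT r|lborel. \<zeta> r * \<theta> n r)"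
      using tf by eventually_elim (rule wk)
    from Lim_transform_eventually[OF 1 this] have "\<beta> s - \<beta> t = - (LINT r|lborel. indicator {s<..t} r * \<zeta> r)"
      using tendsto_minus[OF 2] by (rule LIMSEQ_unique)
    then show ?thesis by simp
  qed
  show ?thesis
  proof (cases "t = 0")
    case True
    have "AE r in lborel. r \<noteq> (0::real)" by (rule AE_lborel_singleton)
    then have "AE r in lborel. indicator {0..t} r * \<zeta> r = 0" by eventually_elim (simp add: True)
    then have "(LINT r|lborel. indicator {0..t} r * \<zeta> r) = 0" by (rule integral_eq_zero_AE)
    then show ?thesis using True by simp
  next
    case False
    then have tp: "0 < t" using t by simp
    define \<Phi> where "\<Phi> s = (LINT r|lborel. indicator {0..s} r * \<zeta> r)" for s
    define s where "s n = t * inverse (real (Suc (Suc n)))" for n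
    have sl: "s \<longlonglongrightarrow> 0"
      using tendsto_mult[OF tendsto_const[of t] LIMSEQ_Suc[OF LIMSEQ_inverse_real_of_nat]] by (simp add: s_def[abs_def])
    have s: "0 < s n" "s n < t" for n
    proof -
      have "inverse (real (Suc (Suc n))) < 1" "0 < inverse (real (Suc (Suc n)))" by (simp_all add: inverse_less_1_iff)
      then show "0 < s n" "s n < t"
        unfolding s_def using tp by (simp_all only: mult_pos_pos mult_less_cancel_left2 not_le simp_thms less_asym, simp_all)
    qed
    have "\<beta> t - \<beta> (s n) = \<Phi> t - \<Phi> (s n)" for n
      using inc[OF s] indefinite_integral(2)[OF \<zeta>, of "s n" t] s[of n] by (simp add: \<Phi>_def)
    moreover have "(\<lambda>n. \<beta> t - \<beta> (s n)) \<longlonglongrightarrow> \<beta> t - \<beta> 0"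
    proof (intro tendsto_diff tendsto_const)
      show "(\<lambda>n. \<beta> (s n)) \<longlonglongrightarrow> \<beta> 0"
        using t s less_trans[OF s(2) t(2)] by (intro continuous_on_tendsto_compose[OF \<beta> sl]) (auto intro!: always_eventually less_imp_le)
    qed
    moreover have "(\<lambda>n. \<Phi> t - \<Phi> (s n)) \<longlonglongrightarrow> \<Phi> t - \<Phi> 0"
      using indefinite_integral(1)[OF \<zeta>] unfolding \<Phi>_def[symmetric]
      by (intro tendsto_diff tendsto_const continuous_on_tendsto_compose[OF _ sl]) auto
    ultimately have "\<beta> t - \<beta> 0 = \<Phi> t - \<Phi> 0" using LIMSEQ_unique by simp
    moreover have "\<Phi> 0 = 0"
    proof -
      have "AE r in lborel. r \<noteq> (0::real)" by (rule AE_lborel_singleton)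
      then have "AE r in lborel. indicator {0..0} r * \<zeta> r = 0" by eventually_elim simp
      then show ?thesis unfolding \<Phi>_def by (rule integral_eq_zero_AE)
    qed
    ultimately show ?thesis by (simp add: \<Phi>_def)
  qed
qed


lemma integral_mult_snd:
  fixes F H :: "real \<times> 'a::euclidean_space => real"
  assumes "F \<in> L2 lborel" "H \<in> L2 lborel"
  shows "integrable lborel (\<lambda>x. LINT t|lborel. F (t, x) * H (t, x))"
    "(LINT x|lborel. LINT t|lborel. F (t, x) * H (t, x)) = (LINT p|lborel. F p * H p)"
proof -
  have i: "integrable (lborel \<Otimes>\<^sub>M lborel) (\<lambda>(t, x). F (t, x) * H (t, x))"
    using L2_integrable_mult[OF assms] by (simp add: lborel_prod split_def)
  show "integrable lborel (\<lambda>x. LINT t|lborel. F (t, x) * H (t, x))" by (rule lborel_pair.integrable_snd[OF i])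
  show "(LINT x|lborel. LINT t|lborel. F (t, x) * H (t, x)) = (LINT p|lborel. F p * H p)"
    using lborel_pair.integral_snd[OF i] by (simp add: lborel_prod split_def)
qed

text \<open>Pairing with a fixed \<open>E\<close> reduces to a scalar function of time: continuity
  of \<open>u\<close> in L2 makes the pairing continuous, and Fubini turns the weak time derivative,
  which is posed for almost every \<open>x\<close>, into a scalar one. Then
  \<open>weak_derivative_increment\<close> applies.\<close>

lemma (in bounded_open) weak_time_increment:
  fixes T :: real and u ut :: "real => 'a => real"
  assumes E: "E \<in> L2 lborel" and E0: "\<And>x. x \<notin> \<Omega> ==> E x = 0"
    and u: "u \<in> C_L2 \<Omega> T" and wd: "has_weak_time_derivative \<Omega> T u ut"
    and U: "U \<in> L2 lborel" "\<And>p. p \<notin> {0<..<T} \<times> \<Omega> ==> U p = 0"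
      "AE t in lebesgue_on {0<..<T}. AE x in lebesgue_on \<Omega>. U (t, x) = u t x"
      "AE x in lebesgue_on \<Omega>. AE t in lebesgue_on {0<..<T}. U (t, x) = u t x"
    and Z: "Z \<in> L2 lborel" "\<And>p. p \<notin> {0<..<T} \<times> \<Omega> ==> Z p = 0"
      "AE x in lebesgue_on \<Omega>. AE t in lebesgue_on {0<..<T}. Z (t, x) = ut t x"
    and t: "0 \<le> t" "t < T"
  shows "(LINT x|lebesgue_on \<Omega>. E x * (u t x - u 0 x)) = (LINT r|lborel. indicator {0..t} r * (LINT x|lborel. E x * Z (r, x)))"
proof -
  let ?I = "{0<..<T}"
  have I: "?I \<in> sets lebesgue" by simp
  have Em [measurable]: "E \<in> borel_measurable borel" using L2_measurable[OF E] by simp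
  have Um [measurable]: "U \<in> borel_measurable (borel \<Otimes>\<^sub>M borel)" using L2_measurable[OF U(1)] by (simp add: borel_prod)
  have Zm [measurable]: "Z \<in> borel_measurable (borel \<Otimes>\<^sub>M borel)" using L2_measurable[OF Z(1)] by (simp add: borel_prod)
  have E2: "E \<in> L2 (lebesgue_on \<Omega>)" using L2_borel_representative[OF dom_sets Em E0, of E] E by simp
  have ul: "u r \<in> L2 (lebesgue_on \<Omega>)" if "r \<in> {0..T}" for r using u that by (simp add: C_L2_def)
  define \<beta> where "\<beta> r = (LINT x|lebesgue_on \<Omega>. u r x * E x)" for r
  have \<beta>c: "continuous_on {0..T} \<beta>"
  proof -
    define u' where "u' r = (if r \<in> {0..T} then u r else (\<lambda>x. 0))" for r
    have u'2: "u' r \<in> L2 (lebesgue_on \<Omega>)" for r using ul by (auto simp: u'_def L2_zero)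
    have "((\<lambda>r. LINT x|lebesgue_on \<Omega>. u' r x * E x) \<longlongrightarrow> (LINT x|lebesgue_on \<Omega>. u' s x * E x)) (at s within {0..T})" if s: "s \<in> {0..T}" for s
    proof (rule L2_tendsto_inner[OF u'2 u'2 E2])
      have "((\<lambda>r. L2_norm (lebesgue_on \<Omega>) (\<lambda>x. u r x - u s x)) \<longlongrightarrow> 0) (at s within {0..T})"
        using u s by (simp add: C_L2_def)
      then show "((\<lambda>r. L2_norm (lebesgue_on \<Omega>) (\<lambda>x. u' r x - u' s x)) \<longlongrightarrow> 0) (at s within {0..T})"
        by (rule Lim_transform_eventually) (use s in \<open>auto simp: u'_def eventually_at intro!: exI[of _ 1]\<close>)
    qed
    then have "continuous_on {0..T} (\<lambda>r. LINT x|lebesgue_on \<Omega>. u' r x * E x)" by (simp add: continuous_on_def)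
    then show ?thesis by (rule continuous_on_eq) (simp add: u'_def \<beta>_def)
  qed
  \<comment> \<open>Cutting \<open>E\<close> to the time interval makes it an element of L2 in
    space-time.\<close>
  define H where "H p = indicator ?I (fst p) * E (snd p)" for p :: "real \<times> 'a"
  have Hm [measurable]: "H \<in> borel_measurable (borel \<Otimes>\<^sub>M borel)" unfolding H_def[abs_def] by measurable
  have H: "H \<in> L2 lborel"
  proof -
    have iE: "integrable lborel (\<lambda>x. (E x)\<^sup>2)" by (rule L2_integrable_square[OF E])
    have sq: "(H (r, x))\<^sup>2 = indicator ?I r * (E x)\<^sup>2" for r x by (auto simp: H_def indicator_def)
    have "integrable (lborel \<Otimes>\<^sub>M lborel) (\<lambda>p. (H p)\<^sup>2)"
    proof (rule lborel_pair.Fubini_integrable)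
      show "(\<lambda>p. (H p)\<^sup>2) \<in> borel_measurable (lborel \<Otimes>\<^sub>M lborel)" by measurable
      show "integrable lborel (\<lambda>r. LINT x|lborel. norm ((H (r, x))\<^sup>2))"
        unfolding sq by (simp add: abs_mult integrable_indicat_real_bounded)
      show "AE r in lborel. integrable lborel (\<lambda>x. (H (r, x))\<^sup>2)"
        unfolding sq by (intro AE_I2 integrable_mult_right iE)
    qed
    then show ?thesis using Hm by (simp add: L2_def lborel_prod borel_prod)
  qed
  define \<zeta> where "\<zeta> r = (LINT x|lborel. E x * Z (r, x))" for r
  have \<zeta>H: "\<zeta> r = (LINT x|lborel. Z (r, x) * H (r, x))" for r
    unfolding \<zeta>_def
  proof (intro Bochner_Integration.integral_cong refl)
    fix x show "E x * Z (r, x) = Z (r, x) * H (r, x)" using Z(2)[of "(r, x)"] by (cases "r \<in> ?I") (auto simp: H_def)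
  qed
  have \<zeta>: "integrable lborel \<zeta>" unfolding \<zeta>H[abs_def] by (rule integral_mult_fst(1)[OF Z(1) H])
  have "\<beta> t - \<beta> 0 = (LINT r|lborel. indicator {0..t} r * \<zeta> r)"
  proof (rule weak_derivative_increment[OF \<beta>c \<zeta> _ t])
    fix \<theta> assume \<theta>: "test_function ?I \<theta>"
    have dd: "\<theta> differentiable (at r)" for r
      using \<theta> by (intro smooth_on_differentiable[OF _ open_UNIV]) (auto simp: test_function_def)
    have pd: "partial_derivative 1 \<theta> = deriv \<theta>" using partial_derivative_real[OF dd] by auto
    have \<theta>': "test_function ?I (deriv \<theta>)" using test_function_partial[OF \<theta>, of 1] by (simp add: pd)
    have bm: "(\<lambda>p. \<phi> (fst p) * H p) \<in> L2 lborel" if \<phi>: "test_function ?I \<phi>" for \<phi>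
    proof -
      obtain C where C: "\<And>x. \<bar>\<phi> x\<bar> \<le> C" using test_function_bounded[OF \<phi>] by blast
      have [measurable]: "\<phi> \<in> borel_measurable borel" by (rule test_function_measurable[OF \<phi>])
      have "(\<lambda>p::real \<times> 'a. \<phi> (fst p)) \<in> borel_measurable (borel \<Otimes>\<^sub>M borel)" by measurable
      then show ?thesis using C by (intro L2_bounded_mult[OF H, of _ C]) (simp_all add: borel_prod)
    qed
    have rep: "(LINT r|lborel. F (r, x) * (\<phi> r * H (r, x))) = E x * (LINT r|lebesgue_on ?I. f r x * \<phi> r)"
      if F: "F \<in> borel_measurable (borel \<Otimes>\<^sub>M borel)" "\<And>p. p \<notin> ?I \<times> \<Omega> ==> F p = 0" and ae: "AE t in lebesgue_on ?I. F (t, x) = f t x" and \<phi>: "test_function ?I \<phi>" for F f x \<phi>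
    proof -
      have [measurable]: "\<phi> \<in> borel_measurable borel" by (rule test_function_measurable[OF \<phi>])
      note [measurable] = F(1)
      have "(LINT r|lebesgue_on ?I. f r x * \<phi> r) = (LINT r|lborel. F (r, x) * \<phi> r)"
      proof (rule borel_representative(3)[OF I])
        show "(\<lambda>r. F (r, x) * \<phi> r) \<in> borel_measurable borel" by measurable
        show "F (r, x) * \<phi> r = 0" if "r \<notin> ?I" for r using F(2)[of "(r, x)"] that by auto
        show "AE r in lebesgue_on ?I. F (r, x) * \<phi> r = f r x * \<phi> r" using ae by eventually_elim simp
      qed
      moreover have "F (r, x) * (\<phi> r * H (r, x)) = E x * (F (r, x) * \<phi> r)" for r
        using F(2)[of "(r, x)"] by (auto simp: H_def indicator_def)
      ultimately show ?thesis by (simp only: integral_mult_right_zero)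
    qed
    have "(LINT r|lborel. indicator ?I r * (\<beta> r * deriv \<theta> r)) = (LINT r|lborel. LINT x|lborel. U (r, x) * (deriv \<theta> r * H (r, x)))"
    proof (rule integral_cong_AE)
      have "continuous_on ?I (\<lambda>r. \<beta> r * deriv \<theta> r)"
        using \<theta>' by (intro continuous_on_mult continuous_on_subset[OF \<beta>c] continuous_on_subset[OF smooth_on_continuous]) (auto simp: test_function_def)
      then show "(\<lambda>r. indicator ?I r * (\<beta> r * deriv \<theta> r)) \<in> borel_measurable lborel"
        using borel_measurable_continuous_on_indicator[of ?I "\<lambda>r. \<beta> r * deriv \<theta> r"] by simp
      show "(\<lambda>r. LINT x|lborel. U (r, x) * (deriv \<theta> r * H (r, x))) \<in> borel_measurable lborel"
        using integral_mult_fst(1)[OF U(1) bm[OF \<theta>']] by (intro borel_measurable_integrable) simp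
      have "AE r in lborel. r \<in> ?I \<longrightarrow> (AE x in lebesgue_on \<Omega>. U (r, x) = u r x)" using U(3) I by (simp only: AE_lebesgue_on_iff)
      then show "AE r in lborel. indicator ?I r * (\<beta> r * deriv \<theta> r) = (LINT x|lborel. U (r, x) * (deriv \<theta> r * H (r, x)))"
      proof eventually_elim
        case (elim r)
        show ?case
        proof (cases "r \<in> ?I")
          case True
          with elim have ae: "AE x in lebesgue_on \<Omega>. U (r, x) = u r x" by blast
          have "\<beta> r = (LINT x|lborel. U (r, x) * E x)" unfolding \<beta>_def
          proof (rule borel_representative(3)[OF dom_sets])
            show "(\<lambda>x. U (r, x) * E x) \<in> borel_measurable borel" by measurable
            show "U (r, x) * E x = 0" if "x \<notin> \<Omega>" for x using E0[OF that] by simp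
            show "AE x in lebesgue_on \<Omega>. U (r, x) * E x = u r x * E x" using ae by eventually_elim simp
          qed
          moreover have "U (r, x) * (deriv \<theta> r * H (r, x)) = deriv \<theta> r * (U (r, x) * E x)" for x
            using True by (simp add: H_def)
          ultimately have "(LINT x|lborel. U (r, x) * (deriv \<theta> r * H (r, x))) = deriv \<theta> r * \<beta> r"
            by (simp only: integral_mult_right_zero)
          then show ?thesis using True by simp
        next
          case False
          then show ?thesis by (simp add: H_def)
        qed
      qed
    qed
    also have "\<dots> = (LINT x|lborel. LINT r|lborel. U (r, x) * (deriv \<theta> r * H (r, x)))"
      using integral_mult_fst(2)[OF U(1) bm[OF \<theta>']] integral_mult_snd(2)[OF U(1) bm[OF \<theta>']] by simp
    also have "\<dots> = (LINT x|lborel. - (LINT r|lborel. Z (r, x) * (\<theta> r * H (r, x))))"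
    proof (rule integral_cong_AE)
      show "(\<lambda>x. LINT r|lborel. U (r, x) * (deriv \<theta> r * H (r, x))) \<in> borel_measurable lborel"
        using integral_mult_snd(1)[OF U(1) bm[OF \<theta>']] by (intro borel_measurable_integrable) simp
      show "(\<lambda>x. - (LINT r|lborel. Z (r, x) * (\<theta> r * H (r, x)))) \<in> borel_measurable lborel"
        using integral_mult_snd(1)[OF Z(1) bm[OF \<theta>]] by (intro borel_measurable_uminus borel_measurable_integrable) simp
      have "AE x in lebesgue_on \<Omega>. (LINT r|lborel. U (r, x) * (deriv \<theta> r * H (r, x))) = - (LINT r|lborel. Z (r, x) * (\<theta> r * H (r, x)))"
        using U(4) Z(3) wd[unfolded has_weak_time_derivative_def, rule_format, OF \<theta>]
      proof eventually_elim
        case (elim x)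
        show ?case using rep[where F = U and f = u and x = x, OF Um U(2) elim(1) \<theta>'] rep[where F = Z and f = ut and x = x, OF Zm Z(2) elim(2) \<theta>] elim(3) by simp
      qed
      then have "AE x in lborel. x \<in> \<Omega> \<longrightarrow> (LINT r|lborel. U (r, x) * (deriv \<theta> r * H (r, x))) = - (LINT r|lborel. Z (r, x) * (\<theta> r * H (r, x)))"
        using dom_sets by (simp only: AE_lebesgue_on_iff)
      then show "AE x in lborel. (LINT r|lborel. U (r, x) * (deriv \<theta> r * H (r, x))) = - (LINT r|lborel. Z (r, x) * (\<theta> r * H (r, x)))"
      proof eventually_elim
        case (elim x)
        then show ?case using U(2) Z(2) by (cases "x \<in> \<Omega>") auto
      qed
    qed
    also have "\<dots> = - (LINT r|lborel. LINT x|lborel. Z (r, x) * (\<theta> r * H (r, x)))"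
      using integral_mult_fst(2)[OF Z(1) bm[OF \<theta>]] integral_mult_snd(2)[OF Z(1) bm[OF \<theta>]] by simp
    also have "(LINT r|lborel. LINT x|lborel. Z (r, x) * (\<theta> r * H (r, x))) = (LINT r|lborel. \<zeta> r * \<theta> r)"
      unfolding \<zeta>H by (intro Bochner_Integration.integral_cong refl) (simp add: mult.left_commute mult.commute[of _ "\<theta> _"])
    finally show "(LINT r|lborel. indicator ?I r * (\<beta> r * deriv \<theta> r)) = - (LINT r|lborel. \<zeta> r * \<theta> r)" .
  qed
  moreover have "\<beta> t - \<beta> 0 = (LINT x|lebesgue_on \<Omega>. E x * (u t x - u 0 x))"
    unfolding \<beta>_def using t L2_integrable_mult[OF ul E2]
    by (subst Bochner_Integration.integral_diff[symmetric]) (auto simp: algebra_simps)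
  ultimately show ?thesis by (simp add: \<zeta>_def)
qed

section \<open>The energy inequality at a fixed time\<close>

lemma D01_derivative:
  assumes "f differentiable_on {0<..1}" "0 < s" "s < 1"
  shows "(f has_real_derivative D01 f s) (at s)"
proof -
  have "f differentiable (at s within {0<..1})" using assms by (auto simp: differentiable_on_def)
  then have "(f has_vector_derivative D01 f s) (at s within {0<..1})"
    unfolding D01_def by (simp only: vector_derivative_works)
  then have "(f has_vector_derivative D01 f s) (at s within {0<..<1})"
    by (rule has_vector_derivative_within_subset) auto
  moreover have "at s within {0<..<1} = at s" by (rule at_within_open) (use assms in auto)
  ultimately show ?thesis by (simp add: has_real_derivative_iff_has_vector_derivative)
qed

lemma potential_tangent:
  assumes pot: "potential N A \<psi>" and E0: "E0 \<psi>" and x: "0 < x" "x < 1" and y: "0 \<le> y" "y \<le> 1"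
  shows "D01 \<psi> x * (y - x) \<le> \<psi> y - \<psi> x"
proof -
  obtain \<zeta> where \<zeta>: "0 < \<zeta>" "\<And>s. s \<in> {0<..1} ==> \<zeta> \<le> D01 (D01 \<psi>) s" using E0 by (auto simp: E0_def)
  have d: "(\<psi> has_real_derivative D01 \<psi> s) (at s)" "(D01 \<psi> has_real_derivative D01 (D01 \<psi>) s) (at s)" if "0 < s" "s < 1" for s
    using pot that by (auto simp: potential_def intro: D01_derivative)
  have conv: "convex_on {0<..<1} \<psi>"
  proof (rule convex_on_realI[where f' = "D01 \<psi>"])
    show "(\<psi> has_real_derivative D01 \<psi> s) (at s)" if "s \<in> {0<..<1}" for s using d(1)[of s] that by simp
    show "D01 \<psi> s \<le> D01 \<psi> t" if "s \<in> {0<..<1}" "t \<in> {0<..<1}" "s \<le> t" for s t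
    proof (rule DERIV_nonneg_imp_nondecreasing[OF that(3)])
      fix r assume "s \<le> r" "r \<le> t"
      then show "\<exists>y. (D01 \<psi> has_real_derivative y) (at r) \<and> 0 \<le> y"
        using d(2)[of r] \<zeta>(1) \<zeta>(2)[of r] that by (intro exI[of _ "D01 (D01 \<psi>) r"]) auto
    qed
  qed simp
  have in01: "D01 \<psi> x * (z - x) \<le> \<psi> z - \<psi> x" if "z \<in> {0<..<1}" for z
    using conv x that d(1)[OF x]
    by (intro convex_on_imp_above_tangent[where A = "{0<..<1}"]) (auto simp: interior_open has_field_derivative_at_within)
  have "0 \<le> \<psi> y - \<psi> x - D01 \<psi> x * (y - x)"
  proof (rule continuous_ge_on_closure[where S = "{0<..<1}" and f = "\<lambda>z. \<psi> z - \<psi> x - D01 \<psi> x * (z - x)"])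
    have "continuous_on {0..1} \<psi>" using pot by (simp add: potential_def)
    then show "continuous_on (closure {0<..<1}) (\<lambda>z. \<psi> z - \<psi> x - D01 \<psi> x * (z - x))" by (auto intro!: continuous_intros)
  qed (use y in01 in auto)
  then show ?thesis by simp
qed

section \<open>Algebra of the mobility matrix\<close>

lemma mat_vec_diff: "mat_vec N M (\<lambda>j. v j - w j) i = mat_vec N M v i - mat_vec N M w i"
  by (simp add: mat_vec_def right_diff_distrib sum_subtractf)

lemma mobility_const:
  assumes "mobility_matrix N \<alpha>" "i < N"
  shows "mat_vec N \<alpha> (\<lambda>_. c) i = 0"
  using assms unfolding mobility_matrix_def by blast

text \<open>Constants lie in the kernel, so row sums vanish; by symmetry column sums vanish as
  well.\<close>

lemma mobility_sum:
  assumes "mobility_matrix N \<alpha>"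
  shows "(\<Sum>i<N. mat_vec N \<alpha> v i) = 0"
proof -
  have "(\<Sum>i<N. \<alpha> i j) = 0" if j: "j < N" for j
  proof -
    have "(\<Sum>i<N. \<alpha> i j) = (\<Sum>i<N. \<alpha> j i * 1)"
      using assms j by (intro sum.cong) (auto simp: mobility_matrix_def symmetric_mat_def)
    then show ?thesis using mobility_const[OF assms j, of 1] by (simp add: mat_vec_def)
  qed
  then have "(\<Sum>j<N. (\<Sum>i<N. \<alpha> i j) * v j) = 0" by simp
  then show ?thesis unfolding mat_vec_def by (subst sum.swap) (simp add: sum_distrib_right)
qed

text \<open>
  Only the projection \<open>q\<close> of \<open>p\<close> to \<open>T\<Sigma>\<close> enters, since \<open>\<alpha>\<close> annihilates constants; the term
  \<open>- l\<^sub>0 |q|\<^sup>2\<close> then absorbs everything that is linear in \<open>q\<close>.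
\<close>

lemma dissipation_pointwise:
  fixes p d B :: "nat => real"
  assumes N: "0 < N" and mob: "mobility_matrix N \<alpha>" and l0: "0 < l0" "\<And>\<eta>. \<eta> \<in> T_Sigma N ==> l0 * dot N \<eta> \<eta> \<le> dot N (mat_vec N \<alpha> \<eta>) \<eta>"
    and B: "\<And>i. i < N ==> \<bar>B i\<bar> \<le> a" and a: "0 \<le> a" and d: "\<And>i. i < N ==> \<bar>d i\<bar> \<le> 1" "(\<Sum>i<N. d i) = 0"
  defines "c \<equiv> 1 + a * (\<Sum>i<N. \<Sum>j<N. \<bar>\<alpha> i j\<bar>)"
  shows "(\<Sum>i<N. (p i + B i) * (d i - mat_vec N \<alpha> p i)) \<le> real N * (c\<^sup>2 / (4 * l0) + a)"
proof -
  define k where "k = (\<Sum>m<N. p m) / real N"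
  define q where "q i = p i - k" for i
  \<comment> \<open>In \<open>c = 1 + a * S\<close> the 1 stems from
    \<open>\<bar>d i\<bar> \<le> 1\<close> and the term \<open>a * S\<close> from the pairing of
    \<open>B\<close> with the matrix applied to \<open>q\<close>.\<close>
  define S where "S = (\<Sum>i<N. \<Sum>j<N. \<bar>\<alpha> i j\<bar>)"
  have qT: "q \<in> T_Sigma N" using N by (simp add: T_Sigma_def q_def k_def sum_subtractf)
  have aq: "mat_vec N \<alpha> p i = mat_vec N \<alpha> q i" if "i < N" for i
    using mobility_const[OF mob that, of k] by (simp add: q_def[abs_def] mat_vec_diff)
  have y0: "(\<Sum>i<N. d i - mat_vec N \<alpha> p i) = 0" by (simp add: sum_subtractf d(2) mobility_sum[OF mob])
  have "(\<Sum>i<N. (p i + B i) * (d i - mat_vec N \<alpha> p i))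
    = (\<Sum>i<N. (q i + B i) * (d i - mat_vec N \<alpha> p i)) + k * (\<Sum>i<N. d i - mat_vec N \<alpha> p i)"
    unfolding sum_distrib_left sum.distrib[symmetric] by (intro sum.cong) (auto simp: q_def algebra_simps)
  also have "\<dots> = (\<Sum>i<N. (q i + B i) * (d i - mat_vec N \<alpha> q i))" unfolding y0 by (simp add: aq)
  also have "\<dots> = - dot N (mat_vec N \<alpha> q) q + ((\<Sum>i<N. (q i + B i) * d i) + (\<Sum>i<N. - (B i * mat_vec N \<alpha> q i)))"
    unfolding dot_def sum_negf[symmetric] sum.distrib[symmetric] by (intro sum.cong) (auto simp: algebra_simps)
  also have "\<dots> \<le> - (l0 * dot N q q) + ((\<Sum>i<N. \<bar>q i\<bar> + a) + (\<Sum>j<N. a * S * \<bar>q j\<bar>))"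
  proof (intro add_mono)
    show "- dot N (mat_vec N \<alpha> q) q \<le> - (l0 * dot N q q)" using l0(2)[OF qT] by simp
    show "(\<Sum>i<N. (q i + B i) * d i) \<le> (\<Sum>i<N. \<bar>q i\<bar> + a)"
    proof (rule sum_mono)
      fix i assume "i \<in> {..<N}"
      then have i: "i < N" by simp
      have "(q i + B i) * d i \<le> \<bar>q i + B i\<bar> * \<bar>d i\<bar>" by (simp add: abs_mult[symmetric])
      also have "\<dots> \<le> \<bar>q i + B i\<bar> * 1" by (intro mult_left_mono d(1) i) simp
      also have "\<dots> \<le> \<bar>q i\<bar> + a" using B[OF i] abs_triangle_ineq[of "q i" "B i"] by simp
      finally show "(q i + B i) * d i \<le> \<bar>q i\<bar> + a" .
    qed
    have "(\<Sum>i<N. - (B i * mat_vec N \<alpha> q i)) \<le> (\<Sum>i<N. a * (\<Sum>j<N. \<bar>\<alpha> i j\<bar> * \<bar>q j\<bar>))"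
    proof (rule sum_mono)
      fix i assume "i \<in> {..<N}"
      then have i: "i < N" by simp
      have "- (B i * mat_vec N \<alpha> q i) \<le> \<bar>B i\<bar> * \<bar>mat_vec N \<alpha> q i\<bar>" unfolding abs_mult[symmetric] by (rule abs_ge_minus_self)
      also have "\<dots> \<le> a * (\<Sum>j<N. \<bar>\<alpha> i j\<bar> * \<bar>q j\<bar>)"
      proof (intro mult_mono B i a)
        show "\<bar>mat_vec N \<alpha> q i\<bar> \<le> (\<Sum>j<N. \<bar>\<alpha> i j\<bar> * \<bar>q j\<bar>)"
          unfolding mat_vec_def abs_mult[symmetric] by (rule sum_abs)
      qed simp
      finally show "- (B i * mat_vec N \<alpha> q i) \<le> a * (\<Sum>j<N. \<bar>\<alpha> i j\<bar> * \<bar>q j\<bar>)" .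
    qed
    also have "\<dots> = (\<Sum>j<N. a * (\<Sum>i<N. \<bar>\<alpha> i j\<bar>) * \<bar>q j\<bar>)"
      by (simp add: sum_distrib_left sum_distrib_right mult.assoc) (rule sum.swap)
    also have "\<dots> \<le> (\<Sum>j<N. a * S * \<bar>q j\<bar>)"
    proof (intro sum_mono mult_right_mono mult_left_mono a)
      fix j assume "j \<in> {..<N}"
      then show "(\<Sum>i<N. \<bar>\<alpha> i j\<bar>) \<le> S" unfolding S_def by (intro sum_mono member_le_sum) auto
    qed simp
    finally show "(\<Sum>i<N. - (B i * mat_vec N \<alpha> q i)) \<le> (\<Sum>j<N. a * S * \<bar>q j\<bar>)" .
  qed
  also have "\<dots> = (\<Sum>i<N. c * \<bar>q i\<bar> - l0 * (q i)\<^sup>2 + a)"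
    unfolding dot_def sum_distrib_left sum_negf[symmetric] sum.distrib[symmetric]
    by (intro sum.cong) (auto simp: c_def S_def[symmetric] power2_eq_square algebra_simps)
  also have "\<dots> \<le> (\<Sum>i<N. c\<^sup>2 / (4 * l0) + a)"
  proof (rule sum_mono)
    fix i
    \<comment> \<open>The bound \<open>c\<^sup>2 / (4 * l0)\<close> is the maximum of
      \<open>c * y - l0 * y\<^sup>2\<close>, attained at \<open>y = c / (2 * l0)\<close>.\<close>
    have "0 \<le> (2 * l0 * \<bar>q i\<bar> - c)\<^sup>2" by simp
    also have "\<dots> = c\<^sup>2 - 4 * l0 * (c * \<bar>q i\<bar> - l0 * (q i)\<^sup>2)"
      by (simp add: power2_diff power_mult_distrib algebra_simps power2_eq_square)
    finally have "(c * \<bar>q i\<bar> - l0 * (q i)\<^sup>2) * (4 * l0) \<le> c\<^sup>2" by (simp add: algebra_simps)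
    then have "c * \<bar>q i\<bar> - l0 * (q i)\<^sup>2 \<le> c\<^sup>2 / (4 * l0)" using l0(1) by (simp add: pos_le_divide_eq)
    then show "c * \<bar>q i\<bar> - l0 * (q i)\<^sup>2 + a \<le> c\<^sup>2 / (4 * l0) + a" by simp
  qed
  also have "\<dots> = real N * (c\<^sup>2 / (4 * l0) + a)" by simp
  finally show ?thesis .
qed

text \<open>Fixes the data on which the constants may depend: domain, mobility, potential and the
  means \<open>m\<close>. Neither \<open>\<gamma>\<close> nor the solution appears.
  \<open>Mp\<close> bounds \<open>\<psi>\<close> on the unit interval, and \<open>a\<close> bounds
  the entries of \<open>A\<close> applied to vectors with entries in that interval.\<close>

locale energy_setting = bounded_open \<Omega> for \<Omega> :: "'a::euclidean_space set" +
  fixes N :: nat and \<alpha> A :: "nat => nat => real" and \<psi> :: "real => real" and m :: "nat => real" and l0 Mp a :: real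
  assumes dim: "2 \<le> DIM('a)" and dom: "smooth_bounded_domain \<Omega>" and N2: "2 \<le> N"
    and mob: "mobility_matrix N \<alpha>" and l0: "0 < l0" "\<And>\<eta>. \<eta> \<in> T_Sigma N ==> l0 * dot N \<eta> \<eta> \<le> dot N (mat_vec N \<alpha> \<eta>) \<eta>"
    and pot: "potential N A \<psi>" and E0: "E0 \<psi>"
    and Mp: "0 \<le> Mp" "\<And>y. 0 \<le> y ==> y \<le> 1 ==> \<bar>\<psi> y\<bar> \<le> Mp"
    and a: "0 \<le> a" "\<And>v i. i < N ==> (\<And>j. j < N ==> 0 \<le> v j \<and> v j \<le> 1) ==> \<bar>mat_vec N A v i\<bar> \<le> a"
begin

abbreviation "n2 \<equiv> L2_norm (lebesgue_on \<Omega>)"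

definition V where "V = measure lebesgue \<Omega>"
definition D where "D v = (\<Sum>i<N. \<Sum>b\<in>Basis. (n2 (weak_partial \<Omega> b (\<lambda>x. v x i)))\<^sup>2)"
text \<open>The energy without the quadratic term in \<open>A\<close>: the convex part, to which the
  subgradients belong.\<close>

definition F where "F \<gamma> v = (\<Sum>i<N. LINT x|lebesgue_on \<Omega>. \<psi> (v x i)) + \<gamma> / 2 * D v"
text \<open>Competitors in the subgradient inequality. Their components need not sum to 1, because
  \<open>\<xi>\<close> below is the gradient before projection.\<close>

definition adm where "adm v \<longleftrightarrow> (\<forall>i<N. (\<lambda>x. v x i) \<in> H1 \<Omega>) \<and> (AE x in lebesgue_on \<Omega>. \<forall>i<N. 0 \<le> v x i \<and> v x i \<le> 1)"

lemma V_measure: "measure (lebesgue_on \<Omega>) (space (lebesgue_on \<Omega>)) = V"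
  using dom_sets by (simp add: V_def measure_restrict_space)

lemma V_pos: "0 < V"
proof -
  have "\<Omega> \<noteq> {}" using dom by (simp add: smooth_bounded_domain_def)
  then have "\<not> negligible \<Omega>" using open_not_negligible[OF open_dom] by blast
  moreover have "\<Omega> \<in> lmeasurable" by (rule lmeasurable_open[OF bounded_dom open_dom])
  ultimately show ?thesis using negligible_iff_measure0[of \<Omega>] by (simp add: V_def less_le)
qed

lemma integral_const_dom: "(LINT x|lebesgue_on \<Omega>. (c::real)) = c * V"
  using V_measure by (simp add: mult.commute)

lemma bounded_abs_integral:
  assumes "integrable (lebesgue_on \<Omega>) f" "AE x in lebesgue_on \<Omega>. \<bar>f x\<bar> \<le> c"
  shows "\<bar>LINT x|lebesgue_on \<Omega>. f x\<bar> \<le> c * V"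
proof -
  have "\<bar>LINT x|lebesgue_on \<Omega>. f x\<bar> \<le> (LINT x|lebesgue_on \<Omega>. \<bar>f x\<bar>)" by (rule integral_abs_bound)
  also have "\<dots> \<le> (LINT x|lebesgue_on \<Omega>. c)"
    by (rule integral_mono_AE) (use assms L2_integrable[OF L2_const] in auto)
  finally show ?thesis unfolding integral_const_dom .
qed

lemma psi_compose:
  assumes f: "f \<in> borel_measurable (lebesgue_on \<Omega>)" and f01: "AE x in lebesgue_on \<Omega>. 0 \<le> f x \<and> f x \<le> 1"
  shows "integrable (lebesgue_on \<Omega>) (\<lambda>x. \<psi> (f x))" "\<bar>LINT x|lebesgue_on \<Omega>. \<psi> (f x)\<bar> \<le> Mp * V"
proof -
  \<comment> \<open>Clamping extends \<open>\<psi>\<close>, which is controlled only on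
    \<open>{0..1}\<close>, to a continuous function on the line; measurability of the composition
    follows.\<close>
  define g where "g y = \<psi> (max 0 (min 1 y))" for y
  have "continuous_on UNIV g" unfolding g_def
    by (rule continuous_on_compose2[of "{0..1}" \<psi>]) (use pot in \<open>auto simp: potential_def intro!: continuous_intros\<close>)
  then have "g \<in> borel_measurable borel" by (rule borel_measurable_continuous_onI)
  then have gm: "(\<lambda>x. g (f x)) \<in> borel_measurable (lebesgue_on \<Omega>)" using f by (rule measurable_compose[rotated])
  have "AE x in lebesgue_on \<Omega>. g (f x) = \<psi> (f x)" using f01 by eventually_elim (simp add: g_def)
  then have m: "(\<lambda>x. \<psi> (f x)) \<in> borel_measurable (lebesgue_on \<Omega>)" by (rule borel_measurable_lebesgue_on_AE[OF gm _ dom_sets])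
  have b: "AE x in lebesgue_on \<Omega>. \<bar>\<psi> (f x)\<bar> \<le> Mp" using f01 by eventually_elim (use Mp(2) in auto)
  show i: "integrable (lebesgue_on \<Omega>) (\<lambda>x. \<psi> (f x))" by (rule L2_integrable[OF L2_bounded[OF m b]])
  show "\<bar>LINT x|lebesgue_on \<Omega>. \<psi> (f x)\<bar> \<le> Mp * V" by (rule bounded_abs_integral[OF i b])
qed

lemma adm_psi:
  assumes "adm v" "i < N"
  shows "integrable (lebesgue_on \<Omega>) (\<lambda>x. \<psi> (v x i))" "\<bar>LINT x|lebesgue_on \<Omega>. \<psi> (v x i)\<bar> \<le> Mp * V"
proof -
  have "(\<lambda>x. v x i) \<in> borel_measurable (lebesgue_on \<Omega>)" using assms by (auto simp: adm_def intro: L2_measurable H1_L2)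
  moreover have "AE x in lebesgue_on \<Omega>. 0 \<le> v x i \<and> v x i \<le> 1"
    using assms(1)[unfolded adm_def, THEN conjunct2] by eventually_elim (use assms(2) in auto)
  ultimately show "integrable (lebesgue_on \<Omega>) (\<lambda>x. \<psi> (v x i))" "\<bar>LINT x|lebesgue_on \<Omega>. \<psi> (v x i)\<bar> \<le> Mp * V"
    by (rule psi_compose)+
qed

lemma D_nonneg: "0 \<le> D v"
  unfolding D_def by (intro sum_nonneg) simp

lemma F_bounds:
  assumes "adm v"
  shows "\<bar>F \<gamma> v - \<gamma> / 2 * D v\<bar> \<le> N * (Mp * V)"
proof -
  have "\<bar>\<Sum>i<N. LINT x|lebesgue_on \<Omega>. \<psi> (v x i)\<bar> \<le> (\<Sum>i<N. Mp * V)"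
    using adm_psi(2)[OF assms] by (intro order_trans[OF sum_abs] sum_mono) auto
  then show ?thesis by (simp add: F_def)
qed

lemma energy_F:
  assumes v: "adm v"
  shows "\<bar>energy \<Omega> N \<gamma> A \<psi> v - F \<gamma> v\<bar> \<le> N * a / 2 * V"
proof -
  have v2: "(\<lambda>x. v x i) \<in> L2 (lebesgue_on \<Omega>)" if "i < N" for i using v that by (auto simp: adm_def intro: H1_L2)
  have v01: "AE x in lebesgue_on \<Omega>. \<forall>i<N. 0 \<le> v x i \<and> v x i \<le> 1" using v by (simp add: adm_def)
  define Q where "Q x = 1 / 2 * dot N (v x) (mat_vec N A (v x))" for x
  have "(\<lambda>x. mat_vec N A (v x) i) \<in> L2 (lebesgue_on \<Omega>)" for i
    unfolding mat_vec_def by (intro L2_sum L2_cmult v2) auto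
  then have Qi: "integrable (lebesgue_on \<Omega>) Q"
    unfolding Q_def dot_def by (intro integrable_mult_right Bochner_Integration.integrable_sum L2_integrable_mult v2) auto
  have Qb: "AE x in lebesgue_on \<Omega>. \<bar>Q x\<bar> \<le> N * a / 2"
    using v01
  proof eventually_elim
    case (elim x)
    have "\<bar>dot N (v x) (mat_vec N A (v x))\<bar> \<le> (\<Sum>i<N. a)"
      unfolding dot_def
    proof (intro order_trans[OF sum_abs] sum_mono)
      fix i assume "i \<in> {..<N}"
      then have "\<bar>v x i\<bar> * \<bar>mat_vec N A (v x) i\<bar> \<le> 1 * a" using elim by (intro mult_mono a(2)) auto
      then show "\<bar>v x i * mat_vec N A (v x) i\<bar> \<le> a" by (simp add: abs_mult)
    qed
    then show ?case by (simp add: Q_def abs_mult)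
  qed
  have "(LINT x|lebesgue_on \<Omega>. Psi N A \<psi> (v x)) = (LINT x|lebesgue_on \<Omega>. (\<Sum>i<N. \<psi> (v x i)) - Q x)"
    by (simp add: Psi_def Q_def)
  also have "\<dots> = (\<Sum>i<N. LINT x|lebesgue_on \<Omega>. \<psi> (v x i)) - (LINT x|lebesgue_on \<Omega>. Q x)"
    using adm_psi(1)[OF v] Qi by (subst Bochner_Integration.integral_diff) (auto intro!: Bochner_Integration.integral_sum)
  finally have "energy \<Omega> N \<gamma> A \<psi> v - F \<gamma> v = - (LINT x|lebesgue_on \<Omega>. Q x)"
    by (simp add: energy_def F_def D_def)
  then show ?thesis using bounded_abs_integral[OF Qi Qb] by simp
qed

text \<open>The first summand bounds \<open>F \<gamma>\<close> at the constant competitor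
  \<open>m\<close>; the second is the bound of \<open>dissipation_pointwise\<close> times the
  volume.\<close>

definition C3 where "C3 = N * (Mp * V) + N * ((1 + a * (\<Sum>i<N. \<Sum>j<N. \<bar>\<alpha> i j\<bar>))\<^sup>2 / (4 * l0) + a) * V"

lemma C3_nonneg: "0 \<le> C3"
  using Mp(1) V_pos l0(1) a(1) by (auto simp: C3_def intro!: add_nonneg_nonneg mult_nonneg_nonneg divide_nonneg_pos)

end

text \<open>One good time frozen: properties of a solution that hold for almost every time, stated
  for \<open>U = u t\<close> and \<open>W = w t\<close>.\<close>

locale energy_state = energy_setting \<Omega> N \<alpha> A \<psi> m l0 Mp a
  for \<Omega> :: "'a::euclidean_space set" and N :: nat and \<alpha> A \<psi> m l0 Mp a +
  fixes \<gamma> :: real and U W :: "'a => nat => real"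
  assumes gam: "0 < \<gamma>" and UH2: "\<And>i. i < N ==> (\<lambda>x. U x i) \<in> H2 \<Omega>"
    and U01: "AE x in lebesgue_on \<Omega>. \<forall>i<N. 0 < U x i \<and> U x i < 1"
    and Usum: "AE x in lebesgue_on \<Omega>. (\<Sum>i<N. U x i) = 1"
    and Umean: "\<And>i. i < N ==> mean \<Omega> U i = m i"
    and phi: "\<And>i. i < N ==> (\<lambda>x. D01 \<psi> (U x i)) \<in> L2 (lebesgue_on \<Omega>)"
    and W: "\<And>i. i < N ==> (\<lambda>x. W x i) \<in> L2 (lebesgue_on \<Omega>)"
    and pde: "AE x in lebesgue_on \<Omega>. \<forall>i<N. W x i = proj N (\<lambda>j. - mat_vec N A (U x) j + D01 \<psi> (U x j)) i
                     - \<gamma> * weak_laplacian \<Omega> (\<lambda>y. U y i) x"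
    and normal: "\<And>i. i < N ==> \<exists>h. has_normal_derivative \<Omega> (\<lambda>x. U x i) h \<and> (AE x in surface_measure \<Omega>. h x = 0)"
begin

text \<open>\<open>S\<close> is the mean that the projection in the equation for \<open>w\<close>
  removes. Adding it and \<open>A U\<close> back to \<open>W\<close> gives the unprojected
  expression of \<open>xi_eq\<close>. The route through \<open>W\<close> avoids the Laplacian, whose
  separate choice at each time need not be jointly measurable.\<close>

definition S where "S x = (\<Sum>j<N. D01 \<psi> (U x j)) / real N - (\<Sum>j<N. mat_vec N A (U x) j) / real N"
definition \<xi> where "\<xi> i x = W x i + mat_vec N A (U x) i + S x"

lemma U_H1: "i < N ==> (\<lambda>x. U x i) \<in> H1 \<Omega>"
  using UH2 by (simp add: H2_def)

lemma U_L2: "i < N ==> (\<lambda>x. U x i) \<in> L2 (lebesgue_on \<Omega>)"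
  by (rule H1_L2[OF U_H1])

lemma U_adm: "adm U"
proof -
  have "AE x in lebesgue_on \<Omega>. \<forall>i<N. 0 \<le> U x i \<and> U x i \<le> 1" using U01 by eventually_elim (auto simp: less_imp_le)
  then show ?thesis using U_H1 by (simp add: adm_def)
qed

lemma AU_L2: "(\<lambda>x. mat_vec N A (U x) i) \<in> L2 (lebesgue_on \<Omega>)"
  unfolding mat_vec_def by (intro L2_sum L2_cmult U_L2) auto

lemma S_L2: "S \<in> L2 (lebesgue_on \<Omega>)"
proof -
  have "(\<lambda>x. 1 / real N * (\<Sum>j<N. D01 \<psi> (U x j)) - 1 / real N * (\<Sum>j<N. mat_vec N A (U x) j)) \<in> L2 (lebesgue_on \<Omega>)"
    by (intro L2_diff L2_cmult L2_sum phi AU_L2) auto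
  then show ?thesis by (simp add: S_def[abs_def])
qed

lemma xi_L2: "i < N ==> \<xi> i \<in> L2 (lebesgue_on \<Omega>)"
  unfolding \<xi>_def[abs_def] by (intro L2_add W AU_L2 S_L2)

lemma xi_eq:
  assumes i: "i < N"
  shows "AE x in lebesgue_on \<Omega>. \<xi> i x = D01 \<psi> (U x i) - \<gamma> * weak_laplacian \<Omega> (\<lambda>y. U y i) x"
  using pde
proof eventually_elim
  case (elim x)
  have "(\<Sum>j<N. - mat_vec N A (U x) j + D01 \<psi> (U x j)) = (\<Sum>j<N. D01 \<psi> (U x j)) - (\<Sum>j<N. mat_vec N A (U x) j)"
    unfolding sum_subtractf[symmetric] by (intro sum.cong) auto
  then show ?case using elim i by (simp add: \<xi>_def S_def proj_def diff_divide_distrib)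
qed

text \<open>Green's formula with the Neumann condition turns the Laplacian into a gradient pairing.
  Then two convexity inequalities suffice: \<open>potential_tangent\<close> for
  \<open>\<psi>\<close>, and \<open>p * q \<le> (p\<^sup>2 + q\<^sup>2) / 2\<close> for the
  gradients.\<close>

lemma subgradient:
  assumes v: "adm v"
  shows "F \<gamma> U + (\<Sum>i<N. LINT x|lebesgue_on \<Omega>. \<xi> i x * (v x i - U x i)) \<le> F \<gamma> v"
proof -
  have "(LINT x|lebesgue_on \<Omega>. \<psi> (U x i)) + \<gamma> / 2 * (\<Sum>b\<in>Basis. (n2 (weak_partial \<Omega> b (\<lambda>x. U x i)))\<^sup>2) + (LINT x|lebesgue_on \<Omega>. \<xi> i x * (v x i - U x i))
     \<le> (LINT x|lebesgue_on \<Omega>. \<psi> (v x i)) + \<gamma> / 2 * (\<Sum>b\<in>Basis. (n2 (weak_partial \<Omega> b (\<lambda>x. v x i)))\<^sup>2)" if i: "i < N" for i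
  proof -
    let ?d = "\<lambda>x. v x i - U x i" and ?u = "\<lambda>x. U x i" and ?v = "\<lambda>x. v x i"
    have vH: "?v \<in> H1 \<Omega>" using v i by (simp add: adm_def)
    have dH: "?d \<in> H1 \<Omega>" by (rule H1_diff(1)[OF vH U_H1[OF i]])
    have db: "AE x in lebesgue_on \<Omega>. \<bar>?d x\<bar> \<le> 1"
      using v[unfolded adm_def, THEN conjunct2] U01
    proof eventually_elim
      case (elim x)
      then have "0 \<le> v x i" "v x i \<le> 1" "0 < U x i" "U x i < 1" using i by auto
      then show ?case by linarith
    qed
    obtain h where h: "has_normal_derivative \<Omega> ?u h" "AE x in surface_measure \<Omega>. h x = 0" using normal[OF i] by blast
    have green: "(LINT x|lebesgue_on \<Omega>. weak_laplacian \<Omega> ?u x * ?d x)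
        = - (\<Sum>b\<in>Basis. LINT x|lebesgue_on \<Omega>. weak_partial \<Omega> b ?u x * weak_partial \<Omega> b ?d x)"
      by (rule green_formula[OF dim dom UH2[OF i] h dH db]) simp
    have lap: "weak_laplacian \<Omega> ?u \<in> L2 (lebesgue_on \<Omega>)"
      unfolding weak_laplacian_def[abs_def] using UH2[OF i] by (intro L2_sum H1_weak_partial(2)) (auto simp: H2_def)
    have d2: "?d \<in> L2 (lebesgue_on \<Omega>)" by (rule H1_L2[OF dH])
    have "(LINT x|lebesgue_on \<Omega>. \<xi> i x * ?d x) = (LINT x|lebesgue_on \<Omega>. D01 \<psi> (U x i) * ?d x - \<gamma> * (weak_laplacian \<Omega> ?u x * ?d x))"
    proof (rule integral_cong_AE)
      show "(\<lambda>x. \<xi> i x * ?d x) \<in> borel_measurable (lebesgue_on \<Omega>)"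
        by (rule borel_measurable_integrable[OF L2_integrable_mult[OF xi_L2[OF i] d2]])
      show "(\<lambda>x. D01 \<psi> (U x i) * ?d x - \<gamma> * (weak_laplacian \<Omega> ?u x * ?d x)) \<in> borel_measurable (lebesgue_on \<Omega>)"
        by (rule borel_measurable_integrable) (intro Bochner_Integration.integrable_diff integrable_mult_right L2_integrable_mult phi i lap d2)
      show "AE x in lebesgue_on \<Omega>. \<xi> i x * ?d x = D01 \<psi> (U x i) * ?d x - \<gamma> * (weak_laplacian \<Omega> ?u x * ?d x)"
        using xi_eq[OF i] by eventually_elim (simp add: left_diff_distrib)
    qed
    also have "\<dots> = (LINT x|lebesgue_on \<Omega>. D01 \<psi> (U x i) * ?d x) - \<gamma> * (LINT x|lebesgue_on \<Omega>. weak_laplacian \<Omega> ?u x * ?d x)"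
      using L2_integrable_mult[OF phi[OF i] d2] L2_integrable_mult[OF lap d2] by simp
    also have "\<dots> = (LINT x|lebesgue_on \<Omega>. D01 \<psi> (U x i) * ?d x) + \<gamma> * (\<Sum>b\<in>Basis. LINT x|lebesgue_on \<Omega>. weak_partial \<Omega> b ?u x * weak_partial \<Omega> b ?d x)"
      unfolding green by simp
    also have "\<dots> \<le> ((LINT x|lebesgue_on \<Omega>. \<psi> (v x i)) - (LINT x|lebesgue_on \<Omega>. \<psi> (U x i)))
        + \<gamma> * (\<Sum>b\<in>Basis. ((n2 (weak_partial \<Omega> b ?v))\<^sup>2 - (n2 (weak_partial \<Omega> b ?u))\<^sup>2) / 2)"
    proof (intro add_mono mult_left_mono sum_mono)
      have "(LINT x|lebesgue_on \<Omega>. D01 \<psi> (U x i) * ?d x) \<le> (LINT x|lebesgue_on \<Omega>. \<psi> (v x i) - \<psi> (U x i))"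
      proof (rule integral_mono_AE)
        show "AE x in lebesgue_on \<Omega>. D01 \<psi> (U x i) * ?d x \<le> \<psi> (v x i) - \<psi> (U x i)"
          using v[unfolded adm_def, THEN conjunct2] U01
          by eventually_elim (use i in \<open>auto intro!: potential_tangent[OF pot E0]\<close>)
      qed (use L2_integrable_mult[OF phi[OF i] d2] adm_psi(1)[OF v i] adm_psi(1)[OF U_adm i] in auto)
      then show "(LINT x|lebesgue_on \<Omega>. D01 \<psi> (U x i) * ?d x) \<le> (LINT x|lebesgue_on \<Omega>. \<psi> (v x i)) - (LINT x|lebesgue_on \<Omega>. \<psi> (U x i))"
        using adm_psi(1)[OF v i] adm_psi(1)[OF U_adm i] by simp
      fix b :: 'a assume b: "b \<in> Basis"
      let ?pu = "weak_partial \<Omega> b ?u" and ?pv = "weak_partial \<Omega> b ?v"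
      have pu: "?pu \<in> L2 (lebesgue_on \<Omega>)" by (rule H1_weak_partial(2)[OF U_H1[OF i] b])
      have pv: "?pv \<in> L2 (lebesgue_on \<Omega>)" by (rule H1_weak_partial(2)[OF vH b])
      have pd: "weak_partial \<Omega> b ?d \<in> L2 (lebesgue_on \<Omega>)" by (rule H1_weak_partial(2)[OF dH b])
      have "(LINT x|lebesgue_on \<Omega>. ?pu x * weak_partial \<Omega> b ?d x) = (LINT x|lebesgue_on \<Omega>. ?pu x * ?pv x - (?pu x)\<^sup>2)"
      proof (rule integral_cong_AE)
        show "AE x in lebesgue_on \<Omega>. ?pu x * weak_partial \<Omega> b ?d x = ?pu x * ?pv x - (?pu x)\<^sup>2"
          using H1_diff(2)[OF vH U_H1[OF i] b] by eventually_elim (simp add: power2_eq_square right_diff_distrib)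
        show "(\<lambda>x. ?pu x * weak_partial \<Omega> b ?d x) \<in> borel_measurable (lebesgue_on \<Omega>)"
          by (rule borel_measurable_integrable[OF L2_integrable_mult[OF pu pd]])
        show "(\<lambda>x. ?pu x * ?pv x - (?pu x)\<^sup>2) \<in> borel_measurable (lebesgue_on \<Omega>)"
          by (rule borel_measurable_integrable) (intro Bochner_Integration.integrable_diff L2_integrable_mult L2_integrable_square pu pv)
      qed
      also have "\<dots> = (LINT x|lebesgue_on \<Omega>. ?pu x * ?pv x) - (n2 ?pu)\<^sup>2"
        using L2_integrable_mult[OF pu pv] L2_integrable_square[OF pu] by (simp add: L2_norm_sq)
      also have "\<dots> \<le> ((n2 ?pv)\<^sup>2 - (n2 ?pu)\<^sup>2) / 2"
        using abs_le_D1[OF abs_integral_mult_le[OF pu pv]] by (simp add: L2_norm_sq field_simps)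
      finally show "(LINT x|lebesgue_on \<Omega>. ?pu x * weak_partial \<Omega> b ?d x) \<le> ((n2 ?pv)\<^sup>2 - (n2 ?pu)\<^sup>2) / 2" .
    qed (use gam in simp)
    also have "(\<Sum>b\<in>Basis. ((n2 (weak_partial \<Omega> b ?v))\<^sup>2 - (n2 (weak_partial \<Omega> b ?u))\<^sup>2) / 2)
       = ((\<Sum>b\<in>Basis. (n2 (weak_partial \<Omega> b ?v))\<^sup>2) - (\<Sum>b\<in>Basis. (n2 (weak_partial \<Omega> b ?u))\<^sup>2)) / 2"
      by (simp only: sum_subtractf sum_divide_distrib[symmetric])
    finally show ?thesis by (simp add: algebra_simps diff_divide_distrib)
  qed
  then have "(\<Sum>i<N. (LINT x|lebesgue_on \<Omega>. \<psi> (U x i)) + \<gamma> / 2 * (\<Sum>b\<in>Basis. (n2 (weak_partial \<Omega> b (\<lambda>x. U x i)))\<^sup>2) + (LINT x|lebesgue_on \<Omega>. \<xi> i x * (v x i - U x i)))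
     \<le> (\<Sum>i<N. (LINT x|lebesgue_on \<Omega>. \<psi> (v x i)) + \<gamma> / 2 * (\<Sum>b\<in>Basis. (n2 (weak_partial \<Omega> b (\<lambda>x. v x i)))\<^sup>2))"
    by (intro sum_mono) auto
  then show ?thesis by (simp add: F_def D_def sum.distrib sum_distrib_left)
qed

lemma m01:
  assumes i: "i < N"
  shows "0 \<le> m i" "m i \<le> 1"
proof -
  have Ui: "integrable (lebesgue_on \<Omega>) (\<lambda>x. U x i)" by (rule L2_integrable[OF U_L2[OF i]])
  have mi: "(LINT x|lebesgue_on \<Omega>. U x i) = m i * V" using Umean[OF i] V_pos by (simp add: mean_def V_def[symmetric] field_simps)
  have U0: "AE x in lebesgue_on \<Omega>. 0 \<le> U x i" and U1: "AE x in lebesgue_on \<Omega>. U x i \<le> 1"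
    using U01 by (eventually_elim, use i in \<open>simp add: less_imp_le\<close>)+
  have "0 \<le> (LINT x|lebesgue_on \<Omega>. U x i)" by (rule integral_nonneg_AE[OF U0])
  then show "0 \<le> m i" using V_pos by (simp add: mi zero_le_mult_iff)
  have "(LINT x|lebesgue_on \<Omega>. U x i) \<le> (LINT x|lebesgue_on \<Omega>. 1)"
    by (rule integral_mono_AE[OF Ui L2_integrable[OF L2_const] U1])
  then show "m i \<le> 1" using V_pos unfolding integral_const_dom mi by simp
qed

lemma m_sum: "(\<Sum>i<N. m i) = 1"
proof -
  have "(\<Sum>i<N. m i) * V = (\<Sum>i<N. LINT x|lebesgue_on \<Omega>. U x i)"
    using V_pos by (simp add: sum_distrib_right Umean[symmetric] mean_def V_def)
  also have "\<dots> = (LINT x|lebesgue_on \<Omega>. (\<Sum>i<N. U x i))"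
    by (rule Bochner_Integration.integral_sum[symmetric]) (auto intro: L2_integrable U_L2)
  also have "\<dots> = (LINT x|lebesgue_on \<Omega>. 1)"
    by (rule integral_cong_AE) (use Usum L2_measurable[OF L2_sum[of "{..<N}" "\<lambda>i x. U x i"]] U_L2 in auto)
  also have "\<dots> = 1 * V" by (rule integral_const_dom)
  finally show ?thesis using V_pos by simp
qed

text \<open>The competitor \<open>m\<close> contributes no Dirichlet term, so
  \<open>\<gamma>\<close> leaves the bound. The pairing of \<open>\<xi>\<close> with
  \<open>z\<close> differs from that with \<open>m - U\<close> by the pairing with
  \<open>y = z + U - m\<close>; there \<open>S\<close> drops out as the components of
  \<open>y\<close> sum to 0, and the means of \<open>W\<close> as each component has integral 0. The
  rest is \<open>dissipation_pointwise\<close>.\<close>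

lemma dissipation:
  "F \<gamma> U + (\<Sum>i<N. LINT x|lebesgue_on \<Omega>. \<xi> i x * (- mat_vec N \<alpha> (\<lambda>j. W x j - mean \<Omega> W j) i)) \<le> C3"
proof -
  define p where "p i x = W x i - mean \<Omega> W i" for i x
  define z where "z i x = - mat_vec N \<alpha> (\<lambda>j. p j x) i" for i x
  define y where "y i x = z i x + (U x i - m i)" for i x
  have p2: "p i \<in> L2 (lebesgue_on \<Omega>)" if "i < N" for i unfolding p_def[abs_def] by (intro L2_diff W that L2_const)
  have z2: "z i \<in> L2 (lebesgue_on \<Omega>)" for i unfolding z_def[abs_def] mat_vec_def by (intro L2_uminus L2_sum L2_cmult p2) auto
  have Um2: "(\<lambda>x. U x i - m i) \<in> L2 (lebesgue_on \<Omega>)" if "i < N" for i by (intro L2_diff U_L2 that L2_const)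
  have y2: "y i \<in> L2 (lebesgue_on \<Omega>)" if "i < N" for i unfolding y_def[abs_def] by (intro L2_add z2 Um2 that)
  have p0: "(LINT x|lebesgue_on \<Omega>. p i x) = 0" if i: "i < N" for i
    unfolding p_def using L2_integrable[OF W[OF i]] L2_integrable[OF L2_const, of "mean \<Omega> W i"] V_pos
    by (subst Bochner_Integration.integral_diff) (simp_all only: integral_const_dom, simp add: mean_def V_def[symmetric])
  have y0: "(LINT x|lebesgue_on \<Omega>. y i x) = 0" if i: "i < N" for i
  proof -
    have "(LINT x|lebesgue_on \<Omega>. z i x) = - (\<Sum>j<N. \<alpha> i j * (LINT x|lebesgue_on \<Omega>. p j x))"
      unfolding z_def mat_vec_def using L2_integrable[OF p2] by (simp add: Bochner_Integration.integral_sum)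
    then have "(LINT x|lebesgue_on \<Omega>. z i x) = 0" using p0 by simp
    moreover have "(LINT x|lebesgue_on \<Omega>. U x i - m i) = 0"
      using L2_integrable[OF U_L2[OF i]] L2_integrable[OF L2_const, of "m i"] Umean[OF i] V_pos
      by (subst Bochner_Integration.integral_diff) (simp_all only: integral_const_dom, simp add: mean_def V_def[symmetric] field_simps)
    ultimately show ?thesis unfolding y_def
      using L2_integrable[OF z2] L2_integrable[OF Um2[OF i]] by (subst Bochner_Integration.integral_add) auto
  qed
  have ysum: "AE x in lebesgue_on \<Omega>. (\<Sum>i<N. y i x) = 0"
    using Usum by eventually_elim (simp add: y_def z_def sum.distrib sum_negf sum_subtractf mobility_sum[OF mob] m_sum)
  have c: "adm (\<lambda>x. m)" and Dc: "D (\<lambda>x. m) = 0"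
  proof -
    show "adm (\<lambda>x. m)" using m01 by (simp add: adm_def smooth_H1[OF smooth_on_const])
    have "n2 (weak_partial \<Omega> b (\<lambda>x. m i)) = 0" if b: "b \<in> Basis" for b i
    proof -
      have pz: "partial_derivative b (\<lambda>x. m i) = (\<lambda>x. 0)" by (rule ext, rule partial_derivative_eq[OF has_derivative_const])
      have "AE x in lebesgue_on \<Omega>. weak_partial \<Omega> b (\<lambda>x. m i) x = 0"
        using weak_partial_eq(2)[OF smooth_weak_partial[OF smooth_on_const b, of "m i"]] by (simp add: pz)
      then have "n2 (weak_partial \<Omega> b (\<lambda>x. m i)) = n2 (\<lambda>x. 0)"
        by (intro L2_norm_cong_AE L2_measurable[OF H1_weak_partial(2)[OF smooth_H1[OF smooth_on_const] b]]) auto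
      then show ?thesis by (simp add: L2_norm_def)
    qed
    then show "D (\<lambda>x. m) = 0" by (simp add: D_def)
  qed
  have "F \<gamma> (\<lambda>x. m) \<le> N * (Mp * V)" using abs_le_D1[OF F_bounds[OF c, of \<gamma>]] by (simp add: Dc)
  then have "F \<gamma> U + (\<Sum>i<N. LINT x|lebesgue_on \<Omega>. \<xi> i x * (m i - U x i)) \<le> N * (Mp * V)"
    using subgradient[OF c] by linarith
  moreover have "(\<Sum>i<N. LINT x|lebesgue_on \<Omega>. \<xi> i x * z i x) - (\<Sum>i<N. LINT x|lebesgue_on \<Omega>. \<xi> i x * (m i - U x i))
     = (\<Sum>i<N. LINT x|lebesgue_on \<Omega>. \<xi> i x * y i x)"
    unfolding sum_subtractf[symmetric]
  proof (intro sum.cong refl)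
    fix i assume "i \<in> {..<N}"
    then have i: "i < N" by simp
    have mU: "(\<lambda>x. m i - U x i) \<in> L2 (lebesgue_on \<Omega>)" by (intro L2_diff L2_const U_L2 i)
    show "(LINT x|lebesgue_on \<Omega>. \<xi> i x * z i x) - (LINT x|lebesgue_on \<Omega>. \<xi> i x * (m i - U x i)) = (LINT x|lebesgue_on \<Omega>. \<xi> i x * y i x)"
      using L2_integrable_mult[OF xi_L2[OF i] z2[of i]] L2_integrable_mult[OF xi_L2[OF i] mU]
      by (subst Bochner_Integration.integral_diff[symmetric]) (auto simp: y_def algebra_simps)
  qed
  moreover have "(\<Sum>i<N. LINT x|lebesgue_on \<Omega>. \<xi> i x * y i x) \<le> N * ((1 + a * (\<Sum>i<N. \<Sum>j<N. \<bar>\<alpha> i j\<bar>))\<^sup>2 / (4 * l0) + a) * V"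
  proof -
    let ?K = "N * ((1 + a * (\<Sum>i<N. \<Sum>j<N. \<bar>\<alpha> i j\<bar>))\<^sup>2 / (4 * l0) + a)"
    have iy: "integrable (lebesgue_on \<Omega>) (\<lambda>x. \<xi> i x * y i x)" if "i < N" for i by (intro L2_integrable_mult xi_L2 y2 that)
    have ipy: "integrable (lebesgue_on \<Omega>) (\<lambda>x. (p i x + mat_vec N A (U x) i) * y i x)" if "i < N" for i
      by (intro L2_integrable_mult L2_add p2 AU_L2 y2 that)
    have imy: "integrable (lebesgue_on \<Omega>) (\<lambda>x. mean \<Omega> W i * y i x)" if "i < N" for i
      by (intro integrable_mult_right L2_integrable y2 that)
    have "(\<Sum>i<N. LINT x|lebesgue_on \<Omega>. \<xi> i x * y i x) = (LINT x|lebesgue_on \<Omega>. (\<Sum>i<N. \<xi> i x * y i x))"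
      using iy by (intro Bochner_Integration.integral_sum[symmetric]) auto
    also have "\<dots> = (LINT x|lebesgue_on \<Omega>. (\<Sum>i<N. (p i x + mat_vec N A (U x) i) * y i x) + (\<Sum>i<N. mean \<Omega> W i * y i x))"
    proof (rule integral_cong_AE)
      show "(\<lambda>x. \<Sum>i<N. \<xi> i x * y i x) \<in> borel_measurable (lebesgue_on \<Omega>)"
        using iy by (intro borel_measurable_integrable Bochner_Integration.integrable_sum) auto
      show "(\<lambda>x. (\<Sum>i<N. (p i x + mat_vec N A (U x) i) * y i x) + (\<Sum>i<N. mean \<Omega> W i * y i x)) \<in> borel_measurable (lebesgue_on \<Omega>)"
        using ipy imy by (intro borel_measurable_integrable Bochner_Integration.integrable_add Bochner_Integration.integrable_sum) auto
      show "AE x in lebesgue_on \<Omega>. (\<Sum>i<N. \<xi> i x * y i x) = (\<Sum>i<N. (p i x + mat_vec N A (U x) i) * y i x) + (\<Sum>i<N. mean \<Omega> W i * y i x)"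
        using ysum
      proof eventually_elim
        case (elim x)
        have "(\<Sum>i<N. \<xi> i x * y i x) = (\<Sum>i<N. (p i x + mat_vec N A (U x) i) * y i x) + (\<Sum>i<N. mean \<Omega> W i * y i x) + S x * (\<Sum>i<N. y i x)"
          unfolding sum_distrib_left sum.distrib[symmetric] by (intro sum.cong) (auto simp: \<xi>_def p_def algebra_simps)
        then show ?case using elim by simp
      qed
    qed
    also have "\<dots> = (LINT x|lebesgue_on \<Omega>. (\<Sum>i<N. (p i x + mat_vec N A (U x) i) * y i x)) + (\<Sum>i<N. mean \<Omega> W i * (LINT x|lebesgue_on \<Omega>. y i x))"
      using ipy imy by (subst Bochner_Integration.integral_add) (auto simp: Bochner_Integration.integral_sum)
    also have "\<dots> = (LINT x|lebesgue_on \<Omega>. (\<Sum>i<N. (p i x + mat_vec N A (U x) i) * y i x))" using y0 by simp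
    also have "\<dots> \<le> (LINT x|lebesgue_on \<Omega>. ?K)"
    proof (rule integral_mono_AE)
      show "AE x in lebesgue_on \<Omega>. (\<Sum>i<N. (p i x + mat_vec N A (U x) i) * y i x) \<le> ?K"
        using U01 Usum
      proof eventually_elim
        case (elim x)
        have "(\<Sum>i<N. (p i x + mat_vec N A (U x) i) * ((U x i - m i) - mat_vec N \<alpha> (\<lambda>j. p j x) i)) \<le> ?K"
        proof (rule dissipation_pointwise[OF _ mob l0])
          show "\<bar>mat_vec N A (U x) i\<bar> \<le> a" if "i < N" for i using elim(1) by (intro a(2) that) (auto simp: less_imp_le)
          show "\<bar>U x i - m i\<bar> \<le> 1" if "i < N" for i
          proof -
            have "0 < U x i" "U x i < 1" using elim(1) that by auto
            then show ?thesis using m01[OF that] by linarith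
          qed
          show "(\<Sum>i<N. U x i - m i) = 0" using elim(2) by (simp add: sum_subtractf m_sum)
        qed (use N2 a in auto)
        then show ?case by (simp add: y_def z_def)
      qed
    qed (use ipy L2_integrable[OF L2_const] in \<open>auto intro!: Bochner_Integration.integrable_sum\<close>)
    also have "\<dots> = ?K * V" by (rule integral_const_dom)
    finally show ?thesis .
  qed
  ultimately have "F \<gamma> U + (\<Sum>i<N. LINT x|lebesgue_on \<Omega>. \<xi> i x * z i x) \<le> C3" unfolding C3_def by linarith
  then show ?thesis by (simp add: z_def p_def)
qed

end

section \<open>Decay of the energy\<close>

text \<open>The form in which the Gronwall argument consumes the chain inequality: a bound at the
  good times strictly between \<open>t1\<close> and \<open>t2\<close> is enough, as the other times
  form a null set.\<close>

lemma (in time_chain) chain_bound: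
  assumes t1: "t1 \<in> insert 0 G" and t2: "t2 \<in> G" and lt: "t1 < t2"
    and c: "\<And>r. r \<in> G ==> t1 < r ==> r < t2 ==> (\<Sum>i<N. LINT x|lborel. \<Xi> i (r, x) * Z i (r, x)) \<le> c"
  shows "f t2 - f t1 \<le> c * (t2 - t1)"
proof -
  have ii: "integrable lborel (\<lambda>r. indicator {t1..t2} r * (LINT x|lborel. \<Xi> i (r, x) * Z i (r, x)))" if "i < N" for i
    using integrable_mult_indicator[OF _ integral_mult_fst(1)[OF \<Xi>[OF that] Z[OF that]], of "{t1..t2}"] by simp
  have ic: "integrable lborel (\<lambda>r. indicator {t1..t2} r * c)"
    by (rule integrable_mult_left) (simp add: integrable_indicat_real_bounded)
  have "f t2 - f t1 \<le> (\<Sum>i<N. LINT r|lborel. indicator {t1..t2} r * (LINT x|lborel. \<Xi> i (r, x) * Z i (r, x)))"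
    by (rule chain_inequality[OF t1 t2 lt])
  also have "\<dots> = (LINT r|lborel. (\<Sum>i<N. indicator {t1..t2} r * (LINT x|lborel. \<Xi> i (r, x) * Z i (r, x))))"
    using ii by (intro Bochner_Integration.integral_sum[symmetric]) auto
  also have "\<dots> \<le> (LINT r|lborel. indicator {t1..t2} r * c)"
  proof (rule integral_mono_AE)
    have "AE r in lborel. r \<noteq> t1" "AE r in lborel. r \<noteq> t2" by (rule AE_lborel_singleton)+
    with AE_G show "AE r in lborel. (\<Sum>i<N. indicator {t1..t2} r * (LINT x|lborel. \<Xi> i (r, x) * Z i (r, x))) \<le> indicator {t1..t2} r * c"
    proof eventually_elim
      case (elim r)
      show ?case
      proof (cases "r \<in> {t1..t2}")
        case True
        then have "r \<in> G" "t1 < r" "r < t2" using elim G(2) t2 G_pos[OF t1] by auto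
        then show ?thesis using c[of r] True by simp
      qed simp
    qed
    show "integrable lborel (\<lambda>r. \<Sum>i<N. indicator {t1..t2} r * (LINT x|lborel. \<Xi> i (r, x) * Z i (r, x)))"
      using ii by (intro Bochner_Integration.integrable_sum) auto
  qed (rule ic)
  also have "\<dots> = c * (t2 - t1)" using lt by simp
  finally show ?thesis .
qed

text \<open>\<open>d\<close> measures how far \<open>f\<close> is from the unit interval. Clamping
  is the nearest point projection, so \<open>\<bar>d x\<bar>\<close> is at most the distance of
  \<open>f x\<close> to \<open>s k x\<close>, which tends to 0 in L2.\<close>

lemma L2_limit_bounds:
  assumes s: "\<And>k. s k \<in> L2 M" and f: "f \<in> L2 M" and lim: "(\<lambda>k. L2_norm M (\<lambda>x. s k x - f x)) \<longlonglongrightarrow> 0"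
    and b: "\<And>k. AE x in M. 0 \<le> s k x \<and> s k x \<le> 1"
  shows "AE x in M. 0 \<le> f x \<and> f x \<le> (1 :: real)"
proof -
  define d where "d x = f x - max 0 (min 1 (f x))" for x
  have [measurable]: "f \<in> borel_measurable M" by (rule L2_measurable[OF f])
  have "d \<in> borel_measurable M" unfolding d_def[abs_def] by measurable
  then have d2: "d \<in> L2 M" by (rule L2_bound[OF f]) (auto simp: d_def)
  have "L2_norm M d \<le> L2_norm M (\<lambda>x. s k x - f x)" for k
    unfolding L2_norm_def
  proof (intro real_sqrt_le_mono integral_mono_AE L2_integrable_square d2 L2_diff s f)
    show "AE x in M. (d x)\<^sup>2 \<le> (s k x - f x)\<^sup>2"
      using b[of k]
    proof eventually_elim
      case (elim x)
      then have "\<bar>d x\<bar> \<le> \<bar>s k x - f x\<bar>" by (auto simp: d_def)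
      then show ?case by (simp add: abs_le_square_iff)
    qed
  qed
  then have "L2_norm M d \<le> 0" by (intro LIMSEQ_le_const[OF lim]) auto
  then have "(LINT x|M. (d x)\<^sup>2) = 0" using L2_norm_nonneg[of M d] L2_norm_sq[of M d] by simp
  then have "AE x in M. (d x)\<^sup>2 = 0" by (subst (asm) integral_nonneg_eq_0_iff_AE[OF L2_integrable_square[OF d2]]) auto
  then show ?thesis by eventually_elim (auto simp: d_def max_def min_def split: if_splits)
qed

text \<open>
  Over a time step of length between \<open>1/2\<close> and \<open>1\<close> the shifted energy is contracted by the factor
  \<open>2/3\<close>, up to a constant; this is the origin of \<open>\<omega> = ln (3/2)\<close>.
\<close>

lemma decay_estimate:
  fixes f ac :: "real => real"
  assumes G: "\<And>t. t \<in> G ==> 0 < t \<and> t \<le> T"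
    and dense: "\<And>x y. 0 \<le> x ==> x < y ==> y \<le> T ==> \<exists>r\<in>G. x < r \<and> r < y"
    and step: "\<And>t1 t2 c. t1 \<in> insert 0 G ==> t2 \<in> G ==> t1 < t2 ==>
      (\<And>r. r \<in> G ==> t1 < r ==> r < t2 ==> ac r \<le> c) ==> f t2 - f t1 \<le> c * (t2 - t1)"
    and ac: "\<And>r. r \<in> G ==> ac r \<le> C - f r" and low: "\<And>r. r \<in> insert 0 G ==> - B \<le> f r"
    and BC: "0 \<le> B" "0 \<le> C" and t: "t \<in> G"
  shows "f t + B \<le> 3 / 2 * exp (- ln (3 / 2) * t) * (f 0 + B) + 4 * (C + B)"
proof -
  define K where "K = C + B"
  define g where "g t = f t + B" for t
  define E where "E t = exp (- ln (3 / 2) * t)" for t :: real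
  have K: "0 \<le> K" using BC by (simp add: K_def)
  have g0: "0 \<le> g r" if "r \<in> insert 0 G" for r using low[OF that] by (simp add: g_def)
  \<comment> \<open>Crude growth bound: \<open>ac\<close> never exceeds \<open>K\<close>, as
    \<open>f\<close> is bounded below by \<open>- B\<close>.\<close>
  have up: "g t2 - g t1 \<le> K * (t2 - t1)" if "t1 \<in> insert 0 G" "t2 \<in> G" "t1 < t2" for t1 t2
  proof -
    have "f t2 - f t1 \<le> K * (t2 - t1)"
    proof (rule step[OF that])
      fix r assume "r \<in> G"
      then show "ac r \<le> K" using ac[of r] low[of r] by (simp add: K_def)
    qed
    then show ?thesis by (simp add: g_def)
  qed
  \<comment> \<open>By \<open>up\<close>, the value of \<open>g\<close> at an intermediate good time
    \<open>r\<close> is at least \<open>g t2 - K * (t2 - t1)\<close>. So the upper bound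
    \<open>K - g r\<close> for \<open>ac r\<close> can be expressed by \<open>g t2\<close>, which
    makes the step implicit and contracting.\<close>
  have contr: "g t2 - g t1 \<le> (K - g t2 + K * (t2 - t1)) * (t2 - t1)" if "t1 \<in> insert 0 G" "t2 \<in> G" "t1 < t2" for t1 t2
  proof -
    have "f t2 - f t1 \<le> (K - g t2 + K * (t2 - t1)) * (t2 - t1)"
    proof (rule step[OF that])
      fix r assume r: "r \<in> G" "t1 < r" "r < t2"
      have "g t2 - g r \<le> K * (t2 - r)" using up[of r t2] r that by simp
      also have "\<dots> \<le> K * (t2 - t1)" using r K by (intro mult_left_mono) auto
      finally show "ac r \<le> K - g t2 + K * (t2 - t1)" using ac[OF r(1)] by (simp add: K_def g_def)
    qed
    then show ?thesis by (simp add: g_def)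
  qed
  have E1: "E (r - 1) = 3 / 2 * E r" for r
  proof -
    have "E (r - 1) = exp (- ln (3 / 2) * r + ln (3 / 2))" by (simp add: E_def algebra_simps)
    also have "\<dots> = E r * exp (ln (3 / 2))" unfolding E_def by (rule exp_add)
    finally show ?thesis by simp
  qed
  have Emono: "E r \<le> E s" if "s \<le> r" for r s
    unfolding E_def using that by (simp add: mult_left_mono)
  \<comment> \<open>Induction over half units of time, since each step is longer than 1/2. A step of
    length \<open>h\<close> yields \<open>(1 + h) * g t \<le> g s + 2 * K\<close>, hence
    \<open>g t \<le> 2 / 3 * g s + 4 / 3 * K\<close> with fixed point \<open>4 * K\<close>; the
    prefactor \<open>3 / 2\<close> pays for the first unit of time.\<close>
  have claim: "g t \<le> 3 / 2 * E t * g 0 + 4 * K" if "t \<in> G" "t \<le> 1 + real n / 2" for n t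
    using that
  proof (induction n arbitrary: t)
    case (0 t)
    have t1: "0 < t" "t \<le> 1" using G[of t] 0 by auto
    have "g t - g 0 \<le> K * t" using up[of 0 t] 0 t1 by simp
    also have "\<dots> \<le> K * 1" using t1 K by (intro mult_left_mono) auto
    finally have "g t \<le> g 0 + K" by simp
    moreover have "1 * g 0 \<le> (3 / 2 * E t) * g 0"
    proof (rule mult_right_mono)
      have "E 0 \<le> E (t - 1)" by (rule Emono) (use t1 in simp)
      then show "1 \<le> 3 / 2 * E t" unfolding E1 by (simp add: E_def)
    qed (simp add: g0)
    ultimately show ?case using K by simp
  next
    case (Suc n t)
    show ?case
    proof (cases "t \<le> 1 + real n / 2")
      case True
      then show ?thesis using Suc by blast
    next
      case False
      then have tg: "1 < t" by (smt (verit) divide_nonneg_pos of_nat_0_le_iff)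
      obtain s where s: "s \<in> G" "t - 1 < s" "s < t - 1 / 2" using dense[of "t - 1" "t - 1 / 2"] tg G[OF Suc.prems(1)] by auto
      define h where "h = t - s"
      have h: "1 / 2 < h" "h < 1" using s by (auto simp: h_def)
      have gs: "g s \<le> 3 / 2 * E s * g 0 + 4 * K" using Suc.prems(2) s(3) by (intro Suc.IH s(1)) (simp add: add_divide_distrib)
      have "g t - g s \<le> (K - g t + K * h) * h" using contr[of s t] s Suc.prems(1) by (simp add: h_def)
      then have 1: "g t + g t * h \<le> g s + K * h + K * h * h" by (simp add: algebra_simps)
      have 2: "K * h \<le> K * 1" by (rule mult_left_mono) (use h K in auto)
      have hh: "K * h * h \<le> K * 1 * 1" by (rule mult_mono[OF 2]) (use h K in auto)
      have 3: "g t * (1 / 2) \<le> g t * h" using h g0[of t] Suc.prems(1) by (intro mult_left_mono) auto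
      have "E s * g 0 \<le> E (t - 1) * g 0" by (intro mult_right_mono Emono g0) (use s in auto)
      then have 4: "E s * g 0 \<le> 3 / 2 * E t * g 0" unfolding E1 .
      have "3 / 2 * E s * g 0 = 3 / 2 * (E s * g 0)" by simp
      with 1 2 hh 3 4 gs show ?thesis by linarith
    qed
  qed
  obtain n :: nat where "2 * t < real n" using reals_Archimedean2 by blast
  then have "t \<le> 1 + real n / 2" by simp
  then show ?thesis using claim[OF t] by (simp add: g_def K_def E_def)
qed

lemma AE_all_less: "(\<And>i. i < N ==> AE x in M. Q i x) ==> AE x in M. \<forall>i<(N::nat). Q i x"
  by (simp add: AE_all_countable)

section \<open>Representatives of the components of a solution\<close>

context energy_setting
begin

text \<open>Bundled so that a single choice per component provides all properties at once.\<close>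

definition represents :: "real => (real => 'a => real) => (real \<times> 'a => real) => bool" where
  "represents T f H \<longleftrightarrow> H \<in> L2 lborel \<and> H \<in> borel_measurable borel \<and> (\<forall>p. p \<notin> {0<..<T} \<times> \<Omega> \<longrightarrow> H p = 0) \<and>
    (AE t in lebesgue_on {0<..<T}. AE x in lebesgue_on \<Omega>. H (t, x) = f t x) \<and>
    (AE x in lebesgue_on \<Omega>. AE t in lebesgue_on {0<..<T}. H (t, x) = f t x)"

lemma representsD:
  assumes "represents T f H"
  shows "H \<in> L2 lborel" "H \<in> borel_measurable borel" "\<And>p. p \<notin> {0<..<T} \<times> \<Omega> ==> H p = 0"
    "AE t in lebesgue_on {0<..<T}. AE x in lebesgue_on \<Omega>. H (t, x) = f t x"
    "AE x in lebesgue_on \<Omega>. AE t in lebesgue_on {0<..<T}. H (t, x) = f t x"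
  using assms unfolding represents_def by blast+

lemma represents_L2_L2:
  assumes "f \<in> L2_L2 \<Omega> T"
  shows "\<exists>H. represents T f H"
  using L2_L2_representative[OF assms] unfolding represents_def by blast

lemma represents_bounded:
  assumes "jointly_measurable \<Omega> T f"
    and b: "AE t in lebesgue_on {0<..<T}. AE x in lebesgue_on \<Omega>. \<bar>f t x\<bar> \<le> 1"
  shows "\<exists>H. represents T f H"
proof -
  obtain H where H: "H \<in> borel_measurable borel" "\<And>p. p \<notin> {0<..<T} \<times> \<Omega> ==> H p = 0"
    "AE t in lebesgue_on {0<..<T}. AE x in lebesgue_on \<Omega>. H (t, x) = f t x"
    "AE x in lebesgue_on \<Omega>. AE t in lebesgue_on {0<..<T}. H (t, x) = f t x"
    using joint_representative[OF assms(1)] by blast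
  have ae: "AE t in lebesgue_on {0<..<T}. AE x in lebesgue_on \<Omega>. \<bar>H (t, x)\<bar> \<le> 1"
    using H(3) b
  proof eventually_elim
    case (elim t)
    then show ?case by eventually_elim simp
  qed
  have "H \<in> L2 lborel" by (rule bounded_representative_L2[where T = T and C = 1, OF H(1) _ ae]) (rule H(2), assumption, simp)
  then show ?thesis using H unfolding represents_def by blast
qed

end

lemma damped_bound:
  fixes e x y k z :: real
  assumes e: "0 \<le> e" "e \<le> 1" and xy: "x \<le> y + k" and k: "0 \<le> k"
  shows "3 / 2 * e * x + z \<le> 3 / 2 * e * y + 3 / 2 * k + z"
proof -
  have "e * x \<le> e * (y + k)" using xy e(1) by (rule mult_left_mono)
  also have "\<dots> = e * y + e * k" by (rule distrib_left)
  also have "e * k \<le> 1 * k" using e(2) k by (rule mult_right_mono)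
  finally show ?thesis by simp
qed

section \<open>The energy estimate for a solution\<close>

context energy_setting
begin

lemma solution_chain:
  fixes u w :: "real => 'a => nat => real"
  assumes gam: "0 < \<gamma>" and sol: "finite_energy_solution \<Omega> N \<gamma> \<alpha> A \<psi> u0 u w"
    and u0m: "\<And>i. i < N ==> mean \<Omega> u0 i = m i" and u0adm: "adm (u 0)" and T: "0 < T"
  obtains G ac where "\<And>t. t \<in> G ==> 0 < t \<and> t < T" "\<And>x y. 0 \<le> x ==> x < y ==> y \<le> T ==> \<exists>r\<in>G. x < r \<and> r < y"
    "\<And>t. t \<in> G ==> adm (u t)" "\<And>r. r \<in> G ==> ac r \<le> C3 - F \<gamma> (u r)"
    "\<And>t1 t2 c. t1 \<in> insert 0 G ==> t2 \<in> G ==> t1 < t2 ==>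
      (\<And>r. r \<in> G ==> t1 < r ==> r < t2 ==> ac r \<le> c) ==> F \<gamma> (u t2) - F \<gamma> (u t1) \<le> c * (t2 - t1)"
proof -
  let ?I = "{0<..<T}"
  have I: "?I \<in> sets lebesgue" by simp
  note solT = sol[unfolded finite_energy_solution_def, THEN conjunct1, rule_format, OF T]
  have cl: "(\<lambda>t x. u t x i) \<in> C_L2 \<Omega> T" "(\<lambda>t x. u t x i) \<in> Linf_H1 \<Omega> T" "(\<lambda>t x. u t x i) \<in> L2_H2 \<Omega> T"
    "(\<lambda>t x. w t x i) \<in> L2_L2 \<Omega> T" "(\<lambda>t x. D01 \<psi> (u t x i)) \<in> L2_L2 \<Omega> T" if "i < N" for i
    using solT that by blast+
  have aeK: "AE t in lebesgue_on ?I. u t \<in> K_set \<Omega> N \<and> (\<forall>i<N. mean \<Omega> (u t) i = mean \<Omega> u0 i)"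
    and ae01: "AE t in lebesgue_on ?I. AE x in lebesgue_on \<Omega>. \<forall>i<N. 0 < u t x i \<and> u t x i < 1"
    and aepde: "AE t in lebesgue_on ?I. AE x in lebesgue_on \<Omega>. \<forall>i<N.
           w t x i = proj N (\<lambda>j. - mat_vec N A (u t x) j + D01 \<psi> (u t x j)) i - \<gamma> * weak_laplacian \<Omega> (\<lambda>y. u t y i) x"
    and aen: "AE t in lebesgue_on ?I. \<forall>i<N. \<exists>h. has_normal_derivative \<Omega> (\<lambda>x. u t x i) h \<and> (AE x in surface_measure \<Omega>. h x = 0)"
    using solT by blast+
  obtain ut where ut: "\<And>i. i < N ==> (\<lambda>t x. ut t x i) \<in> L2_L2 \<Omega> T"
      "\<And>i. i < N ==> has_weak_time_derivative \<Omega> T (\<lambda>t x. u t x i) (\<lambda>t x. ut t x i)"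
    and aeut: "AE t in lebesgue_on ?I. AE x in lebesgue_on \<Omega>. \<forall>i<N. ut t x i + mat_vec N \<alpha> (\<lambda>j. w t x j - mean \<Omega> (w t) j) i = 0"
    using solT by blast
  define Zr where "Zr i = (SOME H. represents T (\<lambda>t x. ut t x i) H)" for i
  define Wr where "Wr i = (SOME H. represents T (\<lambda>t x. w t x i) H)" for i
  define Pr where "Pr i = (SOME H. represents T (\<lambda>t x. D01 \<psi> (u t x i)) H)" for i
  define Ur where "Ur i = (SOME H. represents T (\<lambda>t x. u t x i) H)" for i
  have Zr: "represents T (\<lambda>t x. ut t x i) (Zr i)" if "i < N" for i
    unfolding Zr_def by (rule someI_ex[OF represents_L2_L2[OF ut(1)[OF that]]])
  have Wr: "represents T (\<lambda>t x. w t x i) (Wr i)" if "i < N" for i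
    unfolding Wr_def by (rule someI_ex[OF represents_L2_L2[OF cl(4)[OF that]]])
  have Pr: "represents T (\<lambda>t x. D01 \<psi> (u t x i)) (Pr i)" if "i < N" for i
    unfolding Pr_def by (rule someI_ex[OF represents_L2_L2[OF cl(5)[OF that]]])
  have Ur: "represents T (\<lambda>t x. u t x i) (Ur i)" if i: "i < N" for i
  proof -
    have "AE t in lebesgue_on ?I. AE x in lebesgue_on \<Omega>. \<bar>u t x i\<bar> \<le> 1"
      using ae01
    proof eventually_elim
      case (elim t)
      then show ?case by eventually_elim (use i in \<open>auto simp: abs_le_iff less_imp_le\<close>)
    qed
    moreover have "jointly_measurable \<Omega> T (\<lambda>t x. u t x i)" using cl(2)[OF i] by (simp add: Linf_H1_def)
    ultimately show ?thesis unfolding Ur_def using someI_ex[OF represents_bounded] by blast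
  qed
  \<comment> \<open>Borel version of \<open>\<xi>\<close> on the whole of space-time, assembled from
    the representatives of \<open>w\<close>, \<open>u\<close> and the derivative of
    \<open>\<psi>\<close> at \<open>u\<close>.\<close>
  define \<Xi> where "\<Xi> i p = Wr i p + mat_vec N A (\<lambda>j. Ur j p) i
    + (1 / real N * (\<Sum>j<N. Pr j p) - 1 / real N * (\<Sum>j<N. mat_vec N A (\<lambda>k. Ur k p) j))" for i p
  have \<Xi>2: "\<Xi> i \<in> L2 lborel" if "i < N" for i
    unfolding \<Xi>_def[abs_def] mat_vec_def
    by (intro L2_add L2_diff L2_cmult L2_sum representsD(1)[OF Wr] representsD(1)[OF Ur] representsD(1)[OF Pr] that) auto
  have \<Xi>0: "\<Xi> i p = 0" if "i < N" "p \<notin> ?I \<times> \<Omega>" for i p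
    using representsD(3)[OF Wr that(2)] representsD(3)[OF Ur that(2)] representsD(3)[OF Pr that(2)] that(1)
    by (simp add: \<Xi>_def mat_vec_def)
  obtain Mi where Mi: "AE t in lebesgue_on ?I. (\<lambda>x. u t x i) \<in> H1 \<Omega> \<and> H1_norm \<Omega> (\<lambda>x. u t x i) \<le> Mi i" if "i < N" for i
  proof -
    have "\<forall>i. \<exists>M. i < N \<longrightarrow> (AE t in lebesgue_on ?I. (\<lambda>x. u t x i) \<in> H1 \<Omega> \<and> H1_norm \<Omega> (\<lambda>x. u t x i) \<le> M)"
      using cl(2) by (auto simp: Linf_H1_def)
    from choice[OF this] obtain M where "\<forall>i. i < N \<longrightarrow> (AE t in lebesgue_on ?I. (\<lambda>x. u t x i) \<in> H1 \<Omega> \<and> H1_norm \<Omega> (\<lambda>x. u t x i) \<le> M i)" ..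
    then show ?thesis by (intro that[of M]) blast
  qed
  have lift: "AE t in lebesgue_on ?I. Q t" if "AE t in lborel. Q t" for Q
  proof -
    have "AE t in lborel. t \<in> ?I \<longrightarrow> Q t" using that by eventually_elim simp
    then show ?thesis by (simp only: AE_lebesgue_on_iff[OF I])
  qed
  define good where "good t \<longleftrightarrow>
    (\<forall>i<N. AE x in lebesgue_on \<Omega>. Wr i (t, x) = w t x i) \<and> (\<forall>i<N. AE x in lebesgue_on \<Omega>. Pr i (t, x) = D01 \<psi> (u t x i)) \<and>
    (\<forall>i<N. AE x in lebesgue_on \<Omega>. Ur i (t, x) = u t x i) \<and> (\<forall>i<N. AE x in lebesgue_on \<Omega>. Zr i (t, x) = ut t x i) \<and>
    (\<forall>i<N. (\<lambda>x. Wr i (t, x)) \<in> L2 lborel) \<and> (\<forall>i<N. (\<lambda>x. Pr i (t, x)) \<in> L2 lborel) \<and> (\<forall>i<N. (\<lambda>x. \<Xi> i (t, x)) \<in> L2 lborel) \<and>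
    (\<forall>i<N. (\<lambda>x. u t x i) \<in> H2 \<Omega>) \<and> (\<forall>i<N. H1_norm \<Omega> (\<lambda>x. u t x i) \<le> Mi i) \<and>
    (u t \<in> K_set \<Omega> N \<and> (\<forall>i<N. mean \<Omega> (u t) i = mean \<Omega> u0 i)) \<and>
    (AE x in lebesgue_on \<Omega>. \<forall>i<N. 0 < u t x i \<and> u t x i < 1) \<and>
    (AE x in lebesgue_on \<Omega>. \<forall>i<N. ut t x i + mat_vec N \<alpha> (\<lambda>j. w t x j - mean \<Omega> (w t) j) i = 0) \<and>
    (AE x in lebesgue_on \<Omega>. \<forall>i<N.
           w t x i = proj N (\<lambda>j. - mat_vec N A (u t x) j + D01 \<psi> (u t x j)) i - \<gamma> * weak_laplacian \<Omega> (\<lambda>y. u t y i) x) \<and>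
    (\<forall>i<N. \<exists>h. has_normal_derivative \<Omega> (\<lambda>x. u t x i) h \<and> (AE x in surface_measure \<Omega>. h x = 0))" for t
  have h1: "AE t in lebesgue_on ?I. \<forall>i<N. AE x in lebesgue_on \<Omega>. Wr i (t, x) = w t x i" by (rule AE_all_less, rule representsD(4)[OF Wr])
  have h2: "AE t in lebesgue_on ?I. \<forall>i<N. AE x in lebesgue_on \<Omega>. Pr i (t, x) = D01 \<psi> (u t x i)" by (rule AE_all_less, rule representsD(4)[OF Pr])
  have h3: "AE t in lebesgue_on ?I. \<forall>i<N. AE x in lebesgue_on \<Omega>. Ur i (t, x) = u t x i" by (rule AE_all_less, rule representsD(4)[OF Ur])
  have h4: "AE t in lebesgue_on ?I. \<forall>i<N. AE x in lebesgue_on \<Omega>. Zr i (t, x) = ut t x i" by (rule AE_all_less, rule representsD(4)[OF Zr])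
  have h5: "AE t in lebesgue_on ?I. \<forall>i<N. (\<lambda>x. Wr i (t, x)) \<in> L2 lborel" by (rule AE_all_less, rule lift, rule section_L2(1), rule representsD(1)[OF Wr])
  have h6: "AE t in lebesgue_on ?I. \<forall>i<N. (\<lambda>x. Pr i (t, x)) \<in> L2 lborel" by (rule AE_all_less, rule lift, rule section_L2(1), rule representsD(1)[OF Pr])
  have h7: "AE t in lebesgue_on ?I. \<forall>i<N. (\<lambda>x. \<Xi> i (t, x)) \<in> L2 lborel" by (rule AE_all_less, rule lift, rule section_L2(1), rule \<Xi>2)
  have h8: "AE t in lebesgue_on ?I. \<forall>i<N. (\<lambda>x. u t x i) \<in> H2 \<Omega>" by (rule AE_all_less) (use cl(3) in \<open>simp add: L2_H2_def\<close>)
  have h9: "AE t in lebesgue_on ?I. \<forall>i<N. H1_norm \<Omega> (\<lambda>x. u t x i) \<le> Mi i"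
  proof (rule AE_all_less)
    fix i assume "i < N"
    from Mi[OF this] show "AE t in lebesgue_on ?I. H1_norm \<Omega> (\<lambda>x. u t x i) \<le> Mi i" by eventually_elim simp
  qed
  have "AE t in lebesgue_on ?I. good t"
    unfolding good_def using h1 h2 h3 h4 h5 h6 h7 h8 h9 aeK ae01 aeut aepde aen by eventually_elim ((elim conjE)?, (intro conjI; assumption))
  then have "AE t in lborel. t \<in> ?I \<longrightarrow> good t" using I by (simp only: AE_lebesgue_on_iff)
  \<comment> \<open>Enlarging the exceptional set to a Borel null set makes \<open>G\<close> Borel,
    as \<open>time_chain\<close> requires.\<close>
  from AE_E[OF this] obtain S where S: "{t. \<not> (t \<in> ?I \<longrightarrow> good t)} \<subseteq> S" "emeasure lborel S = 0" "S \<in> sets borel" by auto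
  have aeS: "AE t in lborel. t \<notin> S" using S by (intro AE_not_in) (auto simp: null_sets_def)
  define G where "G = ?I - S"
  have Gb: "G \<in> sets borel" using S(3) by (simp add: G_def)
  have GI: "G \<subseteq> ?I" by (auto simp: G_def)
  have Ggood: "good t" if "t \<in> G" for t using that S(1) by (auto simp: G_def)
  have gd: "\<forall>i<N. AE x in lebesgue_on \<Omega>. Wr i (t, x) = w t x i" "\<forall>i<N. AE x in lebesgue_on \<Omega>. Pr i (t, x) = D01 \<psi> (u t x i)"
    "\<forall>i<N. AE x in lebesgue_on \<Omega>. Ur i (t, x) = u t x i" "\<forall>i<N. AE x in lebesgue_on \<Omega>. Zr i (t, x) = ut t x i"
    "\<forall>i<N. (\<lambda>x. Wr i (t, x)) \<in> L2 lborel" "\<forall>i<N. (\<lambda>x. Pr i (t, x)) \<in> L2 lborel" "\<forall>i<N. (\<lambda>x. \<Xi> i (t, x)) \<in> L2 lborel"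
    "\<forall>i<N. (\<lambda>x. u t x i) \<in> H2 \<Omega>" "\<forall>i<N. H1_norm \<Omega> (\<lambda>x. u t x i) \<le> Mi i"
    "u t \<in> K_set \<Omega> N" "\<forall>i<N. mean \<Omega> (u t) i = mean \<Omega> u0 i"
    "AE x in lebesgue_on \<Omega>. \<forall>i<N. 0 < u t x i \<and> u t x i < 1"
    "AE x in lebesgue_on \<Omega>. \<forall>i<N. ut t x i + mat_vec N \<alpha> (\<lambda>j. w t x j - mean \<Omega> (w t) j) i = 0"
    "AE x in lebesgue_on \<Omega>. \<forall>i<N.
       w t x i = proj N (\<lambda>j. - mat_vec N A (u t x) j + D01 \<psi> (u t x j)) i - \<gamma> * weak_laplacian \<Omega> (\<lambda>y. u t y i) x"
    "\<forall>i<N. \<exists>h. has_normal_derivative \<Omega> (\<lambda>x. u t x i) h \<and> (AE x in surface_measure \<Omega>. h x = 0)" if "t \<in> G" for t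
    by (insert Ggood[OF that, unfolded good_def], elim conjE, assumption)+
  have state: "energy_state \<Omega> N \<alpha> A \<psi> m l0 Mp a \<gamma> (u t) (w t)" if t: "t \<in> G" for t
  proof -
    note g = gd[OF t]
    have W2: "(\<lambda>x. w t x i) \<in> L2 (lebesgue_on \<Omega>)" and P2: "(\<lambda>x. D01 \<psi> (u t x i)) \<in> L2 (lebesgue_on \<Omega>)" if i: "i < N" for i
    proof -
      have b: "(\<lambda>x. Wr i (t, x)) \<in> L2 lborel" "(\<lambda>x. Pr i (t, x)) \<in> L2 lborel" using g(5,6) i by simp_all
      have "(\<lambda>x. Wr i (t, x)) \<in> borel_measurable borel" "(\<lambda>x. Pr i (t, x)) \<in> borel_measurable borel" using b[THEN L2_measurable] by simp_all
      moreover have "Wr i (t, x) = 0" "Pr i (t, x) = 0" if "x \<notin> \<Omega>" for x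
        using representsD(3)[OF Wr[OF i], of "(t, x)"] representsD(3)[OF Pr[OF i], of "(t, x)"] that by auto
      moreover have "AE x in lebesgue_on \<Omega>. Wr i (t, x) = w t x i" "AE x in lebesgue_on \<Omega>. Pr i (t, x) = D01 \<psi> (u t x i)" using g(1,2) i by simp_all
      ultimately show "(\<lambda>x. w t x i) \<in> L2 (lebesgue_on \<Omega>)" "(\<lambda>x. D01 \<psi> (u t x i)) \<in> L2 (lebesgue_on \<Omega>)"
        using L2_borel_representative[OF dom_sets, of "\<lambda>x. Wr i (t, x)" "\<lambda>x. w t x i"]
          L2_borel_representative[OF dom_sets, of "\<lambda>x. Pr i (t, x)" "\<lambda>x. D01 \<psi> (u t x i)"] b by simp_all
    qed
    have K: "AE x in lebesgue_on \<Omega>. (\<Sum>i<N. u t x i) = 1 \<and> (\<forall>i<N. 0 \<le> u t x i)" using g(10) by (simp add: K_set_def)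
    show ?thesis
    proof unfold_locales
      show "AE x in lebesgue_on \<Omega>. (\<Sum>i<N. u t x i) = 1" using K by eventually_elim simp
      show "mean \<Omega> (u t) i = m i" if "i < N" for i using g(11) u0m that by simp
      show "0 < \<gamma>" by (rule gam)
      show "(\<lambda>x. u t x i) \<in> H2 \<Omega>" if "i < N" for i using g(8) that by simp
      show "(\<lambda>x. D01 \<psi> (u t x i)) \<in> L2 (lebesgue_on \<Omega>)" "(\<lambda>x. w t x i) \<in> L2 (lebesgue_on \<Omega>)" if "i < N" for i
        by (rule P2[OF that], rule W2[OF that])
      show "\<exists>h. has_normal_derivative \<Omega> (\<lambda>x. u t x i) h \<and> (AE x in surface_measure \<Omega>. h x = 0)" if "i < N" for i
        using g(15) that by simp
    qed (rule g(12) g(14))+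
  qed
  have uadm: "adm (u t)" if "t \<in> insert 0 G" for t
    using that u0adm energy_state.U_adm[OF state] by auto
  have \<Xi>O: "(\<lambda>x. \<Xi> i (t, x)) \<in> L2 lborel" "(\<lambda>x. \<Xi> i (t, x)) \<in> L2 (lebesgue_on \<Omega>)" if "t \<in> G" "i < N" for t i
  proof -
    show 1: "(\<lambda>x. \<Xi> i (t, x)) \<in> L2 lborel" using gd(7)[OF that(1)] that(2) by simp
    then have "(\<lambda>x. \<Xi> i (t, x)) \<in> borel_measurable borel" using L2_measurable[OF 1] by simp
    then show "(\<lambda>x. \<Xi> i (t, x)) \<in> L2 (lebesgue_on \<Omega>)"
      using L2_borel_representative[OF dom_sets, of "\<lambda>x. \<Xi> i (t, x)" "\<lambda>x. \<Xi> i (t, x)"] \<Xi>0[OF that(2)] 1 by auto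
  qed
  have \<Xi>\<xi>: "AE x in lebesgue_on \<Omega>. \<Xi> i (t, x) = energy_state.\<xi> N A \<psi> (u t) (w t) i x" if t: "t \<in> G" and i: "i < N" for t i
  proof -
    interpret st: energy_state \<Omega> N \<alpha> A \<psi> m l0 Mp a \<gamma> "u t" "w t" by (rule state[OF t])
    note g = gd[OF t]
    have "AE x in lebesgue_on \<Omega>. \<forall>j<N. Wr j (t, x) = w t x j" "AE x in lebesgue_on \<Omega>. \<forall>j<N. Ur j (t, x) = u t x j"
      "AE x in lebesgue_on \<Omega>. \<forall>j<N. Pr j (t, x) = D01 \<psi> (u t x j)"
      using g(1,2,3) by (auto intro: AE_all_less)
    then show ?thesis
    proof eventually_elim
      case (elim x)
      then show ?case using i by (simp add: \<Xi>_def st.\<xi>_def st.S_def mat_vec_def)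
    qed
  qed
  have sub: "F \<gamma> (u t) + (\<Sum>i<N. LINT x|lebesgue_on \<Omega>. \<Xi> i (t, x) * (v x i - u t x i)) \<le> F \<gamma> v" if t: "t \<in> G" and v: "adm v" for t v
  proof -
    interpret st: energy_state \<Omega> N \<alpha> A \<psi> m l0 Mp a \<gamma> "u t" "w t" by (rule state[OF t])
    have "(LINT x|lebesgue_on \<Omega>. \<Xi> i (t, x) * (v x i - u t x i)) = (LINT x|lebesgue_on \<Omega>. st.\<xi> i x * (v x i - u t x i))" if i: "i < N" for i
    proof (rule integral_cong_AE)
      have d: "(\<lambda>x. v x i - u t x i) \<in> L2 (lebesgue_on \<Omega>)" using v i by (intro L2_diff st.U_L2) (auto simp: adm_def intro: H1_L2)
      show "(\<lambda>x. \<Xi> i (t, x) * (v x i - u t x i)) \<in> borel_measurable (lebesgue_on \<Omega>)"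
        by (rule borel_measurable_integrable[OF L2_integrable_mult[OF \<Xi>O(2)[OF t i] d]])
      show "(\<lambda>x. st.\<xi> i x * (v x i - u t x i)) \<in> borel_measurable (lebesgue_on \<Omega>)"
        by (rule borel_measurable_integrable[OF L2_integrable_mult[OF st.xi_L2[OF i] d]])
      show "AE x in lebesgue_on \<Omega>. \<Xi> i (t, x) * (v x i - u t x i) = st.\<xi> i x * (v x i - u t x i)"
        using \<Xi>\<xi>[OF t i] by eventually_elim simp
    qed
    then show ?thesis using st.subgradient[OF v] by simp
  qed
  have diss: "F \<gamma> (u t) + (\<Sum>i<N. LINT x|lborel. \<Xi> i (t, x) * Zr i (t, x)) \<le> C3" if t: "t \<in> G" for t
  proof -
    interpret st: energy_state \<Omega> N \<alpha> A \<psi> m l0 Mp a \<gamma> "u t" "w t" by (rule state[OF t])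
    note g = gd[OF t]
    have "(LINT x|lebesgue_on \<Omega>. st.\<xi> i x * (- mat_vec N \<alpha> (\<lambda>j. w t x j - mean \<Omega> (w t) j) i)) = (LINT x|lborel. \<Xi> i (t, x) * Zr i (t, x))" if i: "i < N" for i
    proof (rule borel_representative(3)[OF dom_sets])
      have [measurable]: "Zr i \<in> borel_measurable (borel \<Otimes>\<^sub>M borel)" using representsD(2)[OF Zr[OF i]] by (simp add: borel_prod)
      have [measurable]: "\<Xi> i \<in> borel_measurable (borel \<Otimes>\<^sub>M borel)" using L2_measurable[OF \<Xi>2[OF i]] by (simp add: borel_prod)
      show "(\<lambda>x. \<Xi> i (t, x) * Zr i (t, x)) \<in> borel_measurable borel" by measurable
      show "\<Xi> i (t, x) * Zr i (t, x) = 0" if "x \<notin> \<Omega>" for x using \<Xi>0[OF i, of "(t, x)"] that by simp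
      have "AE x in lebesgue_on \<Omega>. Zr i (t, x) = ut t x i" "AE x in lebesgue_on \<Omega>. \<forall>i<N. ut t x i + mat_vec N \<alpha> (\<lambda>j. w t x j - mean \<Omega> (w t) j) i = 0"
        using g(4) i g(13) by simp_all
      with \<Xi>\<xi>[OF t i] show "AE x in lebesgue_on \<Omega>. \<Xi> i (t, x) * Zr i (t, x) = st.\<xi> i x * (- mat_vec N \<alpha> (\<lambda>j. w t x j - mean \<Omega> (w t) j) i)"
      proof eventually_elim
        case (elim x)
        then have "ut t x i = - mat_vec N \<alpha> (\<lambda>j. w t x j - mean \<Omega> (w t) j) i" using i by (simp add: eq_neg_iff_add_eq_0)
        then show ?case using elim by simp
      qed
    qed
    then show ?thesis using st.dissipation by simp
  qed
  define P where "P t s = (\<Sum>i<N. LINT r|lborel. indicator {0..s} r * (LINT x|lborel. \<Xi> i (t, x) * Zr i (r, x)))" for t s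
  have Peq: "P t s = (\<Sum>i<N. LINT x|lebesgue_on \<Omega>. \<Xi> i (t, x) * (u s x i - u 0 x i))" if t: "t \<in> G" and s: "0 \<le> s" "s < T" for t s
    unfolding P_def
  proof (intro sum.cong refl)
    fix i assume "i \<in> {..<N}"
    then have i: "i < N" by simp
    show "(LINT r|lborel. indicator {0..s} r * (LINT x|lborel. \<Xi> i (t, x) * Zr i (r, x))) = (LINT x|lebesgue_on \<Omega>. \<Xi> i (t, x) * (u s x i - u 0 x i))"
    proof (rule weak_time_increment[symmetric, where U = "Ur i" and T = T])
      show "\<Xi> i (t, x) = 0" if "x \<notin> \<Omega>" for x using \<Xi>0[OF i, of "(t, x)"] that by simp
    qed (rule \<Xi>O(1)[OF t i] cl(1)[OF i] ut(2)[OF i] representsD(1,4,5)[OF Ur[OF i]] representsD(1,5)[OF Zr[OF i]] s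
        representsD(3)[OF Ur[OF i]] representsD(3)[OF Zr[OF i]]; assumption?)+
  qed
  have uL2: "(\<lambda>x. u s x i) \<in> L2 (lebesgue_on \<Omega>)" if "s \<in> insert 0 G" "i < N" for s i
    using uadm[OF that(1)] that(2) by (auto simp: adm_def intro: H1_L2)
  have Psub: "F \<gamma> (u t) - F \<gamma> (u s) \<le> P t t - P t s" if t: "t \<in> G" and s: "s \<in> insert 0 G" for t s
  proof -
    have "P t t - P t s = - (\<Sum>i<N. LINT x|lebesgue_on \<Omega>. \<Xi> i (t, x) * (u s x i - u t x i))"
    proof -
      have "(LINT x|lebesgue_on \<Omega>. \<Xi> i (t, x) * (u t x i - u 0 x i)) - (LINT x|lebesgue_on \<Omega>. \<Xi> i (t, x) * (u s x i - u 0 x i))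
        = - (LINT x|lebesgue_on \<Omega>. \<Xi> i (t, x) * (u s x i - u t x i))" if i: "i < N" for i
      proof -
        have int: "integrable (lebesgue_on \<Omega>) (\<lambda>x. \<Xi> i (t, x) * (u r x i - u r' x i))" if "r \<in> insert 0 G" "r' \<in> insert 0 G" for r r'
          by (intro L2_integrable_mult \<Xi>O(2) L2_diff uL2 that t i)
        have "(LINT x|lebesgue_on \<Omega>. \<Xi> i (t, x) * (u t x i - u 0 x i)) - (LINT x|lebesgue_on \<Omega>. \<Xi> i (t, x) * (u s x i - u 0 x i))
          = (LINT x|lebesgue_on \<Omega>. \<Xi> i (t, x) * (u t x i - u 0 x i) - \<Xi> i (t, x) * (u s x i - u 0 x i))"
          using s t by (intro Bochner_Integration.integral_diff[symmetric] int) auto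
        also have "\<dots> = (LINT x|lebesgue_on \<Omega>. - (\<Xi> i (t, x) * (u s x i - u t x i)))"
          by (intro Bochner_Integration.integral_cong refl) (simp add: algebra_simps)
        finally show ?thesis by simp
      qed
      moreover have "0 \<le> s" "s < T" "0 \<le> t" "t < T" using s t GI T by auto
      ultimately show ?thesis using t by (simp add: Peq sum_subtractf[symmetric] sum_negf[symmetric])
    qed
    then show ?thesis using sub[OF t uadm[OF s]] by linarith
  qed
  define Mf where "Mf = N * (Mp * V) + \<gamma> / 2 * (\<Sum>i<N. (Mi i)\<^sup>2)"
  have fb: "\<bar>F \<gamma> (u t)\<bar> \<le> Mf" if t: "t \<in> G" for t
  proof -
    note g = gd[OF t]
    have "D (u t) \<le> (\<Sum>i<N. (Mi i)\<^sup>2)"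
      unfolding D_def
    proof (rule sum_mono)
      fix i assume "i \<in> {..<N}"
      then have "H1_norm \<Omega> (\<lambda>x. u t x i) \<le> Mi i" using g(9) by simp
      moreover have nn: "0 \<le> (n2 (\<lambda>x. u t x i))\<^sup>2 + (\<Sum>b\<in>Basis. (n2 (weak_partial \<Omega> b (\<lambda>x. u t x i)))\<^sup>2)" by (intro add_nonneg_nonneg sum_nonneg) auto
      ultimately have "(H1_norm \<Omega> (\<lambda>x. u t x i))\<^sup>2 \<le> (Mi i)\<^sup>2" by (intro power_mono) (simp_all add: H1_norm_def)
      moreover have "(H1_norm \<Omega> (\<lambda>x. u t x i))\<^sup>2 = (n2 (\<lambda>x. u t x i))\<^sup>2 + (\<Sum>b\<in>Basis. (n2 (weak_partial \<Omega> b (\<lambda>x. u t x i)))\<^sup>2)"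
        unfolding H1_norm_def by (rule real_sqrt_pow2[OF nn])
      ultimately show "(\<Sum>b\<in>Basis. (n2 (weak_partial \<Omega> b (\<lambda>x. u t x i)))\<^sup>2) \<le> (Mi i)\<^sup>2"
        using zero_le_power2[of "n2 (\<lambda>x. u t x i)"] by linarith
    qed
    then have "\<gamma> / 2 * D (u t) \<le> \<gamma> / 2 * (\<Sum>i<N. (Mi i)\<^sup>2)" using gam by (intro mult_left_mono) auto
    moreover have "0 \<le> \<gamma> / 2 * D (u t)" using gam D_nonneg by simp
    ultimately show ?thesis using F_bounds[of "u t" \<gamma>] uadm[of t] t unfolding Mf_def by auto
  qed
  interpret tc: time_chain N T Mf \<Xi> Zr "\<lambda>t. F \<gamma> (u t)" G P
  proof
    show "AE t in lborel. t \<in> ?I \<longrightarrow> t \<in> G" using aeS by eventually_elim (simp add: G_def)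
    show "\<Xi> i \<in> L2 lborel" if "i < N" for i by (rule \<Xi>2[OF that])
    show "Zr i \<in> L2 lborel" if "i < N" for i by (rule representsD(1)[OF Zr[OF that]])
    show "G \<in> sets borel" by (rule Gb)
    show "G \<subseteq> ?I" by (rule GI)
    show "\<bar>F \<gamma> (u t)\<bar> \<le> Mf" if "t \<in> G" for t by (rule fb[OF that])
    show "P t s = (\<Sum>i<N. LINT r|lborel. indicator {0..s} r * (LINT x|lborel. \<Xi> i (t, x) * Zr i (r, x)))" for t s by (rule P_def)
    show "(\<lambda>x. \<Xi> i (t, x)) \<in> L2 lborel" if "t \<in> G" "i < N" for t i by (rule \<Xi>O(1)[OF that])
    show "F \<gamma> (u t) - F \<gamma> (u s) \<le> P t t - P t s" if "t \<in> G" "s \<in> insert 0 G" for t s by (rule Psub[OF that])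
  qed
  have dense: "\<exists>r\<in>G. x < r \<and> r < y" if xy: "0 \<le> x" "x < y" "y \<le> T" for x y
  proof (rule ccontr)
    assume "\<not> ?thesis"
    then have "{x<..<y} \<subseteq> S" using xy by (auto simp: G_def)
    then have "emeasure lborel {x<..<y} \<le> emeasure lborel S" using S(3) by (intro emeasure_mono) auto
    then show False using S(2) xy by simp
  qed
  show thesis
  proof (rule that[of G "\<lambda>r. \<Sum>i<N. LINT x|lborel. \<Xi> i (r, x) * Zr i (r, x)"])
    show "0 < t \<and> t < T" if "t \<in> G" for t using that GI by auto
    show "(\<Sum>i<N. LINT x|lborel. \<Xi> i (r, x) * Zr i (r, x)) \<le> C3 - F \<gamma> (u r)" if "r \<in> G" for r using diss[OF that] by simp
    show "\<exists>r\<in>G. x < r \<and> r < y" if "0 \<le> x" "x < y" "y \<le> T" for x y by (rule dense[OF that])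
    show "adm (u t)" if "t \<in> G" for t using uadm[of t] that by simp
  qed (rule tc.chain_bound)
qed

text \<open>Collected costs: \<open>3 / 2\<close> times the error of replacing the convex part of
  the initial energy, shifted by its lower bound, by the energy itself; the constant of
  \<open>decay_estimate\<close>; the return from the Dirichlet bound to the energy at time
  \<open>t\<close>; and 1 for strict positivity.\<close>

definition C2 where
  "C2 = 3 / 2 * (N * a / 2 * V + N * (Mp * V)) + 4 * (C3 + N * (Mp * V)) + N * (Mp * V) + N * a / 2 * V + 1"

lemma C2_pos: "0 < C2"
  using C3_nonneg Mp(1) V_pos a(1) unfolding C2_def by (intro add_nonneg_pos add_nonneg_nonneg mult_nonneg_nonneg) auto

text \<open>\<open>decay_estimate\<close> covers good times only. A given positive \<open>t\<close>
  is approached by good times from the right; along them \<open>u\<close> converges in L2 and the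
  Dirichlet term is bounded, so \<open>H1_lsc\<close> passes the bound to \<open>t\<close>. The
  potential part is bounded outright and only enlarges the constant.\<close>

lemma energy_estimate:
  fixes u w :: "real => 'a => nat => real"
  assumes gam: "0 < \<gamma>" and u0: "u0 \<in> K_set \<Omega> N" and u0m: "\<And>i. i < N ==> mean \<Omega> u0 i = m i"
    and sol: "finite_energy_solution \<Omega> N \<gamma> \<alpha> A \<psi> u0 u w" and t: "0 \<le> t"
  shows "energy \<Omega> N \<gamma> A \<psi> (u t) \<le> 3 / 2 * exp (- ln (3 / 2) * t) * energy \<Omega> N \<gamma> A \<psi> (u 0) + C2"
proof -
  define B where "B = N * (Mp * V)"
  define h where "h = N * a / 2 * V"
  have Bh: "0 \<le> B" "0 \<le> h" using Mp(1) a(1) V_pos by (auto simp: B_def h_def)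
  have C2: "C2 = 3 / 2 * (h + B) + 4 * (C3 + B) + B + h + 1" by (simp add: C2_def B_def h_def)
  have init: "AE x in lebesgue_on \<Omega>. \<forall>i<N. u 0 x i = u0 x i" using sol by (simp add: finite_energy_solution_def)
  have adm0: "adm (u 0)"
    unfolding adm_def
  proof (intro conjI allI impI)
    fix i assume i: "i < N"
    have "AE x in lebesgue_on \<Omega>. u0 x i = u 0 x i" using init by eventually_elim (simp add: i)
    moreover have "(\<lambda>x. u0 x i) \<in> H1 \<Omega>" using u0 i by (simp add: K_set_def)
    ultimately show "(\<lambda>x. u 0 x i) \<in> H1 \<Omega>" by (rule H1_cong_AE(1)[rotated])
  next
    have "AE x in lebesgue_on \<Omega>. (\<Sum>i<N. u0 x i) = 1 \<and> (\<forall>i<N. 0 \<le> u0 x i)" using u0 by (simp add: K_set_def)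
    with init show "AE x in lebesgue_on \<Omega>. \<forall>i<N. 0 \<le> u 0 x i \<and> u 0 x i \<le> 1"
    proof eventually_elim
      case (elim x)
      have "u0 x i \<le> 1" if "i < N" for i
        using member_le_sum[of i "{..<N}" "u0 x"] elim that by auto
      then show ?case using elim by auto
    qed
  qed
  have Flow: "- B \<le> F \<gamma> v" "\<gamma> / 2 * D v \<le> F \<gamma> v + B" "F \<gamma> v \<le> \<gamma> / 2 * D v + B" if "adm v" for v
  proof -
    have "\<bar>F \<gamma> v - \<gamma> / 2 * D v\<bar> \<le> B" using F_bounds[OF that] by (simp add: B_def)
    moreover have "0 \<le> \<gamma> / 2 * D v" using gam D_nonneg by simp
    ultimately show "- B \<le> F \<gamma> v" "\<gamma> / 2 * D v \<le> F \<gamma> v + B" "F \<gamma> v \<le> \<gamma> / 2 * D v + B" by linarith+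
  qed
  have EF: "\<bar>energy \<Omega> N \<gamma> A \<psi> v - F \<gamma> v\<bar> \<le> h" if "adm v" for v using energy_F[OF that] by (simp add: h_def)
  show ?thesis
  proof (cases "t = 0")
    case True
    \<comment> \<open>At \<open>t = 0\<close> the factor \<open>3 / 2\<close> meets an energy that
      may be negative; the lower bound absorbs the difference into \<open>C2\<close>.\<close>
    have "- B - h \<le> energy \<Omega> N \<gamma> A \<psi> (u 0)" using Flow(1)[OF adm0] EF[OF adm0] by linarith
    then have "energy \<Omega> N \<gamma> A \<psi> (u 0) \<le> 3 / 2 * energy \<Omega> N \<gamma> A \<psi> (u 0) + C2" using Bh C3_nonneg unfolding C2 by argo
    then show ?thesis using True by simp
  next
    case False
    then have tp: "0 < t" using t by simp
    \<comment> \<open>The horizon \<open>t + 1\<close> leaves good times to the right of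
      \<open>t\<close>.\<close>
    obtain G ac where G: "\<And>t'. t' \<in> G ==> 0 < t' \<and> t' < t + 1"
      and dense: "\<And>x y. 0 \<le> x ==> x < y ==> y \<le> t + 1 ==> \<exists>r\<in>G. x < r \<and> r < y"
      and Gadm: "\<And>t. t \<in> G ==> adm (u t)" and ac: "\<And>r. r \<in> G ==> ac r \<le> C3 - F \<gamma> (u r)"
      and step: "\<And>t1 t2 c. t1 \<in> insert 0 G ==> t2 \<in> G ==> t1 < t2 ==>
        (\<And>r. r \<in> G ==> t1 < r ==> r < t2 ==> ac r \<le> c) ==> F \<gamma> (u t2) - F \<gamma> (u t1) \<le> c * (t2 - t1)"
      by (rule solution_chain[OF gam sol u0m adm0, of "t + 1"]) (use t in auto)
    define R where "R = 3 / 2 * exp (- ln (3 / 2) * t) * (F \<gamma> (u 0) + B) + 4 * (C3 + B)"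
    have FG: "F \<gamma> (u s) + B \<le> R" if s: "s \<in> G" "t \<le> s" for s
    proof -
      have "F \<gamma> (u s) + B \<le> 3 / 2 * exp (- ln (3 / 2) * s) * (F \<gamma> (u 0) + B) + 4 * (C3 + B)"
      proof (rule decay_estimate[where f = "\<lambda>t. F \<gamma> (u t)" and G = G and T = "t + 1" and ac = ac, OF _ dense step ac _ Bh(1) C3_nonneg s(1)])
        show "0 < r \<and> r \<le> t + 1" if "r \<in> G" for r using G[OF that] by auto
        show "- B \<le> F \<gamma> (u r)" if "r \<in> insert 0 G" for r using that Flow(1) Gadm adm0 by auto
      qed
      also have "\<dots> \<le> R"
        unfolding R_def using Flow(1)[OF adm0] s(2) by (intro add_mono mult_right_mono mult_left_mono) auto
      finally show ?thesis .
    qed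
    define s where "s k = (SOME r. r \<in> G \<and> t < r \<and> r < t + inverse (real (Suc k)))" for k
    have s: "s k \<in> G" "t < s k" "s k < t + inverse (real (Suc k))" for k
    proof -
      have "inverse (real (Suc k)) \<le> 1" by (simp add: inverse_le_1_iff)
      then have "\<exists>r. r \<in> G \<and> t < r \<and> r < t + inverse (real (Suc k))"
        using dense[of t "t + inverse (real (Suc k))"] t by auto
      from someI_ex[OF this] show "s k \<in> G" "t < s k" "s k < t + inverse (real (Suc k))" by (simp_all add: s_def)
    qed
    have sl: "s \<longlonglongrightarrow> t"
    proof (rule tendsto_sandwich[of "\<lambda>k. t" s sequentially "\<lambda>k. t + inverse (real (Suc k))"])
      have "(\<lambda>k. t + inverse (real (Suc k))) \<longlonglongrightarrow> t + 0" by (intro tendsto_intros LIMSEQ_inverse_real_of_nat)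
      then show "(\<lambda>k. t + inverse (real (Suc k))) \<longlonglongrightarrow> t" by simp
    qed (use s in \<open>auto intro!: always_eventually less_imp_le\<close>)
    have sT: "s k \<in> {0..t + 1}" "s k \<noteq> t" for k using s[of k] G[of "s k"] by auto
    have cl: "(\<lambda>t x. u t x i) \<in> C_L2 \<Omega> (t + 1)" if "i < N" for i
      using sol[unfolded finite_energy_solution_def, THEN conjunct1, rule_format, of "t + 1"] t that by auto
    have utL2: "(\<lambda>x. u t x i) \<in> L2 (lebesgue_on \<Omega>)" if "i < N" for i using cl[OF that] t by (simp add: C_L2_def)
    have usH: "(\<lambda>x. u (s k) x i) \<in> H1 \<Omega>" if "i < N" for i k using Gadm[OF s(1)] that by (simp add: adm_def)
    have lim: "(\<lambda>k. n2 (\<lambda>x. u (s k) x i - u t x i)) \<longlonglongrightarrow> 0" if "i < N" for i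
    proof -
      have c: "((\<lambda>r. n2 (\<lambda>x. u r x i - u t x i)) \<longlongrightarrow> 0) (at t within {0..t + 1})" using cl[OF that] t by (simp add: C_L2_def)
      have "filterlim s (at t within {0..t + 1}) sequentially" using sl sT by (simp add: filterlim_at)
      from filterlim_compose[OF c this] show ?thesis .
    qed
    \<comment> \<open>The factor \<open>2 / \<gamma>\<close> is undone after the passage to the
      limit, so the final constant stays free of \<open>\<gamma>\<close>.\<close>
    have Ds: "D (u (s k)) \<le> 2 / \<gamma> * R" for k
    proof -
      have "\<gamma> / 2 * D (u (s k)) \<le> R" using Flow(2)[OF Gadm[OF s(1)[of k]]] FG[OF s(1)[of k] less_imp_le[OF s(2)[of k]]] by linarith
      then show ?thesis using gam by (simp add: field_simps)
    qed
    have lsc: "(\<forall>i\<in>{..<N}. (\<lambda>x. u t x i) \<in> H1 \<Omega>) \<and> (\<Sum>i<N. \<Sum>b\<in>Basis. (n2 (weak_partial \<Omega> b (\<lambda>x. u t x i)))\<^sup>2) \<le> 2 / \<gamma> * R"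
      by (rule H1_lsc[where s = "\<lambda>k i x. u (s k) x i"]) (use utL2 usH lim Ds[unfolded D_def] in auto)
    have "AE x in lebesgue_on \<Omega>. 0 \<le> u t x i \<and> u t x i \<le> 1" if i: "i < N" for i
    proof (rule L2_limit_bounds[where s = "\<lambda>k x. u (s k) x i", OF H1_L2[OF usH[OF i]] utL2[OF i] lim[OF i]])
      show "AE x in lebesgue_on \<Omega>. 0 \<le> u (s k) x i \<and> u (s k) x i \<le> 1" for k
        using Gadm[OF s(1), of k, unfolded adm_def, THEN conjunct2] by eventually_elim (use i in auto)
    qed
    then have admt: "adm (u t)" using lsc unfolding adm_def by (auto intro: AE_all_less)
    have "\<gamma> / 2 * D (u t) \<le> R" using lsc gam by (simp add: D_def field_simps)
    then have "energy \<Omega> N \<gamma> A \<psi> (u t) \<le> R + B + h" using Flow(3)[OF admt] EF[OF admt] by linarith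
    also have "R \<le> 3 / 2 * exp (- ln (3 / 2) * t) * energy \<Omega> N \<gamma> A \<psi> (u 0) + 3 / 2 * (h + B) + 4 * (C3 + B)"
    proof -
      define e where "e = exp (- ln (3 / 2) * t)"
      have e: "0 \<le> e" "e \<le> 1" using t by (auto simp: e_def)
      have "F \<gamma> (u 0) + B \<le> energy \<Omega> N \<gamma> A \<psi> (u 0) + (h + B)" using EF[OF adm0] by linarith
      from damped_bound[OF e this] Bh show ?thesis unfolding R_def e_def[symmetric] by (simp add: add.assoc)
    qed
    finally show ?thesis unfolding C2 by simp
  qed
qed

end

text \<open>The argument works in every dimension at least 2, so both halves of the final theorem
  are instances. The witnesses \<open>3 / 2\<close> and \<open>C2\<close> are chosen before
  \<open>\<gamma>\<close>, the datum and the solution.\<close>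

lemma energy_decay:
  fixes \<Omega> :: "'a::euclidean_space set"
  assumes dim: "2 \<le> DIM('a)" and dom: "smooth_bounded_domain \<Omega>" and N: "2 \<le> N" and mob: "mobility_matrix N \<alpha>"
    and pot: "potential N A \<psi>" and M0: "M0 N \<alpha>" and E0: "E0 \<psi>"
  shows "\<exists>C\<^sub>1 C\<^sub>2 :: real. C\<^sub>1 > 0 \<and> C\<^sub>2 > 0 \<and>
           (\<forall>\<gamma> \<delta>\<^sub>0 u\<^sub>0 u w.
              \<gamma> > 0 \<and> u\<^sub>0 \<in> K_set \<Omega> N \<and> (\<forall>i<N. mean \<Omega> u\<^sub>0 i = m i) \<and>
              0 < \<delta>\<^sub>0 \<and> \<delta>\<^sub>0 < 1 / real N \<and> (\<forall>i<N. \<delta>\<^sub>0 < mean \<Omega> u\<^sub>0 i) \<and>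
              finite_energy_solution \<Omega> N \<gamma> \<alpha> A \<psi> u\<^sub>0 u w \<longrightarrow>
              (\<forall>t\<ge>0. energy \<Omega> N \<gamma> A \<psi> (u t)
                 \<le> C\<^sub>1 * exp (- ln (3 / 2) * t) * energy \<Omega> N \<gamma> A \<psi> (u 0) + C\<^sub>2))"
proof -
  obtain l0 where l0: "0 < l0" "\<And>\<eta>. \<eta> \<in> T_Sigma N ==> l0 * dot N \<eta> \<eta> \<le> dot N (mat_vec N \<alpha> \<eta>) \<eta>" using M0 by (auto simp: M0_def)
  have "bounded (\<psi> ` {0..1})" using pot by (intro compact_imp_bounded compact_continuous_image) (auto simp: potential_def)
  then obtain Mp where Mp: "0 < Mp" "\<And>y. y \<in> {0..1} ==> \<bar>\<psi> y\<bar> \<le> Mp" by (auto simp: bounded_pos)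
  define a where "a = (\<Sum>i<N. \<Sum>j<N. \<bar>A i j\<bar>)"
  have av: "\<bar>mat_vec N A v i\<bar> \<le> a" if i: "i < N" and v: "\<And>j. j < N ==> 0 \<le> v j \<and> v j \<le> 1" for v i
  proof -
    have "\<bar>mat_vec N A v i\<bar> \<le> (\<Sum>j<N. \<bar>A i j\<bar> * \<bar>v j\<bar>)" unfolding mat_vec_def abs_mult[symmetric] by (rule sum_abs)
    also have "\<dots> \<le> (\<Sum>j<N. \<bar>A i j\<bar> * 1)" using v by (intro sum_mono mult_left_mono) auto
    also have "\<dots> \<le> a" unfolding a_def using i member_le_sum[of i "{..<N}" "\<lambda>i. \<Sum>j<N. \<bar>A i j\<bar>"] by (simp add: sum_nonneg)
    finally show ?thesis .
  qed
  interpret energy_setting \<Omega> N \<alpha> A \<psi> m l0 Mp a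
  proof
    show "open \<Omega>" "bounded \<Omega>" using dom by (simp_all add: smooth_bounded_domain_def)
    show "0 \<le> a" unfolding a_def by (intro sum_nonneg) simp
  qed (use assms l0 Mp av in auto)
  have est: "energy \<Omega> N \<gamma> A \<psi> (u t) \<le> 3 / 2 * exp (- ln (3 / 2) * t) * energy \<Omega> N \<gamma> A \<psi> (u 0) + C2"
    if "0 < \<gamma>" "u0 \<in> K_set \<Omega> N" "\<forall>i<N. mean \<Omega> u0 i = m i" "finite_energy_solution \<Omega> N \<gamma> \<alpha> A \<psi> u0 u w" "0 \<le> t" for \<gamma> u0 u w t
    by (rule energy_estimate[OF that(1,2) _ that(4,5)]) (use that(3) in simp)
  show ?thesis
  proof (rule exI[of _ "3 / 2"], rule exI[of _ C2], intro conjI allI impI)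
    show "0 < (3 / 2 :: real)" by simp
    show "0 < C2" by (rule C2_pos)
  qed (elim conjE, rule est)
qed

theorem theorem3p9:
  "\<exists>\<omega>::real. \<omega> > 0 \<and>
     (\<forall>(\<Omega> :: (real ^ 2) set) (N :: nat) \<alpha> A \<psi> (m :: nat \<Rightarrow> real).
        smooth_bounded_domain \<Omega> \<and> N \<ge> 2 \<and> mobility_matrix N \<alpha> \<and> potential N A \<psi> \<and>
        M0 N \<alpha> \<and> E0 \<psi> \<and> E1 \<psi> \<longrightarrow>
        (\<exists>C\<^sub>1 C\<^sub>2 :: real. C\<^sub>1 > 0 \<and> C\<^sub>2 > 0 \<and>
           (\<forall>\<gamma> \<delta>\<^sub>0 u\<^sub>0 u w.
              \<gamma> > 0 \<and> u\<^sub>0 \<in> K_set \<Omega> N \<and> (\<forall>i<N. mean \<Omega> u\<^sub>0 i = m i) \<and>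
              0 < \<delta>\<^sub>0 \<and> \<delta>\<^sub>0 < 1 / real N \<and> (\<forall>i<N. \<delta>\<^sub>0 < mean \<Omega> u\<^sub>0 i) \<and>
              finite_energy_solution \<Omega> N \<gamma> \<alpha> A \<psi> u\<^sub>0 u w \<longrightarrow>
              (\<forall>t\<ge>0. energy \<Omega> N \<gamma> A \<psi> (u t)
                 \<le> C\<^sub>1 * exp (- \<omega> * t) * energy \<Omega> N \<gamma> A \<psi> (u 0) + C\<^sub>2)))) \<and>
     (\<forall>(\<Omega> :: (real ^ 3) set) (N :: nat) \<alpha> A \<psi> (m :: nat \<Rightarrow> real).
        smooth_bounded_domain \<Omega> \<and> N \<ge> 2 \<and> mobility_matrix N \<alpha> \<and> potential N A \<psi> \<and>
        M0 N \<alpha> \<and> E0 \<psi> \<and> E1 \<psi> \<longrightarrow>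
        (\<exists>C\<^sub>1 C\<^sub>2 :: real. C\<^sub>1 > 0 \<and> C\<^sub>2 > 0 \<and>
           (\<forall>\<gamma> \<delta>\<^sub>0 u\<^sub>0 u w.
              \<gamma> > 0 \<and> u\<^sub>0 \<in> K_set \<Omega> N \<and> (\<forall>i<N. mean \<Omega> u\<^sub>0 i = m i) \<and>
              0 < \<delta>\<^sub>0 \<and> \<delta>\<^sub>0 < 1 / real N \<and> (\<forall>i<N. \<delta>\<^sub>0 < mean \<Omega> u\<^sub>0 i) \<and>
              finite_energy_solution \<Omega> N \<gamma> \<alpha> A \<psi> u\<^sub>0 u w \<longrightarrow>
              (\<forall>t\<ge>0. energy \<Omega> N \<gamma> A \<psi> (u t)
                 \<le> C\<^sub>1 * exp (- \<omega> * t) * energy \<Omega> N \<gamma> A \<psi> (u 0) + C\<^sub>2))))"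
proof (rule exI[of _ "ln (3 / 2)"], intro conjI allI impI)
  show "ln (3 / 2) > (0 :: real)" by simp
qed (rule energy_decay; simp)+

end
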